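(* Let $x_0\in\mathfrak S_\star\setminus\mathfrak E_\star$. Assume that the orthonormal frame $(\vec{\mathbf e}_1,\vec{\mathbf e}_2)$ is chosen so that $\vec{\mathbf e}_1=\vec e_{x_0}$. Then $$2\Theta_\star(x_0)=m_{\star,2,2}(x_0)-m_{\star,1,1}(x_0)\qquad\text{and}\qquad m_{\star,1,2}(x_0)=0.$$
   Context: $\Omega\subset\mathbb R^2$ is a smooth bounded domain. $V:\mathbb R^k\to\mathbb R$ ($k\ge1$) is smooth with $\inf V=0$ and satisfies: (1) the zero set $\Sigma=\{V=0\}$ is finite with at least two elements; (2) $\nabla^2V(\sigma)$ is positive definite at each $\sigma\in\Sigma$; (3) there are $\alpha_\infty,R_\infty>0$ with $y\cdot\nabla V(y)\ge\alpha_\infty|y|^2$ if $|y|>R_\infty$, and $V(y)\to+\infty$ as $|y|\to+\infty$. Set $e_\varepsilon(u)=\varepsilon\frac{|\nabla u|^2}{2}+\frac1\varepsilon V(u)$ and $E_\varepsilon(u)=\int_\Omega e_\varepsilon(u)dx$. $D^2(x,r)$ is the open disk of center $x$ and radius $r$. Let $M_0>0$, $\varepsilon_n\in(0,1]$, $\varepsilon_n\to0$, and let $u_{\varepsilon_n}\in H^1(\Omega,\mathbb R^k)$ be solutions of $-\Delta u_{\varepsilon_n}=-\varepsilon_n^{-2}\nabla_uV(u_{\varepsilon_n})$ in $\Omega$ with $E_{\varepsilon_n}(u_{\varepsilon_n})\le M_0$. Passing to a subsequence, weakly as measures on $\Omega$: $e_{\varepsilon_n}(u_{\varepsilon_n})dx\rightharpoonup\nu_\star$,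 $\frac{V(u_{\varepsilon_n})}{\varepsilon_n}dx\rightharpoonup\zeta_\star$ and, in coordinates relative to an orthonormal frame $(\vec{\mathbf e}_1,\vec{\mathbf e}_2)$, $\varepsilon_n\,\partial_{x_i}u_{\varepsilon_n}\cdot\partial_{x_j}u_{\varepsilon_n}\,dx\rightharpoonup\mu_{\star,i,j}$, $i,j=1,2$. Let $\eta_1>0$ be a constant depending only on $V$ with the clearing-out property (such a constant exists): for every sequence $\tilde\varepsilon_n\in(0,1]$ with $\tilde\varepsilon_n\to0$, all solutions $v_n\in H^1(\Omega,\mathbb R^k)$ of $-\Delta v_n=-\tilde\varepsilon_n^{-2}\nabla_uV(v_n)$ in $\Omega$ with $\sup_nE_{\tilde\varepsilon_n}(v_n)<+\infty$, and every measure $\nu$ on $\Omega$ such that $e_{\tilde\varepsilon_n}(v_n)dx\rightharpoonup\nu$ weakly as measures on $\Omega$, if $D^2(x_0,r)\subset\Omega$ and $\nu(\overline{D^2(x_0,r)})<\eta_1r$, then $\nu(\overline{D^2(x_0,r/2)})=0$. The concentration set is $\mathfrak S_\star=\{x\in\Omega:\liminf_{r\to0}\nu_\star(\overline{D^2(x,r)})/r\ge\eta_1\}$; it is closed in $\Omega$, $1$-rectifiable and of finite $\mathcal H^1$ measure, and $\nu_\star$ vanishes outside it. (Closed disks are understood intersected with $\Omega$.) Put $\lambda=\mathcal H^1\llcorner\mathfrak S_\star$. Lebesgue decomposition with respect to $\lambda$: $\nu_\star=\nu_\star^{ac}+\nu_\star^s$, $\zeta_\star=\zeta_\star^{ac}+\zeta_\star^s$,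 $\mu_{\star,i,j}=\mu_{\star,i,j}^{ac}+\mu_{\star,i,j}^s$, with densities $\nu_\star^{ac}=\mathbf e_\star\lambda$, $\zeta_\star^{ac}=\Theta_\star\lambda$, $\mu_{\star,i,j}^{ac}=m_{\star,i,j}\lambda$. Exceptional set $\mathfrak E_\star=\mathfrak A_\star\cup\mathfrak B_\star\cup\mathfrak C_\star$, where: - $\mathfrak A_\star\subset\mathfrak S_\star$ is an $\mathcal H^1$-null set such that every $x_0\in\mathfrak S_\star\setminus\mathfrak A_\star$ satisfies $\lim_{r\to0}\frac{\mathcal H^1(\mathfrak S_\star\cap D^2(x_0,r))}{2r}=1$ and has an approximate tangent unit vector $\vec e_{x_0}$: for every $\theta\in(0,\pi/2)$, $\lim_{r\to0}\frac1r\mathcal H^1\big(\mathfrak S_\star\cap D^2(x_0,r)\setminus\mathcal C(x_0,\vec e_{x_0},\theta)\big)=0$, with $\mathcal C(x_0,\vec e,\theta)=\{y:|\vec e^\perp\cdot(y-x_0)|\le\tan\theta|\vec e\cdot(y-x_0)|\}$, $\vec e^\perp$ a unit vector orthogonal to $\vec e$; - $\mathfrak B_\star\subset\mathfrak S_\star$ is an $\mathcal H^1$-null set such that $\nu_\star^s$, $\zeta_\star^s$ and $\mu_{\star,i,j}^s$ vanish on $\mathfrak S_\star\setminus\mathfrak B_\star$; - $\mathfrak C_\star$ is the complement in $\mathfrak S_\star$ of the set of common Lebesgue points of $\Theta_\star,\mathbf e_\star,m_{\star,i,j}$, where $x_0$ is a Lebesgue point of $f$ if $\lim_{r\to0}\frac1r\int_{\mathfrak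 S_\star\cap D^2(x_0,r)}|f-f(x_0)|\,d\lambda=0$. *)

theory Defs
  imports "HOL-Analysis.Analysis"
begin

subsection \<open>Smooth functions and smooth domains\<close>

text \<open>Only meant for open \<open>S\<close>.\<close>

primrec Ck_on :: "nat \<Rightarrow> 'a::real_normed_vector set \<Rightarrow> ('a \<Rightarrow> 'b::real_normed_vector) \<Rightarrow> bool" where
  "Ck_on 0 S f \<longleftrightarrow> continuous_on S f"
| "Ck_on (Suc n) S f \<longleftrightarrow>
     (\<forall>x\<in>S. f differentiable (at x)) \<and>
     (\<forall>v. Ck_on n S (\<lambda>x. frechet_derivative f (at x) v))"

definition smooth_on :: "'a::real_normed_vector set \<Rightarrow> ('a \<Rightarrow> 'b::real_normed_vector) \<Rightarrow> bool" where
  "smooth_on S f \<longleftrightarrow> (\<forall>n. Ck_on n S f)"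

text \<open>Near each boundary point the domain is the negativity set of a smooth function with
  non-vanishing differential; in particular it lies locally on one side of its boundary.\<close>

definition smooth_boundary :: "'a::real_normed_vector set \<Rightarrow> bool" where
  "smooth_boundary \<Omega> \<longleftrightarrow>
     (\<forall>p\<in>frontier \<Omega>. \<exists>U (\<phi> :: 'a \<Rightarrow> real).
        open U \<and> p \<in> U \<and> smooth_on U \<phi> \<and>
        (\<exists>v. frechet_derivative \<phi> (at p) v \<noteq> 0) \<and>
        \<Omega> \<inter> U = {x \<in> U. \<phi> x < 0})"

definition smooth_bounded_domain :: "'a::real_normed_vector set \<Rightarrow> bool" where
  "smooth_bounded_domain \<Omega> \<longleftrightarrow>
     open \<Omega> \<and> connected \<Omega> \<and> \<Omega> \<noteq> {} \<and> bounded \<Omega> \<and> smooth_boundary \<Omega>"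


subsection \<open>The potential\<close>

definition grad :: "('a::euclidean_space \<Rightarrow> real) \<Rightarrow> 'a \<Rightarrow> 'a" where
  "grad f y = (\<Sum>b\<in>Basis. frechet_derivative f (at y) b *\<^sub>R b)"

definition hess :: "('a::euclidean_space \<Rightarrow> real) \<Rightarrow> 'a \<Rightarrow> 'a \<Rightarrow> 'a \<Rightarrow> real" where
  "hess f y v w = frechet_derivative (\<lambda>z. frechet_derivative f (at z) w) (at y) v"

definition multi_well_potential :: "('a::euclidean_space \<Rightarrow> real) \<Rightarrow> bool" where
  "multi_well_potential V \<longleftrightarrow>
     smooth_on UNIV V \<and>
     bdd_below (range V) \<and> (INF y. V y) = 0 \<and>
     finite {y. V y = 0} \<and> card {y. V y = 0} \<ge> 2 \<and>
     (\<forall>\<sigma>. V \<sigma> = 0 \<longrightarrow> (\<forall>v. v \<noteq> 0 \<longrightarrow> hess V \<sigma> v v > 0)) \<and>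
     (\<exists>\<alpha>>0. \<exists>R>0. \<forall>y. norm y > R \<longrightarrow> y \<bullet> grad V y \<ge> \<alpha> * (norm y)\<^sup>2) \<and>
     filterlim V at_top at_infinity"


subsection \<open>Sobolev functions and weak solutions\<close>

definition compact_support_in :: "'a::topological_space set \<Rightarrow> ('a \<Rightarrow> 'b::zero) \<Rightarrow> bool" where
  "compact_support_in \<Omega> f \<longleftrightarrow> (\<exists>K. compact K \<and> K \<subseteq> \<Omega> \<and> (\<forall>x. x \<notin> K \<longrightarrow> f x = 0))"

definition test_function :: "'a::real_normed_vector set \<Rightarrow> ('a \<Rightarrow> real) \<Rightarrow> bool" where
  "test_function \<Omega> \<phi> \<longleftrightarrow> smooth_on UNIV \<phi> \<and> compact_support_in \<Omega> \<phi>"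

definition L2_on :: "'a::euclidean_space set \<Rightarrow> ('a \<Rightarrow> 'b::euclidean_space) \<Rightarrow> bool" where
  "L2_on \<Omega> f \<longleftrightarrow>
     f \<in> borel_measurable (lebesgue_on \<Omega>) \<and>
     integrable (lebesgue_on \<Omega>) (\<lambda>x. (norm (f x))\<^sup>2)"

definition is_weak_deriv ::
  "'a::euclidean_space set \<Rightarrow> 'a \<Rightarrow> ('a \<Rightarrow> 'b::euclidean_space) \<Rightarrow> ('a \<Rightarrow> 'b) \<Rightarrow> bool" where
  "is_weak_deriv \<Omega> v u g \<longleftrightarrow>
     (\<forall>\<phi>. test_function \<Omega> \<phi> \<longrightarrow>
        (LINT x:\<Omega>|lebesgue. frechet_derivative \<phi> (at x) v *\<^sub>R u x)
        = - (LINT x:\<Omega>|lebesgue. \<phi> x *\<^sub>R g x))"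

definition H1 :: "'a::euclidean_space set \<Rightarrow> ('a \<Rightarrow> 'b::euclidean_space) \<Rightarrow> bool" where
  "H1 \<Omega> u \<longleftrightarrow> L2_on \<Omega> u \<and> (\<forall>v. \<exists>g. L2_on \<Omega> g \<and> is_weak_deriv \<Omega> v u g)"

text \<open>The weak derivative of an \<open>H1\<close> function in direction \<open>v\<close>, unique up to a null set. It is only
  used under integral signs, so the choice of the representative does not matter.\<close>

definition weak_deriv ::
  "'a::euclidean_space set \<Rightarrow> 'a \<Rightarrow> ('a \<Rightarrow> 'b::euclidean_space) \<Rightarrow> 'a \<Rightarrow> 'b" where
  "weak_deriv \<Omega> v u = (SOME g. L2_on \<Omega> g \<and> is_weak_deriv \<Omega> v u g)"

text \<open>\<open>- \<Delta> u = - \<epsilon>\<^sup>-\<^sup>2 \<nabla>V(u)\<close> in the sense of distributions. No upper growth bound is imposed on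
  \<open>\<nabla>V\<close>, so local integrability of \<open>\<nabla>V(u)\<close> is part of being a solution.\<close>

definition weak_solution ::
  "'a::euclidean_space set \<Rightarrow> ('b::euclidean_space \<Rightarrow> real) \<Rightarrow> real \<Rightarrow> ('a \<Rightarrow> 'b) \<Rightarrow> bool" where
  "weak_solution \<Omega> V \<epsilon> u \<longleftrightarrow>
     H1 \<Omega> u \<and>
     (\<forall>K. compact K \<and> K \<subseteq> \<Omega> \<longrightarrow> set_integrable lebesgue K (\<lambda>x. grad V (u x))) \<and>
     (\<forall>\<phi>. test_function \<Omega> \<phi> \<longrightarrow>
        (LINT x:\<Omega>|lebesgue. (\<Sum>b\<in>Basis. frechet_derivative \<phi> (at x) b *\<^sub>R weak_deriv \<Omega> b u x))
        = - (1 / \<epsilon>\<^sup>2) *\<^sub>R (LINT x:\<Omega>|lebesgue. \<phi> x *\<^sub>R grad V (u x)))"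

definition energy_density ::
  "'a::euclidean_space set \<Rightarrow> ('b::euclidean_space \<Rightarrow> real) \<Rightarrow> real \<Rightarrow> ('a \<Rightarrow> 'b) \<Rightarrow> 'a \<Rightarrow> real" where
  "energy_density \<Omega> V \<epsilon> u x =
     \<epsilon> * (\<Sum>b\<in>Basis. (norm (weak_deriv \<Omega> b u x))\<^sup>2) / 2 + V (u x) / \<epsilon>"

definition energy ::
  "'a::euclidean_space set \<Rightarrow> ('b::euclidean_space \<Rightarrow> real) \<Rightarrow> real \<Rightarrow> ('a \<Rightarrow> 'b) \<Rightarrow> ennreal" where
  "energy \<Omega> V \<epsilon> u = (\<integral>\<^sup>+x\<in>\<Omega>. ennreal (energy_density \<Omega> V \<epsilon> u x) \<partial>lebesgue)"


subsection \<open>Measures on an open set and weak convergence\<close>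

definition radon_measure_on :: "'a::euclidean_space set \<Rightarrow> 'a measure \<Rightarrow> bool" where
  "radon_measure_on \<Omega> \<nu> \<longleftrightarrow>
     sets \<nu> = sets (restrict_space borel \<Omega>) \<and>
     (\<forall>K. compact K \<and> K \<subseteq> \<Omega> \<longrightarrow> emeasure \<nu> K < \<infinity>)"

definition weak_limit_measure ::
  "'a::euclidean_space set \<Rightarrow> (nat \<Rightarrow> 'a \<Rightarrow> real) \<Rightarrow> 'a measure \<Rightarrow> bool" where
  "weak_limit_measure \<Omega> f \<nu> \<longleftrightarrow>
     radon_measure_on \<Omega> \<nu> \<and>
     (\<forall>\<psi>::'a \<Rightarrow> real. continuous_on UNIV \<psi> \<and> compact_support_in \<Omega> \<psi> \<longrightarrow>
        (\<lambda>n. LINT x:\<Omega>|lebesgue. \<psi> x * f n x) \<longlonglongrightarrow> (LINT x|\<nu>. \<psi> x))"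

text \<open>A finite signed measure on \<open>\<Omega>\<close> is represented by a pair of finite measures, of which it is
  the difference; by the Jordan decomposition every finite signed measure has this form. The pair
  is not unique, but only the difference enters the notions below.\<close>

type_synonym 'a signed_measure = "'a measure \<times> 'a measure"

definition signed_measure_on :: "'a::euclidean_space set \<Rightarrow> 'a signed_measure \<Rightarrow> bool" where
  "signed_measure_on \<Omega> \<mu> \<longleftrightarrow>
     sets (fst \<mu>) = sets (restrict_space borel \<Omega>) \<and> finite_measure (fst \<mu>) \<and>
     sets (snd \<mu>) = sets (restrict_space borel \<Omega>) \<and> finite_measure (snd \<mu>)"

definition smeasure :: "'a signed_measure \<Rightarrow> 'a set \<Rightarrow> real" where
  "smeasure \<mu> A = measure (fst \<mu>) A - measure (snd \<mu>) A"

definition sintegral :: "'a signed_measure \<Rightarrow> ('a \<Rightarrow> real) \<Rightarrow> real" where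
  "sintegral \<mu> \<psi> = (LINT x|fst \<mu>. \<psi> x) - (LINT x|snd \<mu>. \<psi> x)"

definition weak_limit_signed ::
  "'a::euclidean_space set \<Rightarrow> (nat \<Rightarrow> 'a \<Rightarrow> real) \<Rightarrow> 'a signed_measure \<Rightarrow> bool" where
  "weak_limit_signed \<Omega> f \<mu> \<longleftrightarrow>
     signed_measure_on \<Omega> \<mu> \<and>
     (\<forall>\<psi>::'a \<Rightarrow> real. continuous_on UNIV \<psi> \<and> compact_support_in \<Omega> \<psi> \<longrightarrow>
        (\<lambda>n. LINT x:\<Omega>|lebesgue. \<psi> x * f n x) \<longlonglongrightarrow> sintegral \<mu> \<psi>)"

text \<open>Vanishing on a possibly non-measurable set means vanishing on all its measurable subsets; for
  a signed measure this says that the total variation vanishes.\<close>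

definition measure_vanishes_on :: "'a measure \<Rightarrow> 'a set \<Rightarrow> bool" where
  "measure_vanishes_on \<nu> A \<longleftrightarrow> (\<forall>D\<in>sets \<nu>. D \<subseteq> A \<longrightarrow> emeasure \<nu> D = 0)"

definition signed_vanishes_on :: "'a signed_measure \<Rightarrow> 'a set \<Rightarrow> bool" where
  "signed_vanishes_on \<mu> A \<longleftrightarrow> (\<forall>D\<in>sets (fst \<mu>). D \<subseteq> A \<longrightarrow> smeasure \<mu> D = 0)"

text \<open>\<open>\<nu> = f l + \<nu>s\<close> with \<open>\<nu>s\<close> singular with respect to \<open>l\<close>.\<close>

definition lebesgue_decomp ::
  "'a measure \<Rightarrow> 'a measure \<Rightarrow> ('a \<Rightarrow> real) \<Rightarrow> 'a measure \<Rightarrow> bool" where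
  "lebesgue_decomp l \<nu> f \<nu>s \<longleftrightarrow>
     integrable l f \<and> (AE x in l. 0 \<le> f x) \<and> sets \<nu>s = sets l \<and>
     (\<exists>N\<in>sets l. emeasure l N = 0 \<and> measure_vanishes_on \<nu>s (space l - N)) \<and>
     (\<forall>A\<in>sets l. emeasure \<nu> A = (\<integral>\<^sup>+x\<in>A. ennreal (f x) \<partial>l) + emeasure \<nu>s A)"

definition signed_lebesgue_decomp ::
  "'a::euclidean_space set \<Rightarrow> 'a measure \<Rightarrow> 'a signed_measure \<Rightarrow> ('a \<Rightarrow> real) \<Rightarrow> 'a signed_measure \<Rightarrow> bool" where
  "signed_lebesgue_decomp \<Omega> l \<mu> f \<mu>s \<longleftrightarrow>
     integrable l f \<and> signed_measure_on \<Omega> \<mu>s \<and>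
     (\<exists>N\<in>sets l. emeasure l N = 0 \<and> signed_vanishes_on \<mu>s (space l - N)) \<and>
     (\<forall>A\<in>sets l. smeasure \<mu> A = (LINT x:A|l. f x) + smeasure \<mu>s A)"


subsection \<open>One-dimensional Hausdorff measure\<close>

definition hausdorff1 :: "'a::metric_space set \<Rightarrow> ennreal" where
  "hausdorff1 A =
     (SUP \<delta>\<in>{0::real<..}.
        INF C\<in>{C :: nat \<Rightarrow> 'a set. A \<subseteq> (\<Union>i. C i) \<and> (\<forall>i. bounded (C i) \<and> diameter (C i) \<le> \<delta>)}.
          (\<Sum>i. ennreal (diameter (C i))))"

definition hausdorff1_restr :: "'a::euclidean_space set \<Rightarrow> 'a set \<Rightarrow> 'a measure" where
  "hausdorff1_restr \<Omega> S =
     measure_of \<Omega> (sets (restrict_space borel \<Omega>)) (\<lambda>A. hausdorff1 (A \<inter> S))"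


subsection \<open>Clearing-out constant and concentration set\<close>

definition clearing_out ::
  "'a::euclidean_space set \<Rightarrow> ('b::euclidean_space \<Rightarrow> real) \<Rightarrow> real \<Rightarrow> bool" where
  "clearing_out \<Omega> V \<eta> \<longleftrightarrow>
     (\<forall>(\<epsilon> :: nat \<Rightarrow> real) (v :: nat \<Rightarrow> 'a \<Rightarrow> 'b) \<nu> x r.
        (\<forall>n. 0 < \<epsilon> n \<and> \<epsilon> n \<le> 1) \<and> \<epsilon> \<longlonglongrightarrow> 0 \<and>
        (\<forall>n. weak_solution \<Omega> V (\<epsilon> n) (v n)) \<and>
        (SUP n. energy \<Omega> V (\<epsilon> n) (v n)) < \<infinity> \<and>
        weak_limit_measure \<Omega> (\<lambda>n. energy_density \<Omega> V (\<epsilon> n) (v n)) \<nu> \<and>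
        0 < r \<and> ball x r \<subseteq> \<Omega> \<and> emeasure \<nu> (cball x r \<inter> \<Omega>) < ennreal (\<eta> * r)
        \<longrightarrow> emeasure \<nu> (cball x (r / 2) \<inter> \<Omega>) = 0)"

definition concentration_set :: "'a::euclidean_space set \<Rightarrow> real \<Rightarrow> 'a measure \<Rightarrow> 'a set" where
  "concentration_set \<Omega> \<eta> \<nu> =
     {x \<in> \<Omega>. Liminf (at_right 0) (\<lambda>r. emeasure \<nu> (cball x r \<inter> \<Omega>) / ennreal r) \<ge> ennreal \<eta>}"


subsection \<open>Approximate tangents and Lebesgue points\<close>

definition perp :: "real^2 \<Rightarrow> real^2" where
  "perp v = vector [- (v $ 2), v $ 1]"

definition cone :: "real^2 \<Rightarrow> real^2 \<Rightarrow> real \<Rightarrow> (real^2) set" where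
  "cone x v \<theta> = {y. \<bar>perp v \<bullet> (y - x)\<bar> \<le> tan \<theta> * \<bar>v \<bullet> (y - x)\<bar>}"

definition unit_density_at :: "(real^2) set \<Rightarrow> real^2 \<Rightarrow> bool" where
  "unit_density_at S x \<longleftrightarrow>
     ((\<lambda>r. hausdorff1 (S \<inter> ball x r) / ennreal (2 * r)) \<longlongrightarrow> 1) (at_right 0)"

definition approx_tangent :: "(real^2) set \<Rightarrow> real^2 \<Rightarrow> real^2 \<Rightarrow> bool" where
  "approx_tangent S x v \<longleftrightarrow>
     norm v = 1 \<and>
     (\<forall>\<theta>\<in>{0<..<pi/2}.
        ((\<lambda>r. hausdorff1 (S \<inter> ball x r - cone x v \<theta>) / ennreal r) \<longlongrightarrow> 0) (at_right 0))"

definition lebesgue_point ::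
  "(real^2) measure \<Rightarrow> (real^2) set \<Rightarrow> (real^2 \<Rightarrow> real) \<Rightarrow> real^2 \<Rightarrow> bool" where
  "lebesgue_point l S f x \<longleftrightarrow>
     ((\<lambda>r. (\<integral>\<^sup>+y\<in>S \<inter> ball x r. ennreal \<bar>f y - f x\<bar> \<partial>l) / ennreal r) \<longlongrightarrow> 0) (at_right 0)"

end

theory Submission
  imports Defs
begin

text \<open>Testing the equation with \<open>\<partial>\<^sub>j u\<close> yields the conservation law \<open>div T = 0\<close> for the stress tensor
  \<open>T\<^sub>i\<^sub>j = e\<^sub>\<epsilon>(u) \<delta>\<^sub>i\<^sub>j - \<epsilon> \<partial>\<^sub>i u \<bullet> \<partial>\<^sub>j u\<close>; it survives in the limit as an identity between the measures \<open>\<zeta>\<close>, \<open>\<mu>\<^sub>i\<^sub>j\<close>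
  and \<open>C\<^sup>1\<close> test functions. The identity needs \<open>u\<close> locally bounded, because \<open>\<nabla>V(u)\<close> is only assumed
  locally integrable: Kato's inequality for \<open>(1 + |u|\<^sup>2)\<^sup>1\<^sup>/\<^sup>2\<close> and a mean value argument give the bound, and
  then mollification gives the identity.

  A divergence-free tensor does not charge \<open>H\<^sup>1\<close>-null sets: with test functions \<open>g(x \<bullet> v) \<xi>(x)\<close>, where
  \<open>g'\<close> is supported near the Lebesgue null projection of the null set, only the component \<open>T v \<bullet> v\<close>
  survives. Hence the stress tensor is absolutely continuous with respect to the restriction of \<open>H\<^sup>1\<close> to
  the concentration set, whatever the singular parts are. At \<open>x\<^sub>0\<close> test with
  \<open>\<phi>(x) = ((x - x\<^sub>0) \<bullet> e\<^sub>2) max(0, 1 - |x - x\<^sub>0|\<^sup>2/r\<^sup>2)\<^sup>2\<close>: on the tangent line \<open>\<partial>\<^sub>2\<phi>\<close> is non-negative with integral of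
  order \<open>r\<close>, while \<open>\<partial>\<^sub>1\<phi>\<close> vanishes, so \<open>r \<longrightarrow> 0\<close> forces the densities of \<open>T\<^sub>2\<^sub>2\<close> and \<open>T\<^sub>1\<^sub>2\<close> to vanish at \<open>x\<^sub>0\<close>.
  These are the two assertions.\<close>

subsection \<open>One-dimensional Hausdorff measure is a measure\<close>

text \<open>That the singular parts vanish on \<open>S - B\<close> says nothing about their mass in
  disks around a point, since \<open>B\<close> may accumulate there; a singular mass of order r
  would survive the blow-up. Lebesgue points control the densities only, which is why absolute
  continuity of the stress itself has to come first. The stress entries are kept as finite families
  of positive measures with real coefficients: the limit of the potential term is finite only on
  compact sets, so a difference of measures need not make sense on every Borel set, and all
  statements are confined to sets of finite measure or to compactly supported functions. The test
  functions adapted to null sets, boxes and disks are C1 and not smooth, so the limiting identity is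
  needed for C1 functions. The mean value argument rests on one identity in the plane: the Laplacian
  of the bump with profile \<open>flat 0\<close> at radius s, divided by s, is the derivative in s
  of \<open>2 / s^2\<close> times the bump with profile \<open>flat 2\<close>. Both assertions come
  from the stress entries with a normal index, because the tangential derivative of the test
  function is negligible.\<close>

lemma UN_case_nat: "(\<Union>i. case i of 0 \<Rightarrow> P | Suc k \<Rightarrow> Q k) = P \<union> (\<Union>k. Q k)"
proof -
  have "(\<Union>i. case i of 0 \<Rightarrow> P | Suc k \<Rightarrow> Q k) = (\<Union>i\<in>insert 0 (range Suc). case i of 0 \<Rightarrow> P | Suc k \<Rightarrow> Q k)"
    by (subst UNIV_nat_eq) (rule refl)
  also have "\<dots> = P \<union> (\<Union>k. Q k)" by (simp only: UN_insert nat.case image_image[symmetric] UN_simps)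
  finally show ?thesis .
qed

text \<open>Caratheodory's criterion for metric outer measures. Points of \<open>A - F\<close> may
  lie arbitrarily close to \<open>F\<close>, so additivity on separated sets does not apply
  directly. It applies to the parts \<open>An n\<close> at positive distance from \<open>F\<close>,
  and what is lost is the tail of a convergent series of layers.\<close>

lemma metric_outer_measure_closed:
  fixes f :: "'a::metric_space set \<Rightarrow> ennreal"
  assumes pos: "f {} = 0" and mono: "\<And>A B. A \<subseteq> B \<Longrightarrow> f A \<le> f B"
    and csub: "\<And>A::nat \<Rightarrow> 'a set. f (\<Union>i. A i) \<le> (\<Sum>i. f (A i))"
    and met: "\<And>A B d. 0 < d \<Longrightarrow> (\<And>x y. x \<in> A \<Longrightarrow> y \<in> B \<Longrightarrow> d \<le> dist x y) \<Longrightarrow> f A + f B \<le> f (A \<union> B)"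
    and F: "closed F"
  shows "f (A \<inter> F) + f (A - F) \<le> f A"
proof (cases "F = {} \<or> f A = \<infinity>")
  case True
  then show ?thesis by (auto simp: pos)
next
  case False
  then have ne: "F \<noteq> {}" and fin: "f A < \<infinity>" by (auto simp: less_top)
  define An where "An n = {x \<in> A - F. infdist x F \<ge> inverse (real (Suc n))}" for n
  define R where "R k = An (Suc k) - An k" for k
  have An_mono: "An n \<subseteq> An (Suc n)" for n
    unfolding An_def by (auto intro: order_trans[rotated] simp: le_imp_inverse_le)
  have R_sep: "inverse (real (k + 2)) - inverse (real (k + 3)) \<le> dist x y"
    if "x \<in> R k" "y \<in> R i" "k + 2 \<le> i" for k i x y
  proof -
    have "infdist x F \<ge> inverse (real (k + 2))" using that(1) by (auto simp: R_def An_def)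
    moreover have "infdist y F < inverse (real (Suc i))" using that(2) by (auto simp: R_def An_def)
    moreover have "inverse (real (Suc i)) \<le> inverse (real (k + 3))"
      using that(3) by (intro le_imp_inverse_le) auto
    moreover have "infdist x F \<le> infdist y F + dist x y" by (rule infdist_triangle)
    ultimately show ?thesis by linarith
  qed
  have gap: "0 < inverse (real (k + 2)) - inverse (real (k + 3))" for k
    by simp
  \<comment> \<open>Neighbouring layers may touch, but layers whose indices differ by at least two
    are a positive distance apart. Splitting by parity therefore gives additivity along each
    half.\<close>
  have parity: "(\<Sum>k<n. f (R (2 * k + c))) \<le> f (\<Union>k<n. R (2 * k + c))" for n c
  proof (induction n)
    case (Suc n)
    have "(\<Sum>k<Suc n. f (R (2 * k + c))) \<le> f (\<Union>k<n. R (2 * k + c)) + f (R (2 * n + c))"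
      using Suc by (auto intro: add_right_mono)
    also have "\<dots> \<le> f ((\<Union>k<n. R (2 * k + c)) \<union> R (2 * n + c))"
    proof (cases "n = 0")
      case True then show ?thesis by (simp add: pos)
    next
      case n: False
      \<comment> \<open>Only finitely many layers are compared with the new one, so one separation
        constant serves them all.\<close>
      define d where "d = Min ((\<lambda>k. inverse (real (2*k+c + 2)) - inverse (real (2*k+c + 3))) ` {..<n})"
      have "0 < d" unfolding d_def using gap n by (subst Min_gr_iff) (auto simp del: of_nat_add)
      moreover have "d \<le> dist x y" if x: "x \<in> (\<Union>k<n. R (2 * k + c))" and y: "y \<in> R (2 * n + c)" for x y
      proof -
        from x obtain k where k: "k < n" "x \<in> R (2 * k + c)" by auto
        have "d \<le> inverse (real (2*k+c + 2)) - inverse (real (2*k+c + 3))"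
          unfolding d_def using k(1) by (intro Min_le) auto
        also have "\<dots> \<le> dist x y" using k y by (intro R_sep) auto
        finally show ?thesis .
      qed
      ultimately show ?thesis by (rule met)
    qed
    also have "\<dots> = f (\<Union>k<Suc n. R (2 * k + c))" by (simp add: lessThan_Suc Un_commute)
    finally show ?case .
  qed (simp add: pos)
  have RA: "R k \<subseteq> A" for k by (auto simp: R_def An_def)
  have split2: "(\<Sum>k<2*n. f (R k)) = (\<Sum>k<n. f (R (2 * k + 0))) + (\<Sum>k<n. f (R (2 * k + 1)))" for n
    by (induction n) (auto simp: algebra_simps)
  \<comment> \<open>Each parity class lies inside \<open>A\<close>, hence the factor two; finiteness
    of \<open>f A\<close> then makes the series of layers converge.\<close>
  have "(\<Sum>k<n. f (R k)) \<le> f A + f A" for n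
  proof -
    have "(\<Sum>k<n. f (R k)) \<le> (\<Sum>k<2*n. f (R k))" by (intro sum_mono2) auto
    also have "\<dots> \<le> f (\<Union>k<n. R (2 * k + 0)) + f (\<Union>k<n. R (2 * k + 1))"
      unfolding split2 by (intro add_mono parity)
    also have "\<dots> \<le> f A + f A" using RA by (intro add_mono mono) auto
    finally show ?thesis .
  qed
  then have "(\<Sum>k. f (R k)) \<le> f A + f A"
    by (auto intro!: suminf_le_const)
  also have "\<dots> < \<infinity>" using fin by simp
  finally have sfin: "(\<Sum>k. f (R k)) < \<infinity>" .
  have Rfin: "f (R k) < \<infinity>" for k using mono[OF RA, of k] fin by (rule le_less_trans)
  define r where "r k = enn2real (f (R k))" for k
  have r: "f (R k) = ennreal (r k)" "0 \<le> r k" for k using Rfin by (auto simp: r_def)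
  have summ: "summable r"
    using sfin r by (intro summable_suminf_not_top) (auto simp: less_top)
  have tail: "(\<Sum>k. f (R (k + n))) = ennreal (\<Sum>k. r (k + n))" for n
    unfolding r(1) using summable_ignore_initial_segment[OF summ] r(2) by (intro suminf_ennreal2) auto
  have cov: "A - F \<subseteq> An n \<union> (\<Union>k. R (k + n))" for n
  proof
    fix x assume x: "x \<in> A - F"
    then have "infdist x F > 0" using in_closed_iff_infdist_zero[OF F ne, of x] infdist_nonneg[of x F] by force
    then obtain m where "inverse (real (Suc m)) < infdist x F" using reals_Archimedean by blast
    then have ex: "\<exists>m. x \<in> An m" using x by (auto simp: An_def intro!: exI[of _ m])
    show "x \<in> An n \<union> (\<Union>k. R (k + n))"
    proof (cases "x \<in> An n")
      case nx: False
      define m where "m = (LEAST m. x \<in> An m)"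
      have m: "x \<in> An m" and ml: "\<And>k. k < m \<Longrightarrow> x \<notin> An k"
        unfolding m_def using ex by (auto intro: LeastI_ex dest: not_less_Least)
      have "n < m"
      proof (rule ccontr)
        assume "\<not> n < m" then have "An m \<subseteq> An n" using An_mono lift_Suc_mono_le[of An m n] by auto
        then show False using m nx by auto
      qed
      then have "x \<in> R ((m - 1 - n) + n)" using m ml[of "m - 1"] by (auto simp: R_def)
      then show ?thesis by blast
    qed simp
  qed
  \<comment> \<open>\<open>An n\<close> is separated from \<open>F\<close>, so it can be measured
    together with \<open>A \<inter> F\<close>; the remaining layers cost only the tail, which tends
    to 0.\<close>
  have key: "f (A \<inter> F) + f (A - F) \<le> f A + ennreal (\<Sum>k. r (k + n))" for n
  proof -
    have "f (A - F) \<le> f (An n \<union> (\<Union>k. R (k + n)))" by (rule mono[OF cov])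
    also have "\<dots> = f (\<Union>i. case i of 0 \<Rightarrow> An n | Suc k \<Rightarrow> R (k + n))"
      by (simp add: UN_case_nat)
    also have "\<dots> \<le> (\<Sum>i. f (case i of 0 \<Rightarrow> An n | Suc k \<Rightarrow> R (k + n)))" by (rule csub)
    also have "\<dots> = f (An n) + (\<Sum>k. f (R (k + n)))"
      using suminf_offset[of "\<lambda>i. f (case i of 0 \<Rightarrow> An n | Suc k \<Rightarrow> R (k + n))" 1]
      by (simp add: summableI)
    finally have "f (A \<inter> F) + f (A - F) \<le> (f (A \<inter> F) + f (An n)) + ennreal (\<Sum>k. r (k + n))"
      by (simp add: tail add.assoc add_left_mono)
    also have "f (A \<inter> F) + f (An n) \<le> f ((A \<inter> F) \<union> An n)"
    proof (rule met)
      fix x y assume "x \<in> A \<inter> F" "y \<in> An n"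
      then show "inverse (real (Suc n)) \<le> dist x y"
        using infdist_le[of x F y] by (auto simp: An_def dist_commute)
    qed simp
    also have "\<dots> \<le> f A" by (intro mono) (auto simp: An_def)
    finally show ?thesis by (simp add: add_right_mono)
  qed
  have "(\<lambda>n. suminf r - sum r {..<n}) \<longlonglongrightarrow> suminf r - suminf r"
    by (intro tendsto_intros summable_LIMSEQ summ)
  then have "(\<lambda>n. ennreal (\<Sum>k. r (k + n))) \<longlonglongrightarrow> ennreal 0"
    by (intro tendsto_ennrealI) (simp add: suminf_minus_initial_segment[OF summ])
  then have "(\<lambda>n. f A + ennreal (\<Sum>k. r (k + n))) \<longlonglongrightarrow> f A + 0"
    by (intro tendsto_add) auto
  then show ?thesis using key by (intro LIMSEQ_le_const[of _ "f A"]) auto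
qed

section \<open>Hausdorff premeasures at a fixed mesh\<close>

definition hausdorff1_pre :: "real \<Rightarrow> 'a::metric_space set \<Rightarrow> ennreal" where
  "hausdorff1_pre \<delta> A = (INF C\<in>{C :: nat \<Rightarrow> 'a set. A \<subseteq> (\<Union>i. C i) \<and> (\<forall>i. bounded (C i) \<and> diameter (C i) \<le> \<delta>)}.
          (\<Sum>i. ennreal (diameter (C i))))"

lemma hausdorff1_eq_SUP_pre: "hausdorff1 A = (SUP \<delta>\<in>{0<..}. hausdorff1_pre \<delta> A)"
  unfolding hausdorff1_def hausdorff1_pre_def ..

lemma hausdorff1_pre_le:
  "A \<subseteq> (\<Union>i. C i) \<Longrightarrow> (\<And>i. bounded (C i)) \<Longrightarrow> (\<And>i. diameter (C i) \<le> \<delta>) \<Longrightarrow>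
   hausdorff1_pre \<delta> A \<le> (\<Sum>i::nat. ennreal (diameter (C i)))"
  unfolding hausdorff1_pre_def by (intro INF_lower) auto

lemma hausdorff1_pre_less:
  assumes "hausdorff1_pre \<delta> A < e"
  obtains C where "A \<subseteq> (\<Union>i::nat. C i)" "\<And>i. bounded (C i)" "\<And>i. diameter (C i) \<le> \<delta>"
    "(\<Sum>i. ennreal (diameter (C i))) < e"
  using assms unfolding hausdorff1_pre_def INF_less_iff by blast

lemma hausdorff1_pre_mono: "A \<subseteq> B \<Longrightarrow> hausdorff1_pre \<delta> A \<le> hausdorff1_pre \<delta> B"
  unfolding hausdorff1_pre_def by (intro INF_superset_mono) auto

lemma hausdorff1_pre_antimono: "\<delta> \<le> \<delta>' \<Longrightarrow> hausdorff1_pre \<delta>' A \<le> hausdorff1_pre \<delta> A"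
  unfolding hausdorff1_pre_def by (intro INF_superset_mono) (auto intro: order_trans)

lemma hausdorff1_pre_le_hausdorff1: "0 < \<delta> \<Longrightarrow> hausdorff1_pre \<delta> A \<le> hausdorff1 A"
  unfolding hausdorff1_eq_SUP_pre by (intro SUP_upper) auto

lemma hausdorff1_empty: "hausdorff1 {} = 0"
proof -
  have "hausdorff1_pre \<delta> ({}::'a set) \<le> 0" if "0 < \<delta>" for \<delta>
    using hausdorff1_pre_le[of "{}" "\<lambda>_. {}::'a set" \<delta>] that by simp
  then show ?thesis unfolding hausdorff1_eq_SUP_pre by (metis SUP_least greaterThan_iff le_zero_eq)
qed

lemma hausdorff1_mono: "A \<subseteq> B \<Longrightarrow> hausdorff1 A \<le> hausdorff1 B"
  unfolding hausdorff1_eq_SUP_pre by (intro SUP_mono) (auto intro: hausdorff1_pre_mono)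

text \<open>Covers with errors \<open>e * (1/2) ^ Suc n\<close> are merged into one sequence by the
  pairing bijection; the mesh bound is preserved because no covering set is altered.\<close>

lemma hausdorff1_pre_csub:
  fixes A :: "nat \<Rightarrow> 'a::metric_space set"
  shows "hausdorff1_pre \<delta> (\<Union>i. A i) \<le> (\<Sum>n. hausdorff1_pre \<delta> (A n))"
proof (rule ennreal_le_epsilon)
  fix e :: real assume e: "0 < e" and fin: "(\<Sum>n. hausdorff1_pre \<delta> (A n)) < top"
  then have *: "hausdorff1_pre \<delta> (A n) < hausdorff1_pre \<delta> (A n) + e * (1/2)^Suc n" for n
    by (auto simp add: less_top dest!: ennreal_suminf_lessD)
  have "\<exists>B. A n \<subseteq> (\<Union>i::nat. B i) \<and> (\<forall>i. bounded (B i) \<and> diameter (B i) \<le> \<delta>) \<and>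
      (\<Sum>i. ennreal (diameter (B i))) \<le> hausdorff1_pre \<delta> (A n) + e * (1/2)^Suc n" for n
    by (rule hausdorff1_pre_less[OF *[of n]]) (auto intro: less_imp_le)
  then obtain B where B: "\<And>n. A n \<subseteq> (\<Union>i::nat. B n i)" "\<And>n i. bounded (B n i)" "\<And>n i. diameter (B n i) \<le> \<delta>"
      "\<And>n. (\<Sum>i. ennreal (diameter (B n i))) \<le> hausdorff1_pre \<delta> (A n) + e * (1/2)^Suc n"
    by metis
  define C where "C = case_prod B o prod_decode"
  have A_C: "(\<Union>i. A i) \<subseteq> (\<Union>i. C i)"
    using B(1) by (auto simp add: C_def subset_eq) (metis prod.case prod_encode_inverse)
  have "hausdorff1_pre \<delta> (\<Union>i. A i) \<le> (\<Sum>i. ennreal (diameter (C i)))"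
    using A_C B by (intro hausdorff1_pre_le) (auto simp: C_def split: prod.splits)
  also have "\<dots> = (\<Sum>n. \<Sum>i. ennreal (diameter (B n i)))"
    using suminf_ennreal_2dimen[of "\<lambda>n. \<Sum>i. ennreal (diameter (B n i))" "\<lambda>(n,i). ennreal (diameter (B n i))"]
    unfolding C_def comp_def by (simp add: split_beta)
  also have "\<dots> \<le> (\<Sum>n. hausdorff1_pre \<delta> (A n) + e * (1/2) ^ Suc n)"
    using B by (intro suminf_le allI) auto
  also have "... = (\<Sum>n. hausdorff1_pre \<delta> (A n)) + (\<Sum>n. ennreal e * ennreal ((1/2) ^ Suc n))"
    using \<open>0 < e\<close> by (subst suminf_add[symmetric])
                     (auto simp del: ennreal_suminf_cmult simp add: ennreal_mult[symmetric])
  also have "\<dots> = (\<Sum>n. hausdorff1_pre \<delta> (A n)) + e"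
    unfolding ennreal_suminf_cmult
    by (subst suminf_ennreal_eq[OF zero_le_power power_half_series]) auto
  finally show "hausdorff1_pre \<delta> (\<Union>i. A i) \<le> (\<Sum>n. hausdorff1_pre \<delta> (A n)) + e" .
qed

lemma hausdorff1_csub:
  fixes A :: "nat \<Rightarrow> 'a::metric_space set"
  shows "hausdorff1 (\<Union>i. A i) \<le> (\<Sum>n. hausdorff1 (A n))"
proof -
  have "hausdorff1_pre \<delta> (\<Union>i. A i) \<le> (\<Sum>n. hausdorff1 (A n))" if "0 < \<delta>" for \<delta>
    using hausdorff1_pre_csub[of \<delta> A] by (rule order_trans) (intro suminf_le hausdorff1_pre_le_hausdorff1 that summableI)
  then show ?thesis unfolding hausdorff1_eq_SUP_pre[of "\<Union>i. A i"] by (intro SUP_least) auto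
qed

text \<open>A set of diameter below \<open>d\<close> cannot meet both \<open>A\<close> and
  \<open>B\<close>, so a fine cover of the union splits into two disjoint subfamilies, one for each
  set.\<close>

lemma hausdorff1_separated:
  assumes d: "0 < d" and sep: "\<And>x y. x \<in> A \<Longrightarrow> y \<in> B \<Longrightarrow> d \<le> dist x y"
  shows "hausdorff1 A + hausdorff1 B \<le> hausdorff1 (A \<union> B)"
proof -
  have 1: "hausdorff1_pre \<delta> A + hausdorff1_pre \<delta> B \<le> hausdorff1_pre \<delta> (A \<union> B)" if "0 < \<delta>" "\<delta> < d" for \<delta>
    unfolding hausdorff1_pre_def[of \<delta> "A \<union> B"]
  proof (rule INF_greatest, safe)
    fix C :: "nat \<Rightarrow> 'a set" assume C: "A \<union> B \<subseteq> (\<Union>i. C i)" "\<forall>i. bounded (C i) \<and> diameter (C i) \<le> \<delta>"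
    \<comment> \<open>Sets outside the subfamily are replaced by the empty set, of diameter 0, so
      that both covers keep the index set of \<open>C\<close>.\<close>
    define CA where "CA i = (if C i \<inter> A \<noteq> {} then C i else {})" for i
    define CB where "CB i = (if C i \<inter> B \<noteq> {} then C i else {})" for i
    have disj: "C i \<inter> A = {} \<or> C i \<inter> B = {}" for i
    proof (rule ccontr)
      assume "\<not> ?thesis"
      then obtain x y where xy: "x \<in> C i" "x \<in> A" "y \<in> C i" "y \<in> B" by auto
      have "dist x y \<le> diameter (C i)" using C(2) xy by (intro diameter_bounded_bound) auto
      moreover have "diameter (C i) \<le> \<delta>" using C(2) by blast
      moreover have "d \<le> dist x y" using sep xy(2,4) by blast
      ultimately show False using that by simp
    qed
    have le1: "hausdorff1_pre \<delta> A \<le> (\<Sum>i. ennreal (diameter (CA i)))"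
    proof (rule hausdorff1_pre_le)
      show "A \<subseteq> (\<Union>i. CA i)"
      proof
        fix x assume x: "x \<in> A"
        then obtain i where "x \<in> C i" using C(1) by blast
        then have "x \<in> CA i" using x by (auto simp: CA_def)
        then show "x \<in> (\<Union>i. CA i)" by blast
      qed
    qed (use C(2) that in \<open>simp_all add: CA_def\<close>)
    have le2: "hausdorff1_pre \<delta> B \<le> (\<Sum>i. ennreal (diameter (CB i)))"
    proof (rule hausdorff1_pre_le)
      show "B \<subseteq> (\<Union>i. CB i)"
      proof
        fix x assume x: "x \<in> B"
        then obtain i where "x \<in> C i" using C(1) by blast
        then have "x \<in> CB i" using x by (auto simp: CB_def)
        then show "x \<in> (\<Union>i. CB i)" by blast
      qed
    qed (use C(2) that in \<open>simp_all add: CB_def\<close>)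
    have "hausdorff1_pre \<delta> A + hausdorff1_pre \<delta> B \<le> (\<Sum>i. ennreal (diameter (CA i))) + (\<Sum>i. ennreal (diameter (CB i)))"
      by (rule add_mono[OF le1 le2])
    also have "(\<Sum>i. ennreal (diameter (CA i))) + (\<Sum>i. ennreal (diameter (CB i)))
       = (\<Sum>i. ennreal (diameter (CA i)) + ennreal (diameter (CB i)))"
      by (rule suminf_add) auto
    also have "\<dots> \<le> (\<Sum>i. ennreal (diameter (C i)))"
      using disj by (intro suminf_le) (auto simp: CA_def CB_def)
    finally show "hausdorff1_pre \<delta> A + hausdorff1_pre \<delta> B \<le> (\<Sum>i. ennreal (diameter (C i)))" .
  qed
  \<comment> \<open>The two suprema run over independent scales; the smaller of both, reduced
    further to \<open>d/2\<close>, handles them together.\<close>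
  have 2: "hausdorff1_pre a A + hausdorff1_pre b B \<le> hausdorff1 (A \<union> B)" if "0 < a" "0 < b" for a b
  proof -
    define \<delta> where "\<delta> = min (min a b) (d/2)"
    have \<delta>: "0 < \<delta>" "\<delta> < d" "\<delta> \<le> a" "\<delta> \<le> b" using that d by (auto simp: \<delta>_def)
    have "hausdorff1_pre a A + hausdorff1_pre b B \<le> hausdorff1_pre \<delta> A + hausdorff1_pre \<delta> B"
      using \<delta> by (intro add_mono hausdorff1_pre_antimono) auto
    also have "\<dots> \<le> hausdorff1 (A \<union> B)" using 1[OF \<delta>(1,2)] hausdorff1_pre_le_hausdorff1[OF \<delta>(1)] by (rule order_trans)
    finally show ?thesis .
  qed
  have ne: "{0::real<..} \<noteq> {}" by (simp add: greaterThan_non_empty)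
  have "hausdorff1 A + hausdorff1 B = (SUP a\<in>{0<..}. SUP b\<in>{0<..}. hausdorff1_pre a A + hausdorff1_pre b B)"
    unfolding hausdorff1_eq_SUP_pre
    by (simp only: ennreal_SUP_add_left[OF ne] ennreal_SUP_add_right[OF ne, symmetric])
  also have "\<dots> \<le> hausdorff1 (A \<union> B)" using 2 by (intro SUP_least) auto
  finally show ?thesis .
qed

text \<open>\<open>measure_of\<close> returns the given set function only once it is known to be
  countably additive. Intersecting with an arbitrary set \<open>S\<close> first yields again a
  metric outer measure, for which Borel sets are Caratheodory measurable, so the measurability of
  \<open>S\<close> does not enter.\<close>

lemma emeasure_hausdorff1_restr:
  fixes \<Omega> S :: "'a::euclidean_space set"
  assumes "open \<Omega>" and A: "A \<in> sets (restrict_space borel \<Omega>)"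
  shows "emeasure (hausdorff1_restr \<Omega> S) A = hausdorff1 (A \<inter> S)"
proof -
  define f where "f A = hausdorff1 (A \<inter> S)" for A
  define L where "L = lambda_system UNIV (UNIV :: 'a set set) f"
  have emp: "f {} = 0" by (simp add: f_def hausdorff1_empty)
  have mono: "f A \<le> f B" if "A \<subseteq> B" for A B using that by (auto simp: f_def intro!: hausdorff1_mono)
  have csub: "f (\<Union>i. A i) \<le> (\<Sum>i. f (A i))" for A :: "nat \<Rightarrow> 'a set"
    using hausdorff1_csub[of "\<lambda>i. A i \<inter> S"] by (simp add: f_def Int_UN_distrib2)
  have met: "f A + f B \<le> f (A \<union> B)" if "0 < d" "\<And>x y. x \<in> A \<Longrightarrow> y \<in> B \<Longrightarrow> d \<le> dist x y" for A B d
    unfolding f_def Int_Un_distrib2 using that by (intro hausdorff1_separated[of d]) auto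
  interpret U: sigma_algebra "UNIV :: 'a set" "UNIV :: 'a set set"
    using sigma_algebra_Pow[of "UNIV :: 'a set"] by simp
  have oms: "outer_measure_space UNIV f"
    unfolding outer_measure_space_def positive_def increasing_def countably_subadditive_def
    using emp mono csub by auto
  have ms: "measure_space UNIV L f"
    unfolding L_def by (rule U.caratheodory_lemma[OF oms])
  then interpret L: sigma_algebra UNIV L by (simp add: measure_space_def)
  have closed: "F \<in> L" if "closed F" for F
    unfolding L_def lambda_system_def
  proof safe
    fix x :: "'a set"
    have le: "f (x \<inter> F) + f (x - F) \<le> f x"
      using emp mono csub met that by (rule metric_outer_measure_closed)
    have "f x \<le> f (\<Union>i::nat. if i = 0 then x \<inter> F else if i = 1 then x - F else {})"
      by (intro mono) (force split: if_splits)
    also have "\<dots> \<le> (\<Sum>i::nat. f (if i = 0 then x \<inter> F else if i = 1 then x - F else {}))"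
      by (rule csub)
    also have "\<dots> = (\<Sum>i\<in>{0,1::nat}. f (if i = 0 then x \<inter> F else if i = 1 then x - F else {}))"
      by (rule suminf_finite) (auto simp: emp)
    also have "\<dots> = f (x \<inter> F) + f (x - F)" by simp
    finally show "f (F \<inter> x) + f ((UNIV - F) \<inter> x) = f x"
      using le by (simp add: Int_commute Diff_eq)
  qed auto
  have "sets borel \<subseteq> L"
  proof -
    have "sigma_sets UNIV (Collect closed) \<subseteq> L"
      by (rule L.sigma_sets_subset) (auto intro: closed)
    then show ?thesis by (simp add: borel_eq_closed)
  qed
  then have sub: "sets (restrict_space borel \<Omega>) \<subseteq> L"
    using \<open>open \<Omega>\<close> by (auto simp: sets_restrict_space)
  have sa: "sigma_algebra \<Omega> (sets (restrict_space borel \<Omega>))"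
    using sets.sigma_algebra_axioms[of "restrict_space borel \<Omega>"] by (simp add: space_restrict_space)
  have "positive (sets (restrict_space borel \<Omega>)) f" by (simp add: positive_def emp)
  moreover have "countably_additive (sets (restrict_space borel \<Omega>)) f"
    using ms sub unfolding measure_space_def countably_additive_def by blast
  ultimately show ?thesis unfolding hausdorff1_restr_def f_def[symmetric]
    using sa A by (intro emeasure_measure_of_sigma)
qed

lemma sets_hausdorff1_restr: "sets (hausdorff1_restr \<Omega> S) = sets (restrict_space borel \<Omega>)"
proof -
  have "sigma_algebra \<Omega> (sets (restrict_space borel \<Omega>))"
    using sets.sigma_algebra_axioms[of "restrict_space borel \<Omega>"] by (simp add: space_restrict_space)
  then show ?thesis unfolding hausdorff1_restr_def by (rule sigma_algebra.sets_measure_of_eq)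
qed

subsection \<open>Continuously differentiable functions and signed families of measures\<close>

text \<open>Continuity is asked for each fixed direction, as in \<open>Ck_on (Suc 0)\<close>; in
  finite dimension this amounts to continuity of the derivative as an operator. One derivative is
  all that the divergence identities involve.\<close>

definition C1 :: "('a::real_normed_vector \<Rightarrow> 'b::real_normed_vector) \<Rightarrow> bool" where
  "C1 f \<longleftrightarrow> (\<forall>x. f differentiable (at x)) \<and> (\<forall>v. continuous_on UNIV (\<lambda>x. frechet_derivative f (at x) v))"

lemma C1I:
  assumes "\<And>x. (f has_derivative f' x) (at x)" "\<And>v. continuous_on UNIV (\<lambda>x. f' x v)"
  shows "C1 f" "frechet_derivative f (at x) = f' x"
proof -
  show *: "frechet_derivative f (at x) = f' x" for x
    using assms(1) by (metis frechet_derivative_at)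
  show "C1 f" unfolding C1_def * using assms by (auto simp: differentiable_def)
qed

lemma C1_has_derivative: "C1 f \<Longrightarrow> (f has_derivative frechet_derivative f (at x)) (at x)"
  unfolding C1_def by (simp add: frechet_derivative_works)

lemma C1_continuous: "C1 f \<Longrightarrow> continuous_on UNIV f"
  by (auto simp: continuous_on_eq_continuous_at intro: has_derivative_continuous[OF C1_has_derivative])

lemma C1_continuous_deriv: "C1 f \<Longrightarrow> continuous_on UNIV (\<lambda>x. frechet_derivative f (at x) v)"
  unfolding C1_def by simp

lemma C1_Ck: "C1 f \<longleftrightarrow> Ck_on (Suc 0) UNIV f"
  unfolding C1_def by simp

lemma smooth_C1: "smooth_on UNIV f \<Longrightarrow> C1 f"
  unfolding smooth_on_def C1_Ck by blast

lemma smooth_deriv: "smooth_on UNIV f \<Longrightarrow> smooth_on UNIV (\<lambda>x. frechet_derivative f (at x) v)"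
  unfolding smooth_on_def by (metis Ck_on.simps(2))

lemma
  assumes f: "C1 f" and g: "C1 (g :: 'a::real_normed_vector \<Rightarrow> real)"
  shows C1_mult: "C1 (\<lambda>x. f x * g x)"
    and D_mult: "frechet_derivative (\<lambda>x. f x * g x) (at x) v
       = f x * frechet_derivative g (at x) v + frechet_derivative f (at x) v * g x"
proof -
  have 1: "((\<lambda>x. f x * g x) has_derivative (\<lambda>v. f x * frechet_derivative g (at x) v + frechet_derivative f (at x) v * g x)) (at x)" for x
    by (intro has_derivative_mult C1_has_derivative f g)
  have 2: "continuous_on UNIV (\<lambda>x. f x * frechet_derivative g (at x) v + frechet_derivative f (at x) v * g x)" for v
    by (intro continuous_intros C1_continuous C1_continuous_deriv f g)
  show "C1 (\<lambda>x. f x * g x)" by (rule C1I(1)[OF 1 2])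
  show "frechet_derivative (\<lambda>x. f x * g x) (at x) v
       = f x * frechet_derivative g (at x) v + frechet_derivative f (at x) v * g x"
    by (subst C1I(2)[OF 1 2]) simp
qed

lemma
  fixes f :: "'a::real_normed_vector \<Rightarrow> real"
  assumes f: "C1 f" and g: "\<And>x. (g has_real_derivative g' (f x)) (at (f x))"
    and c: "continuous_on UNIV (\<lambda>x. g' (f x))"
  shows C1_compose: "C1 (\<lambda>x. g (f x))"
    and D_compose: "frechet_derivative (\<lambda>x. g (f x)) (at x) v = g' (f x) * frechet_derivative f (at x) v"
proof -
  have 1: "((\<lambda>x. g (f x)) has_derivative (\<lambda>v. g' (f x) * frechet_derivative f (at x) v)) (at x)" for x
    using has_derivative_compose[OF C1_has_derivative[OF f, of x] g[unfolded has_field_derivative_def, of x]] .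
  have 2: "continuous_on UNIV (\<lambda>x. g' (f x) * frechet_derivative f (at x) v)" for v
    by (intro continuous_intros c C1_continuous_deriv f)
  show "C1 (\<lambda>x. g (f x))" by (rule C1I(1)[OF 1 2])
  show "frechet_derivative (\<lambda>x. g (f x)) (at x) v = g' (f x) * frechet_derivative f (at x) v"
    by (subst C1I(2)[OF 1 2]) simp
qed

lemma
  fixes b c :: "'a::real_inner"
  shows C1_affine: "C1 (\<lambda>x. (x - c) \<bullet> b)"
    and D_affine: "frechet_derivative (\<lambda>x. (x - c) \<bullet> b) (at x) v = v \<bullet> b"
proof -
  have 1: "((\<lambda>x. (x - c) \<bullet> b) has_derivative (\<lambda>v. v \<bullet> b)) (at x)" for x
    by (auto intro!: derivative_eq_intros)
  show "C1 (\<lambda>x. (x - c) \<bullet> b)" by (rule C1I(1)[OF 1]) simp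
  show "frechet_derivative (\<lambda>x. (x - c) \<bullet> b) (at x) v = v \<bullet> b"
    by (subst C1I(2)[OF 1]) auto
qed

lemma
  fixes c :: "'a::real_inner"
  shows C1_quad: "C1 (\<lambda>x. s - (x - c) \<bullet> (x - c))"
    and D_quad: "frechet_derivative (\<lambda>x. s - (x - c) \<bullet> (x - c)) (at x) v = - 2 * ((x - c) \<bullet> v)"
proof -
  have 1: "((\<lambda>x. s - (x - c) \<bullet> (x - c)) has_derivative (\<lambda>v. - 2 * ((x - c) \<bullet> v))) (at x)" for x
    by (auto intro!: derivative_eq_intros simp: inner_commute)
  have 2: "continuous_on UNIV (\<lambda>x. - 2 * ((x - c) \<bullet> v))" for v by (intro continuous_intros)
  show "C1 (\<lambda>x. s - (x - c) \<bullet> (x - c))" by (rule C1I(1)[OF 1 2])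
  show "frechet_derivative (\<lambda>x. s - (x - c) \<bullet> (x - c)) (at x) v = - 2 * ((x - c) \<bullet> v)"
    by (subst C1I(2)[OF 1 2]) auto
qed

lemma C1_const: "C1 (\<lambda>x. c)"
  by (rule C1I(1)[where f' = "\<lambda>_ _. 0"]) auto

lemma C1_prod:
  fixes f :: "'i \<Rightarrow> 'a::real_normed_vector \<Rightarrow> real"
  shows "(\<And>i. i \<in> I \<Longrightarrow> C1 (f i)) \<Longrightarrow> C1 (\<lambda>x. \<Prod>i\<in>I. f i x)"
  by (induction I rule: infinite_finite_induct) (auto intro!: C1_const C1_mult)

text \<open>A C1 replacement of the positive part, positive exactly for positive arguments. It turns
  open sets described by inequalities into positivity sets of C1 functions.\<close>

definition pos_square :: "real \<Rightarrow> real" where "pos_square t = (max 0 t)\<^sup>2"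

lemma pos_square_deriv: "(pos_square has_real_derivative 2 * max 0 t) (at t)"
proof (cases "t = 0")
  case True
  have "(\<lambda>h. (pos_square (0 + h) - pos_square 0) / h) \<midarrow>0\<rightarrow> 0"
  proof (rule Lim_null_comparison)
    show "\<forall>\<^sub>F h in at 0. norm ((pos_square (0 + h) - pos_square 0) / h) \<le> \<bar>h\<bar>"
      by (intro always_eventually) (auto simp: pos_square_def max_def power2_eq_square)
  qed (auto intro!: tendsto_eq_intros)
  then show ?thesis using True by (simp add: DERIV_def)
next
  case False
  show ?thesis
  proof (cases "t > 0")
    case True
    have "((\<lambda>t. t\<^sup>2) has_real_derivative 2 * t) (at t)" by (auto intro!: derivative_eq_intros)
    moreover have "\<forall>\<^sub>F x in nhds t. pos_square x = x\<^sup>2"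
      by (rule eventually_mono[OF eventually_nhds_in_open[of "{0<..}" t]]) (use True in \<open>auto simp: pos_square_def\<close>)
    ultimately show ?thesis using True by (subst DERIV_cong_ev[OF refl _ refl]) auto
  next
    case neg: False
    have "((\<lambda>t. 0) has_real_derivative 0) (at t)" by simp
    moreover have "\<forall>\<^sub>F x in nhds t. pos_square x = 0"
      by (rule eventually_mono[OF eventually_nhds_in_open[of "{..<0}" t]]) (use neg False in \<open>auto simp: pos_square_def\<close>)
    ultimately show ?thesis using neg by (subst DERIV_cong_ev[OF refl _ refl]) auto
  qed
qed

lemma
  assumes f: "C1 f"
  shows C1_pos_square: "C1 (\<lambda>x. pos_square (f x))"
    and D_pos_square: "frechet_derivative (\<lambda>x. pos_square (f x)) (at x) v = 2 * max 0 (f x) * frechet_derivative f (at x) v"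
proof -
  have c: "continuous_on UNIV (\<lambda>x. 2 * max 0 (f x))" by (intro continuous_intros C1_continuous f)
  show "C1 (\<lambda>x. pos_square (f x))" by (rule C1_compose[of f pos_square "\<lambda>t. 2 * max 0 t", OF f pos_square_deriv c])
  show "frechet_derivative (\<lambda>x. pos_square (f x)) (at x) v = 2 * max 0 (f x) * frechet_derivative f (at x) v"
    by (rule D_compose[of f pos_square "\<lambda>t. 2 * max 0 t", OF f pos_square_deriv c])
qed

lemma pos_square_nonneg: "0 \<le> pos_square t" by (simp add: pos_square_def)
lemma pos_square_pos: "0 < pos_square t \<longleftrightarrow> 0 < t" by (auto simp: pos_square_def max_def)

lemma pos_square_mult_pos: "0 < pos_square s * pos_square t \<longleftrightarrow> 0 < s \<and> 0 < t"
  by (simp add: zero_less_mult_iff pos_square_pos pos_square_nonneg[THEN leD])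

text \<open>For growing \<open>k\<close> these functions increase to the indicator of the set where
  \<open>f\<close> is positive, without enlarging the support. Through them an identity known for C1
  test functions reaches the measures of open sets.\<close>

lemma C1_kfrac:
  fixes f :: "'a::real_normed_vector \<Rightarrow> real"
  assumes f: "C1 f" "\<And>x. 0 \<le> f x" and k: "0 \<le> k"
  shows "C1 (\<lambda>x. k * f x / (1 + k * f x))"
proof (rule C1_compose[OF f(1)])
  show "((\<lambda>t. k * t / (1 + k * t)) has_real_derivative k / (1 + k * f x)\<^sup>2) (at (f x))" for x
  proof -
    have "1 + k * f x \<noteq> 0" using mult_nonneg_nonneg[OF k f(2)[of x]] by linarith
    then show ?thesis by (auto intro!: derivative_eq_intros simp: field_simps power2_eq_square)
  qed
  have "1 + k * f x \<noteq> 0" for x using mult_nonneg_nonneg[OF k f(2)[of x]] by linarith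
  then show "continuous_on UNIV (\<lambda>x. k / (1 + k * f x)\<^sup>2)"
    by (intro continuous_intros C1_continuous f) auto
qed

lemma kfrac_tendsto:
  assumes "0 \<le> (t::real)"
  shows "(\<lambda>k. real k * t / (1 + real k * t)) \<longlonglongrightarrow> (if 0 < t then 1 else 0)"
proof (cases "t > 0")
  case True
  have "filterlim (\<lambda>k. 1 + real k * t) at_top sequentially"
    by (intro filterlim_tendsto_add_at_top[OF tendsto_const]
        filterlim_at_top_mult_tendsto_pos[OF tendsto_const True] filterlim_real_sequentially)
  then have "(\<lambda>k. 1 - inverse (1 + real k * t)) \<longlonglongrightarrow> 1 - 0"
    by (intro tendsto_intros tendsto_inverse_0_at_top)
  moreover have "1 - inverse (1 + real k * t) = real k * t / (1 + real k * t)" for k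
  proof -
    have "1 + real k * t \<noteq> 0" using mult_nonneg_nonneg[OF of_nat_0_le_iff[of k] less_imp_le[OF True]] by linarith
    then show ?thesis by (simp add: field_simps)
  qed
  ultimately show ?thesis using True by simp
qed (use assms in auto)

lemma kfrac_bound: "0 \<le> (t::real) \<Longrightarrow> \<bar>real k * t / (1 + real k * t)\<bar> \<le> 1"
proof -
  assume "0 \<le> t"
  then have "0 \<le> real k * t" by simp
  then show ?thesis by (subst abs_of_nonneg) (auto simp: divide_le_eq)
qed

definition C1c :: "'a::real_normed_vector set \<Rightarrow> ('a \<Rightarrow> real) \<Rightarrow> bool" where
  "C1c \<Omega> \<phi> \<longleftrightarrow> C1 \<phi> \<and> compact_support_in \<Omega> \<phi>"

lemma compact_support_inI: "compact K \<Longrightarrow> K \<subseteq> \<Omega> \<Longrightarrow> (\<And>x. x \<notin> K \<Longrightarrow> f x = 0) \<Longrightarrow> compact_support_in \<Omega> f"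
  unfolding compact_support_in_def by blast

lemma deriv_zero_outside:
  fixes f :: "'a::real_normed_vector \<Rightarrow> 'b::real_normed_vector"
  assumes "closed K" "\<And>x. x \<notin> K \<Longrightarrow> f x = 0" "x \<notin> K"
  shows "frechet_derivative f (at x) v = 0"
proof -
  have "(f has_derivative (\<lambda>_. 0)) (at x)"
    by (rule has_derivative_transform_within_open[of "\<lambda>_. 0" _ x UNIV "- K"])
      (use assms in auto)
  then show ?thesis by (metis frechet_derivative_at)
qed

lemma C1c_deriv:
  assumes "C1c \<Omega> f"
  shows "continuous_on UNIV (\<lambda>x. frechet_derivative f (at x) v)"
    "compact_support_in \<Omega> (\<lambda>x. frechet_derivative f (at x) v)"
  using assms unfolding C1c_def compact_support_in_def
  by (auto intro: C1_continuous_deriv) (metis compact_imp_closed deriv_zero_outside)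

lemma bounded_compact_support:
  fixes f :: "'a::metric_space \<Rightarrow> 'b::real_normed_vector"
  assumes "continuous_on UNIV f" "compact_support_in \<Omega> f"
  obtains B where "0 \<le> B" "\<And>x. norm (f x) \<le> B"
proof -
  from assms(2) obtain K where K: "compact K" "\<And>x. x \<notin> K \<Longrightarrow> f x = 0" by (auto simp: compact_support_in_def)
  have "compact (f ` K)" using assms(1) K(1) by (intro compact_continuous_image) (auto intro: continuous_on_subset)
  then obtain B where "\<And>y. y \<in> f ` K \<Longrightarrow> norm y \<le> B" using compact_imp_bounded bounded_iff by metis
  then have "norm (f x) \<le> max 0 B" for x by (cases "x \<in> K") (auto simp: K(2) max.coboundedI2)
  then show ?thesis by (intro that[of "max 0 B"]) auto
qed

section \<open>Finite linear combinations of measures, tested on sets and on functions\<close>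

lemma integrable_compact_support:
  fixes f :: "'a::euclidean_space \<Rightarrow> real"
  assumes f: "f \<in> borel_measurable borel" "\<And>x. \<bar>f x\<bar> \<le> B" "\<And>x. x \<notin> K \<Longrightarrow> f x = 0"
    and K: "K \<in> sets borel" "sets M = sets borel" "emeasure M K < \<infinity>"
  shows "integrable M f"
proof (rule Bochner_Integration.integrable_bound)
  show "integrable M (\<lambda>x. B * indicator K x)" using K by simp
  show "f \<in> borel_measurable M" using f(1) K(2) by (simp cong: measurable_cong_sets)
  show "AE x in M. norm (f x) \<le> norm (B * indicator K x)"
  proof (intro always_eventually allI)
    fix x show "norm (f x) \<le> norm (B * indicator K x)"
      using f(2)[of x] f(3)[of x] by (auto simp: indicator_def)
  qed
qed

text \<open>Approximation by simple functions. The members of the family may be infinite on the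
  whole space, so everything stays bounded and supported in \<open>K\<close>, where each integral
  converges separately.\<close>

lemma signed_family_bounded_borel:
  fixes P :: "'i \<Rightarrow> 'a::euclidean_space measure"
  assumes "finite I" and P: "\<And>i. i \<in> I \<Longrightarrow> sets (P i) = sets borel" "\<And>i. i \<in> I \<Longrightarrow> emeasure (P i) K < \<infinity>"
    and K: "K \<in> sets borel"
    and zero: "\<And>D. D \<in> sets borel \<Longrightarrow> D \<subseteq> K \<Longrightarrow> (\<Sum>i\<in>I. c i * measure (P i) D) = 0"
    and f: "f \<in> borel_measurable borel" "\<And>x. \<bar>f x\<bar> \<le> B" "\<And>x. x \<notin> K \<Longrightarrow> f x = 0"
  shows "(\<Sum>i\<in>I. c i * (LINT x|P i. f x)) = (0::real)"
proof -
  have int: "integrable (P i) g" if "i \<in> I" "g \<in> borel_measurable borel" "\<And>x. 0 \<le> g x" "\<And>x. g x \<le> B"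
      "\<And>x. x \<notin> K \<Longrightarrow> g x = 0" for g :: "'a \<Rightarrow> real" and B i
    using that P K by (intro integrable_compact_support[of g B K]) auto
  \<comment> \<open>Support and boundedness are premises inside the induction predicate: the pieces
    produced by the induction inherit them from the whole function.\<close>
  have nn: "(\<forall>x. x \<notin> K \<longrightarrow> g x = 0) \<longrightarrow> (\<exists>B. \<forall>x. g x \<le> B) \<longrightarrow> (\<Sum>i\<in>I. c i * (LINT x|P i. g x)) = 0"
    if "g \<in> borel_measurable borel" "\<And>x. 0 \<le> g x" for g :: "'a \<Rightarrow> real"
    using that
  proof (induction g rule: borel_measurable_induct_real)
    case (set A)
    show ?case
    proof (intro impI)
      assume *: "\<forall>x. x \<notin> K \<longrightarrow> indicat_real A x = 0"
      then have "A \<subseteq> K" by (auto simp: indicator_def split: if_splits)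
      moreover have "(LINT x|P i. indicat_real A x) = measure (P i) A" if "i \<in> I" for i
        using set P(1)[OF that] sets_eq_imp_space_eq[OF P(1)[OF that]] by (simp add: Int_absorb2)
      ultimately show "(\<Sum>i\<in>I. c i * (LINT x|P i. indicat_real A x)) = 0"
        using zero[OF set] by simp
    qed
  next
    case (mult u a)
    show ?case
    proof (cases "a = 0")
      case False
      with mult(1) have a: "a > 0" by simp
      show ?thesis
      proof (intro impI)
        assume *: "\<forall>x. x \<notin> K \<longrightarrow> a * u x = 0" and "\<exists>B. \<forall>x. a * u x \<le> B"
        then obtain B where B: "\<forall>x. a * u x \<le> B" by blast
        then have "\<forall>x. u x \<le> B / a" using a by (simp add: field_simps)
        then have "(\<Sum>i\<in>I. c i * (LINT x|P i. u x)) = 0" using mult * a by auto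
        then have "a * (\<Sum>i\<in>I. c i * (LINT x|P i. u x)) = 0" by simp
        then show "(\<Sum>i\<in>I. c i * (LINT x|P i. a * u x)) = 0"
          by (simp add: sum_distrib_left mult.left_commute)
      qed
    qed simp
  next
    case (add u v)
    show ?case
    proof (intro impI)
      assume *: "\<forall>x. x \<notin> K \<longrightarrow> v x + u x = 0" and "\<exists>B. \<forall>x. v x + u x \<le> B"
      then obtain B where B: "\<forall>x. v x + u x \<le> B" by blast
      have z: "v x = 0" "u x = 0" if "x \<notin> K" for x
        using that * add(2)[of x] add(4)[of x] by (auto simp: add_nonneg_eq_0_iff)
      have b: "v x \<le> B" "u x \<le> B" for x using B[rule_format, of x] add(2)[of x] add(4)[of x] by linarith+
      have "(LINT x|P i. v x + u x) = (LINT x|P i. v x) + (LINT x|P i. u x)" if "i \<in> I" for i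
        using that add b z by (intro Bochner_Integration.integral_add int) auto
      then have "(\<Sum>i\<in>I. c i * (LINT x|P i. v x + u x)) =
          (\<Sum>i\<in>I. c i * (LINT x|P i. v x)) + (\<Sum>i\<in>I. c i * (LINT x|P i. u x))"
        by (simp add: sum.distrib distrib_left)
      also have "(\<Sum>i\<in>I. c i * (LINT x|P i. v x)) = 0" using add b z by blast
      also have "(\<Sum>i\<in>I. c i * (LINT x|P i. u x)) = 0" using add b z by blast
      finally show "(\<Sum>i\<in>I. c i * (LINT x|P i. v x + u x)) = 0" by simp
    qed
  next
    case (seq U)
    show ?case
    proof (intro impI)
      assume *: "\<forall>x. x \<notin> K \<longrightarrow> g x = 0" and "\<exists>B. \<forall>x. g x \<le> B"
      then obtain B where B: "\<forall>x. g x \<le> B" by blast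
      have conv: "(\<lambda>j. U j x) \<longlonglongrightarrow> g x" for x using seq by simp
      have le: "U j x \<le> g x" for j x
        using \<open>incseq U\<close> conv by (intro incseq_le) (auto simp: incseq_def le_fun_def)
      have b: "U j x \<le> B" for j x using le[of j x] B by (meson order_trans)
      have z: "U j x = 0" if "x \<notin> K" for j x using le[of j x] seq(2)[of j x] * that by auto
      have "(\<lambda>j. LINT x|P i. U j x) \<longlonglongrightarrow> (LINT x|P i. g x)" if "i \<in> I" for i
      proof (rule integral_dominated_convergence[where w = "\<lambda>x. B * indicator K x"])
        show "g \<in> borel_measurable (P i)" using that(1) \<open>g \<in> borel_measurable borel\<close> P(1)[OF \<open>i \<in> I\<close>] by (simp cong: measurable_cong_sets)
        show "U j \<in> borel_measurable (P i)" for j using seq(1) P(1)[OF that] by (simp cong: measurable_cong_sets)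
        show "integrable (P i) (\<lambda>x. B * indicator K x)" using P[OF that] K by simp
        show "AE x in P i. (\<lambda>j. U j x) \<longlonglongrightarrow> g x" using conv by simp
        show "AE x in P i. norm (U j x) \<le> B * indicator K x" for j
          using b z seq(2) by (intro always_eventually) (auto simp: indicator_def)
      qed
      then have "(\<lambda>j. \<Sum>i\<in>I. c i * (LINT x|P i. U j x)) \<longlonglongrightarrow> (\<Sum>i\<in>I. c i * (LINT x|P i. g x))"
        by (intro tendsto_intros)
      moreover have "(\<Sum>i\<in>I. c i * (LINT x|P i. U j x)) = 0" for j using seq.IH b z by blast
      ultimately show "(\<Sum>i\<in>I. c i * (LINT x|P i. g x)) = 0"
        by (simp add: LIMSEQ_const_iff)
    qed
  qed
  have fp: "(\<lambda>x. max 0 (f x)) \<in> borel_measurable borel" "(\<lambda>x. max 0 (- f x)) \<in> borel_measurable borel"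
    using f(1) by measurable
  have fb: "max 0 (f x) \<le> \<bar>B\<bar>" "max 0 (- f x) \<le> \<bar>B\<bar>" for x using f(2)[of x] by auto
  have "(LINT x|P i. f x) = (LINT x|P i. max 0 (f x)) - (LINT x|P i. max 0 (- f x))" if "i \<in> I" for i
  proof -
    have "(LINT x|P i. f x) = (LINT x|P i. max 0 (f x) - max 0 (- f x))"
      by (intro Bochner_Integration.integral_cong) (auto simp: max_def)
    also have "\<dots> = (LINT x|P i. max 0 (f x)) - (LINT x|P i. max 0 (- f x))"
    proof (rule Bochner_Integration.integral_diff)
      show "integrable (P i) (\<lambda>x. max 0 (f x))"
        by (rule int[OF that fp(1) _ fb(1)]) (simp_all add: f(3))
      show "integrable (P i) (\<lambda>x. max 0 (- f x))"
        by (rule int[OF that fp(2) _ fb(2)]) (simp_all add: f(3))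
    qed
    finally show ?thesis .
  qed
  then have "(\<Sum>i\<in>I. c i * (LINT x|P i. f x)) =
     (\<Sum>i\<in>I. c i * (LINT x|P i. max 0 (f x))) - (\<Sum>i\<in>I. c i * (LINT x|P i. max 0 (- f x)))"
    by (simp add: sum_subtractf right_diff_distrib)
  moreover have "(\<Sum>i\<in>I. c i * (LINT x|P i. max 0 (f x))) = 0"
  proof (rule nn[OF fp(1), rule_format])
    show "\<exists>B. \<forall>x. max 0 (f x) \<le> B" using fb(1) by blast
  qed (simp_all add: f(3))
  moreover have "(\<Sum>i\<in>I. c i * (LINT x|P i. max 0 (- f x))) = 0"
  proof (rule nn[OF fp(2), rule_format])
    show "\<exists>B. \<forall>x. max 0 (- f x) \<le> B" using fb(2) by blast
  qed (simp_all add: f(3))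
  ultimately show ?thesis by simp
qed

text \<open>A pi-lambda argument. Boxes are positivity sets of C1 functions, and multiplying by a
  bump of the ball keeps all measures involved finite. The Borel set \<open>Z\<close> is a weight
  that cannot be absorbed into the C1 test function.\<close>

lemma signed_family_zero_ball:
  fixes P :: "'i \<Rightarrow> 'a::euclidean_space measure"
  assumes "finite I" and P: "\<And>i. i \<in> I \<Longrightarrow> sets (P i) = sets borel" "\<And>i. i \<in> I \<Longrightarrow> emeasure (P i) (cball x r) < \<infinity>"
    and Z: "Z \<in> sets borel" and r: "0 < r"
    and zero: "\<And>\<xi>. C1 \<xi> \<Longrightarrow> (\<And>y. y \<notin> cball x r \<Longrightarrow> \<xi> y = 0) \<Longrightarrow> (\<Sum>i\<in>I. c i * (LINT y|P i. indicator Z y * \<xi> y)) = 0"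
    and D: "D \<in> sets borel"
  shows "(\<Sum>i\<in>I. c i * measure (P i) (D \<inter> (Z \<inter> ball x r))) = (0::real)"
proof -
  define W where "W = Z \<inter> ball x r"
  have W: "W \<in> sets borel" using Z by (simp add: W_def)
  have fin: "emeasure (P i) (A \<inter> W) < \<infinity>" if "i \<in> I" "A \<in> sets borel" for i A
    using P that by (intro le_less_trans[OF emeasure_mono P(2)[OF \<open>i \<in> I\<close>]]) (auto simp: W_def)
  \<comment> \<open>Dominated convergence along the functions of \<open>C1_kfrac\<close>, which tend
    to the indicator of the positivity set of \<open>\<theta>\<close>.\<close>
  have key: "(\<Sum>i\<in>I. c i * measure (P i) (Z \<inter> {y. 0 < \<theta> y})) = 0"
    if \<theta>: "C1 \<theta>" "\<And>y. 0 \<le> \<theta> y" "\<And>y. y \<notin> cball x r \<Longrightarrow> \<theta> y = 0" for \<theta> :: "'a \<Rightarrow> real"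
  proof -
    have [measurable]: "\<theta> \<in> borel_measurable borel" using C1_continuous[OF \<theta>(1)] by (rule borel_measurable_continuous_onI)
    have op: "{y. 0 < \<theta> y} \<in> sets borel"
      by (rule borel_open, rule open_Collect_less[OF continuous_on_const C1_continuous[OF \<theta>(1)]])
    have "(\<lambda>k. LINT y|P i. indicator Z y * (real k * \<theta> y / (1 + real k * \<theta> y))) \<longlonglongrightarrow> (LINT y|P i. indicator (Z \<inter> {y. 0 < \<theta> y}) y)"
      if "i \<in> I" for i
    proof (rule integral_dominated_convergence[where w = "\<lambda>y. indicator (cball x r) y"])
      have [measurable_cong]: "sets (P i) = sets borel" by (rule P(1)[OF that])
      show "integrable (P i) (\<lambda>y. indicat_real (cball x r) y)" using P[OF that] by simp
      show "indicat_real (Z \<inter> {y. 0 < \<theta> y}) \<in> borel_measurable (P i)" using Z op by measurable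
      show "(\<lambda>y. indicat_real Z y * (real k * \<theta> y / (1 + real k * \<theta> y))) \<in> borel_measurable (P i)" for k
        using Z by measurable
      show "AE y in P i. (\<lambda>k. indicat_real Z y * (real k * \<theta> y / (1 + real k * \<theta> y))) \<longlonglongrightarrow> indicator (Z \<inter> {y. 0 < \<theta> y}) y"
      proof (intro always_eventually allI)
        fix y
        have "(\<lambda>k. indicat_real Z y * (real k * \<theta> y / (1 + real k * \<theta> y))) \<longlonglongrightarrow> indicat_real Z y * (if 0 < \<theta> y then 1 else 0)"
          by (intro tendsto_intros kfrac_tendsto \<theta>)
        then show "(\<lambda>k. indicat_real Z y * (real k * \<theta> y / (1 + real k * \<theta> y))) \<longlonglongrightarrow> indicator (Z \<inter> {y. 0 < \<theta> y}) y"
          by (cases "y \<in> Z"; cases "0 < \<theta> y") simp_all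
      qed
      show "AE y in P i. norm (indicat_real Z y * (real k * \<theta> y / (1 + real k * \<theta> y))) \<le> indicator (cball x r) y" for k
      proof (intro always_eventually allI)
        fix y show "norm (indicat_real Z y * (real k * \<theta> y / (1 + real k * \<theta> y))) \<le> indicator (cball x r) y"
          using kfrac_bound[OF \<theta>(2), of k y] \<theta>(3)[of y] by (auto simp: indicator_def)
      qed
    qed
    then have "(\<lambda>k. \<Sum>i\<in>I. c i * (LINT y|P i. indicator Z y * (real k * \<theta> y / (1 + real k * \<theta> y)))) \<longlonglongrightarrow>
        (\<Sum>i\<in>I. c i * (LINT y|P i. indicator (Z \<inter> {y. 0 < \<theta> y}) y))" by (intro tendsto_intros)
    moreover have "(\<Sum>i\<in>I. c i * (LINT y|P i. indicator Z y * (real k * \<theta> y / (1 + real k * \<theta> y)))) = 0" for k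
      by (rule zero) (auto intro!: C1_kfrac \<theta>)
    ultimately have "(\<Sum>i\<in>I. c i * (LINT y|P i. indicator (Z \<inter> {y. 0 < \<theta> y}) y)) = 0" by (simp add: LIMSEQ_const_iff)
    moreover have "(LINT y|P i. indicator (Z \<inter> {y. 0 < \<theta> y}) y) = measure (P i) (Z \<inter> {y. 0 < \<theta> y})" if "i \<in> I" for i
      using Z op P(1)[OF that] sets_eq_imp_space_eq[OF P(1)[OF that]] by simp
    ultimately show ?thesis by simp
  qed
  define bump where "bump y = pos_square (r\<^sup>2 - (y - x) \<bullet> (y - x))" for y
  have bump: "C1 bump" "0 \<le> bump y" "0 < bump y \<longleftrightarrow> y \<in> ball x r" for y
  proof -
    show "C1 bump" unfolding bump_def by (intro C1_pos_square C1_quad)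
    have "(y - x) \<bullet> (y - x) < r\<^sup>2 \<longleftrightarrow> norm (y - x) < r"
      using r by (simp add: norm_lt_square)
    then show "0 < bump y \<longleftrightarrow> y \<in> ball x r" by (simp add: bump_def pos_square_pos dist_norm norm_minus_commute)
  qed (simp add: bump_def pos_square_nonneg)
  have bump0: "bump y = 0" if y: "y \<notin> cball x r" for y
  proof (rule antisym)
    have "y \<notin> ball x r" using y by (simp only: mem_ball mem_cball not_less not_le less_imp_le)
    then have "\<not> 0 < bump y" by (simp only: bump(3) not_False_eq_True)
    then show "bump y \<le> 0" by (simp only: not_less)
  qed (rule bump(2))
  \<comment> \<open>Complements in the Dynkin system are taken inside \<open>W\<close>, so the value
    on all of \<open>W\<close> is needed beforehand.\<close>
  have univ: "(\<Sum>i\<in>I. c i * measure (P i) (UNIV \<inter> W)) = 0"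
  proof -
    have eq: "Z \<inter> {y. 0 < bump y} = UNIV \<inter> W" unfolding bump(3) W_def by auto
    have "(\<Sum>i\<in>I. c i * measure (P i) (Z \<inter> {y. 0 < bump y})) = 0"
      by (rule key) (fact bump(1), fact bump(2), fact bump0)
    then show ?thesis unfolding eq .
  qed
  have Dsig: "D \<in> sigma_sets UNIV (range (\<lambda> (a, b). box a b :: 'a set))" using D by (simp add: borel_eq_box)
  have Int: "Int_stable (range (\<lambda> (a, b). box a b :: 'a set))" by (auto simp: Int_stable_def box_Int_box)
  have sig: "A \<in> sets borel" if "A \<in> sigma_sets UNIV (range (\<lambda> (a, b). box a b :: 'a set))" for A
    using that by (simp add: borel_eq_box)
  have "(\<Sum>i\<in>I. c i * measure (P i) (D \<inter> W)) = 0"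
  proof (rule sigma_sets_induct_disjoint[OF Int _ Dsig])
    show "range (\<lambda>(a, b). box a b) \<subseteq> Pow UNIV" by simp
    show "(\<Sum>i\<in>I. c i * measure (P i) ({} \<inter> W)) = 0" by simp
    fix A :: "'a set" assume "A \<in> range (\<lambda>(a, b). box a b)"
    then obtain a b where A: "A = box a b" by auto
    \<comment> \<open>Each factor is positive exactly between the two faces of the box orthogonal to
      \<open>i\<close>, so the product is positive exactly on the open box.\<close>
    define \<beta> where "\<beta> y = (\<Prod>i\<in>Basis. pos_square ((y - a) \<bullet> i) * pos_square ((y - b) \<bullet> (- i)))" for y
    have \<beta>: "C1 \<beta>" "0 \<le> \<beta> y" "0 < \<beta> y \<longleftrightarrow> y \<in> A" for y
    proof -
      show "C1 \<beta>" unfolding \<beta>_def by (intro C1_prod C1_mult C1_pos_square C1_affine)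
      show nn: "0 \<le> \<beta> y" unfolding \<beta>_def by (intro prod_nonneg mult_nonneg_nonneg pos_square_nonneg ballI)
      have "0 < \<beta> y \<longleftrightarrow> (\<forall>i\<in>Basis. 0 < pos_square ((y - a) \<bullet> i) * pos_square ((y - b) \<bullet> (- i)))"
      proof
        assume "0 < \<beta> y" then have "\<beta> y \<noteq> 0" by simp
        then have "\<forall>i\<in>Basis. pos_square ((y - a) \<bullet> i) * pos_square ((y - b) \<bullet> (- i)) \<noteq> 0"
          unfolding \<beta>_def prod_zero_iff[OF finite_Basis] by blast
        then show "\<forall>i\<in>Basis. 0 < pos_square ((y - a) \<bullet> i) * pos_square ((y - b) \<bullet> (- i))"
          by (metis pos_square_nonneg mult_nonneg_nonneg less_le)
      qed (auto simp: \<beta>_def intro: prod_pos)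
      also have "\<dots> \<longleftrightarrow> y \<in> A"
        unfolding A mem_box by (intro ball_cong refl) (simp add: pos_square_mult_pos inner_diff_left)
      finally show "0 < \<beta> y \<longleftrightarrow> y \<in> A" .
    qed
    have "0 < \<beta> y * bump y \<longleftrightarrow> y \<in> A \<and> y \<in> ball x r" for y
      by (simp only: zero_less_mult_iff \<beta>(3) bump(3) leD[OF \<beta>(2)] simp_thms)
    then have eq: "Z \<inter> {y. 0 < \<beta> y * bump y} = A \<inter> W" unfolding W_def by blast
    have "(\<Sum>i\<in>I. c i * measure (P i) (Z \<inter> {y. 0 < \<beta> y * bump y})) = 0"
    proof (rule key)
      show "C1 (\<lambda>y. \<beta> y * bump y)" by (intro C1_mult \<beta>(1) bump(1))
      show "0 \<le> \<beta> y * bump y" for y by (intro mult_nonneg_nonneg \<beta>(2) bump(2))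
      show "\<beta> y * bump y = 0" if "y \<notin> cball x r" for y using bump0[OF that] by simp
    qed
    then show "(\<Sum>i\<in>I. c i * measure (P i) (A \<inter> W)) = 0" unfolding eq .
  next
    fix A assume A: "A \<in> sigma_sets UNIV (range (\<lambda> (a, b). box a b :: 'a set))"
       and IH: "(\<Sum>i\<in>I. c i * measure (P i) (A \<inter> W)) = 0"
    have "measure (P i) ((UNIV - A) \<inter> W) = measure (P i) (UNIV \<inter> W) - measure (P i) (A \<inter> W)" if i: "i \<in> I" for i
    proof -
      have "(UNIV - A) \<inter> W = (UNIV \<inter> W) - (A \<inter> W)" by auto
      moreover have "measure (P i) ((UNIV \<inter> W) - (A \<inter> W)) = measure (P i) (UNIV \<inter> W) - measure (P i) (A \<inter> W)"
        using fin[OF i, of UNIV] W sig[OF A] P(1)[OF i] by (intro measure_Diff) auto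
      ultimately show ?thesis by simp
    qed
    then have "(\<Sum>i\<in>I. c i * measure (P i) ((UNIV - A) \<inter> W))
      = (\<Sum>i\<in>I. c i * measure (P i) (UNIV \<inter> W)) - (\<Sum>i\<in>I. c i * measure (P i) (A \<inter> W))"
      by (simp add: sum_subtractf right_diff_distrib)
    then show "(\<Sum>i\<in>I. c i * measure (P i) ((UNIV - A) \<inter> W)) = 0" using IH univ by simp
  next
    fix A :: "nat \<Rightarrow> 'a set" assume dis: "disjoint_family A" and A: "range A \<subseteq> sigma_sets UNIV (range (\<lambda> (a, b). box a b :: 'a set))"
      and IH: "\<And>j. (\<Sum>i\<in>I. c i * measure (P i) (A j \<inter> W)) = 0"
    have "(\<lambda>j. measure (P i) (A j \<inter> W)) sums measure (P i) ((\<Union>j. A j) \<inter> W)" if i: "i \<in> I" for i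
    proof -
      have UN: "(\<Union>j. A j) \<inter> W = (\<Union>j. A j \<inter> W)" by auto
      have "(\<Union>j. A j) \<in> sets borel" using A sig by (auto intro!: sets.countable_UN)
      then have "emeasure (P i) (\<Union>j. A j \<inter> W) \<noteq> \<infinity>"
        using fin[OF i, of "\<Union>j. A j"] by (simp add: UN[symmetric] less_top)
      moreover have "disjoint_family (\<lambda>j. A j \<inter> W)" using dis unfolding disjoint_family_on_def by blast
      moreover have "range (\<lambda>j. A j \<inter> W) \<subseteq> sets (P i)" using A sig W P(1)[OF i] by blast
      ultimately show ?thesis unfolding UN by (intro measure_UNION) auto
    qed
    then have "(\<lambda>j. \<Sum>i\<in>I. c i * measure (P i) (A j \<inter> W)) sums (\<Sum>i\<in>I. c i * measure (P i) ((\<Union>j. A j) \<inter> W))"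
      by (intro sums_sum sums_mult)
    then show "(\<Sum>i\<in>I. c i * measure (P i) ((\<Union>j. A j) \<inter> W)) = 0"
      using IH by (simp add: sums_0 sums_unique2)
  qed
  then show ?thesis by (simp add: W_def)
qed

text \<open>Finiteness is available only on compact subsets of \<open>U\<close>. Countably many
  balls with closure in \<open>U\<close> cover it; cutting \<open>D\<close> along their disjointed
  sequence reduces the claim to one ball, and finiteness on \<open>D\<close> allows the values to be
  summed.\<close>

lemma signed_family_zero:
  fixes P :: "'i \<Rightarrow> 'a::euclidean_space measure"
  assumes "finite I" and P: "\<And>i. i \<in> I \<Longrightarrow> sets (P i) = sets borel"
    "\<And>i K. i \<in> I \<Longrightarrow> compact K \<Longrightarrow> K \<subseteq> U \<Longrightarrow> emeasure (P i) K < \<infinity>"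
    and Z: "Z \<in> sets borel" and U: "open U"
    and zero: "\<And>\<xi>. C1c U \<xi> \<Longrightarrow> (\<Sum>i\<in>I. c i * (LINT y|P i. indicator Z y * \<xi> y)) = 0"
    and D: "D \<in> sets borel" "D \<subseteq> Z \<inter> U" "\<And>i. i \<in> I \<Longrightarrow> emeasure (P i) D < \<infinity>"
  shows "(\<Sum>i\<in>I. c i * measure (P i) D) = (0::real)"
proof -
  define \<F> where "\<F> = {ball x r |x r. 0 < r \<and> cball x r \<subseteq> U}"
  obtain \<G> where \<G>: "\<G> \<subseteq> \<F>" "countable \<G>" "\<Union>\<G> = \<Union>\<F>"
    by (rule Lindelof[of \<F>]) (auto simp: \<F>_def)
  have UF: "U \<subseteq> \<Union>\<F>"
  proof
    fix x assume "x \<in> U" then obtain r where "r > 0" "cball x r \<subseteq> U" using U open_contains_cball by blast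
    then show "x \<in> \<Union>\<F>" by (auto simp: \<F>_def intro!: exI[of _ "ball x r"])
  qed
  \<comment> \<open>The empty set is added so that the enumeration has a nonempty range to run
    through.\<close>
  define G where "G = from_nat_into (insert {} \<G>)"
  have rG: "range G = insert {} \<G>" unfolding G_def using \<G>(2) by (intro range_from_nat_into) auto
  have Gb: "G j = {} \<or> (\<exists>x r. 0 < r \<and> cball x r \<subseteq> U \<and> G j = ball x r)" for j
  proof -
    have "G j \<in> insert {} \<G>" using rG by auto
    moreover have "G j \<in> \<F>" if "G j \<in> \<G>" using that \<G>(1) by blast
    ultimately show ?thesis by (auto simp: \<F>_def)
  qed
  have GU: "D \<subseteq> (\<Union>j. G j)" using UF \<G>(3) rG D(2) by auto
  define A where "A j = D \<inter> disjointed G j" for j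
  have Gm: "range G \<subseteq> sets borel" using Gb by (auto simp: image_iff) (metis borel_open open_ball open_empty)
  have dm: "disjointed G j \<in> sets borel" for j using sets.range_disjointed_sets[OF Gm] by auto
  have Am: "A j \<in> sets borel" for j using dm D(1) by (simp add: A_def)
  have UA: "(\<Union>j. A j) = D" using GU UN_disjointed_eq[of G] by (auto simp: A_def)
  have disA: "disjoint_family A" using disjoint_family_disjointed[of G] by (auto simp: A_def disjoint_family_on_def)
  have A0: "(\<Sum>i\<in>I. c i * measure (P i) (A j)) = 0" for j
  proof (cases "G j = {}")
    case True then have "A j = {}" using disjointed_subset[of G j] by (auto simp: A_def)
    then show ?thesis by simp
  next
    case False
    then obtain x r where xr: "0 < r" "cball x r \<subseteq> U" "G j = ball x r" using Gb by blast
    have "(\<Sum>i\<in>I. c i * measure (P i) (A j \<inter> (Z \<inter> ball x r))) = 0"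
    proof (rule signed_family_zero_ball[OF \<open>finite I\<close> P(1) _ Z xr(1) _ Am])
      show "emeasure (P i) (cball x r) < \<infinity>" if "i \<in> I" for i using P(2)[OF that] xr by auto
      fix \<xi> :: "'a \<Rightarrow> real" assume "C1 \<xi>" "\<And>y. y \<notin> cball x r \<Longrightarrow> \<xi> y = 0"
      then show "(\<Sum>i\<in>I. c i * (LINT y|P i. indicat_real Z y * \<xi> y)) = 0"
        using xr by (intro zero) (auto simp: C1c_def intro!: compact_support_inI[of "cball x r"])
    qed auto
    moreover have "A j \<inter> (Z \<inter> ball x r) = A j" using D(2) xr(3) disjointed_subset[of G j] by (auto simp: A_def)
    ultimately show ?thesis by simp
  qed
  have "(\<lambda>j. measure (P i) (A j)) sums measure (P i) D" if i: "i \<in> I" for i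
    using measure_UNION[of A "P i"] Am disA D(3)[OF i] P(1)[OF i] by (auto simp: UA less_top)
  then have "(\<lambda>j. \<Sum>i\<in>I. c i * measure (P i) (A j)) sums (\<Sum>i\<in>I. c i * measure (P i) D)"
    by (intro sums_sum sums_mult)
  then show ?thesis using A0 by (simp add: sums_0 sums_unique2)
qed

subsection \<open>Smooth bump functions\<close>

text \<open>The powers of 1/t make the family closed under differentiation up to linear
  combinations, with all derivatives vanishing at 0. \<open>flat 0\<close> is the classical
  exp(-1/t).\<close>

definition flat :: "nat \<Rightarrow> real \<Rightarrow> real" where
  "flat a t = (if t > 0 then inverse t ^ a * exp (- inverse t) else 0)"

lemma flat_nonneg: "0 \<le> flat a t" by (simp add: flat_def)
lemma flat_zero: "t \<le> 0 \<Longrightarrow> flat a t = 0" by (simp add: flat_def)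

lemma flat_deriv: "(flat a has_real_derivative flat (a + 2) t - real a * flat (a + 1) t) (at t)"
proof (cases t "0::real" rule: linorder_cases)
  case less
  have "((\<lambda>t. 0) has_real_derivative 0) (at t)" by simp
  moreover have "\<forall>\<^sub>F x in nhds t. flat a x = 0"
    by (rule eventually_mono[OF eventually_nhds_in_open[of "{..<0}" t]]) (use less in \<open>auto simp: flat_def\<close>)
  ultimately show ?thesis using less by (subst DERIV_cong_ev[OF refl _ refl]) (auto simp: flat_def)
next
  case greater
  have "((\<lambda>t. inverse t ^ a * exp (- inverse t)) has_real_derivative flat (a + 2) t - real a * flat (a + 1) t) (at t)"
    using greater
    by (auto intro!: derivative_eq_intros simp: flat_def power2_eq_square)
       (cases a; simp add: field_simps power_add)
  moreover have "\<forall>\<^sub>F x in nhds t. flat a x = inverse x ^ a * exp (- inverse x)"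
    by (rule eventually_mono[OF eventually_nhds_in_open[of "{0<..}" t]]) (use greater in \<open>auto simp: flat_def\<close>)
  ultimately show ?thesis by (subst DERIV_cong_ev[OF refl _ refl]) auto
next
  case equal
  have "(\<lambda>h. (flat a (0 + h) - flat a 0) / h) \<midarrow>0\<rightarrow> 0"
    unfolding filterlim_at_split
  proof
    show "((\<lambda>h. (flat a (0 + h) - flat a 0) / h) \<longlongrightarrow> 0) (at_left 0)"
      by (rule tendsto_eventually) (auto simp: eventually_at_filter flat_def)
    \<comment> \<open>From the right the difference quotient at 0 is a power of 1/h divided by
      exp(1/h), and the exponential wins.\<close>
    have "((\<lambda>h. inverse h ^ (a + 1) / exp (inverse h)) \<longlongrightarrow> 0) (at_right (0::real))"
      using filterlim_compose[OF tendsto_power_div_exp_0[of "a + 1"] filterlim_inverse_at_top_right] by simp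
    moreover have "\<forall>\<^sub>F h in at_right (0::real). inverse h ^ (a + 1) / exp (inverse h) = (flat a (0 + h) - flat a 0) / h"
      by (auto simp: eventually_at_filter flat_def exp_minus field_simps)
    ultimately show "((\<lambda>h. (flat a (0 + h) - flat a 0) / h) \<longlongrightarrow> 0) (at_right 0)"
      by (rule Lim_transform_eventually)
  qed
  then show ?thesis using equal by (simp add: DERIV_def flat_def)
qed

lemma flat_continuous: "continuous_on UNIV (flat a)"
  using flat_deriv by (auto intro!: continuous_at_imp_continuous_on DERIV_isCont)

lemma flat_0_le_1: "flat 0 t \<le> 1"
  by (simp add: flat_def)

lemma Ck_on_add:
  "Ck_on n UNIV f \<Longrightarrow> Ck_on n UNIV g \<Longrightarrow> Ck_on n UNIV (\<lambda>x. f x + g x)"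
proof (induction n arbitrary: f g)
  case 0
  then show ?case by (auto intro: continuous_on_add)
next
  case (Suc n)
  have "frechet_derivative (\<lambda>x. f x + g x) (at x) v = frechet_derivative f (at x) v + frechet_derivative g (at x) v" for x v
  proof -
    have "((\<lambda>x. f x + g x) has_derivative (\<lambda>v. frechet_derivative f (at x) v + frechet_derivative g (at x) v)) (at x)"
      using Suc.prems by (intro has_derivative_add) (auto simp: frechet_derivative_works)
    then show ?thesis by (metis frechet_derivative_at)
  qed
  then show ?case using Suc by auto
qed

lemma real_polynomial_function_deriv:
  assumes "real_polynomial_function p"
  shows "\<exists>p'. (\<forall>x. (p has_derivative p' x) (at x)) \<and> (\<forall>v. real_polynomial_function (\<lambda>x. p' x v))"
  using assms
proof (induction p rule: real_polynomial_function.induct)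
  case (linear f)
  then show ?case by (intro exI[of _ "\<lambda>x. f"]) (auto intro: bounded_linear_imp_has_derivative real_polynomial_function.intros(2))
next
  case (const c)
  then show ?case by (intro exI[of _ "\<lambda>x v. 0"]) (auto intro: real_polynomial_function.intros(2))
next
  case (add f g)
  then obtain f' g' where *: "\<forall>x. (f has_derivative f' x) (at x)" "\<forall>v. real_polynomial_function (\<lambda>x. f' x v)"
    "\<forall>x. (g has_derivative g' x) (at x)" "\<forall>v. real_polynomial_function (\<lambda>x. g' x v)" by blast
  then show ?case by (intro exI[of _ "\<lambda>x v. f' x v + g' x v"]) (auto intro: has_derivative_add real_polynomial_function.intros(3))
next
  case (mult f g)
  then obtain f' g' where *: "\<forall>x. (f has_derivative f' x) (at x)" "\<forall>v. real_polynomial_function (\<lambda>x. f' x v)"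
    "\<forall>x. (g has_derivative g' x) (at x)" "\<forall>v. real_polynomial_function (\<lambda>x. g' x v)" by blast
  show ?case
  proof (intro exI[of _ "\<lambda>x v. f x * g' x v + f' x v * g x"] conjI allI)
    show "((\<lambda>x. f x * g x) has_derivative (\<lambda>v. f x * g' x v + f' x v * g x)) (at x)" for x
      using * by (intro has_derivative_mult) auto
    show "real_polynomial_function (\<lambda>x. f x * g' x v + f' x v * g x)" for v
      using * mult.hyps by (intro real_polynomial_function.intros(3,4)) auto
  qed
qed

text \<open>Both the exponent \<open>a\<close> and the polynomial factor \<open>p\<close> vary in
  the induction: a directional derivative of \<open>flat a (q x) * p x\<close> is a sum of three
  terms of the same shape.\<close>

lemma Ck_on_bump:
  assumes q: "real_polynomial_function q"
  shows "real_polynomial_function p \<Longrightarrow> Ck_on n UNIV (\<lambda>x. flat a (q x) * p x)"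
proof (induction n arbitrary: a p)
  case 0
  have "continuous_on UNIV q" "continuous_on UNIV p"
    using q 0 by (auto intro: continuous_on_polymonial_function simp: real_polynomial_function_eq)
  then show ?case by (auto intro!: continuous_on_mult continuous_on_compose2[OF flat_continuous])
next
  case (Suc n)
  obtain q' where q': "\<forall>x. (q has_derivative q' x) (at x)" "\<forall>v. real_polynomial_function (\<lambda>x. q' x v)"
    using real_polynomial_function_deriv[OF q] by blast
  obtain p' where p': "\<forall>x. (p has_derivative p' x) (at x)" "\<forall>v. real_polynomial_function (\<lambda>x. p' x v)"
    using real_polynomial_function_deriv[OF Suc.prems] by blast
  have der: "((\<lambda>x. flat a (q x) * p x) has_derivative
      (\<lambda>v. flat a (q x) * p' x v + ((flat (a + 2) (q x) - real a * flat (a + 1) (q x)) * q' x v) * p x)) (at x)" for x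
    using q' p' by (intro has_derivative_mult has_derivative_compose[OF _ flat_deriv[unfolded has_field_derivative_def]]) auto
  have fd: "frechet_derivative (\<lambda>x. flat a (q x) * p x) (at x) v =
     (flat a (q x) * p' x v + flat (a + 2) (q x) * (q' x v * p x)) + flat (a + 1) (q x) * (- real a * (q' x v * p x))" for x v
    by (subst frechet_derivative_at[OF der, symmetric]) (simp add: algebra_simps)
  show ?case
    unfolding Ck_on.simps fd
  proof (intro conjI ballI allI)
    show "(\<lambda>x. flat a (q x) * p x) differentiable at x" for x using der by (auto simp: differentiable_def)
    show "Ck_on n UNIV (\<lambda>x. (flat a (q x) * p' x v + flat (a + 2) (q x) * (q' x v * p x)) + flat (a + 1) (q x) * (- real a * (q' x v * p x)))" for v
      using q' p' Suc.prems by (intro Ck_on_add Suc.IH real_polynomial_function.intros(2-4)) auto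
  qed
qed

lemma real_polynomial_function_quad:
  "real_polynomial_function (\<lambda>y. 1 - ((x - y) \<bullet> (x - y)) * c)" for x :: "'a::euclidean_space"
proof -
  have lin: "real_polynomial_function (\<lambda>y. y \<bullet> b)" for b :: 'a
    by (intro real_polynomial_function.intros(1) bounded_linear_inner_left)
  have "real_polynomial_function (\<lambda>y. 1 + (- c) * (\<Sum>b\<in>Basis. (x \<bullet> b + (-1) * (y \<bullet> b)) * (x \<bullet> b + (-1) * (y \<bullet> b))))"
    by (intro real_polynomial_function.intros(2-) real_polynomial_function_sum lin finite_Basis)
  moreover have "(x - y) \<bullet> (x - y) = (\<Sum>b\<in>Basis. (x \<bullet> b + (-1) * (y \<bullet> b)) * (x \<bullet> b + (-1) * (y \<bullet> b)))" for y
    by (subst euclidean_inner) (simp add: inner_diff_left)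
  ultimately show ?thesis by (simp add: mult.commute)
qed

lemma smooth_bump:
  fixes x :: "'a::euclidean_space"
  shows "smooth_on UNIV (\<lambda>y. flat a (1 - ((x - y) \<bullet> (x - y)) * c) * d)"
  unfolding smooth_on_def
  by (intro allI Ck_on_bump real_polynomial_function_quad real_polynomial_function.intros(2))

subsection \<open>Divergence-free families of measures\<close>

text \<open>The map \<open>x \<bullet> v\<close> is 1-Lipschitz, so a set of diameter d projects
  into an interval of radius d around the image of any of its points; a null set has arbitrarily
  cheap covers.\<close>

lemma hausdorff1_null_projection:
  fixes v :: "'a::euclidean_space"
  assumes N: "hausdorff1 N = 0" and v: "norm v \<le> 1" and e: "0 < e"
  obtains U :: "real set" where "open U" "emeasure lborel U \<le> ennreal e" "\<And>x. x \<in> N \<Longrightarrow> x \<bullet> v \<in> U"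
proof -
  \<comment> \<open>The mesh bound 1 is arbitrary, only the sum of the diameters matters. The
    intervals have twice the radius as length, so the budget is twice e/4 for the diameters and e/2
    for the enlargements.\<close>
  have "hausdorff1_pre 1 N < ennreal (e / 4)"
    using hausdorff1_pre_le_hausdorff1[of 1 N] N e by (simp add: le_zero_eq)
  then obtain C where C: "N \<subseteq> (\<Union>i::nat. C i)" "\<And>i. bounded (C i)" "(\<Sum>i. ennreal (diameter (C i))) < ennreal (e / 4)"
    by (rule hausdorff1_pre_less) (rule that; assumption)
  \<comment> \<open>For an empty \<open>C i\<close> this is an unspecified point; its interval is
    short all the same.\<close>
  define c where "c i = (SOME x. x \<in> C i)" for i
  \<comment> \<open>The positive summand lets an open interval contain the projection even of a set
    of diameter 0.\<close>
  define r where "r i = diameter (C i) + e / 4 * (1/2) ^ Suc i" for i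
  have d0: "0 \<le> diameter (C i)" for i by (rule diameter_ge_0[OF C(2)])
  have r: "0 \<le> r i" "diameter (C i) < r i" for i
  proof -
    have "0 < e / 4 * (1/2) ^ Suc i" using e by (intro mult_pos_pos zero_less_power) simp_all
    then show "0 \<le> r i" "diameter (C i) < r i" unfolding r_def using d0[of i] by linarith+
  qed
  define U where "U = (\<Union>i. {c i \<bullet> v - r i <..< c i \<bullet> v + r i})"
  show ?thesis
  proof (rule that[of U])
    show "open U" unfolding U_def by (intro open_UN ballI open_greaterThanLessThan)
    have "emeasure lborel U \<le> (\<Sum>i. emeasure lborel {c i \<bullet> v - r i <..< c i \<bullet> v + r i})"
      unfolding U_def by (rule emeasure_subadditive_countably) auto
    also have "\<dots> = (\<Sum>i. 2 * ennreal (diameter (C i)) + ennreal (e / 2) * ennreal ((1/2) ^ Suc i))"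
    proof (intro suminf_cong)
      fix i
      have "emeasure lborel {c i \<bullet> v - r i <..< c i \<bullet> v + r i} = ennreal (2 * r i)"
        using r(1)[of i] by simp
      also have "2 * r i = 2 * diameter (C i) + e / 2 * (1/2) ^ Suc i" by (simp add: r_def algebra_simps)
      also have "ennreal \<dots> = ennreal (2 * diameter (C i)) + ennreal (e / 2 * (1/2) ^ Suc i)"
        using d0[of i] e by (intro ennreal_plus) auto
      also have "\<dots> = 2 * ennreal (diameter (C i)) + ennreal (e / 2) * ennreal ((1/2) ^ Suc i)"
      proof -
        have "ennreal (2 * diameter (C i)) = 2 * ennreal (diameter (C i))"
          using d0[of i] by (simp add: ennreal_mult)
        moreover have "ennreal (e / 2 * (1/2) ^ Suc i) = ennreal (e / 2) * ennreal ((1/2) ^ Suc i)"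
          using e by (intro ennreal_mult) auto
        ultimately show ?thesis by (simp only:)
      qed
      finally show "emeasure lborel {c i \<bullet> v - r i <..< c i \<bullet> v + r i} =
         2 * ennreal (diameter (C i)) + ennreal (e / 2) * ennreal ((1/2) ^ Suc i)" .
    qed
    also have "\<dots> = (\<Sum>i. 2 * ennreal (diameter (C i))) + (\<Sum>i. ennreal (e / 2) * ennreal ((1/2) ^ Suc i))"
      by (rule suminf_add[symmetric]) auto
    also have "\<dots> = 2 * (\<Sum>i. ennreal (diameter (C i))) + ennreal (e / 2)"
      unfolding ennreal_suminf_cmult
      by (subst suminf_ennreal_eq[OF zero_le_power power_half_series]) auto
    also have "\<dots> \<le> 2 * ennreal (e / 4) + ennreal (e / 2)"
      using C(3) by (intro add_right_mono mult_left_mono) auto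
    also have "\<dots> = ennreal (2 * (e / 4) + e / 2)"
    proof -
      have "ennreal (2 * (e / 4)) = ennreal 2 * ennreal (e / 4)" using e by (intro ennreal_mult) auto
      then have "2 * ennreal (e / 4) = ennreal (2 * (e / 4))" by simp
      then show ?thesis using e by (subst ennreal_plus) auto
    qed
    finally show "emeasure lborel U \<le> ennreal e" by simp
    fix x assume "x \<in> N"
    then obtain i where i: "x \<in> C i" using C(1) by blast
    have "c i \<in> C i" unfolding c_def using i by (rule someI)
    then have "norm (x - c i) \<le> diameter (C i)"
      using diameter_bounded_bound[OF C(2) i] by (simp add: dist_norm)
    moreover have "\<bar>(x - c i) \<bullet> v\<bar> \<le> norm (x - c i)"
      using Cauchy_Schwarz_ineq2[of "x - c i" v] v mult_left_le[of "norm v" "norm (x - c i)"] by simp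
    ultimately have "\<bar>x \<bullet> v - c i \<bullet> v\<bar> < r i" using r(2)[of i] by (simp add: inner_diff_left)
    then show "x \<bullet> v \<in> U" unfolding U_def by (auto intro!: exI[of _ i] simp: abs_less_iff)
  qed
qed

text \<open>Increments of an antiderivative are integrals of \<open>h\<close>, hence at most the
  length of \<open>U\<close>. The point is that \<open>g\<close> is uniformly small although its
  derivative need not be.\<close>

lemma antiderivative_small:
  fixes h :: "real \<Rightarrow> real"
  assumes h: "continuous_on UNIV h" "\<And>t. 0 \<le> h t" "\<And>t. h t \<le> indicator U t"
    and U: "open U" "emeasure lborel U \<le> ennreal L" and L: "0 \<le> L"
  obtains g where "\<And>t. (g has_real_derivative h t) (at t)" "\<And>t. \<bar>g t\<bar> \<le> L"
proof -
  have "\<exists>F. \<forall>x::real. -\<infinity> < ereal x \<longrightarrow> ereal x < \<infinity> \<longrightarrow> (F has_vector_derivative h x) (at x)"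
    using h(1) by (intro einterval_antiderivative) (auto simp: continuous_on_eq_continuous_at)
  then obtain F where F: "(F has_real_derivative h x) (at x)" for x
    by (auto simp: has_real_derivative_iff_has_vector_derivative)
  have finU: "emeasure lborel U < \<infinity>" using U(2) by (rule le_less_trans) simp
  have iU: "integrable lborel (indicat_real U)" using U(1) finU by simp
  have inc: "F a \<le> F b \<and> F b - F a \<le> L" if "a \<le> b" for a b
  proof -
    have eq: "(\<integral>x. indicator {a..b} x *\<^sub>R h x \<partial>lborel) = F b - F a"
      using that F h(1)
      by (intro integral_FTC_Icc)
         (auto intro: has_field_derivative_at_within continuous_on_subset simp flip: has_real_derivative_iff_has_vector_derivative)
    have "0 \<le> (\<integral>x. indicator {a..b} x *\<^sub>R h x \<partial>lborel)"
      using h(2) by (intro Bochner_Integration.integral_nonneg) auto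
    moreover have "(\<integral>x. indicator {a..b} x *\<^sub>R h x \<partial>lborel) \<le> (\<integral>x. indicat_real U x \<partial>lborel)"
    proof (rule integral_mono_AE'[OF iU])
      show "AE x in lborel. indicator {a..b} x *\<^sub>R h x \<le> indicat_real U x"
      proof (intro AE_I2)
        fix x
        show "indicator {a..b} x *\<^sub>R h x \<le> indicat_real U x"
          using h(3)[of x] order_trans[OF h(2)[of x] h(3)[of x]] by (cases "x \<in> {a..b}") simp_all
      qed
      show "AE x in lborel. 0 \<le> indicat_real U x" by simp
    qed
    moreover have "(\<integral>x. indicat_real U x \<partial>lborel) = measure lborel U" using U(1) by simp
    moreover have "measure lborel U \<le> L" using U(2) L by (simp add: measure_def enn2real_leI)
    ultimately show ?thesis using eq by auto
  qed
  show ?thesis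
  proof (rule that[of "\<lambda>t. F t - F 0"])
    show "((\<lambda>t. F t - F 0) has_real_derivative h t) (at t)" for t
      using F[of t] by (auto intro!: derivative_eq_intros)
    show "\<bar>F t - F 0\<bar> \<le> L" for t using inc[of 0 t] inc[of t 0] by (cases "0 \<le> t") auto
  qed
qed

text \<open>For the test function \<open>g (x \<bullet> v) * \<xi> x\<close> the derivative of
  \<open>g\<close> appears only along \<open>v\<close>, because \<open>w\<close> is orthogonal to
  \<open>v\<close>. All other terms carry the factor \<open>g\<close>, which is at most
  \<open>L\<close> in modulus.\<close>

lemma div_free_strip_bound:
  fixes P :: "'i \<Rightarrow> 'a::euclidean_space measure" and Q :: "'j \<Rightarrow> 'a measure" and c :: "'i \<Rightarrow> real" and d :: "'j \<Rightarrow> real"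
  assumes fin: "finite I" "finite J"
    and P: "\<And>i. i \<in> I \<Longrightarrow> sets (P i) = sets borel" "\<And>i K. i \<in> I \<Longrightarrow> compact K \<Longrightarrow> K \<subseteq> \<Omega> \<Longrightarrow> emeasure (P i) K < \<infinity>"
    and Q: "\<And>j. j \<in> J \<Longrightarrow> sets (Q j) = sets borel" "\<And>j K. j \<in> J \<Longrightarrow> compact K \<Longrightarrow> K \<subseteq> \<Omega> \<Longrightarrow> emeasure (Q j) K < \<infinity>"
    and vw: "v \<bullet> v = 1" "w \<bullet> v = 0"
    and div: "\<And>\<phi>. C1c \<Omega> \<phi> \<Longrightarrow>
      (\<Sum>i\<in>I. c i * (LINT x|P i. frechet_derivative \<phi> (at x) v)) + (\<Sum>j\<in>J. d j * (LINT x|Q j. frechet_derivative \<phi> (at x) w)) = 0"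
    and \<xi>: "C1c \<Omega> \<xi>"
    and U: "open U" "emeasure lborel U \<le> ennreal L" "0 \<le> L"
  shows "\<bar>\<Sum>i\<in>I. c i * (LINT x|P i. indicator U (x \<bullet> v) * \<xi> x)\<bar> \<le>
    L * ((\<Sum>i\<in>I. \<bar>c i\<bar> * (LINT x|P i. \<bar>frechet_derivative \<xi> (at x) v\<bar>)) + (\<Sum>j\<in>J. \<bar>d j\<bar> * (LINT x|Q j. \<bar>frechet_derivative \<xi> (at x) w\<bar>)))"
    (is "_ \<le> L * ?C")
proof -
  let ?D = "\<lambda>v x. frechet_derivative \<xi> (at x) v"
  obtain K where K: "compact K" "K \<subseteq> \<Omega>" "\<And>x. x \<notin> K \<Longrightarrow> \<xi> x = 0"
    using \<xi> unfolding C1c_def compact_support_in_def by blast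
  have C1\<xi>: "C1 \<xi>" and cs: "compact_support_in \<Omega> \<xi>" using \<xi> by (auto simp: C1c_def)
  obtain B where B: "0 \<le> B" "\<And>x. norm (\<xi> x) \<le> B" using bounded_compact_support[OF C1_continuous[OF C1\<xi>] cs] by blast
  have DK: "?D u x = 0" if "x \<notin> K" for u x
    using deriv_zero_outside[OF compact_imp_closed[OF K(1)] K(3) that] .
  have Db: "\<exists>B. \<forall>x. norm (?D u x) \<le> B" for u
    using bounded_compact_support[OF C1c_deriv[OF \<xi>], of u] by metis
  have [measurable]: "\<xi> \<in> borel_measurable borel" by (rule borel_measurable_continuous_onI[OF C1_continuous[OF C1\<xi>]])
  have [measurable]: "?D u \<in> borel_measurable borel" for u by (rule borel_measurable_continuous_onI[OF C1_continuous_deriv[OF C1\<xi>]])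
  have Kb: "K \<in> sets borel" using K(1) by (simp add: borel_compact)
  have int\<xi>: "integrable M (\<lambda>x. f (x \<bullet> v) * \<xi> x)"
    if "f \<in> borel_measurable borel" "\<And>t. \<bar>f t\<bar> \<le> b" "sets M = sets borel" "emeasure M K < \<infinity>" for f :: "real \<Rightarrow> real" and b M
  proof (rule integrable_compact_support[OF _ _ _ Kb that(3,4)])
    show "(\<lambda>x. f (x \<bullet> v) * \<xi> x) \<in> borel_measurable borel" using that(1) by measurable
    show "\<bar>f (x \<bullet> v) * \<xi> x\<bar> \<le> b * B" for x
      unfolding abs_mult using that(2)[of "x \<bullet> v"] B(2)[of x] abs_ge_zero[of "f (x \<bullet> v)"]
      by (intro mult_mono) auto
    show "f (x \<bullet> v) * \<xi> x = 0" if "x \<notin> K" for x using K(3)[OF that] by simp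
  qed
  have intD: "integrable M (\<lambda>x. f (x \<bullet> v) * ?D u x)"
    if "f \<in> borel_measurable borel" "\<And>t. \<bar>f t\<bar> \<le> b" "sets M = sets borel" "emeasure M K < \<infinity>" for f :: "real \<Rightarrow> real" and b u M
  proof -
    obtain B' where B': "\<And>x. norm (?D u x) \<le> B'" using Db by blast
    show ?thesis
    proof (rule integrable_compact_support[OF _ _ _ Kb that(3,4)])
      show "(\<lambda>x. f (x \<bullet> v) * ?D u x) \<in> borel_measurable borel" using that(1) by measurable
      show "\<bar>f (x \<bullet> v) * ?D u x\<bar> \<le> b * B'" for x
        unfolding abs_mult using that(2)[of "x \<bullet> v"] B'[of x] abs_ge_zero[of "f (x \<bullet> v)"]
        by (intro mult_mono) auto
      show "f (x \<bullet> v) * ?D u x = 0" if "x \<notin> K" for x using DK[OF that] by simp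
    qed
  qed
  have intabs: "integrable M (\<lambda>x. \<bar>?D u x\<bar>)" if "sets M = sets borel" "emeasure M K < \<infinity>" for u M
    using intD[of "\<lambda>_. 1" 1 M u] that by auto
  \<comment> \<open>Continuous approximations from below of the indicator of \<open>U\<close>, by
    truncated multiples of the distance to the complement.\<close>
  define h where "h k t = min 1 (real k * infdist t (- U))" for k :: nat and t :: real
  \<comment> \<open>\<open>infdist\<close> to the empty set is 0, which would make every
    \<open>h k\<close> vanish; a set of finite length leaves a nonempty complement.\<close>
  have Une: "- U \<noteq> {}"
  proof
    assume "- U = {}" then have "U = UNIV" by auto
    then show False using U(2) by (simp add: top_unique)
  qed
  have hc: "continuous_on UNIV (h k)" for k unfolding h_def by (intro continuous_intros)
  have h0: "0 \<le> h k t" "h k t \<le> 1" for k t by (auto simp: h_def infdist_nonneg)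
  have hU: "h k t \<le> indicator U t" for k t
    using h0(2)[of k t] Une by (auto simp: h_def indicator_def)
  have hlim: "(\<lambda>k. h k t) \<longlonglongrightarrow> indicator U t" for t
  proof (cases "t \<in> U")
    case False
    then have "h k t = 0" for k using Une by (auto simp: h_def)
    then show ?thesis using False by simp
  next
    case True
    have "closed (- U)" using U(1) by (simp add: closed_Compl)
    then have p: "0 < infdist t (- U)"
      using in_closed_iff_infdist_zero[of "- U" t] Une True infdist_nonneg[of t "- U"] by force
    obtain k0 :: nat where k0: "1 / infdist t (- U) \<le> real k0" using real_arch_simple by blast
    have "\<forall>\<^sub>F k in sequentially. h k t = 1" using eventually_ge_at_top[of k0]
    proof eventually_elim
      case (elim k)
      have "1 \<le> real k0 * infdist t (- U)" using k0 p by (simp add: field_simps)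
      also have "\<dots> \<le> real k * infdist t (- U)" using elim p by (intro mult_right_mono) auto
      finally show ?case by (simp add: h_def)
    qed
    then show ?thesis using True by (simp add: tendsto_eventually)
  qed
  have step: "\<bar>\<Sum>i\<in>I. c i * (LINT x|P i. h k (x \<bullet> v) * \<xi> x)\<bar> \<le> L * ?C" for k
  proof -
    obtain g where g: "\<And>t. (g has_real_derivative h k t) (at t)" "\<And>t. \<bar>g t\<bar> \<le> L"
      using antiderivative_small[OF hc h0(1) hU U] by metis
    have gc: "continuous_on UNIV g" using g(1) by (auto intro!: continuous_at_imp_continuous_on DERIV_isCont)
    have [measurable]: "g \<in> borel_measurable borel" "h k \<in> borel_measurable borel"
      using gc hc by (auto intro: borel_measurable_continuous_onI)
    have aff: "C1 (\<lambda>x. x \<bullet> v)" "frechet_derivative (\<lambda>x. x \<bullet> v) (at x) u = u \<bullet> v" for x u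
      using C1_affine[of 0 v] D_affine[of 0 v x u] by simp_all
    have c2: "continuous_on UNIV (\<lambda>x. h k (x \<bullet> v))" by (rule continuous_on_compose2[OF hc]) (auto intro!: continuous_intros)
    note comp = C1_compose[OF aff(1) g(1) c2] D_compose[OF aff(1) g(1) c2]
    define \<phi> where "\<phi> x = g (x \<bullet> v) * \<xi> x" for x
    have \<phi>: "C1c \<Omega> \<phi>" unfolding C1c_def \<phi>_def
      using K by (intro conjI C1_mult comp C1\<xi> compact_support_inI[of K]) auto
    have D\<phi>: "frechet_derivative \<phi> (at x) u = g (x \<bullet> v) * ?D u x + (u \<bullet> v) * (h k (x \<bullet> v) * \<xi> x)" for x u
      unfolding \<phi>_def by (subst D_mult[OF comp(1) C1\<xi>]) (simp add: comp(2) aff(2))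
    have PK: "emeasure (P i) K < \<infinity>" if "i \<in> I" for i using P(2)[OF that K(1,2)] .
    have QK: "emeasure (Q j) K < \<infinity>" if "j \<in> J" for j using Q(2)[OF that K(1,2)] .
    have hb: "\<bar>h k t\<bar> \<le> 1" for t using h0[of k t] by simp
    have eqP: "(LINT x|P i. frechet_derivative \<phi> (at x) v) = (LINT x|P i. g (x \<bullet> v) * ?D v x) + (LINT x|P i. h k (x \<bullet> v) * \<xi> x)"
      if "i \<in> I" for i
      unfolding D\<phi> vw(1) mult_1
      by (intro Bochner_Integration.integral_add intD[OF _ g(2)] int\<xi>[OF _ hb] P(1) PK that) auto
    have eqQ: "(LINT x|Q j. frechet_derivative \<phi> (at x) w) = (LINT x|Q j. g (x \<bullet> v) * ?D w x)" for j
      unfolding D\<phi> vw(2) by simp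
    have bd: "\<bar>LINT x|M. g (x \<bullet> v) * ?D u x\<bar> \<le> L * (LINT x|M. \<bar>?D u x\<bar>)"
      if M: "sets M = sets borel" "emeasure M K < \<infinity>" for M u
    proof -
      have "\<bar>LINT x|M. g (x \<bullet> v) * ?D u x\<bar> \<le> (LINT x|M. L * \<bar>?D u x\<bar>)"
        unfolding real_norm_def[symmetric]
      proof (rule Bochner_Integration.integral_norm_bound_integral)
        show "integrable M (\<lambda>x. g (x \<bullet> v) * ?D u x)" by (intro intD[OF _ g(2)] M) auto
        show "integrable M (\<lambda>x. L * norm (?D u x))" using intabs[OF M] by simp
        show "norm (g (x \<bullet> v) * ?D u x) \<le> L * norm (?D u x)" for x
          unfolding norm_mult using g(2) by (intro mult_right_mono) auto
      qed
      then show ?thesis by simp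
    qed
    have "(\<Sum>i\<in>I. c i * (LINT x|P i. h k (x \<bullet> v) * \<xi> x)) =
       - (\<Sum>i\<in>I. c i * (LINT x|P i. g (x \<bullet> v) * ?D v x)) - (\<Sum>j\<in>J. d j * (LINT x|Q j. g (x \<bullet> v) * ?D w x))"
      using div[OF \<phi>] eqP eqQ by (simp add: distrib_left sum.distrib)
    then have "\<bar>\<Sum>i\<in>I. c i * (LINT x|P i. h k (x \<bullet> v) * \<xi> x)\<bar> \<le>
       \<bar>\<Sum>i\<in>I. c i * (LINT x|P i. g (x \<bullet> v) * ?D v x)\<bar> + \<bar>\<Sum>j\<in>J. d j * (LINT x|Q j. g (x \<bullet> v) * ?D w x)\<bar>"
      by linarith
    also have "\<dots> \<le> (\<Sum>i\<in>I. \<bar>c i\<bar> * (L * (LINT x|P i. \<bar>?D v x\<bar>))) + (\<Sum>j\<in>J. \<bar>d j\<bar> * (L * (LINT x|Q j. \<bar>?D w x\<bar>)))"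
    proof (rule add_mono)
      show "\<bar>\<Sum>i\<in>I. c i * (LINT x|P i. g (x \<bullet> v) * ?D v x)\<bar> \<le> (\<Sum>i\<in>I. \<bar>c i\<bar> * (L * (LINT x|P i. \<bar>?D v x\<bar>)))"
        by (rule order_trans[OF sum_abs], rule sum_mono)
          (simp only: abs_mult, intro mult_left_mono bd P(1) PK, auto)
      show "\<bar>\<Sum>j\<in>J. d j * (LINT x|Q j. g (x \<bullet> v) * ?D w x)\<bar> \<le> (\<Sum>j\<in>J. \<bar>d j\<bar> * (L * (LINT x|Q j. \<bar>?D w x\<bar>)))"
        by (rule order_trans[OF sum_abs], rule sum_mono)
          (simp only: abs_mult, intro mult_left_mono bd Q(1) QK, auto)
    qed
    also have "\<dots> = L * ?C" by (simp add: distrib_left sum_distrib_left mult.left_commute)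
    finally show ?thesis .
  qed
  have lim: "(\<lambda>k. LINT x|P i. h k (x \<bullet> v) * \<xi> x) \<longlonglongrightarrow> (LINT x|P i. indicator U (x \<bullet> v) * \<xi> x)" if i: "i \<in> I" for i
  proof (rule integral_dominated_convergence[where w = "\<lambda>x. \<bar>\<xi> x\<bar>"])
    have [measurable_cong]: "sets (P i) = sets borel" by (rule P(1)[OF i])
    have [measurable]: "h k \<in> borel_measurable borel" for k using hc by (rule borel_measurable_continuous_onI)
    have [measurable]: "U \<in> sets borel" using U(1) by simp
    show "(\<lambda>x. indicat_real U (x \<bullet> v) * \<xi> x) \<in> borel_measurable (P i)" by measurable
    show "(\<lambda>x. h k (x \<bullet> v) * \<xi> x) \<in> borel_measurable (P i)" for k by measurable
    show "integrable (P i) (\<lambda>x. \<bar>\<xi> x\<bar>)"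
      using int\<xi>[of "\<lambda>_. 1" 1 "P i"] P(1)[OF i] P(2)[OF i K(1,2)] by simp
    show "AE x in P i. (\<lambda>k. h k (x \<bullet> v) * \<xi> x) \<longlonglongrightarrow> indicat_real U (x \<bullet> v) * \<xi> x"
      by (intro AE_I2 tendsto_intros hlim)
    show "AE x in P i. norm (h k (x \<bullet> v) * \<xi> x) \<le> \<bar>\<xi> x\<bar>" for k
    proof (intro AE_I2)
      fix x
      have "\<bar>h k (x \<bullet> v)\<bar> * \<bar>\<xi> x\<bar> \<le> 1 * \<bar>\<xi> x\<bar>" using h0[of k "x \<bullet> v"] by (intro mult_right_mono) auto
      then show "norm (h k (x \<bullet> v) * \<xi> x) \<le> \<bar>\<xi> x\<bar>" by (simp add: abs_mult)
    qed
  qed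
  have "(\<lambda>k. \<bar>\<Sum>i\<in>I. c i * (LINT x|P i. h k (x \<bullet> v) * \<xi> x)\<bar>) \<longlonglongrightarrow> \<bar>\<Sum>i\<in>I. c i * (LINT x|P i. indicator U (x \<bullet> v) * \<xi> x)\<bar>"
    using lim by (intro tendsto_intros)
  then show ?thesis by (rule LIMSEQ_le_const2) (use step in auto)
qed

text \<open>Strip bounds along open sets whose length tends to 0 produce a strip \<open>Z\<close> on
  which the combination kills every test function. Then it vanishes on every Borel part of
  \<open>Z\<close> of finite measure, in particular on \<open>D\<close>.\<close>

lemma div_free_null:
  fixes P :: "'i \<Rightarrow> 'a::euclidean_space measure" and Q :: "'j \<Rightarrow> 'a measure" and c :: "'i \<Rightarrow> real" and d :: "'j \<Rightarrow> real"
  assumes fin: "finite I" "finite J" and \<Omega>: "open \<Omega>"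
    and P: "\<And>i. i \<in> I \<Longrightarrow> sets (P i) = sets borel" "\<And>i K. i \<in> I \<Longrightarrow> compact K \<Longrightarrow> K \<subseteq> \<Omega> \<Longrightarrow> emeasure (P i) K < \<infinity>"
    and Q: "\<And>j. j \<in> J \<Longrightarrow> sets (Q j) = sets borel" "\<And>j K. j \<in> J \<Longrightarrow> compact K \<Longrightarrow> K \<subseteq> \<Omega> \<Longrightarrow> emeasure (Q j) K < \<infinity>"
    and vw: "v \<bullet> v = 1" "w \<bullet> v = 0"
    and div: "\<And>\<phi>. C1c \<Omega> \<phi> \<Longrightarrow>
      (\<Sum>i\<in>I. c i * (LINT x|P i. frechet_derivative \<phi> (at x) v)) + (\<Sum>j\<in>J. d j * (LINT x|Q j. frechet_derivative \<phi> (at x) w)) = 0"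
    and D: "hausdorff1 D = 0" "D \<in> sets borel" "D \<subseteq> \<Omega>" "\<And>i. i \<in> I \<Longrightarrow> emeasure (P i) D < \<infinity>"
  shows "(\<Sum>i\<in>I. c i * measure (P i) D) = 0"
proof -
  have "norm v \<le> 1" using vw(1) by (simp add: norm_eq_sqrt_inner)
  then have "\<exists>U. open U \<and> emeasure lborel U \<le> ennreal (1 / real (Suc n)) \<and> (\<forall>x\<in>D. x \<bullet> v \<in> U)" for n
    by (metis hausdorff1_null_projection[OF D(1)] divide_pos_pos of_nat_0_less_iff zero_less_Suc zero_less_one)
  then obtain U where U: "\<And>n. open (U n)" "\<And>n. emeasure lborel (U n) \<le> ennreal (1 / real (Suc n))" "\<And>n x. x \<in> D \<Longrightarrow> x \<bullet> v \<in> U n"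
    by metis
  \<comment> \<open>Finite intersections make the sequence decreasing, so that its indicators
    converge pointwise.\<close>
  define V where "V n = (\<Inter>i\<le>n. U i)" for n
  have V: "open (V n)" "emeasure lborel (V n) \<le> ennreal (1 / real (Suc n))" for n
  proof -
    show "open (V n)" unfolding V_def using U(1) by (intro open_INT) auto
    have "emeasure lborel (V n) \<le> emeasure lborel (U n)" using U(1) by (intro emeasure_mono) (auto simp: V_def)
    then show "emeasure lborel (V n) \<le> ennreal (1 / real (Suc n))" using U(2) by (rule order_trans)
  qed
  \<comment> \<open>A Borel set containing \<open>D\<close> and saturated in the directions
    orthogonal to \<open>v\<close>; \<open>D\<close> itself need not have this form.\<close>
  define Z where "Z = {x. x \<bullet> v \<in> (\<Inter>n. V n)}"
  have Vb[measurable]: "V n \<in> sets borel" for n using V(1) by simp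
  have Zb: "Z \<in> sets borel" unfolding Z_def
  proof -
    have "(\<Inter>n. V n) \<in> sets borel" by auto
    then have "(\<lambda>x. x \<bullet> v) -` (\<Inter>n. V n) \<inter> space borel \<in> sets borel" by (intro measurable_sets[where A = borel]) auto
    then show "{x. x \<bullet> v \<in> (\<Inter>n. V n)} \<in> sets borel" by (simp add: vimage_def)
  qed
  have DZ: "D \<subseteq> Z \<inter> \<Omega>" using U(3) D(3) by (auto simp: Z_def V_def)
  have ind: "(\<lambda>n. indicat_real (V n) t) \<longlonglongrightarrow> indicator (\<Inter>n. V n) t" for t
  proof (cases "t \<in> (\<Inter>n. V n)")
    case False
    then obtain m where m: "t \<notin> V m" by auto
    have "\<forall>\<^sub>F n in sequentially. indicat_real (V n) t = 0"
      using eventually_ge_at_top[of m]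
    proof eventually_elim
      case (elim n) then have "V n \<subseteq> V m" by (auto simp: V_def)
      then show ?case using m by (auto simp: indicator_def)
    qed
    then show ?thesis using False by (simp add: tendsto_eventually)
  qed auto
  show ?thesis
  proof (rule signed_family_zero[OF fin(1) P Zb \<Omega> _ D(2) DZ D(4)])
    fix \<xi> :: "'a \<Rightarrow> real" assume \<xi>: "C1c \<Omega> \<xi>"
    let ?C = "(\<Sum>i\<in>I. \<bar>c i\<bar> * (LINT x|P i. \<bar>frechet_derivative \<xi> (at x) v\<bar>)) + (\<Sum>j\<in>J. \<bar>d j\<bar> * (LINT x|Q j. \<bar>frechet_derivative \<xi> (at x) w\<bar>))"
    have C1\<xi>: "C1 \<xi>" and cs: "compact_support_in \<Omega> \<xi>" using \<xi> by (auto simp: C1c_def)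
    obtain K where K: "compact K" "K \<subseteq> \<Omega>" "\<And>x. x \<notin> K \<Longrightarrow> \<xi> x = 0" using cs unfolding compact_support_in_def by blast
    obtain B where B: "0 \<le> B" "\<And>x. norm (\<xi> x) \<le> B" using bounded_compact_support[OF C1_continuous[OF C1\<xi>] cs] by blast
    have \<xi>m[measurable]: "\<xi> \<in> borel_measurable borel" by (rule borel_measurable_continuous_onI[OF C1_continuous[OF C1\<xi>]])
    have bound: "\<bar>\<Sum>i\<in>I. c i * (LINT x|P i. indicator (V n) (x \<bullet> v) * \<xi> x)\<bar> \<le> 1 / real (Suc n) * ?C" for n
      by (rule div_free_strip_bound[OF fin P Q vw div \<xi> V]) auto
    have lim: "(\<lambda>n. LINT x|P i. indicator (V n) (x \<bullet> v) * \<xi> x) \<longlonglongrightarrow> (LINT x|P i. indicator Z x * \<xi> x)" if i: "i \<in> I" for i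
    proof (rule integral_dominated_convergence[where w = "\<lambda>x. \<bar>\<xi> x\<bar>"])
      have [measurable_cong]: "sets (P i) = sets borel" by (rule P(1)[OF i])
      note [measurable] = Zb
      show "(\<lambda>x. indicat_real Z x * \<xi> x) \<in> borel_measurable (P i)" by measurable
      show "(\<lambda>x. indicat_real (V n) (x \<bullet> v) * \<xi> x) \<in> borel_measurable (P i)" for n by measurable
      show "integrable (P i) (\<lambda>x. \<bar>\<xi> x\<bar>)"
        using B K P(1)[OF i] P(2)[OF i K(1,2)] by (intro integrable_compact_support[of _ B K]) (auto simp: borel_compact)
      show "AE x in P i. (\<lambda>n. indicat_real (V n) (x \<bullet> v) * \<xi> x) \<longlonglongrightarrow> indicat_real Z x * \<xi> x"
      proof (intro AE_I2)
        fix x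
        have "indicat_real Z x = indicator (\<Inter>n. V n) (x \<bullet> v)" by (simp add: Z_def indicator_def)
        then show "(\<lambda>n. indicat_real (V n) (x \<bullet> v) * \<xi> x) \<longlonglongrightarrow> indicat_real Z x * \<xi> x"
          using ind[of "x \<bullet> v"] by (intro tendsto_mult) auto
      qed
      show "AE x in P i. norm (indicat_real (V n) (x \<bullet> v) * \<xi> x) \<le> \<bar>\<xi> x\<bar>" for n
        by (intro AE_I2) (auto simp: indicator_def)
    qed
    have "(\<lambda>n. \<bar>\<Sum>i\<in>I. c i * (LINT x|P i. indicator (V n) (x \<bullet> v) * \<xi> x)\<bar>) \<longlonglongrightarrow> \<bar>\<Sum>i\<in>I. c i * (LINT x|P i. indicator Z x * \<xi> x)\<bar>"
      using lim by (intro tendsto_intros)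
    moreover have "(\<lambda>n. 1 / real (Suc n) * ?C) \<longlonglongrightarrow> 0 * ?C"
      by (intro tendsto_mult tendsto_const LIMSEQ_Suc[OF lim_1_over_n])
    ultimately have "\<bar>\<Sum>i\<in>I. c i * (LINT x|P i. indicator Z x * \<xi> x)\<bar> \<le> 0 * ?C"
      by (rule LIMSEQ_le) (use bound in auto)
    then show "(\<Sum>i\<in>I. c i * (LINT x|P i. indicat_real Z x * \<xi> x)) = 0" by simp
  qed
qed

text \<open>With \<open>v\<close> normal and \<open>w\<close> tangent to the limit line, the
  derivative of the test function along \<open>v\<close> is \<open>\<xi>\<close> plus a term
  \<open>g\<close> which, like the derivative along \<open>w\<close>, carries the factor
  \<open>(x - x0) \<bullet> v\<close>, small inside the cone. In the conclusion 9 = 5 + 4 collects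
  the oscillations of \<open>a\<close> and \<open>b\<close>, 16 = 4 * 3 + 4 the mass inside and
  outside the cone, and 1/4 comes from the mass of \<open>\<xi>\<close>.\<close>

lemma blowup_quantitative:
  fixes P :: "'i \<Rightarrow> 'a::euclidean_space measure" and Q :: "'j \<Rightarrow> 'a measure" and c :: "'i \<Rightarrow> real" and d :: "'j \<Rightarrow> real"
    and l :: "'a measure" and a b :: "'a \<Rightarrow> real"
  assumes vw: "v \<bullet> v = 1" "w \<bullet> w = 1" "w \<bullet> v = 0"
    and r: "0 < r" "cball x0 r \<subseteq> \<Omega>"
    and l: "sets l = sets borel" and ab: "integrable l a" "integrable l b"
    and div: "\<And>\<phi>. C1c \<Omega> \<phi> \<Longrightarrow>
      (\<Sum>i\<in>I. c i * (LINT x|P i. frechet_derivative \<phi> (at x) v)) + (\<Sum>j\<in>J. d j * (LINT x|Q j. frechet_derivative \<phi> (at x) w)) = 0"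
    and densP: "\<And>f B. f \<in> borel_measurable borel \<Longrightarrow> (\<And>x. \<bar>f x\<bar> \<le> B) \<Longrightarrow> (\<And>x. x \<notin> cball x0 r \<Longrightarrow> f x = 0) \<Longrightarrow>
      (\<Sum>i\<in>I. c i * (LINT x|P i. f x)) = (LINT x|l. f x * a x)"
    and densQ: "\<And>f B. f \<in> borel_measurable borel \<Longrightarrow> (\<And>x. \<bar>f x\<bar> \<le> B) \<Longrightarrow> (\<And>x. x \<notin> cball x0 r \<Longrightarrow> f x = 0) \<Longrightarrow>
      (\<Sum>j\<in>J. d j * (LINT x|Q j. f x)) = (LINT x|l. f x * b x)"
    and t: "0 < t"
    and up: "emeasure l (ball x0 r) \<le> ennreal (3 * r)"
    and lo: "ennreal (r / 2) \<le> emeasure l (ball x0 (r / 2))"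
    and off: "emeasure l {y \<in> ball x0 r. t * \<bar>w \<bullet> (y - x0)\<bar> < \<bar>v \<bullet> (y - x0)\<bar>} \<le> ennreal (t * r)"
    and La: "(\<integral>\<^sup>+y\<in>ball x0 r. ennreal \<bar>a y - a x0\<bar> \<partial>l) \<le> ennreal (t * r)"
    and Lb: "(\<integral>\<^sup>+y\<in>ball x0 r. ennreal \<bar>b y - b x0\<bar> \<partial>l) \<le> ennreal (t * r)"
  shows "\<bar>a x0\<bar> / 4 \<le> t * (9 + 16 * (\<bar>a x0\<bar> + \<bar>b x0\<bar>))"
proof -
  \<comment> \<open>The division by the fourth power normalises \<open>\<xi>\<close> to values in
    [0, 1], with a gradient of order 1/r.\<close>
  define \<xi> where "\<xi> x = pos_square (r\<^sup>2 - (x - x0) \<bullet> (x - x0)) / r ^ 4" for x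
  define \<phi> where "\<phi> x = ((x - x0) \<bullet> v) * \<xi> x" for x
  have \<xi>_alt: "\<xi> = (\<lambda>x. pos_square (r\<^sup>2 - (x - x0) \<bullet> (x - x0)) * (1 / r ^ 4))" by (simp add: \<xi>_def fun_eq_iff)
  have C1\<xi>: "C1 \<xi>" unfolding \<xi>_alt by (intro C1_mult C1_pos_square C1_quad C1_const)
  have D\<xi>: "frechet_derivative \<xi> (at x) u = - 4 * max 0 (r\<^sup>2 - (x - x0) \<bullet> (x - x0)) * ((x - x0) \<bullet> u) / r ^ 4" for x u
    unfolding \<xi>_alt by (subst D_mult[OF C1_pos_square[OF C1_quad] C1_const]) (simp add: D_pos_square[OF C1_quad] D_quad)
  have C1\<phi>: "C1 \<phi>" unfolding \<phi>_def by (intro C1_mult C1_affine C1\<xi>)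
  have D\<phi>: "frechet_derivative \<phi> (at x) u = ((x - x0) \<bullet> v) * frechet_derivative \<xi> (at x) u + (u \<bullet> v) * \<xi> x" for x u
    unfolding \<phi>_def by (subst D_mult[OF C1_affine C1\<xi>]) (simp add: D_affine)
  have inball: "(x - x0) \<bullet> (x - x0) < s\<^sup>2 \<longleftrightarrow> x \<in> ball x0 s" if "0 < s" for x s
  proof -
    have "norm (x - x0) < s \<longleftrightarrow> (x - x0) \<bullet> (x - x0) < s\<^sup>2" using that by (simp add: norm_lt_square)
    then show ?thesis by (simp add: dist_norm norm_minus_commute)
  qed
  have z: "\<xi> x = 0" "frechet_derivative \<xi> (at x) u = 0" if "x \<notin> ball x0 r" for x u
  proof -
    have "r\<^sup>2 - (x - x0) \<bullet> (x - x0) \<le> 0" using that inball[OF r(1), of x] by (simp only: not_less) simp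
    then show "\<xi> x = 0" "frechet_derivative \<xi> (at x) u = 0" by (simp_all add: \<xi>_def pos_square_def D\<xi>)
  qed
  have \<phi>c: "C1c \<Omega> \<phi>" unfolding C1c_def using C1\<phi> r(2)
    by (intro conjI compact_support_inI[of "cball x0 r"]) (auto simp: \<phi>_def intro!: z)
  define f1 where "f1 x = frechet_derivative \<phi> (at x) v" for x
  define f2 where "f2 x = frechet_derivative \<phi> (at x) w" for x
  define g where "g x = ((x - x0) \<bullet> v) * frechet_derivative \<xi> (at x) v" for x
  have f1: "f1 x = g x + \<xi> x" for x unfolding f1_def D\<phi> g_def vw(1) by simp
  have f2: "f2 x = ((x - x0) \<bullet> v) * frechet_derivative \<xi> (at x) w" for x unfolding f2_def D\<phi> vw(3) by simp
  have m[measurable]: "\<xi> \<in> borel_measurable borel" "f1 \<in> borel_measurable borel" "f2 \<in> borel_measurable borel" "g \<in> borel_measurable borel"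
  proof -
    show "\<xi> \<in> borel_measurable borel" by (rule borel_measurable_continuous_onI[OF C1_continuous[OF C1\<xi>]])
    show "f1 \<in> borel_measurable borel" "f2 \<in> borel_measurable borel"
      unfolding f1_def[abs_def] f2_def[abs_def] by (rule borel_measurable_continuous_onI[OF C1_continuous_deriv[OF C1\<phi>]])+
    have "continuous_on UNIV g" unfolding g_def[abs_def]
      by (intro continuous_on_mult C1_continuous_deriv[OF C1\<xi>] continuous_intros)
    then show "g \<in> borel_measurable borel" by (rule borel_measurable_continuous_onI)
  qed
  have nvw: "norm v = 1" "norm w = 1" using vw by (simp_all add: norm_eq_sqrt_inner)
  have inr: "(x - x0) \<bullet> (x - x0) \<le> r\<^sup>2" if "x \<in> ball x0 r" for x using inball[OF r(1), of x] that by simp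
  have ynorm: "\<bar>(x - x0) \<bullet> u\<bar> \<le> r" if "x \<in> ball x0 r" "norm u = 1" for x u
    using Cauchy_Schwarz_ineq2[of "x - x0" u] that by (simp add: dist_norm norm_minus_commute)
  have Dbound: "\<bar>frechet_derivative \<xi> (at x) u\<bar> \<le> 4 / r" if "norm u = 1" for x u
  proof (cases "x \<in> ball x0 r")
    case True
    have "\<bar>max 0 (r\<^sup>2 - (x - x0) \<bullet> (x - x0))\<bar> * \<bar>(x - x0) \<bullet> u\<bar> \<le> r\<^sup>2 * r"
      using ynorm[OF True that] r by (intro mult_mono) auto
    then have "\<bar>frechet_derivative \<xi> (at x) u\<bar> \<le> 4 * (r\<^sup>2 * r) / r ^ 4"
      unfolding D\<xi> using r by (simp add: abs_mult divide_right_mono)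
    also have "\<dots> = 4 / r" using r by (simp add: field_simps power2_eq_square power4_eq_xxxx)
    finally show ?thesis .
  next
    case False then show ?thesis using z r by simp
  qed
  have prodb: "\<bar>((x - x0) \<bullet> v) * frechet_derivative \<xi> (at x) u\<bar> \<le> 4 * indicator (ball x0 r) x" if u: "norm u = 1" for x u
  proof (cases "x \<in> ball x0 r")
    case True
    have "\<bar>((x - x0) \<bullet> v) * frechet_derivative \<xi> (at x) u\<bar> \<le> r * (4 / r)"
      unfolding abs_mult using ynorm[OF True nvw(1)] Dbound[OF u] r by (intro mult_mono) auto
    then show ?thesis using True r by simp
  next
    case False then show ?thesis using z by simp
  qed
  \<comment> \<open>The part of the disk outside the cone of slope \<open>t\<close> around the
    tangent.\<close>
  define Of where "Of = {y \<in> ball x0 r. t * \<bar>w \<bullet> (y - x0)\<bar> < \<bar>v \<bullet> (y - x0)\<bar>}"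
  have Ofb: "Of \<in> sets borel"
  proof -
    have "Of = ball x0 r \<inter> {y. t * \<bar>w \<bullet> (y - x0)\<bar> < \<bar>v \<bullet> (y - x0)\<bar>}" by (auto simp: Of_def)
    moreover have "open {y. t * \<bar>w \<bullet> (y - x0)\<bar> < \<bar>v \<bullet> (y - x0)\<bar>}"
      by (intro open_Collect_less continuous_intros)
    ultimately show ?thesis by simp
  qed
  \<comment> \<open>Inside the cone the factor \<open>(x - x0) \<bullet> v\<close> is at most
    \<open>t * r\<close>, against a derivative of \<open>\<xi>\<close> of at most
    \<open>4 / r\<close>; outside, the crude bound 4 meets a set of small measure.\<close>
  have cone: "\<bar>((x - x0) \<bullet> v) * frechet_derivative \<xi> (at x) u\<bar> \<le> 4 * t * indicator (ball x0 r) x + 4 * indicator Of x"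
    if u: "norm u = 1" for x u
  proof (cases "x \<in> ball x0 r \<and> x \<notin> Of")
    case True
    then have "\<bar>(x - x0) \<bullet> v\<bar> \<le> t * \<bar>(x - x0) \<bullet> w\<bar>" by (auto simp: Of_def inner_commute not_less)
    also have "\<dots> \<le> t * r" using True ynorm[OF _ nvw(2), of x] t by (intro mult_left_mono) auto
    finally have "\<bar>((x - x0) \<bullet> v) * frechet_derivative \<xi> (at x) u\<bar> \<le> (t * r) * (4 / r)"
      unfolding abs_mult using Dbound[OF u, of x] t r by (intro mult_mono) auto
    then show ?thesis using True r t by (simp add: field_simps)
  next
    case False
    then show ?thesis using prodb[OF u, of x] t Of_def by (cases "x \<in> ball x0 r"; cases "x \<in> Of") simp_all
  qed
  have [measurable_cong]: "sets l = sets borel" by (rule l)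
  have spl: "space l = UNIV" using sets_eq_imp_space_eq[OF l] by simp
  have bl: "ball x0 s \<in> sets l" for s using l by simp
  have finb: "emeasure l (ball x0 r) < \<infinity>" using up by (rule le_less_trans) simp
  have Osub: "Of \<subseteq> ball x0 r" by (auto simp: Of_def)
  have finO: "emeasure l Of < \<infinity>" using emeasure_mono[OF Osub bl] finb by (rule le_less_trans)
  have Ol: "Of \<in> sets l" using Ofb l by simp
  have iB: "integrable l (\<lambda>x. k * indicator (ball x0 r) x :: real)" for k using finb bl by simp
  have iO: "integrable l (\<lambda>x. k * indicator Of x :: real)" for k using finO Ol by simp
  have mB: "measure l (ball x0 r) \<le> 3 * r" using up r by (simp add: measure_def enn2real_leI)
  have mO: "measure l Of \<le> t * r" using off r t by (simp add: measure_def enn2real_leI Of_def)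
  have intb: "integrable l f" if "f \<in> borel_measurable borel" "\<And>x. \<bar>f x\<bar> \<le> k * indicator (ball x0 r) x" for f :: "'a \<Rightarrow> real" and k
  proof (rule Bochner_Integration.integrable_bound[OF iB[of k]])
    show "f \<in> borel_measurable l" using that(1) by measurable
    show "AE x in l. norm (f x) \<le> norm (k * indicator (ball x0 r) x)"
      using that(2) by (intro AE_I2) (metis abs_ge_self order_trans real_norm_def)
  qed
  have \<xi>b: "0 \<le> \<xi> x" "\<xi> x \<le> indicator (ball x0 r) x" for x
  proof -
    show "0 \<le> \<xi> x" using r by (simp add: \<xi>_def pos_square_nonneg)
    show "\<xi> x \<le> indicator (ball x0 r) x"
    proof (cases "x \<in> ball x0 r")
      case True
      have "pos_square (r\<^sup>2 - (x - x0) \<bullet> (x - x0)) \<le> (r\<^sup>2)\<^sup>2" unfolding pos_square_def by (intro power_mono) auto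
      then show ?thesis using True r by (simp add: \<xi>_def divide_le_eq flip: power_mult)
    next
      case False then show ?thesis using z by simp
    qed
  qed
  have f1b: "\<bar>f1 x\<bar> \<le> 5 * indicator (ball x0 r) x" for x
    unfolding f1 g_def using prodb[OF nvw(1), of x] \<xi>b[of x] by (cases "x \<in> ball x0 r") auto
  have f2b: "\<bar>f2 x\<bar> \<le> 4 * indicator (ball x0 r) x" for x
    unfolding f2 by (rule prodb[OF nvw(2)])
  have small: "(\<integral>x. \<bar>((x - x0) \<bullet> v) * frechet_derivative \<xi> (at x) u\<bar> \<partial>l) \<le> 16 * t * r" if u: "norm u = 1"
    and mu: "(\<lambda>x. ((x - x0) \<bullet> v) * frechet_derivative \<xi> (at x) u) \<in> borel_measurable borel" for u
  proof -
    have "(\<integral>x. \<bar>((x - x0) \<bullet> v) * frechet_derivative \<xi> (at x) u\<bar> \<partial>l) \<le> (\<integral>x. 4 * t * indicator (ball x0 r) x + 4 * indicator Of x \<partial>l)"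
      using mu prodb[OF u] cone[OF u]
      by (intro integral_mono Bochner_Integration.integrable_add iB iO Bochner_Integration.integrable_abs intb[of _ 4]) auto
    also have "\<dots> = 4 * t * measure l (ball x0 r) + 4 * measure l Of"
      by (subst Bochner_Integration.integral_add[OF iB iO]) (simp add: spl)
    also have "\<dots> \<le> 4 * t * (3 * r) + 4 * (t * r)" using mB mO t by (intro add_mono mult_left_mono) auto
    finally show ?thesis by (simp add: algebra_simps)
  qed
  \<comment> \<open>The density is frozen at \<open>x0\<close>; the error is the Lebesgue point
    bound multiplied by the sup norm \<open>k\<close> of \<open>f\<close>.\<close>
  have osc: "integrable l (\<lambda>x. f x * h x)" "(\<integral>x. f x * h x \<partial>l) = h x0 * (\<integral>x. f x \<partial>l) + (\<integral>x. f x * (h x - h x0) \<partial>l)"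
      "\<bar>\<integral>x. f x * (h x - h x0) \<partial>l\<bar> \<le> k * (t * r)"
    if f: "f \<in> borel_measurable borel" "\<And>x. \<bar>f x\<bar> \<le> k * indicator (ball x0 r) x" and k: "0 \<le> k" and h: "integrable l h"
      and Lh: "(\<integral>\<^sup>+y\<in>ball x0 r. ennreal \<bar>h y - h x0\<bar> \<partial>l) \<le> ennreal (t * r)" for f h k
  proof -
    have [measurable]: "f \<in> borel_measurable borel" by (rule f(1))
    have hm[measurable]: "h \<in> borel_measurable l" using h by auto
    have fm: "f \<in> borel_measurable l" by measurable
    have kb: "\<bar>f x\<bar> \<le> k" for x using f(2)[of x] k by (cases "x \<in> ball x0 r") simp_all
    show i1: "integrable l (\<lambda>x. f x * h x)"
    proof (rule Bochner_Integration.integrable_bound)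
      show "integrable l (\<lambda>x. k * \<bar>h x\<bar>)" using h by simp
      show "AE x in l. norm (f x * h x) \<le> norm (k * \<bar>h x\<bar>)"
        using kb k by (intro AE_I2) (simp add: abs_mult mult_right_mono)
    qed (use fm in measurable)
    have i2: "integrable l f" by (rule intb[OF f])
    have i3: "integrable l (\<lambda>x. f x * (h x - h x0))" unfolding right_diff_distrib using i1 i2 by simp
    have "(\<integral>x. f x * h x \<partial>l) = (\<integral>x. h x0 * f x + f x * (h x - h x0) \<partial>l)" by (simp add: algebra_simps)
    then show "(\<integral>x. f x * h x \<partial>l) = h x0 * (\<integral>x. f x \<partial>l) + (\<integral>x. f x * (h x - h x0) \<partial>l)"
      using i2 i3 by simp
    have "ennreal \<bar>\<integral>x. f x * (h x - h x0) \<partial>l\<bar> \<le> (\<integral>\<^sup>+x. ennreal (norm (f x * (h x - h x0))) \<partial>l)"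
      using integral_norm_bound_ennreal[OF i3] by simp
    also have "\<dots> \<le> (\<integral>\<^sup>+x. ennreal k * (ennreal \<bar>h x - h x0\<bar> * indicator (ball x0 r) x) \<partial>l)"
    proof (rule nn_integral_mono)
      fix x
      show "ennreal (norm (f x * (h x - h x0))) \<le> ennreal k * (ennreal \<bar>h x - h x0\<bar> * indicator (ball x0 r) x)"
        using f(2)[of x] k by (cases "x \<in> ball x0 r") (auto simp: abs_mult ennreal_mult[symmetric] intro!: ennreal_leI mult_right_mono)
    qed
    also have "\<dots> = ennreal k * (\<integral>\<^sup>+x. ennreal \<bar>h x - h x0\<bar> * indicator (ball x0 r) x \<partial>l)"
      using hm bl by (intro nn_integral_cmult borel_measurable_times_ennreal borel_measurable_indicator) auto
    also have "\<dots> \<le> ennreal k * ennreal (t * r)" using Lh by (intro mult_left_mono) auto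
    also have "\<dots> = ennreal (k * (t * r))" using k t r by (simp add: ennreal_mult)
    finally show "\<bar>\<integral>x. f x * (h x - h x0) \<partial>l\<bar> \<le> k * (t * r)"
      using k t r by (subst (asm) ennreal_le_iff) auto
  qed
  have zero1: "x \<notin> cball x0 r \<Longrightarrow> f1 x = 0" "x \<notin> cball x0 r \<Longrightarrow> f2 x = 0" for x
    using f1b[of x] f2b[of x] ball_subset_cball[of x0 r] by (cases "x \<in> ball x0 r"; force)+
  have b5: "\<bar>f1 x\<bar> \<le> 5" "\<bar>f2 x\<bar> \<le> 4" for x
    using f1b[of x] f2b[of x] by (cases "x \<in> ball x0 r"; simp)+
  have eq: "(\<integral>x. f1 x * a x \<partial>l) + (\<integral>x. f2 x * b x \<partial>l) = 0"
    using div[OF \<phi>c] densP[OF m(2) b5(1) zero1(1)] densQ[OF m(3) b5(2) zero1(2)]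
    by (simp add: f1_def f2_def)
  note o1 = osc[OF m(2) f1b _ ab(1) La] and o2 = osc[OF m(3) f2b _ ab(2) Lb]
  have ig: "integrable l g" unfolding g_def using prodb[OF nvw(1)] m(4) by (intro intb[of _ 4]) (auto simp: g_def[abs_def])
  have i\<xi>: "integrable l \<xi>" using \<xi>b by (intro intb[of _ 1]) auto
  have sg: "\<bar>\<integral>x. g x \<partial>l\<bar> \<le> 16 * t * r"
    using small[OF nvw(1)] m(4) integral_abs_bound[of l g] unfolding g_def[abs_def] by linarith
  have sf2: "\<bar>\<integral>x. f2 x \<partial>l\<bar> \<le> 16 * t * r"
    using small[OF nvw(2)] m(3) integral_abs_bound[of l f2] unfolding f2[abs_def] by linarith
  \<comment> \<open>On the half disk \<open>\<xi>\<close> is at least (3/4)^2 = 9/16, and the half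
    disk has measure at least \<open>r / 2\<close>.\<close>
  have low: "r / 4 \<le> (\<integral>x. \<xi> x \<partial>l)"
  proof -
    have finh: "emeasure l (ball x0 (r/2)) < \<infinity>"
      by (rule le_less_trans[OF emeasure_mono[OF _ bl] finb]) (use r in auto)
    have "r / 2 \<le> measure l (ball x0 (r/2))"
      using lo finh r by (simp add: emeasure_eq_ennreal_measure less_top)
    then have "r / 4 \<le> (\<integral>x. 1/2 * indicator (ball x0 (r/2)) x \<partial>l)" using spl by simp
    also have "\<dots> \<le> (\<integral>x. \<xi> x \<partial>l)"
    proof (rule integral_mono[OF _ i\<xi>])
      show "integrable l (\<lambda>x. 1/2 * indicator (ball x0 (r/2)) x :: real)" using finh bl by simp
      fix x
      show "1/2 * indicator (ball x0 (r/2)) x \<le> \<xi> x"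
      proof (cases "x \<in> ball x0 (r/2)")
        case True
        then have "(x - x0) \<bullet> (x - x0) < (r/2)\<^sup>2" using inball[of "r/2" x] r by simp
        then have "3/4 * r\<^sup>2 \<le> r\<^sup>2 - (x - x0) \<bullet> (x - x0)" by (simp add: power_divide)
        then have "(3/4 * r\<^sup>2)\<^sup>2 \<le> pos_square (r\<^sup>2 - (x - x0) \<bullet> (x - x0))" unfolding pos_square_def by (intro power_mono max.coboundedI2) simp_all
        then have "9/16 * r ^ 4 \<le> pos_square (r\<^sup>2 - (x - x0) \<bullet> (x - x0))" by (simp add: power_mult_distrib power_divide flip: power_mult)
        then have "9/16 \<le> \<xi> x" using r by (simp add: \<xi>_def le_divide_eq)
        then show ?thesis using True by simp
      qed (use \<xi>b in simp)
    qed
    finally show ?thesis .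
  qed
  \<comment> \<open>The divergence identity now becomes an equation for \<open>a x0\<close> times
    the mass of \<open>\<xi>\<close>, all other terms being of order \<open>t * r\<close>.\<close>
  have "(\<integral>x. f1 x \<partial>l) = (\<integral>x. g x \<partial>l) + (\<integral>x. \<xi> x \<partial>l)" unfolding f1 using ig i\<xi> by simp
  then have "a x0 * (\<integral>x. \<xi> x \<partial>l) = - (a x0 * (\<integral>x. g x \<partial>l)) - (\<integral>x. f1 x * (a x - a x0) \<partial>l)
      - b x0 * (\<integral>x. f2 x \<partial>l) - (\<integral>x. f2 x * (b x - b x0) \<partial>l)"
    using eq o1(2) o2(2) by (simp add: algebra_simps)
  then have "\<bar>a x0\<bar> * \<bar>\<integral>x. \<xi> x \<partial>l\<bar> \<le> \<bar>a x0\<bar> * \<bar>\<integral>x. g x \<partial>l\<bar> + 5 * (t * r)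
      + \<bar>b x0\<bar> * \<bar>\<integral>x. f2 x \<partial>l\<bar> + 4 * (t * r)"
    using o1(3) o2(3) unfolding abs_mult[symmetric] by linarith
  also have "\<dots> \<le> \<bar>a x0\<bar> * (16 * t * r) + 5 * (t * r) + \<bar>b x0\<bar> * (16 * t * r) + 4 * (t * r)"
    using sg sf2 t r by (intro add_mono mult_left_mono) auto
  also have "\<dots> = (t * (9 + 16 * (\<bar>a x0\<bar> + \<bar>b x0\<bar>))) * r" by (simp add: algebra_simps)
  finally have "\<bar>a x0\<bar> * \<bar>\<integral>x. \<xi> x \<partial>l\<bar> \<le> (t * (9 + 16 * (\<bar>a x0\<bar> + \<bar>b x0\<bar>))) * r" .
  moreover have "\<bar>a x0\<bar> * (r / 4) \<le> \<bar>a x0\<bar> * \<bar>\<integral>x. \<xi> x \<partial>l\<bar>" using low by (intro mult_left_mono) auto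
  ultimately have "(\<bar>a x0\<bar> / 4) * r \<le> (t * (9 + 16 * (\<bar>a x0\<bar> + \<bar>b x0\<bar>))) * r" by (simp add: mult.commute)
  then show ?thesis using r(1) by (rule mult_right_le_imp_le)
qed

subsection \<open>Mollification\<close>

text \<open>The integral runs over the whole space: functions living on a domain enter after
  extension by 0.\<close>

definition conv :: "('a::euclidean_space \<Rightarrow> real) \<Rightarrow> ('a \<Rightarrow> 'b::euclidean_space) \<Rightarrow> 'a \<Rightarrow> 'b" where
  "conv \<rho> f x = (\<integral>y. \<rho> (x - y) *\<^sub>R f y \<partial>lborel)"

lemma integrable_scaleR_bounded:
  fixes f :: "'a \<Rightarrow> 'b::euclidean_space"
  assumes "integrable M f" "k \<in> borel_measurable M" "\<And>y. \<bar>k y\<bar> \<le> B"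
  shows "integrable M (\<lambda>y. k y *\<^sub>R f y)"
proof (rule Bochner_Integration.integrable_bound)
  show "integrable M (\<lambda>y. B * norm (f y))" using assms(1) by simp
  show "(\<lambda>y. k y *\<^sub>R f y) \<in> borel_measurable M" using assms by measurable
  show "AE y in M. norm (k y *\<^sub>R f y) \<le> norm (B * norm (f y))"
    using assms(3) by (intro always_eventually) (auto simp: abs_mult intro!: mult_right_mono order_trans[OF assms(3)])
qed

lemma integrable_conv:
  fixes f :: "'a::euclidean_space \<Rightarrow> 'b::euclidean_space"
  assumes f: "integrable lborel f" and \<rho>: "continuous_on UNIV \<rho>" "compact_support_in UNIV \<rho>"
  shows "integrable lborel (\<lambda>y. \<rho> (x - y) *\<^sub>R f y)"
proof -
  obtain B where B: "0 \<le> B" "\<And>x. norm (\<rho> x) \<le> B" using bounded_compact_support[OF \<rho>] by blast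
  have [measurable]: "\<rho> \<in> borel_measurable borel" by (rule borel_measurable_continuous_onI[OF \<rho>(1)])
  show ?thesis using B by (intro integrable_scaleR_bounded[OF f, of _ B]) auto
qed

lemma uniformly_continuous_compact_support:
  fixes f :: "'a::euclidean_space \<Rightarrow> 'b::real_normed_vector"
  assumes "continuous_on UNIV f" "compact_support_in UNIV f" "0 < e"
  obtains d where "0 < d" "\<And>x y. dist x y < d \<Longrightarrow> dist (f x) (f y) < e"
proof -
  obtain K where K: "compact K" "\<And>x. x \<notin> K \<Longrightarrow> f x = 0" using assms(2) unfolding compact_support_in_def by blast
  obtain R where R: "\<And>x. x \<in> K \<Longrightarrow> norm x \<le> R" using compact_imp_bounded[OF K(1)] bounded_iff by metis
  have "uniformly_continuous_on (cball 0 (R + 1)) f"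
    by (rule compact_uniformly_continuous) (auto intro: continuous_on_subset[OF assms(1)])
  then obtain d where d: "0 < d" "\<And>x y. x \<in> cball 0 (R + 1) \<Longrightarrow> y \<in> cball 0 (R + 1) \<Longrightarrow> dist x y < d \<Longrightarrow> dist (f x) (f y) < e"
    using \<open>0 < e\<close> unfolding uniformly_continuous_on_def by metis
  show ?thesis
  proof (rule that[of "min d 1"])
    fix x y :: 'a assume xy: "dist x y < min d 1"
    have tri: "norm x \<le> norm y + dist x y" "norm y \<le> norm x + dist x y"
      by (metis dist_norm norm_triangle_sub, metis dist_commute dist_norm norm_triangle_sub)
    show "dist (f x) (f y) < e"
    proof (cases "norm x \<le> R + 1 \<and> norm y \<le> R + 1")
      case True
      then show ?thesis using xy by (intro d(2)) auto
    next
      case False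
      then have "x \<notin> K" "y \<notin> K" using tri xy R[of x] R[of y] by auto
      then show ?thesis using K(2) \<open>0 < e\<close> by simp
    qed
  qed (use d in auto)
qed

text \<open>Uniform continuity of the partial derivatives makes the first order expansion uniform in
  \<open>x\<close>. This is what permits differentiation of a convolution with a merely integrable
  function.\<close>

lemma C1_uniform_derivative:
  fixes f :: "'a::euclidean_space \<Rightarrow> real"
  assumes f: "C1c UNIV f" and e: "0 < e"
  obtains d where "0 < d" "\<And>x w. norm w < d \<Longrightarrow> \<bar>f (x + w) - f x - frechet_derivative f (at x) w\<bar> \<le> e * norm w"
proof -
  let ?D = "\<lambda>x. frechet_derivative f (at x)"
  have "\<exists>d>0. \<forall>x y. dist x y < d \<longrightarrow> dist (?D x b) (?D y b) < e / DIM('a)" for b :: 'a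
    by (rule uniformly_continuous_compact_support[of "\<lambda>x. ?D x b" "e / DIM('a)"])
      (use C1c_deriv[OF f] e in auto)
  then obtain d where d: "\<And>b. 0 < d b" "\<And>b x y. dist x y < d b \<Longrightarrow> dist (?D x b) (?D y b) < e / DIM('a)"
    by metis
  define d' where "d' = Min (d ` Basis)"
  have d': "0 < d'" "\<And>b. b \<in> Basis \<Longrightarrow> d' \<le> d b" unfolding d'_def using d by auto
  have hd: "(f has_derivative ?D x) (at x)" for x using f C1_has_derivative unfolding C1c_def by blast
  have exp: "?D x w = (\<Sum>b\<in>Basis. (w \<bullet> b) * ?D x b)" for x w
  proof -
    interpret bounded_linear "?D x" by (rule has_derivative_bounded_linear[OF hd])
    have "?D x w = ?D x (\<Sum>b\<in>Basis. (w \<bullet> b) *\<^sub>R b)" by (simp add: euclidean_representation)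
    also have "\<dots> = (\<Sum>b\<in>Basis. (w \<bullet> b) * ?D x b)" by (simp add: sum scaleR)
    finally show ?thesis .
  qed
  show ?thesis
  proof (rule that[OF d'(1)])
    fix x w :: 'a assume w: "norm w < d'"
    have der: "((\<lambda>t. f (x + t *\<^sub>R w)) has_real_derivative ?D (x + t *\<^sub>R w) w) (at t)" for t
    proof -
      have 1: "((\<lambda>t. x + t *\<^sub>R w) has_derivative (\<lambda>t. t *\<^sub>R w)) (at t)" by (auto intro!: derivative_eq_intros)
      have "((\<lambda>t. f (x + t *\<^sub>R w)) has_derivative (\<lambda>s. ?D (x + t *\<^sub>R w) (s *\<^sub>R w))) (at t)"
        by (rule has_derivative_compose[OF 1 hd])
      moreover have "?D (x + t *\<^sub>R w) (s *\<^sub>R w) = s * ?D (x + t *\<^sub>R w) w" for s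
        using linear_scale[OF has_derivative_linear[OF hd]] by simp
      ultimately show ?thesis unfolding has_field_derivative_def by (simp add: mult.commute[of _ "?D _ _"])
    qed
    obtain t :: real where t: "0 < t" "t < 1" "f (x + 1 *\<^sub>R w) - f (x + 0 *\<^sub>R w) = (1 - 0) * ?D (x + t *\<^sub>R w) w"
      using MVT2[of 0 1 "\<lambda>t. f (x + t *\<^sub>R w)" "\<lambda>t. ?D (x + t *\<^sub>R w) w"] der by auto
    have "\<bar>f (x + w) - f x - ?D x w\<bar> = \<bar>\<Sum>b\<in>Basis. (w \<bullet> b) * (?D (x + t *\<^sub>R w) b - ?D x b)\<bar>"
      using t(3) by (simp add: exp[of _ w] right_diff_distrib sum_subtractf)
    also have "\<dots> \<le> (\<Sum>b\<in>(Basis::'a set). norm w * (e / DIM('a)))"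
    proof (rule order_trans[OF sum_abs], rule sum_mono)
      fix b :: 'a assume b: "b \<in> Basis"
      have "norm (t *\<^sub>R w) \<le> 1 * norm w" using t unfolding norm_scaleR by (intro mult_right_mono) auto
      then have "norm (t *\<^sub>R w) < d b" using w d'(2)[OF b] by linarith
      then have "\<bar>?D (x + t *\<^sub>R w) b - ?D x b\<bar> < e / DIM('a)"
        using d(2)[of "x + t *\<^sub>R w" x b] by (simp add: dist_norm)
      moreover have "\<bar>w \<bullet> b\<bar> \<le> norm w" using b by (rule Basis_le_norm)
      ultimately show "\<bar>(w \<bullet> b) * (?D (x + t *\<^sub>R w) b - ?D x b)\<bar> \<le> norm w * (e / DIM('a))"
        unfolding abs_mult by (intro mult_mono) auto
    qed
    also have "\<dots> = e * norm w" by simp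
    finally show "\<bar>f (x + w) - f x - ?D x w\<bar> \<le> e * norm w" .
  qed
qed

lemma conv_continuous:
  fixes f :: "'a::euclidean_space \<Rightarrow> 'b::euclidean_space"
  assumes f: "integrable lborel f" and \<rho>: "continuous_on UNIV \<rho>" "compact_support_in UNIV \<rho>"
  shows "continuous_on UNIV (conv \<rho> f)"
  unfolding continuous_on_iff
proof (intro ballI allI impI)
  fix x :: 'a and e :: real assume e: "0 < e"
  define L where "L = (\<integral>y. norm (f y) \<partial>lborel)"
  have L: "0 \<le> L" by (simp add: L_def)
  \<comment> \<open>The summand 1 avoids a division by 0 when \<open>f\<close> vanishes almost
    everywhere.\<close>
  obtain d where d: "0 < d" "\<And>x y. dist x y < d \<Longrightarrow> dist (\<rho> x) (\<rho> y) < e / (L + 1)"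
    by (rule uniformly_continuous_compact_support[OF \<rho>, of "e / (L + 1)"]) (use e L in auto)
  show "\<exists>d>0. \<forall>x'\<in>UNIV. dist x' x < d \<longrightarrow> dist (conv \<rho> f x') (conv \<rho> f x) < e"
  proof (intro exI[of _ d] conjI ballI impI d(1))
    fix x' assume x': "dist x' x < d"
    have "conv \<rho> f x' - conv \<rho> f x = (\<integral>y. (\<rho> (x' - y) - \<rho> (x - y)) *\<^sub>R f y \<partial>lborel)"
      unfolding conv_def by (subst Bochner_Integration.integral_diff[symmetric])
        (auto intro!: integrable_conv[OF f \<rho>] simp: scaleR_left_diff_distrib)
    also have "norm \<dots> \<le> (\<integral>y. e / (L + 1) * norm (f y) \<partial>lborel)"
    proof (rule Bochner_Integration.integral_norm_bound_integral)
      show "integrable lborel (\<lambda>y. (\<rho> (x' - y) - \<rho> (x - y)) *\<^sub>R f y)"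
        unfolding scaleR_left_diff_distrib by (intro Bochner_Integration.integrable_diff integrable_conv f \<rho>)
      show "integrable lborel (\<lambda>y. e / (L + 1) * norm (f y))" using f by simp
      fix y
      have "\<bar>\<rho> (x' - y) - \<rho> (x - y)\<bar> \<le> e / (L + 1)"
        using d(2)[of "x' - y" "x - y"] x' by (simp add: dist_norm)
      then show "norm ((\<rho> (x' - y) - \<rho> (x - y)) *\<^sub>R f y) \<le> e / (L + 1) * norm (f y)"
        unfolding norm_scaleR real_norm_def by (intro mult_right_mono) auto
    qed
    also have "\<dots> = e / (L + 1) * L" by (simp add: L_def)
    also have "\<dots> < e" using e L by (simp add: field_simps)
    finally show "dist (conv \<rho> f x') (conv \<rho> f x) < e" by (simp add: dist_norm)
  qed
qed

text \<open>The derivative falls on the kernel; the uniform expansion of \<open>\<rho>\<close>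
  bounds the remainder after integration against \<open>norm (f y)\<close>.\<close>

lemma conv_has_derivative:
  fixes f :: "'a::euclidean_space \<Rightarrow> 'b::euclidean_space"
  assumes f: "integrable lborel f" and \<rho>: "C1c UNIV \<rho>"
  shows "(conv \<rho> f has_derivative (\<lambda>v. conv (\<lambda>z. frechet_derivative \<rho> (at z) v) f x)) (at x)"
proof -
  let ?D = "\<lambda>z. frechet_derivative \<rho> (at z)"
  have hd: "(\<rho> has_derivative ?D z) (at z)" for z using \<rho> C1_has_derivative unfolding C1c_def by blast
  have cs: "continuous_on UNIV \<rho>" "compact_support_in UNIV \<rho>" using \<rho> C1_continuous unfolding C1c_def by auto
  have int: "integrable lborel (\<lambda>y. ?D (x - y) v *\<^sub>R f y)" for v
    by (rule integrable_conv[OF f C1c_deriv[OF \<rho>]])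
  have int0: "integrable lborel (\<lambda>y. \<rho> (x - y) *\<^sub>R f y)" for x
    by (rule integrable_conv[OF f cs])
  define L where "L = (\<integral>y. norm (f y) \<partial>lborel)"
  have L: "0 \<le> L" by (simp add: L_def)
  have lin: "linear (\<lambda>v. conv (\<lambda>z. ?D z v) f x)"
  proof
    fix a b :: 'a and c :: real
    show "conv (\<lambda>z. ?D z (a + b)) f x = conv (\<lambda>z. ?D z a) f x + conv (\<lambda>z. ?D z b) f x"
      unfolding conv_def linear_add[OF has_derivative_linear[OF hd]] scaleR_left_distrib
      by (intro Bochner_Integration.integral_add int)
    show "conv (\<lambda>z. ?D z (c *\<^sub>R a)) f x = c *\<^sub>R conv (\<lambda>z. ?D z a) f x"
      unfolding conv_def linear_scale[OF has_derivative_linear[OF hd]] by (simp flip: scaleR_scaleR)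
  qed
  show ?thesis
    unfolding has_derivative_at_alt
  proof (intro conjI allI impI)
    show "bounded_linear (\<lambda>v. conv (\<lambda>z. ?D z v) f x)" using lin by (simp add: linear_conv_bounded_linear)
    fix e :: real assume e: "0 < e"
    obtain d where d: "0 < d" "\<And>z w. norm w < d \<Longrightarrow> \<bar>\<rho> (z + w) - \<rho> z - ?D z w\<bar> \<le> e / (L + 1) * norm w"
      by (rule C1_uniform_derivative[OF \<rho>, of "e / (L + 1)"]) (use e L in auto)
    show "\<exists>d>0. \<forall>y. norm (y - x) < d \<longrightarrow>
        norm (conv \<rho> f y - conv \<rho> f x - conv (\<lambda>z. ?D z (y - x)) f x) \<le> e * norm (y - x)"
    proof (intro exI[of _ d] conjI allI impI d(1))
      fix x' assume x': "norm (x' - x) < d"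
      have "conv \<rho> f x' - conv \<rho> f x - conv (\<lambda>z. ?D z (x' - x)) f x
          = (\<integral>y. \<rho> (x' - y) *\<^sub>R f y - \<rho> (x - y) *\<^sub>R f y - ?D (x - y) (x' - x) *\<^sub>R f y \<partial>lborel)"
        unfolding conv_def by (simp add: int int0)
      also have "\<dots> = (\<integral>y. (\<rho> (x' - y) - \<rho> (x - y) - ?D (x - y) (x' - x)) *\<^sub>R f y \<partial>lborel)"
        by (simp add: scaleR_left_diff_distrib)
      also have "norm \<dots> \<le> (\<integral>y. (e / (L + 1) * norm (x' - x)) * norm (f y) \<partial>lborel)"
      proof (rule Bochner_Integration.integral_norm_bound_integral)
        show "integrable lborel (\<lambda>y. (\<rho> (x' - y) - \<rho> (x - y) - ?D (x - y) (x' - x)) *\<^sub>R f y)"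
          unfolding scaleR_left_diff_distrib by (intro Bochner_Integration.integrable_diff int int0)
        show "integrable lborel (\<lambda>y. (e / (L + 1) * norm (x' - x)) * norm (f y))" using f by simp
        fix y
        have "\<bar>\<rho> (x' - y) - \<rho> (x - y) - ?D (x - y) (x' - x)\<bar> \<le> e / (L + 1) * norm (x' - x)"
          using d(2)[OF x', of "x - y"] by (simp add: algebra_simps)
        then show "norm ((\<rho> (x' - y) - \<rho> (x - y) - ?D (x - y) (x' - x)) *\<^sub>R f y) \<le> (e / (L + 1) * norm (x' - x)) * norm (f y)"
          unfolding norm_scaleR by (intro mult_right_mono) auto
      qed
      also have "\<dots> = (e / (L + 1) * L) * norm (x' - x)" by (simp add: L_def)
      also have "\<dots> \<le> e * norm (x' - x)"
        using e L by (intro mult_right_mono) (auto simp: field_simps)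
      finally show "norm (conv \<rho> f x' - conv \<rho> f x - conv (\<lambda>z. ?D z (x' - x)) f x) \<le> e * norm (x' - x)" .
    qed
  qed
qed

text \<open>Kept abstract, since besides continuity the convergence results use only positivity,
  unit mass and shrinking support; the concrete kernel is dictated later by the mean value
  argument.\<close>

definition mollifier :: "('a::euclidean_space \<Rightarrow> real) \<Rightarrow> real \<Rightarrow> bool" where
  "mollifier \<rho> \<delta> \<longleftrightarrow> continuous_on UNIV \<rho> \<and> (\<forall>z. 0 \<le> \<rho> z) \<and> (\<forall>z. \<delta> < norm z \<longrightarrow> \<rho> z = 0) \<and> (\<integral>z. \<rho> z \<partial>lborel) = 1"

lemma mollifier_compact: "mollifier \<rho> \<delta> \<Longrightarrow> compact_support_in UNIV \<rho>"
  unfolding mollifier_def by (rule compact_support_inI[of "cball 0 \<delta>"]) auto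

lemma lborel_shift:
  fixes f :: "'a::euclidean_space \<Rightarrow> ennreal"
  assumes [measurable]: "f \<in> borel_measurable borel"
  shows "(\<integral>\<^sup>+x. f (x - y) \<partial>lborel) = (\<integral>\<^sup>+x. f x \<partial>lborel)"
proof -
  have "(\<integral>\<^sup>+x. f x \<partial>lborel) = (\<integral>\<^sup>+x. f x \<partial>(distr lborel borel ((+) (- y))))" by (simp add: lborel_distr_plus)
  also have "\<dots> = (\<integral>\<^sup>+x. f (- y + x) \<partial>lborel)" by (subst nn_integral_distr) auto
  finally show ?thesis by simp
qed

lemma integral_mollifier_shift:
  assumes m: "mollifier \<rho> \<delta>"
  shows "integrable lborel (\<lambda>y. \<rho> (x - y))" "(\<integral>y. \<rho> (x - y) \<partial>lborel) = 1"
    "(\<integral>\<^sup>+x. ennreal (\<rho> (x - y)) \<partial>lborel) = 1"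
proof -
  have [measurable]: "\<rho> \<in> borel_measurable borel" using m by (auto simp: mollifier_def intro: borel_measurable_continuous_onI)
  have nn: "0 \<le> \<rho> z" for z using m by (auto simp: mollifier_def)
  \<comment> \<open>A non-integrable function has integral 0 by convention, so unit mass entails
    integrability.\<close>
  have int: "integrable lborel \<rho>" using m not_integrable_integral_eq unfolding mollifier_def by force
  have "(\<integral>\<^sup>+z. ennreal (\<rho> z) \<partial>lborel) = 1"
    using m nn_integral_eq_integral[OF int] nn by (simp add: mollifier_def)
  then show "(\<integral>\<^sup>+x. ennreal (\<rho> (x - y)) \<partial>lborel) = 1" by (subst lborel_shift) auto
  \<comment> \<open>Reflection and translation at once: an affine map with factor -1, whose Jacobian
    has modulus 1.\<close>
  have refl: "lborel = density (distr lborel borel (\<lambda>y. x + (-1) *\<^sub>R y)) (\<lambda>_. ennreal (\<bar>-1\<bar> ^ DIM('a)))"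
    by (rule lborel_affine) simp
  then have d: "lborel = distr lborel borel (\<lambda>y. x - y)" by (simp add: density_1)
  have "has_bochner_integral (distr lborel borel (\<lambda>y. x - y)) \<rho> 1"
    using int m unfolding d[symmetric] mollifier_def by (simp add: has_bochner_integral_iff)
  then have "has_bochner_integral lborel (\<lambda>y. \<rho> (x - y)) 1"
    by (subst (asm) has_bochner_integral_iff, subst has_bochner_integral_iff) (auto simp: integrable_distr_eq integral_distr)
  then show "integrable lborel (\<lambda>y. \<rho> (x - y))" "(\<integral>y. \<rho> (x - y) \<partial>lborel) = 1" by (auto simp: has_bochner_integral_iff)
qed

text \<open>Jensen's inequality for the probability density \<open>\<rho> (x - y)\<close>. For
  \<open>p = 2\<close> it is the nonnegativity of the variance of \<open>norm (f y)\<close>, which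
  explains the restriction to the exponents 1 and 2.\<close>

lemma conv_norm_pow:
  fixes f :: "'a::euclidean_space \<Rightarrow> 'b::euclidean_space"
  assumes m: "mollifier \<rho> \<delta>" and f: "integrable lborel f" and fp: "integrable lborel (\<lambda>x. norm (f x) ^ p)"
    and p: "p = 1 \<or> p = 2"
  shows "norm (conv \<rho> f x) ^ p \<le> (\<integral>y. \<rho> (x - y) * norm (f y) ^ p \<partial>lborel)"
proof -
  have cs: "continuous_on UNIV \<rho>" "compact_support_in UNIV \<rho>" using m mollifier_compact by (auto simp: mollifier_def)
  have nn: "0 \<le> \<rho> z" for z using m by (auto simp: mollifier_def)
  have i1: "integrable lborel (\<lambda>y. \<rho> (x - y) * norm (f y))"
    using integrable_conv[OF integrable_norm[OF f] cs] by simp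
  have ip: "integrable lborel (\<lambda>y. \<rho> (x - y) * norm (f y) ^ p)"
    using integrable_conv[OF fp cs] by simp
  define t where "t = (\<integral>y. \<rho> (x - y) * norm (f y) \<partial>lborel)"
  have "norm (conv \<rho> f x) \<le> t"
    unfolding conv_def t_def using nn
    by (intro Bochner_Integration.integral_norm_bound_integral integrable_conv[OF f cs] i1) auto
  then have le: "norm (conv \<rho> f x) ^ p \<le> t ^ p" by (intro power_mono) auto
  show ?thesis
  proof (cases "p = 1")
    case True then show ?thesis using le by (simp add: t_def)
  next
    case False
    then have p2: "p = 2" using p by simp
    have "0 \<le> (\<integral>y. \<rho> (x - y) * (norm (f y) - t)\<^sup>2 \<partial>lborel)"
      using nn by (intro Bochner_Integration.integral_nonneg) auto
    also have "\<dots> = (\<integral>y. \<rho> (x - y) * norm (f y) ^ p - 2 * t * (\<rho> (x - y) * norm (f y)) + t\<^sup>2 * \<rho> (x - y) \<partial>lborel)"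
      by (intro Bochner_Integration.integral_cong refl) (simp add: p2 power2_eq_square algebra_simps)
    also have "\<dots> = (\<integral>y. \<rho> (x - y) * norm (f y) ^ p \<partial>lborel) - 2 * t * t + t\<^sup>2 * 1"
      using i1 ip integral_mollifier_shift[OF m, of x] by (simp add: t_def)
    finally show ?thesis using le by (simp add: p2 power2_eq_square)
  qed
qed

text \<open>Jensen pointwise, then Tonelli with kernels of mass 1: convolution with a mollifier is a
  contraction of L^p.\<close>

lemma conv_young:
  fixes f :: "'a::euclidean_space \<Rightarrow> 'b::euclidean_space"
  assumes m: "mollifier \<rho> \<delta>" and f: "integrable lborel f" and fp: "integrable lborel (\<lambda>x. norm (f x) ^ p)"
    and p: "p = 1 \<or> p = 2"
  shows "integrable lborel (\<lambda>x. norm (conv \<rho> f x) ^ p)"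
    "(\<integral>x. norm (conv \<rho> f x) ^ p \<partial>lborel) \<le> (\<integral>x. norm (f x) ^ p \<partial>lborel)"
proof -
  have cs: "continuous_on UNIV \<rho>" "compact_support_in UNIV \<rho>" using m mollifier_compact by (auto simp: mollifier_def)
  have [measurable]: "\<rho> \<in> borel_measurable borel" using cs by (auto intro: borel_measurable_continuous_onI)
  have [measurable]: "f \<in> borel_measurable borel" using f by auto
  have [measurable]: "conv \<rho> f \<in> borel_measurable borel"
    by (intro borel_measurable_continuous_onI conv_continuous f cs)
  have nn: "0 \<le> \<rho> z" for z using m by (auto simp: mollifier_def)
  have ip: "integrable lborel (\<lambda>y. \<rho> (x - y) * norm (f y) ^ p)" for x
    using integrable_conv[OF fp cs] by simp
  have "(\<integral>\<^sup>+x. ennreal (norm (conv \<rho> f x) ^ p) \<partial>lborel)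
      \<le> (\<integral>\<^sup>+x. (\<integral>\<^sup>+y. ennreal (\<rho> (x - y)) * ennreal (norm (f y) ^ p) \<partial>lborel) \<partial>lborel)"
  proof (rule nn_integral_mono)
    fix x
    have "ennreal (norm (conv \<rho> f x) ^ p) \<le> ennreal (\<integral>y. \<rho> (x - y) * norm (f y) ^ p \<partial>lborel)"
      by (intro ennreal_leI conv_norm_pow[OF m f fp p])
    also have "\<dots> = (\<integral>\<^sup>+y. ennreal (\<rho> (x - y) * norm (f y) ^ p) \<partial>lborel)"
      using nn by (intro nn_integral_eq_integral[symmetric] ip) auto
    also have "\<dots> = (\<integral>\<^sup>+y. ennreal (\<rho> (x - y)) * ennreal (norm (f y) ^ p) \<partial>lborel)"
      using nn by (simp add: ennreal_mult')
    finally show "ennreal (norm (conv \<rho> f x) ^ p) \<le> (\<integral>\<^sup>+y. ennreal (\<rho> (x - y)) * ennreal (norm (f y) ^ p) \<partial>lborel)" .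
  qed
  also have "\<dots> = (\<integral>\<^sup>+y. (\<integral>\<^sup>+x. ennreal (\<rho> (x - y)) * ennreal (norm (f y) ^ p) \<partial>lborel) \<partial>lborel)"
    by (rule lborel_pair.Fubini') measurable
  also have "\<dots> = (\<integral>\<^sup>+y. ennreal (norm (f y) ^ p) \<partial>lborel)"
    using integral_mollifier_shift(3)[OF m] by (simp add: nn_integral_multc)
  also have "\<dots> = ennreal (\<integral>x. norm (f x) ^ p \<partial>lborel)"
    by (intro nn_integral_eq_integral fp) auto
  finally have le: "(\<integral>\<^sup>+x. ennreal (norm (conv \<rho> f x) ^ p) \<partial>lborel) \<le> ennreal (\<integral>x. norm (f x) ^ p \<partial>lborel)" .
  show int: "integrable lborel (\<lambda>x. norm (conv \<rho> f x) ^ p)"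
  proof (rule integrableI_bounded)
    have "(\<integral>\<^sup>+x. ennreal (norm (norm (conv \<rho> f x) ^ p)) \<partial>lborel) \<le> ennreal (\<integral>x. norm (f x) ^ p \<partial>lborel)"
      using le by simp
    then show "(\<integral>\<^sup>+x. ennreal (norm (norm (conv \<rho> f x) ^ p)) \<partial>lborel) < \<infinity>"
      by (rule le_less_trans) simp
  qed measurable
  have "ennreal (\<integral>x. norm (conv \<rho> f x) ^ p \<partial>lborel) \<le> ennreal (\<integral>x. norm (f x) ^ p \<partial>lborel)"
    using le nn_integral_eq_integral[OF int] by simp
  then show "(\<integral>x. norm (conv \<rho> f x) ^ p \<partial>lborel) \<le> (\<integral>x. norm (f x) ^ p \<partial>lborel)"
    by (subst (asm) ennreal_le_iff) auto
qed

lemma add_power_le: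
  fixes a b :: real assumes "0 \<le> a" "0 \<le> b"
  shows "(a + b) ^ p \<le> 2 ^ p * (a ^ p + b ^ p)"
proof -
  have "(a + b) ^ p \<le> (2 * max a b) ^ p" using assms by (intro power_mono) auto
  also have "\<dots> = 2 ^ p * max a b ^ p" by (simp add: power_mult_distrib)
  also have "\<dots> \<le> 2 ^ p * (a ^ p + b ^ p)"
    using assms by (intro mult_left_mono) (auto simp: max_def)
  finally show ?thesis .
qed

lemma integrable_indicator_cball:
  "integrable lborel (\<lambda>x. c * indicator (cball (a::'a::euclidean_space) R) x :: real)"
  using emeasure_lborel_cball_finite[of a R] by (simp add: less_top)

lemma integrable_ball_bound:
  fixes f :: "'a::euclidean_space \<Rightarrow> real"
  assumes "f \<in> borel_measurable borel" "\<And>x. \<bar>f x\<bar> \<le> B * indicator (cball 0 R) x"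
  shows "integrable lborel f"
proof (rule Bochner_Integration.integrable_bound)
  show "integrable lborel (\<lambda>x. B * indicator (cball (0::'a) R) x)"
    by (rule integrable_indicator_cball)
  show "AE x in lborel. norm (f x) \<le> norm (B * indicator (cball 0 R) x)"
    using assms(2) by (intro always_eventually allI) (metis abs_ge_self order_trans real_norm_def)
qed (use assms in auto)

text \<open>Truncation of values and of support makes the function bounded. Almost everywhere
  approximation by continuous functions then becomes L^p approximation by dominated convergence,
  once the approximants are clipped and cut off in the same manner.\<close>

lemma Lp_dense:
  fixes f :: "'a::euclidean_space \<Rightarrow> 'b::euclidean_space"
  assumes f[measurable]: "f \<in> borel_measurable borel" and fp: "integrable lborel (\<lambda>x. norm (f x) ^ p)"
    and p: "1 \<le> p" and e: "0 < e"
  obtains g where "continuous_on UNIV g" "compact_support_in UNIV g"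
    "integrable lborel (\<lambda>x. norm (f x - g x) ^ p)" "(\<integral>x. norm (f x - g x) ^ p \<partial>lborel) < e"
proof -
  have p0: "(0::real) ^ p = 0" using p by (simp add: power_0_left)
  define fN where "fN N x = (if norm (f x) \<le> real (Suc N) \<and> norm x \<le> real (Suc N) then f x else 0)" for N :: nat and x
  have fNm[measurable]: "fN N \<in> borel_measurable borel" for N
    unfolding fN_def by measurable
  have "(\<lambda>N. \<integral>x. norm (f x - fN N x) ^ p \<partial>lborel) \<longlonglongrightarrow> (\<integral>x. 0 \<partial>(lborel::'a measure))"
  proof (rule integral_dominated_convergence[where w = "\<lambda>x. norm (f x) ^ p"])
    show "AE x in lborel. (\<lambda>N. norm (f x - fN N x) ^ p) \<longlonglongrightarrow> 0"
    proof (rule AE_I2, rule tendsto_eventually)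
      fix x :: 'a
      obtain M :: nat where M: "max (norm (f x)) (norm x) \<le> real M" using real_arch_simple by blast
      show "\<forall>\<^sub>F N in sequentially. norm (f x - fN N x) ^ p = 0"
        using eventually_ge_at_top[of M]
      proof eventually_elim
        case (elim N)
        then have "real M \<le> real (Suc N)" by simp
        then have "fN N x = f x" using M by (simp add: fN_def)
        then show "norm (f x - fN N x) ^ p = 0" using p by simp
      qed
    qed
    show "AE x in lborel. norm (norm (f x - fN N x) ^ p) \<le> norm (f x) ^ p" for N
      by (intro always_eventually allI) (auto simp: fN_def power_mono p)
  qed (use fp in auto)
  \<comment> \<open>The target leaves room for two errors and for the factor \<open>2 ^ p\<close>
    lost in \<open>add_power_le\<close>.\<close>
  then have "\<forall>\<^sub>F N in sequentially. (\<integral>x. norm (f x - fN N x) ^ p \<partial>lborel) < e / (2 * 2 ^ p)"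
    using e by (intro order_tendstoD(2)[where y = 0]) auto
  then obtain N where N: "(\<integral>x. norm (f x - fN N x) ^ p \<partial>lborel) < e / (2 * 2 ^ p)"
    by (auto simp: eventually_sequentially)
  define h where "h = fN N"
  define K where "K = real (Suc N)"
  have K: "0 < K" by (simp add: K_def)
  have hb: "norm (h x) \<le> K" "K < norm x \<Longrightarrow> h x = 0" for x by (auto simp: h_def fN_def K_def)
  have [measurable]: "h \<in> borel_measurable borel" by (simp add: h_def)
  have "h measurable_on UNIV" by (rule lebesgue_measurable_imp_measurable_on) (auto intro: measurable_completion)
  then obtain Ng F where F: "negligible Ng" "\<And>n. continuous_on UNIV (F n)" "\<And>x. x \<notin> Ng \<Longrightarrow> (\<lambda>n. F n x) \<longlonglongrightarrow> h x"
    unfolding measurable_on_def by auto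
  \<comment> \<open>Radial retraction onto the ball of radius \<open>K\<close>: continuous, and the
    identity on the values of \<open>h\<close>.\<close>
  define clip where "clip y = (K / max K (norm y)) *\<^sub>R y" for y :: 'b
  have clip: "norm (clip y) \<le> K" "norm y \<le> K \<Longrightarrow> clip y = y" for y
    using K by (auto simp: clip_def max_def)
  have clipc: "continuous_on UNIV clip" unfolding clip_def using K by (intro continuous_intros) auto
  define cut where "cut x = max 0 (min 1 (K + 1 - norm x))" for x :: 'a
  have cut: "continuous_on UNIV cut" "0 \<le> cut x" "cut x \<le> 1" "norm x \<le> K \<Longrightarrow> cut x = 1" "K + 1 < norm x \<Longrightarrow> cut x = 0" for x
    unfolding cut_def by (auto intro!: continuous_intros)
  define Gn where "Gn n x = cut x *\<^sub>R clip (F n x)" for n x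
  have Gc: "continuous_on UNIV (Gn n)" for n
    unfolding Gn_def using continuous_on_compose2[OF clipc F(2)[of n]] cut(1) by (intro continuous_intros) auto
  have Gs: "compact_support_in UNIV (Gn n)" for n
    by (rule compact_support_inI[of "cball 0 (K + 1)"]) (auto simp: Gn_def cut)
  have [measurable]: "Gn n \<in> borel_measurable borel" for n by (rule borel_measurable_continuous_onI[OF Gc])
  have bnd: "norm (h x - Gn n x) ^ p \<le> (2 * K) ^ p * indicator (cball 0 (K + 1)) x" for n x
  proof (cases "norm x \<le> K + 1")
    case True
    have "norm (Gn n x) \<le> 1 * K" unfolding Gn_def norm_scaleR using cut(2)[of x] cut(3)[of x] clip(1) K by (intro mult_mono) auto
    then have "norm (h x - Gn n x) \<le> 2 * K" using norm_triangle_ineq4[of "h x" "Gn n x"] hb(1)[of x] by linarith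
    then have "norm (h x - Gn n x) ^ p \<le> (2 * K) ^ p" by (rule power_mono) simp
    then show ?thesis using True by simp
  next
    case False
    then show ?thesis using hb(2)[of x] by (simp add: Gn_def cut p0)
  qed
  have ih: "integrable lborel (\<lambda>x. norm (h x - Gn n x) ^ p)" for n
    using bnd by (intro integrable_ball_bound[of _ "(2*K)^p" "K + 1"]) auto
  have "(\<lambda>n. \<integral>x. norm (h x - Gn n x) ^ p \<partial>lborel) \<longlonglongrightarrow> (\<integral>x. 0 \<partial>(lborel::'a measure))"
  proof (rule integral_dominated_convergence[where w = "\<lambda>x. (2 * K) ^ p * indicator (cball 0 (K + 1)) x"])
    show "integrable lborel (\<lambda>x. (2 * K) ^ p * indicator (cball (0::'a) (K + 1)) x)"
      by (rule integrable_indicator_cball)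
    have "AE x in lborel. x \<notin> Ng"
      using F(1) by (auto simp: negligible_iff_null_sets null_sets_completion_iff2 intro: AE_I')
    then show "AE x in lborel. (\<lambda>n. norm (h x - Gn n x) ^ p) \<longlonglongrightarrow> 0"
    proof eventually_elim
      case (elim x)
      have "isCont clip (h x)" using clipc by (simp add: continuous_on_eq_continuous_at)
      then have "(\<lambda>n. cut x *\<^sub>R clip (F n x)) \<longlonglongrightarrow> cut x *\<^sub>R clip (h x)"
        by (intro tendsto_intros isCont_tendsto_compose[of _ clip] F(3) elim)
      moreover have "cut x *\<^sub>R clip (h x) = h x"
        using hb(1)[of x] hb(2)[of x] clip(2)[of "h x"] cut(4)[of x] by (cases "norm x \<le> K") auto
      ultimately have "(\<lambda>n. norm (h x - Gn n x) ^ p) \<longlonglongrightarrow> norm (h x - h x) ^ p"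
        unfolding Gn_def by (intro tendsto_intros) auto
      then show ?case by (simp add: p0)
    qed
    show "AE x in lborel. norm (norm (h x - Gn n x) ^ p) \<le> (2 * K) ^ p * indicator (cball 0 (K + 1)) x" for n
      using bnd by (intro always_eventually) auto
  qed auto
  then have "\<forall>\<^sub>F n in sequentially. (\<integral>x. norm (h x - Gn n x) ^ p \<partial>lborel) < e / (2 * 2 ^ p)"
    using e by (intro order_tendstoD(2)[where y = 0]) auto
  then obtain n where n: "(\<integral>x. norm (h x - Gn n x) ^ p \<partial>lborel) < e / (2 * 2 ^ p)"
    by (auto simp: eventually_sequentially)
  have le: "norm (f x - Gn n x) ^ p \<le> 2 ^ p * (norm (f x - h x) ^ p + norm (h x - Gn n x) ^ p)" for x
  proof -
    have "norm (f x - Gn n x) ^ p \<le> (norm (f x - h x) + norm (h x - Gn n x)) ^ p"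
      using norm_triangle_ineq[of "f x - h x" "h x - Gn n x"] by (intro power_mono) auto
    also have "\<dots> \<le> 2 ^ p * (norm (f x - h x) ^ p + norm (h x - Gn n x) ^ p)" by (rule add_power_le) auto
    finally show ?thesis .
  qed
  have if1: "integrable lborel (\<lambda>x. norm (f x - h x) ^ p)"
    by (rule Bochner_Integration.integrable_bound[OF fp]) (auto simp: h_def fN_def p power_mono)
  have ir: "integrable lborel (\<lambda>x. 2 ^ p * (norm (f x - h x) ^ p + norm (h x - Gn n x) ^ p))"
    using if1 ih by auto
  have ig: "integrable lborel (\<lambda>x. norm (f x - Gn n x) ^ p)"
    by (rule Bochner_Integration.integrable_bound[OF ir]) (use le in \<open>auto intro: order_trans[OF _ abs_ge_self]\<close>)
  have "(\<integral>x. norm (f x - Gn n x) ^ p \<partial>lborel) \<le> (\<integral>x. 2 ^ p * (norm (f x - h x) ^ p + norm (h x - Gn n x) ^ p) \<partial>lborel)"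
    by (rule integral_mono[OF ig ir le])
  also have "\<dots> = 2 ^ p * ((\<integral>x. norm (f x - h x) ^ p \<partial>lborel) + (\<integral>x. norm (h x - Gn n x) ^ p \<partial>lborel))"
    using if1 ih by simp
  also have "\<dots> < 2 ^ p * (e / (2 * 2 ^ p) + e / (2 * 2 ^ p))"
    using N n by (intro mult_strict_left_mono add_strict_mono) (auto simp: h_def)
  also have "\<dots> = e" by (simp add: field_simps)
  finally show ?thesis using Gc Gs ig by (intro that[of "Gn n"])
qed

lemma conv_diff:
  fixes f g :: "'a::euclidean_space \<Rightarrow> 'b::euclidean_space"
  assumes "integrable lborel f" "integrable lborel g" "continuous_on UNIV \<rho>" "compact_support_in UNIV \<rho>"
  shows "conv \<rho> (\<lambda>x. f x - g x) x = conv \<rho> f x - conv \<rho> g x"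
  unfolding conv_def scaleR_right_diff_distrib
  by (rule Bochner_Integration.integral_diff) (intro integrable_conv assms)+

lemma conv_near:
  fixes g :: "'a::euclidean_space \<Rightarrow> 'b::euclidean_space"
  assumes m: "mollifier \<rho> \<delta>" and g: "integrable lborel g"
    and near: "\<And>y. norm (x - y) \<le> \<delta> \<Longrightarrow> norm (g y - c) \<le> w"
  shows "norm (conv \<rho> g x - c) \<le> w"
proof -
  have cs: "continuous_on UNIV \<rho>" "compact_support_in UNIV \<rho>" using m mollifier_compact by (auto simp: mollifier_def)
  have nn: "0 \<le> \<rho> z" for z using m by (auto simp: mollifier_def)
  have i: "integrable lborel (\<lambda>y. \<rho> (x - y) *\<^sub>R g y)" by (rule integrable_conv[OF g cs])
  have i1: "integrable lborel (\<lambda>y. \<rho> (x - y) *\<^sub>R c)" using integral_mollifier_shift(1)[OF m] by simp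
  have "conv \<rho> g x - c = (\<integral>y. \<rho> (x - y) *\<^sub>R g y \<partial>lborel) - (\<integral>y. \<rho> (x - y) *\<^sub>R c \<partial>lborel)"
    using integral_mollifier_shift(1,2)[OF m, of x] by (simp add: conv_def)
  also have "\<dots> = (\<integral>y. \<rho> (x - y) *\<^sub>R (g y - c) \<partial>lborel)"
    using i i1 by (simp add: scaleR_right_diff_distrib)
  also have "norm \<dots> \<le> (\<integral>y. \<rho> (x - y) * w \<partial>lborel)"
  proof (rule Bochner_Integration.integral_norm_bound_integral)
    show "integrable lborel (\<lambda>y. \<rho> (x - y) *\<^sub>R (g y - c))"
      unfolding scaleR_right_diff_distrib using i i1 by auto
    show "integrable lborel (\<lambda>y. \<rho> (x - y) * w)" using integral_mollifier_shift(1)[OF m] by simp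
    fix y
    show "norm (\<rho> (x - y) *\<^sub>R (g y - c)) \<le> \<rho> (x - y) * w"
    proof (cases "norm (x - y) \<le> \<delta>")
      case True then show ?thesis using near nn by (simp add: mult_left_mono)
    next
      case False then show ?thesis using m by (simp add: mollifier_def)
    qed
  qed
  also have "\<dots> = w" using integral_mollifier_shift(2)[OF m] by simp
  finally show ?thesis .
qed

text \<open>A density argument. For a continuous compactly supported \<open>g\<close> the
  convergence is uniform with support in a fixed ball, and the error \<open>f - g\<close> is not
  increased by the convolution.\<close>

lemma mollifier_conv:
  fixes f :: "'a::euclidean_space \<Rightarrow> 'b::euclidean_space"
  assumes m: "\<And>n. mollifier (\<rho> n) (\<delta> n)" and \<delta>: "\<delta> \<longlonglongrightarrow> 0"
    and f: "integrable lborel f" and fp: "integrable lborel (\<lambda>x. norm (f x) ^ p)" and p: "p = 1 \<or> p = 2"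
  shows "integrable lborel (\<lambda>x. norm (conv (\<rho> n) f x - f x) ^ p)"
    "(\<lambda>n. \<integral>x. norm (conv (\<rho> n) f x - f x) ^ p \<partial>lborel) \<longlonglongrightarrow> 0"
proof -
  have cs: "continuous_on UNIV (\<rho> n)" "compact_support_in UNIV (\<rho> n)" for n using m[of n] mollifier_compact[OF m[of n]] by (auto simp: mollifier_def)
  have [measurable]: "f \<in> borel_measurable borel" using f by auto
  have convm[measurable]: "conv (\<rho> n) g \<in> borel_measurable borel" if "integrable lborel g" for n and g :: "'a \<Rightarrow> 'b"
    by (intro borel_measurable_continuous_onI conv_continuous that cs)
  note [measurable] = convm[OF f]
  have i1: "integrable lborel (\<lambda>x. 2 ^ p * (norm (conv (\<rho> n) f x) ^ p + norm (f x) ^ p))" for n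
    using conv_young(1)[OF m f fp p] fp by auto
  show int: "integrable lborel (\<lambda>x. norm (conv (\<rho> n) f x - f x) ^ p)" for n
  proof (rule Bochner_Integration.integrable_bound[OF i1[of n]])
    have "norm (conv (\<rho> n) f x - f x) ^ p \<le> 2 ^ p * (norm (conv (\<rho> n) f x) ^ p + norm (f x) ^ p)" for x
      by (rule order_trans[OF power_mono[OF norm_triangle_ineq4] add_power_le]) auto
    then show "AE x in lborel. norm (norm (conv (\<rho> n) f x - f x) ^ p) \<le> norm (2 ^ p * (norm (conv (\<rho> n) f x) ^ p + norm (f x) ^ p))"
      by (intro always_eventually) auto
  qed auto
  show "(\<lambda>n. \<integral>x. norm (conv (\<rho> n) f x - f x) ^ p \<partial>lborel) \<longlonglongrightarrow> 0"
  proof (rule LIMSEQ_I)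
    fix e :: real assume e: "0 < e"
    \<comment> \<open>Three errors of size \<open>e'\<close>, each multiplied by
      \<open>4 ^ p\<close>, stay below \<open>e\<close>.\<close>
    define e' where "e' = e / (4 * 4 ^ p)"
    have e': "0 < e'" using e by (simp add: e'_def)
    obtain g where g: "continuous_on UNIV g" "compact_support_in UNIV g"
      "integrable lborel (\<lambda>x. norm (f x - g x) ^ p)" "(\<integral>x. norm (f x - g x) ^ p \<partial>lborel) < e'"
      by (rule Lp_dense[of f p e']) (use fp p e' in auto)
    have [measurable]: "g \<in> borel_measurable borel" by (rule borel_measurable_continuous_onI[OF g(1)])
    obtain K where K: "compact K" "\<And>x. x \<notin> K \<Longrightarrow> g x = 0" using g(2) unfolding compact_support_in_def by blast
    obtain R where R: "\<And>x. x \<in> K \<Longrightarrow> norm x \<le> R" using compact_imp_bounded[OF K(1)] bounded_iff by metis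
    obtain B where B: "0 \<le> B" "\<And>x. norm (g x) \<le> B" using bounded_compact_support[OF g(1,2)] by blast
    have "integrable lborel (\<lambda>x. norm (g x))"
      using B K R by (intro integrable_ball_bound[of _ B R]) (auto simp: indicator_def intro: K(2))
    then have ig: "integrable lborel g" by (subst (asm) integrable_norm_iff) auto
    define vol where "vol = measure lborel (cball (0::'a) (R + 1))"
    \<comment> \<open>As \<open>w\<close> is at most 1, also \<open>w ^ p\<close> is at most
      \<open>w\<close>, and \<open>w * vol\<close> is at most \<open>e'\<close>.\<close>
    define w where "w = min 1 (e' / (vol + 1))"
    have vol: "0 \<le> vol" by (simp add: vol_def)
    have w: "0 < w" "w \<le> 1" using e' vol by (auto simp: w_def)
    obtain d where d: "0 < d" "\<And>x y. dist x y < d \<Longrightarrow> dist (g x) (g y) < w"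
      using uniformly_continuous_compact_support[OF g(1,2) w(1)] by blast
    have "\<forall>\<^sub>F n in sequentially. \<delta> n < min d 1"
      using \<delta> d(1) by (intro order_tendstoD(2)[where y = 0]) auto
    then obtain n0 where n0: "\<And>n. n0 \<le> n \<Longrightarrow> \<delta> n < min d 1" by (auto simp: eventually_sequentially)
    show "\<exists>no. \<forall>n\<ge>no. norm ((\<integral>x. norm (conv (\<rho> n) f x - f x) ^ p \<partial>lborel) - 0) < e"
    proof (intro exI[of _ n0] allI impI)
      fix n assume n: "n0 \<le> n"
      note [measurable] = convm[OF ig]
      have wb: "norm (conv (\<rho> n) g x - g x) ^ p \<le> w * indicator (cball 0 (R + 1)) x" for x
      proof (cases "norm x \<le> R + 1")
        case True
        have "norm (conv (\<rho> n) g x - g x) \<le> w"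
          by (rule conv_near[OF m ig])
            (use n0[OF n] in \<open>auto intro!: less_imp_le[OF d(2)[unfolded dist_norm]] simp: norm_minus_commute\<close>)
        then have "norm (conv (\<rho> n) g x - g x) ^ p \<le> w ^ p" by (intro power_mono) auto
        also have "\<dots> \<le> w ^ 1" using w p by (intro power_decreasing) auto
        finally show ?thesis using True by simp
      next
        case False
        then have gx: "g x = 0" using K(2) R by force
        have "norm (conv (\<rho> n) g x - g x) \<le> 0"
        proof (rule conv_near[OF m ig])
          fix y assume "norm (x - y) \<le> \<delta> n"
          then have "norm x \<le> norm y + 1" using n0[OF n] norm_triangle_sub[of x y] by auto
          then have "y \<notin> K" using False R by force
          then show "norm (g y - g x) \<le> 0" using gx K(2) by simp
        qed
        then have "norm (conv (\<rho> n) g x - g x) = 0" by simp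
        then have "norm (conv (\<rho> n) g x - g x) ^ p = 0" using p by (elim disjE) simp_all
        then show ?thesis using w by (simp only: mult_nonneg_nonneg indicator_pos_le less_imp_le)
      qed
      have iw: "integrable lborel (\<lambda>x. w * indicator (cball (0::'a) (R + 1)) x)"
        by (rule integrable_indicator_cball)
      have icg: "integrable lborel (\<lambda>x. norm (conv (\<rho> n) g x - g x) ^ p)"
        using wb by (intro integrable_ball_bound[of _ w "R + 1"]) auto
      have "(\<integral>x. norm (conv (\<rho> n) g x - g x) ^ p \<partial>lborel) \<le> (\<integral>x. w * indicator (cball 0 (R + 1)) x \<partial>(lborel :: 'a measure))"
        by (rule integral_mono[OF icg iw wb])
      also have "\<dots> = w * vol" using emeasure_lborel_cball_finite[of "0::'a" "R + 1"] by (simp add: vol_def)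
      also have "\<dots> \<le> e' / (vol + 1) * vol" using vol by (intro mult_right_mono) (auto simp: w_def)
      also have "\<dots> \<le> e'" using vol e' by (simp add: field_simps)
      finally have 2: "(\<integral>x. norm (conv (\<rho> n) g x - g x) ^ p \<partial>lborel) \<le> e'" .
      have ifg: "integrable lborel (\<lambda>x. f x - g x)" using f ig by auto
      note Y = conv_young[OF m[of n] ifg g(3) p]
      have le: "norm (conv (\<rho> n) f x - f x) ^ p \<le> 4 ^ p *
          (norm (conv (\<rho> n) (\<lambda>x. f x - g x) x) ^ p + norm (f x - g x) ^ p + norm (conv (\<rho> n) g x - g x) ^ p)" for x
      proof -
        let ?a = "norm (conv (\<rho> n) (\<lambda>x. f x - g x) x)" and ?b = "norm (f x - g x)" and ?c = "norm (conv (\<rho> n) g x - g x)"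
        have "conv (\<rho> n) f x - f x = (conv (\<rho> n) (\<lambda>x. f x - g x) x - (f x - g x)) + (conv (\<rho> n) g x - g x)"
          by (simp add: conv_diff[OF f ig cs])
        then have "norm (conv (\<rho> n) f x - f x) \<le> norm (conv (\<rho> n) (\<lambda>x. f x - g x) x - (f x - g x)) + ?c"
          by (simp only: norm_triangle_ineq)
        also have "\<dots> \<le> (?a + ?b) + ?c" by (intro add_right_mono norm_triangle_ineq4)
        finally have "norm (conv (\<rho> n) f x - f x) \<le> (?a + ?b) + ?c" .
        then have "norm (conv (\<rho> n) f x - f x) ^ p \<le> ((?a + ?b) + ?c) ^ p" by (intro power_mono) auto
        also have "\<dots> \<le> 2 ^ p * ((?a + ?b) ^ p + ?c ^ p)" by (rule add_power_le) auto
        also have "\<dots> \<le> 2 ^ p * (2 ^ p * (?a ^ p + ?b ^ p) + 2 ^ p * ?c ^ p)"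
        proof -
          have "?c ^ p \<le> 2 ^ p * ?c ^ p" using mult_right_mono[of 1 "2 ^ p" "?c ^ p"] by simp
          moreover have "(?a + ?b) ^ p \<le> 2 ^ p * (?a ^ p + ?b ^ p)" by (rule add_power_le) auto
          ultimately show ?thesis by (intro mult_left_mono add_mono) auto
        qed
        also have "\<dots> = 4 ^ p * (?a ^ p + ?b ^ p + ?c ^ p)"
        proof -
          have "(4::real) ^ p = 2 ^ p * 2 ^ p" by (simp flip: power_mult_distrib)
          then show ?thesis by (simp only: distrib_left mult.assoc)
        qed
        finally show ?thesis .
      qed
      have "(\<integral>x. norm (conv (\<rho> n) f x - f x) ^ p \<partial>lborel) \<le> (\<integral>x. 4 ^ p *
          (norm (conv (\<rho> n) (\<lambda>x. f x - g x) x) ^ p + norm (f x - g x) ^ p + norm (conv (\<rho> n) g x - g x) ^ p) \<partial>lborel)"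
        using Y(1) g(3) icg le by (intro integral_mono int) auto
      also have "\<dots> = 4 ^ p * ((\<integral>x. norm (conv (\<rho> n) (\<lambda>x. f x - g x) x) ^ p \<partial>lborel)
          + (\<integral>x. norm (f x - g x) ^ p \<partial>lborel) + (\<integral>x. norm (conv (\<rho> n) g x - g x) ^ p \<partial>lborel))"
        using Y(1) g(3) icg by simp
      also have "\<dots> \<le> 4 ^ p * (e' + e' + e')"
        using Y(2) g(4) 2 by (intro mult_left_mono add_mono) auto
      also have "\<dots> < e" using e by (simp add: e'_def)
      finally show "norm ((\<integral>x. norm (conv (\<rho> n) f x - f x) ^ p \<partial>lborel) - 0) < e" by simp
    qed
  qed
qed

section \<open>Translation invariance, calculus of C1 functions and reflected kernels\<close>

lemma lborel_integral_shift:
  fixes f :: "'a::euclidean_space \<Rightarrow> 'b::euclidean_space"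
  assumes "f \<in> borel_measurable borel"
  shows "(\<integral>x. f (a + x) \<partial>lborel) = (\<integral>x. f x \<partial>lborel)"
proof -
  have "(\<integral>x. f x \<partial>lborel) = (\<integral>x. f x \<partial>(distr lborel borel ((+) a)))" by (simp add: lborel_distr_plus)
  also have "\<dots> = (\<integral>x. f (a + x) \<partial>lborel)" using assms by (intro integral_distr) auto
  finally show ?thesis by simp
qed

lemma integrable_C1c:
  fixes f :: "'a::euclidean_space \<Rightarrow> real"
  assumes "continuous_on UNIV f" "compact_support_in \<Omega> f"
  shows "integrable lborel f"
proof -
  obtain K where K: "compact K" "\<And>x. x \<notin> K \<Longrightarrow> f x = 0" using assms(2) unfolding compact_support_in_def by blast
  obtain B where B: "\<And>x. norm (f x) \<le> B" using bounded_compact_support[OF assms] by blast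
  show ?thesis
    using K B assms(1) emeasure_compact_finite[OF K(1)]
    by (intro integrable_compact_support[of f B K]) (auto simp: borel_compact less_top intro: borel_measurable_continuous_onI)
qed

text \<open>Translation invariance makes the integral of each difference quotient vanish, and
  dominated convergence passes to the derivative.\<close>

lemma integral_deriv_zero:
  fixes f :: "'a::euclidean_space \<Rightarrow> real"
  assumes f: "C1c \<Omega> f"
  shows "(\<integral>x. frechet_derivative f (at x) v \<partial>lborel) = 0"
proof -
  have C1f: "C1 f" and cs: "compact_support_in \<Omega> f" using f by (auto simp: C1c_def)
  obtain K where K: "compact K" "\<And>x. x \<notin> K \<Longrightarrow> f x = 0" using cs unfolding compact_support_in_def by blast
  obtain R where R: "\<And>x. x \<in> K \<Longrightarrow> norm x \<le> R" using compact_imp_bounded[OF K(1)] bounded_iff by metis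
  obtain B where B: "0 \<le> B" "\<And>x. norm (frechet_derivative f (at x) v) \<le> B"
    using bounded_compact_support[OF C1c_deriv[OF f], of v] by blast
  have [measurable]: "f \<in> borel_measurable borel" by (rule borel_measurable_continuous_onI[OF C1_continuous[OF C1f]])
  have hd: "(f has_derivative frechet_derivative f (at x)) (at x)" for x by (rule C1_has_derivative[OF C1f])
  have der: "((\<lambda>t. f (t *\<^sub>R v + x)) has_real_derivative frechet_derivative f (at (t *\<^sub>R v + x)) v) (at t)" for t x
  proof -
    have 1: "((\<lambda>t. t *\<^sub>R v + x) has_derivative (\<lambda>t. t *\<^sub>R v)) (at t)" by (auto intro!: derivative_eq_intros)
    have "((\<lambda>t. f (t *\<^sub>R v + x)) has_derivative (\<lambda>s. frechet_derivative f (at (t *\<^sub>R v + x)) (s *\<^sub>R v))) (at t)"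
      by (rule has_derivative_compose[OF 1 hd])
    moreover have "frechet_derivative f (at (t *\<^sub>R v + x)) (s *\<^sub>R v) = s * frechet_derivative f (at (t *\<^sub>R v + x)) v" for s
      using linear_scale[OF has_derivative_linear[OF hd]] by simp
    ultimately show ?thesis unfolding has_field_derivative_def by (simp add: mult.commute[of _ "frechet_derivative f _ _"])
  qed
  \<comment> \<open>Increments of at most 1 keep all translated supports inside the ball of radius
    \<open>R + norm v\<close>, which gives one integrable majorant.\<close>
  define t where "t n = 1 / real (Suc n)" for n
  have t: "0 < t n" "t n \<le> 1" for n by (auto simp: t_def)
  have t0: "t \<longlonglongrightarrow> 0" unfolding t_def by (rule LIMSEQ_Suc[OF lim_1_over_n])
  have "(\<lambda>n. \<integral>x. (f (t n *\<^sub>R v + x) - f x) / t n \<partial>lborel) \<longlonglongrightarrow> (\<integral>x. frechet_derivative f (at x) v \<partial>lborel)"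
  proof (rule integral_dominated_convergence[where w = "\<lambda>x. B * indicator (cball 0 (R + norm v)) x"])
    show "(\<lambda>x. frechet_derivative f (at x) v) \<in> borel_measurable lborel"
      using C1_continuous_deriv[OF C1f] by (simp add: borel_measurable_continuous_onI)
    show "integrable lborel (\<lambda>x. B * indicator (cball (0::'a) (R + norm v)) x)" by (rule integrable_indicator_cball)
    show "AE x in lborel. (\<lambda>n. (f (t n *\<^sub>R v + x) - f x) / t n) \<longlonglongrightarrow> frechet_derivative f (at x) v"
    proof (rule AE_I2)
      fix x
      have "((\<lambda>h. (f (h *\<^sub>R v + x) - f x) / h) \<longlongrightarrow> frechet_derivative f (at x) v) (at 0)"
        using der[of x 0] by (simp add: DERIV_def)
      moreover have "filterlim t (at 0) sequentially"
        using t0 t(1) by (auto simp: filterlim_at intro!: always_eventually) (metis less_irrefl)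
      ultimately show "(\<lambda>n. (f (t n *\<^sub>R v + x) - f x) / t n) \<longlonglongrightarrow> frechet_derivative f (at x) v"
        by (rule filterlim_compose)
    qed
    show "AE x in lborel. norm ((f (t n *\<^sub>R v + x) - f x) / t n) \<le> B * indicator (cball 0 (R + norm v)) x" for n
    proof (rule AE_I2)
      fix x
      show "norm ((f (t n *\<^sub>R v + x) - f x) / t n) \<le> B * indicator (cball 0 (R + norm v)) x"
      proof (cases "norm x \<le> R + norm v")
        case True
        obtain z where "f (t n *\<^sub>R v + x) - f (0 *\<^sub>R v + x) = (t n - 0) * frechet_derivative f (at (z *\<^sub>R v + x)) v"
          using MVT2[OF t(1)[of n], of "\<lambda>t. f (t *\<^sub>R v + x)" "\<lambda>z. frechet_derivative f (at (z *\<^sub>R v + x)) v"] der by blast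
        then have "(f (t n *\<^sub>R v + x) - f x) / t n = frechet_derivative f (at (z *\<^sub>R v + x)) v"
          using t(1)[of n] by (simp add: field_simps)
        then show ?thesis using B(2) True by simp
      next
        case False
        have "norm (t n *\<^sub>R v) \<le> norm v" using t[of n] by (simp add: mult_left_le_one_le)
        then have "R < norm (t n *\<^sub>R v + x)" "R < norm x"
          using False norm_triangle_ineq4[of "t n *\<^sub>R v + x" "t n *\<^sub>R v"] norm_ge_zero[of v]
          unfolding add_diff_cancel_left' by linarith+
        then have "t n *\<^sub>R v + x \<notin> K" "x \<notin> K" using R by force+
        then show ?thesis using K(2) False by simp
      qed
    qed
  qed measurable
  moreover have "(\<integral>x. (f (t n *\<^sub>R v + x) - f x) / t n \<partial>lborel) = 0" for n
  proof -
    have i: "integrable lborel f" by (rule integrable_C1c[OF C1_continuous[OF C1f] cs])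
    have "integrable (distr lborel borel ((+) (t n *\<^sub>R v))) f" using i by (simp add: lborel_distr_plus)
    then have i2: "integrable lborel (\<lambda>x. f (t n *\<^sub>R v + x))" by (subst (asm) integrable_distr_eq) auto
    show ?thesis using i i2 lborel_integral_shift[of f "t n *\<^sub>R v"] by simp
  qed
  ultimately have "(\<lambda>n::nat. 0) \<longlonglongrightarrow> (\<integral>x. frechet_derivative f (at x) v \<partial>lborel)" by (simp only:)
  then show ?thesis by (simp add: LIMSEQ_const_iff)
qed

lemma
  fixes f g :: "'a::real_normed_vector \<Rightarrow> 'b::real_inner"
  assumes f: "C1 f" and g: "C1 g"
  shows C1_inner: "C1 (\<lambda>x. f x \<bullet> g x)"
    and D_inner: "frechet_derivative (\<lambda>x. f x \<bullet> g x) (at x) v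
       = f x \<bullet> frechet_derivative g (at x) v + frechet_derivative f (at x) v \<bullet> g x"
proof -
  have 1: "((\<lambda>x. f x \<bullet> g x) has_derivative (\<lambda>v. f x \<bullet> frechet_derivative g (at x) v + frechet_derivative f (at x) v \<bullet> g x)) (at x)" for x
    by (intro has_derivative_inner C1_has_derivative f g)
  have 2: "continuous_on UNIV (\<lambda>x. f x \<bullet> frechet_derivative g (at x) v + frechet_derivative f (at x) v \<bullet> g x)" for v
    by (intro continuous_intros C1_continuous C1_continuous_deriv f g)
  show "C1 (\<lambda>x. f x \<bullet> g x)" by (rule C1I(1)[OF 1 2])
  show "frechet_derivative (\<lambda>x. f x \<bullet> g x) (at x) v
       = f x \<bullet> frechet_derivative g (at x) v + frechet_derivative f (at x) v \<bullet> g x"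
    by (subst C1I(2)[OF 1 2]) simp
qed

lemma
  fixes f :: "'a::real_normed_vector \<Rightarrow> 'b::real_inner" and W :: "'b \<Rightarrow> real"
  assumes f: "C1 f" and W: "\<And>y. (W has_derivative (\<lambda>h. gW y \<bullet> h)) (at y)" "continuous_on UNIV gW"
  shows C1_compose_grad: "C1 (\<lambda>x. W (f x))"
    and D_compose_grad: "frechet_derivative (\<lambda>x. W (f x)) (at x) v = gW (f x) \<bullet> frechet_derivative f (at x) v"
proof -
  have 1: "((\<lambda>x. W (f x)) has_derivative (\<lambda>v. gW (f x) \<bullet> frechet_derivative f (at x) v)) (at x)" for x
    by (rule has_derivative_compose[OF C1_has_derivative[OF f] W(1)])
  have 2: "continuous_on UNIV (\<lambda>x. gW (f x) \<bullet> frechet_derivative f (at x) v)" for v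
    by (intro continuous_intros continuous_on_compose2[OF W(2) C1_continuous[OF f]] C1_continuous_deriv f) auto
  show "C1 (\<lambda>x. W (f x))" by (rule C1I(1)[OF 1 2])
  show "frechet_derivative (\<lambda>x. W (f x)) (at x) v = gW (f x) \<bullet> frechet_derivative f (at x) v"
    by (subst C1I(2)[OF 1 2]) simp
qed

lemma frechet_derivative_reflect:
  assumes "f differentiable (at (x - y))"
  shows "((\<lambda>y. f (x - y)) has_derivative (\<lambda>v. frechet_derivative f (at (x - y)) (- v))) (at y)"
    "frechet_derivative (\<lambda>y. f (x - y)) (at y) v = frechet_derivative f (at (x - y)) (- v)"
proof -
  have 1: "((\<lambda>y. x - y) has_derivative (\<lambda>v. - v)) (at y)" by (auto intro!: derivative_eq_intros)
  show *: "((\<lambda>y. f (x - y)) has_derivative (\<lambda>v. frechet_derivative f (at (x - y)) (- v))) (at y)"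
    using has_derivative_compose[OF 1 frechet_derivative_works[THEN iffD1, OF assms]] .
  show "frechet_derivative (\<lambda>y. f (x - y)) (at y) v = frechet_derivative f (at (x - y)) (- v)"
    by (subst frechet_derivative_at[OF *, symmetric]) simp
qed

lemma Ck_on_reflect: "Ck_on n UNIV f \<Longrightarrow> Ck_on n UNIV (\<lambda>y. f (x - y))"
proof (induction n arbitrary: f)
  case 0
  then show ?case by (auto intro!: continuous_on_compose2[of UNIV f] continuous_intros)
next
  case (Suc n)
  then have d: "f differentiable (at z)" for z by simp
  show ?case
    unfolding Ck_on.simps frechet_derivative_reflect(2)[OF d]
  proof (intro conjI ballI allI)
    show "(\<lambda>y. f (x - y)) differentiable (at y)" for y
      using frechet_derivative_reflect(1)[OF d] unfolding differentiable_def by blast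
    show "Ck_on n UNIV (\<lambda>y. frechet_derivative f (at (x - y)) (- v))" for v
      using Suc.prems by (intro Suc.IH[of "\<lambda>z. frechet_derivative f (at z) (- v)"]) simp
  qed
qed

text \<open>Inserting the reflected kernel into a weak formulation turns it into a pointwise
  equation for the mollified function at \<open>x\<close>.\<close>

lemma test_function_reflect:
  fixes \<rho> :: "'a::euclidean_space \<Rightarrow> real"
  assumes "smooth_on UNIV \<rho>" "\<And>z. s < norm z \<Longrightarrow> \<rho> z = 0" "cball x s \<subseteq> \<Omega>"
  shows "test_function \<Omega> (\<lambda>y. \<rho> (x - y))"
  unfolding test_function_def
proof (intro conjI)
  show "smooth_on UNIV (\<lambda>y. \<rho> (x - y))" using assms(1) unfolding smooth_on_def by (blast intro: Ck_on_reflect)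
  show "compact_support_in \<Omega> (\<lambda>y. \<rho> (x - y))"
    using assms(2,3) by (intro compact_support_inI[of "cball x s"]) (auto simp: dist_norm)
qed

lemma deriv_minus:
  assumes "f differentiable (at x)"
  shows "frechet_derivative f (at x) (- v) = - frechet_derivative f (at x) v"
  using linear_neg[OF has_derivative_linear[OF frechet_derivative_works[THEN iffD1, OF assms]]] .

text \<open>Strong L2 convergence of both factors gives convergence of the integrated products.
  Young's inequality with a free parameter plays the role of the Cauchy-Schwarz inequality for
  integrals.\<close>

lemma L2_product_limit:
  fixes f g :: "'a \<Rightarrow> 'b::euclidean_space"
  assumes m: "f \<in> borel_measurable M" "g \<in> borel_measurable M" "\<And>n. fn n \<in> borel_measurable M" "\<And>n. gn n \<in> borel_measurable M"
    and f: "integrable M (\<lambda>x. (norm (f x))\<^sup>2)" and g: "integrable M (\<lambda>x. (norm (g x))\<^sup>2)"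
    and df: "\<And>n. integrable M (\<lambda>x. (norm (fn n x - f x))\<^sup>2)" and dg: "\<And>n. integrable M (\<lambda>x. (norm (gn n x - g x))\<^sup>2)"
    and lf: "(\<lambda>n. \<integral>x. (norm (fn n x - f x))\<^sup>2 \<partial>M) \<longlonglongrightarrow> 0" and lg: "(\<lambda>n. \<integral>x. (norm (gn n x - g x))\<^sup>2 \<partial>M) \<longlonglongrightarrow> 0"
    and \<psi>: "\<psi> \<in> borel_measurable M" "\<And>x. \<bar>\<psi> x\<bar> \<le> (B::real)"
  shows "integrable M (\<lambda>x. \<psi> x * (f x \<bullet> g x))" "integrable M (\<lambda>x. \<psi> x * (fn n x \<bullet> gn n x))"
    "(\<lambda>n. \<integral>x. \<psi> x * (fn n x \<bullet> gn n x) \<partial>M) \<longlonglongrightarrow> (\<integral>x. \<psi> x * (f x \<bullet> g x) \<partial>M)"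
proof -
  note [measurable] = m \<psi>(1)
  \<comment> \<open>Any point of the type witnesses that the bound is nonnegative.\<close>
  have B: "0 \<le> B" using \<psi>(2)[of undefined] by linarith
  have young: "\<bar>a \<bullet> b\<bar> \<le> (norm a)\<^sup>2 + (norm b)\<^sup>2" for a b :: 'b
  proof -
    have "\<bar>a \<bullet> b\<bar> \<le> norm a * norm b" by (rule Cauchy_Schwarz_ineq2)
    also have "\<dots> \<le> (norm a)\<^sup>2 + (norm b)\<^sup>2"
      using sum_squares_bound[of "norm a" "norm b"] mult_nonneg_nonneg[OF norm_ge_zero norm_ge_zero, of a b] by linarith
    finally show ?thesis .
  qed
  have young': "\<bar>a \<bullet> b\<bar> \<le> (norm a)\<^sup>2 / \<eta> + \<eta> * (norm b)\<^sup>2" if "0 < \<eta>" for a b :: 'b and \<eta>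
  proof -
    have "\<bar>((1 / sqrt \<eta>) *\<^sub>R a) \<bullet> (sqrt \<eta> *\<^sub>R b)\<bar> \<le> (norm ((1 / sqrt \<eta>) *\<^sub>R a))\<^sup>2 + (norm (sqrt \<eta> *\<^sub>R b))\<^sup>2" by (rule young)
    then show ?thesis using that by (simp add: power_mult_distrib power_divide)
  qed
  show i: "integrable M (\<lambda>x. \<psi> x * (f x \<bullet> g x))"
  proof (rule Bochner_Integration.integrable_bound)
    show "integrable M (\<lambda>x. B * ((norm (f x))\<^sup>2 + (norm (g x))\<^sup>2))" using f g by auto
    show "AE x in M. norm (\<psi> x * (f x \<bullet> g x)) \<le> norm (B * ((norm (f x))\<^sup>2 + (norm (g x))\<^sup>2))"
      using \<psi>(2) young B by (intro AE_I2) (simp add: abs_mult mult_mono)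
  qed measurable
  define err where "err \<eta> n x = B * ((norm (fn n x - f x))\<^sup>2 + (norm (gn n x - g x))\<^sup>2
     + ((norm (fn n x - f x))\<^sup>2 / \<eta> + \<eta> * (norm (g x))\<^sup>2) + ((norm (gn n x - g x))\<^sup>2 / \<eta> + \<eta> * (norm (f x))\<^sup>2))" for \<eta> n x
  have diff: "\<bar>\<psi> x * (fn n x \<bullet> gn n x) - \<psi> x * (f x \<bullet> g x)\<bar> \<le> err \<eta> n x" if "0 < \<eta>" for n x \<eta>
  proof -
    have "fn n x \<bullet> gn n x - f x \<bullet> g x = (fn n x - f x) \<bullet> (gn n x - g x) + (fn n x - f x) \<bullet> g x + (gn n x - g x) \<bullet> f x"
      by (simp add: inner_diff_left inner_diff_right inner_commute)
    then have "\<bar>fn n x \<bullet> gn n x - f x \<bullet> g x\<bar> \<le> \<bar>(fn n x - f x) \<bullet> (gn n x - g x)\<bar> + \<bar>(fn n x - f x) \<bullet> g x\<bar> + \<bar>(gn n x - g x) \<bullet> f x\<bar>"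
      by linarith
    also have "\<dots> \<le> (norm (fn n x - f x))\<^sup>2 + (norm (gn n x - g x))\<^sup>2
     + ((norm (fn n x - f x))\<^sup>2 / \<eta> + \<eta> * (norm (g x))\<^sup>2) + ((norm (gn n x - g x))\<^sup>2 / \<eta> + \<eta> * (norm (f x))\<^sup>2)"
      by (intro add_mono young young' that)
    finally have "\<bar>\<psi> x\<bar> * \<bar>fn n x \<bullet> gn n x - f x \<bullet> g x\<bar> \<le> err \<eta> n x"
      unfolding err_def using \<psi>(2) B by (intro mult_mono) auto
    then show ?thesis by (simp add: abs_mult right_diff_distrib flip: abs_mult)
  qed
  have ierr: "integrable M (err \<eta> n)" for \<eta> n unfolding err_def using f g df dg by auto
  have i2: "integrable M (\<lambda>x. \<psi> x * (fn n x \<bullet> gn n x) - \<psi> x * (f x \<bullet> g x))" for n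
  proof (rule Bochner_Integration.integrable_bound[OF ierr[of 1 n]])
    show "AE x in M. norm (\<psi> x * (fn n x \<bullet> gn n x) - \<psi> x * (f x \<bullet> g x)) \<le> norm (err 1 n x)"
      using diff[of 1] by (intro AE_I2) (metis abs_ge_self order_trans real_norm_def zero_less_one)
  qed measurable
  show i3: "integrable M (\<lambda>x. \<psi> x * (fn n x \<bullet> gn n x))" for n
    using Bochner_Integration.integrable_add[OF i2[of n] i] by simp
  have "(\<lambda>n. (\<integral>x. \<psi> x * (fn n x \<bullet> gn n x) \<partial>M) - (\<integral>x. \<psi> x * (f x \<bullet> g x) \<partial>M)) \<longlonglongrightarrow> 0"
  proof (rule LIMSEQ_I)
    fix e :: real assume e: "0 < e"
    define N where "N = (\<integral>x. (norm (f x))\<^sup>2 \<partial>M) + (\<integral>x. (norm (g x))\<^sup>2 \<partial>M)"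
    have N: "0 \<le> N" unfolding N_def by (intro add_nonneg_nonneg Bochner_Integration.integral_nonneg) auto
    \<comment> \<open>The parameter is fixed first, so that the terms without a vanishing factor
      contribute less than \<open>e\<close>; for this fixed \<open>\<eta>\<close> the other terms
      tend to 0.\<close>
    define \<eta> where "\<eta> = e / (2 * (B * N + 1))"
    have \<eta>: "0 < \<eta>" using e B N by (simp add: \<eta>_def add_nonneg_pos)
    have "B * (\<eta> * N) < e"
    proof -
      have "B * (\<eta> * N) = e * (B * N) / (2 * (B * N + 1))" by (simp add: \<eta>_def)
      also have "\<dots> < e" using e mult_nonneg_nonneg[OF B N] by (simp add: divide_less_eq)
      finally show ?thesis .
    qed
    have ie: "(\<integral>x. err \<eta> n x \<partial>M) = B * ((\<integral>x. (norm (fn n x - f x))\<^sup>2 \<partial>M) + (\<integral>x. (norm (gn n x - g x))\<^sup>2 \<partial>M)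
       + ((\<integral>x. (norm (fn n x - f x))\<^sup>2 \<partial>M) / \<eta> + \<eta> * (\<integral>x. (norm (g x))\<^sup>2 \<partial>M))
       + ((\<integral>x. (norm (gn n x - g x))\<^sup>2 \<partial>M) / \<eta> + \<eta> * (\<integral>x. (norm (f x))\<^sup>2 \<partial>M)))" for n
      unfolding err_def using f g df dg by simp
    have "(\<lambda>n. \<integral>x. err \<eta> n x \<partial>M) \<longlonglongrightarrow> B * (0 + 0 + (0 / \<eta> + \<eta> * (\<integral>x. (norm (g x))\<^sup>2 \<partial>M)) + (0 / \<eta> + \<eta> * (\<integral>x. (norm (f x))\<^sup>2 \<partial>M)))"
      unfolding ie using \<eta> by (intro tendsto_intros lf lg) auto
    also have "B * (0 + 0 + (0 / \<eta> + \<eta> * (\<integral>x. (norm (g x))\<^sup>2 \<partial>M)) + (0 / \<eta> + \<eta> * (\<integral>x. (norm (f x))\<^sup>2 \<partial>M))) = B * (\<eta> * N)"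
      by (simp add: N_def algebra_simps)
    finally have "\<forall>\<^sub>F n in sequentially. (\<integral>x. err \<eta> n x \<partial>M) < e"
      using \<open>B * (\<eta> * N) < e\<close> by (rule order_tendstoD(2))
    then obtain no where no: "\<And>n. no \<le> n \<Longrightarrow> (\<integral>x. err \<eta> n x \<partial>M) < e" by (auto simp: eventually_sequentially)
    show "\<exists>no. \<forall>n\<ge>no. norm ((\<integral>x. \<psi> x * (fn n x \<bullet> gn n x) \<partial>M) - (\<integral>x. \<psi> x * (f x \<bullet> g x) \<partial>M) - 0) < e"
    proof (intro exI[of _ no] allI impI)
      fix n assume n: "no \<le> n"
      have "(\<integral>x. \<psi> x * (fn n x \<bullet> gn n x) \<partial>M) - (\<integral>x. \<psi> x * (f x \<bullet> g x) \<partial>M) = (\<integral>x. \<psi> x * (fn n x \<bullet> gn n x) - \<psi> x * (f x \<bullet> g x) \<partial>M)"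
        by (rule Bochner_Integration.integral_diff[OF i3 i, symmetric])
      also have "norm \<dots> \<le> (\<integral>x. err \<eta> n x \<partial>M)"
      proof -
        have "norm (\<integral>x. \<psi> x * (fn n x \<bullet> gn n x) - \<psi> x * (f x \<bullet> g x) \<partial>M) \<le> (\<integral>x. \<bar>\<psi> x * (fn n x \<bullet> gn n x) - \<psi> x * (f x \<bullet> g x)\<bar> \<partial>M)"
          by (simp only: real_norm_def integral_abs_bound)
        also have "\<dots> \<le> (\<integral>x. err \<eta> n x \<partial>M)"
          by (intro integral_mono Bochner_Integration.integrable_abs i2 ierr diff[OF \<eta>])
        finally show ?thesis .
      qed
      finally show "norm ((\<integral>x. \<psi> x * (fn n x \<bullet> gn n x) \<partial>M) - (\<integral>x. \<psi> x * (f x \<bullet> g x) \<partial>M) - 0) < e"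
        using no[OF n] by simp
    qed
  qed
  then show "(\<lambda>n. \<integral>x. \<psi> x * (fn n x \<bullet> gn n x) \<partial>M) \<longlonglongrightarrow> (\<integral>x. \<psi> x * (f x \<bullet> g x) \<partial>M)" by (rule LIM_zero_cancel)
qed

text \<open>A constant bound for the derivative of the kernel on the whole interval bounds the
  difference quotients by the mean value theorem, so that a multiple of
  \<open>\<bar>w y\<bar>\<close> is an integrable majorant.\<close>

lemma has_real_derivative_integral:
  fixes f f' :: "real \<Rightarrow> 'a \<Rightarrow> real" and w :: "'a \<Rightarrow> real"
  assumes s: "\<alpha> < s" "s < \<beta>"
    and der: "\<And>s y. \<alpha> < s \<Longrightarrow> s < \<beta> \<Longrightarrow> ((\<lambda>s. f s y) has_real_derivative f' s y) (at s)"
    and bd: "\<And>s y. \<alpha> < s \<Longrightarrow> s < \<beta> \<Longrightarrow> \<bar>f' s y\<bar> \<le> B"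
    and w: "integrable M w" and int: "\<And>s. \<alpha> < s \<Longrightarrow> s < \<beta> \<Longrightarrow> integrable M (\<lambda>y. f s y * w y)"
    and m: "(\<lambda>y. f' s y * w y) \<in> borel_measurable M"
  shows "((\<lambda>s. \<integral>y. f s y * w y \<partial>M) has_real_derivative (\<integral>y. f' s y * w y \<partial>M)) (at s)"
proof -
  define e where "e = min (s - \<alpha>) (\<beta> - s)"
  have e: "0 < e" using s by (simp add: e_def)
  have rng: "\<alpha> < s + h" "s + h < \<beta>" if "\<bar>h\<bar> < e" for h using that by (auto simp: e_def)
  have "((\<lambda>h. ((\<integral>y. f (s + h) y * w y \<partial>M) - (\<integral>y. f s y * w y \<partial>M)) / h) \<longlongrightarrow> (\<integral>y. f' s y * w y \<partial>M)) (at 0 within {-e<..<e})"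
    unfolding tendsto_at_iff_sequentially
  proof (intro allI impI)
    fix X :: "nat \<Rightarrow> real" assume X: "\<forall>i. X i \<in> {-e<..<e} - {0}" "X \<longlonglongrightarrow> 0"
    have Xr: "\<bar>X n\<bar> < e" "X n \<noteq> 0" for n using X(1)[rule_format, of n] by (auto simp: abs_less_iff)
    have "(\<lambda>n. \<integral>y. (f (s + X n) y - f s y) / X n * w y \<partial>M) \<longlonglongrightarrow> (\<integral>y. f' s y * w y \<partial>M)"
    proof (rule integral_dominated_convergence[where w = "\<lambda>y. B * \<bar>w y\<bar>"])
      show "integrable M (\<lambda>y. B * \<bar>w y\<bar>)" using w by simp
      have "(\<lambda>y. (f (s + X n) y * w y - f s y * w y) / X n) \<in> borel_measurable M" for n
        using int[OF rng[OF Xr(1)]] int[OF s] by measurable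
      then show "(\<lambda>y. (f (s + X n) y - f s y) / X n * w y) \<in> borel_measurable M" for n
        by (simp add: left_diff_distrib)
      show "AE y in M. (\<lambda>n. (f (s + X n) y - f s y) / X n * w y) \<longlonglongrightarrow> f' s y * w y"
      proof (rule AE_I2)
        fix y
        have "((\<lambda>h. (f (s + h) y - f s y) / h) \<longlongrightarrow> f' s y) (at 0)" using der[OF s, of y] by (simp add: DERIV_def)
        moreover have "filterlim X (at 0) sequentially" using X(2) Xr(2) by (simp add: filterlim_at)
        ultimately have "(\<lambda>n. (f (s + X n) y - f s y) / X n) \<longlonglongrightarrow> f' s y" by (rule filterlim_compose)
        then show "(\<lambda>n. (f (s + X n) y - f s y) / X n * w y) \<longlonglongrightarrow> f' s y * w y" by (intro tendsto_intros)
      qed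
      show "AE y in M. norm ((f (s + X n) y - f s y) / X n * w y) \<le> B * \<bar>w y\<bar>" for n
      proof (rule AE_I2)
        fix y
        have "norm (f (s + X n) y - f s y) \<le> B * norm (s + X n - s)"
        proof (rule field_differentiable_bound[of "{\<alpha><..<\<beta>}" "\<lambda>s. f s y" "\<lambda>s. f' s y"])
          show "((\<lambda>s. f s y) has_field_derivative f' z y) (at z within {\<alpha><..<\<beta>})" if "z \<in> {\<alpha><..<\<beta>}" for z
            using that der by (auto intro: has_field_derivative_at_within)
        qed (use bd rng[OF Xr(1)] s in auto)
        then have "\<bar>(f (s + X n) y - f s y) / X n\<bar> \<le> B" using Xr(2)[of n] by (simp add: divide_le_eq)
        then show "norm ((f (s + X n) y - f s y) / X n * w y) \<le> B * \<bar>w y\<bar>"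
          unfolding real_norm_def abs_mult by (rule mult_right_mono) simp
      qed
    qed (rule m)
    moreover have "(\<integral>y. (f (s + X n) y - f s y) / X n * w y \<partial>M) = ((\<integral>y. f (s + X n) y * w y \<partial>M) - (\<integral>y. f s y * w y \<partial>M)) / X n" for n
    proof -
      have "(\<integral>y. (f (s + X n) y - f s y) / X n * w y \<partial>M) = (\<integral>y. (f (s + X n) y * w y - f s y * w y) / X n \<partial>M)"
        by (simp add: left_diff_distrib)
      then show ?thesis using int[OF rng[OF Xr(1)], of n] int[OF s] by simp
    qed
    ultimately show "((\<lambda>h. ((\<integral>y. f (s + h) y * w y \<partial>M) - (\<integral>y. f s y * w y \<partial>M)) / h) \<circ> X) \<longlonglongrightarrow> (\<integral>y. f' s y * w y \<partial>M)"
      unfolding comp_def by (simp only:)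
  qed
  then show ?thesis using e by (simp add: DERIV_def at_within_open[of 0 "{-e<..<e}"])
qed

section \<open>Radial kernels and their first two derivatives\<close>

definition dflat :: "nat \<Rightarrow> real \<Rightarrow> real" where "dflat a t = flat (a + 2) t - real a * flat (a + 1) t"
definition ddflat :: "nat \<Rightarrow> real \<Rightarrow> real" where "ddflat a t = dflat (a + 2) t - real a * dflat (a + 1) t"

lemma DERIV_flat: "(flat a has_real_derivative dflat a t) (at t)" unfolding dflat_def by (rule flat_deriv)

lemma DERIV_dflat: "(dflat a has_real_derivative ddflat a t) (at t)"
  unfolding ddflat_def dflat_def[of a, abs_def] by (intro DERIV_diff DERIV_cmult DERIV_flat)

lemma dflat_zero: "t \<le> 0 \<Longrightarrow> dflat a t = 0" by (simp add: dflat_def flat_zero)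

text \<open>The relevant arguments 1 - |z|^2/s^2 never exceed 1, and both functions vanish for
  nonpositive arguments, so the compact interval [0, 1] decides.\<close>

lemma dflat_bounded: obtains B where "0 \<le> B" "\<And>t. t \<le> 1 \<Longrightarrow> \<bar>dflat a t\<bar> \<le> B" "\<And>t. t \<le> 1 \<Longrightarrow> \<bar>flat a t\<bar> \<le> B"
proof -
  have c: "continuous_on {0..1} (flat a)" "continuous_on {0..1} (dflat a)"
    using DERIV_flat DERIV_dflat by (auto intro!: continuous_at_imp_continuous_on DERIV_isCont)
  have "compact (flat a ` {0..1})" "compact (dflat a ` {0..1})" by (intro compact_continuous_image c compact_Icc)+
  then have "bounded (flat a ` {0..1})" "bounded (dflat a ` {0..1})" by (auto intro: compact_imp_bounded)
  then obtain B1 B2 where B: "\<forall>y\<in>flat a ` {0..1}. norm y \<le> B1" "\<forall>y\<in>dflat a ` {0..1}. norm y \<le> B2" unfolding bounded_iff by blast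
  have "\<bar>dflat a t\<bar> \<le> \<bar>B1\<bar> + \<bar>B2\<bar>" "\<bar>flat a t\<bar> \<le> \<bar>B1\<bar> + \<bar>B2\<bar>" if "t \<le> 1" for t
  proof -
    have "\<bar>dflat a t\<bar> \<le> \<bar>B2\<bar>" "\<bar>flat a t\<bar> \<le> \<bar>B1\<bar>"
      using B that by (cases "0 \<le> t"; force simp: dflat_zero flat_zero)+
    then show "\<bar>dflat a t\<bar> \<le> \<bar>B1\<bar> + \<bar>B2\<bar>" "\<bar>flat a t\<bar> \<le> \<bar>B1\<bar> + \<bar>B2\<bar>" by linarith+
  qed
  then show ?thesis by (intro that[of "\<bar>B1\<bar> + \<bar>B2\<bar>"]) auto
qed

lemma has_derivative_quad: "((\<lambda>z::'a::real_inner. 1 - (z \<bullet> z) * k) has_derivative (\<lambda>v. - 2 * k * (z \<bullet> v))) (at z)"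
  by (auto intro!: derivative_eq_intros simp: inner_commute algebra_simps)

lemma D_radial:
  fixes z :: "'a::real_inner"
  shows "frechet_derivative (\<lambda>z. flat a (1 - (z \<bullet> z) * k) * m) (at z) v = dflat a (1 - (z \<bullet> z) * k) * (- 2 * k * (z \<bullet> v)) * m"
proof -
  have "((\<lambda>z. flat a (1 - (z \<bullet> z) * k) * m) has_derivative (\<lambda>v. dflat a (1 - (z \<bullet> z) * k) * (- 2 * k * (z \<bullet> v)) * m)) (at z)"
    by (intro has_derivative_mult_left has_derivative_compose[OF has_derivative_quad DERIV_flat[unfolded has_field_derivative_def]])
  then show ?thesis by (rule fun_cong[OF frechet_derivative_at, symmetric])
qed

text \<open>The explicit formula serves twice: its symmetry in \<open>v\<close> and \<open>w\<close>
  yields equality of mixed derivatives, and its trace yields the Laplacian.\<close>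

lemma D2_radial:
  fixes z :: "'a::real_inner"
  shows "frechet_derivative (\<lambda>z. frechet_derivative (\<lambda>z. flat a (1 - (z \<bullet> z) * k) * m) (at z) v) (at z) w
    = (dflat a (1 - (z \<bullet> z) * k) * (- 2 * k * (w \<bullet> v)) + (ddflat a (1 - (z \<bullet> z) * k) * (- 2 * k * (z \<bullet> w))) * (- 2 * k * (z \<bullet> v))) * m"
proof -
  have 1: "((\<lambda>z. - 2 * k * (z \<bullet> v)) has_derivative (\<lambda>w. - 2 * k * (w \<bullet> v))) (at z)"
    by (auto intro!: derivative_eq_intros)
  have 2: "((\<lambda>z. dflat a (1 - (z \<bullet> z) * k)) has_derivative (\<lambda>w. ddflat a (1 - (z \<bullet> z) * k) * (- 2 * k * (z \<bullet> w)))) (at z)"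
    by (rule has_derivative_compose[OF has_derivative_quad DERIV_dflat[unfolded has_field_derivative_def]])
  have "((\<lambda>z. dflat a (1 - (z \<bullet> z) * k) * (- 2 * k * (z \<bullet> v)) * m) has_derivative
    (\<lambda>w. (dflat a (1 - (z \<bullet> z) * k) * (- 2 * k * (w \<bullet> v)) + (ddflat a (1 - (z \<bullet> z) * k) * (- 2 * k * (z \<bullet> w))) * (- 2 * k * (z \<bullet> v))) * m)) (at z)"
    by (intro has_derivative_mult_left has_derivative_mult 1 2)
  then show ?thesis unfolding D_radial by (rule fun_cong[OF frechet_derivative_at, symmetric])
qed

lemma smooth_radial: "smooth_on UNIV (\<lambda>z::'a::euclidean_space. flat a (1 - (z \<bullet> z) * k) * m)"
  using smooth_bump[of a "0::'a" k m] by simp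

lemma radial_zero:
  fixes z :: "'a::real_inner"
  assumes "0 < s" "s \<le> norm z" shows "1 - (z \<bullet> z) * (1 / s\<^sup>2) \<le> 0"
proof -
  have "s\<^sup>2 \<le> z \<bullet> z" using assms by (simp add: power_mono flip: power2_norm_eq_inner)
  then show ?thesis using assms by (simp add: field_simps)
qed

text \<open>The total mass of the unnormalised bump; the type argument carries the
  dimension.\<close>

definition kmass :: "'a::euclidean_space itself \<Rightarrow> real \<Rightarrow> real" where
  "kmass _ s = (\<integral>z. flat 2 (1 - (z \<bullet> z) * (1 / s\<^sup>2)) \<partial>(lborel :: 'a measure))"

text \<open>The profile is \<open>flat 2\<close>, the derivative of \<open>flat 0\<close>, because
  the averages in the mean value argument come from the Laplacian of a bump with profile
  \<open>flat 0\<close>. The same kernel then serves for mollification.\<close>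

definition kern :: "real \<Rightarrow> 'a::euclidean_space \<Rightarrow> real" where
  "kern s z = flat 2 (1 - (z \<bullet> z) * (1 / s\<^sup>2)) * (1 / kmass TYPE('a) s)"

lemma integrable_radial: "0 < s \<Longrightarrow> integrable lborel (\<lambda>z::'a::euclidean_space. flat a (1 - (z \<bullet> z) * (1 / s\<^sup>2)))"
proof (rule integrable_C1c[where \<Omega> = UNIV])
  assume s: "0 < s"
  show "continuous_on UNIV (\<lambda>z::'a. flat a (1 - (z \<bullet> z) * (1 / s\<^sup>2)))"
    by (intro continuous_on_compose2[OF flat_continuous] continuous_intros) auto
  show "compact_support_in UNIV (\<lambda>z::'a. flat a (1 - (z \<bullet> z) * (1 / s\<^sup>2)))"
  proof (rule compact_support_inI[of "cball 0 s"])
    fix z :: 'a assume "z \<notin> cball 0 s"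
    then have "s \<le> norm z" by simp
    then show "flat a (1 - (z \<bullet> z) * (1 / s\<^sup>2)) = 0" by (intro flat_zero radial_zero s)
  qed auto
qed

lemma radial_ge_one_sub: "0 \<le> (z::'a::real_inner) \<bullet> z * (1 / s\<^sup>2)" by simp

lemma flat_2_lower: "3/4 \<le> t \<Longrightarrow> t \<le> 1 \<Longrightarrow> exp (- 4/3) \<le> flat 2 t"
proof -
  assume t: "3/4 \<le> t" "t \<le> 1"
  have z: "1 \<le> inverse t" "inverse t \<le> 4/3" using t le_imp_inverse_le[of "3/4" t] by (auto simp: one_le_inverse_iff)
  have "1 * exp (- 4/3) \<le> inverse t ^ 2 * exp (- inverse t)"
    using z by (intro mult_mono one_le_power) auto
  then show ?thesis using t by (simp add: flat_def)
qed

text \<open>On the ball of radius \<open>s / 2\<close> the argument of \<open>flat 2\<close> lies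
  between 3/4 and 1, where \<open>flat 2\<close> is at least exp(-4/3); the volume of that ball
  supplies the power of \<open>s\<close>.\<close>

lemma kmass_lower: "\<exists>c>0. \<forall>s>0. c * s ^ DIM('a) \<le> kmass TYPE('a::euclidean_space) s"
proof -
  define c where "c = exp (- 4/3) * ((1/2) ^ DIM('a) * measure lborel (ball (0::'a) 1))"
  have "0 < measure lborel (ball (0::'a) 1)" by (rule content_ball_pos) simp
  then have c: "0 < c" unfolding c_def by (intro mult_pos_pos) auto
  have "c * s ^ DIM('a) \<le> kmass TYPE('a) s" if s: "0 < s" for s
  proof -
    have "c * s ^ DIM('a) = exp (- 4/3) * measure lborel (ball (0::'a) (s/2))"
      using s by (simp add: c_def content_ball_conv_unit_ball[of "s/2"] power_divide)
    also have "\<dots> = (\<integral>z. exp (- 4/3) * indicator (ball (0::'a) (s/2)) z \<partial>lborel)" by simp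
    also have "\<dots> \<le> kmass TYPE('a) s"
      unfolding kmass_def
    proof (rule integral_mono[OF _ integrable_radial[OF s]])
      show "integrable lborel (\<lambda>z. exp (- 4/3) * indicator (ball (0::'a) (s/2)) z :: real)"
        using emeasure_lborel_ball_finite[of "0::'a" "s/2"] by (simp add: less_top)
      fix z :: 'a
      show "exp (- 4/3) * indicator (ball (0::'a) (s/2)) z \<le> flat 2 (1 - (z \<bullet> z) * (1 / s\<^sup>2))"
      proof (cases "z \<in> ball 0 (s/2)")
        case True
        then have "norm z < s / 2" by simp
        then have "z \<bullet> z < (s/2)\<^sup>2" by (simp only: norm_lt_square)
        then have "z \<bullet> z * (1 / s\<^sup>2) \<le> 1/4" using s by (simp add: field_simps power2_eq_square)
        then have "exp (- 4/3) \<le> flat 2 (1 - (z \<bullet> z) * (1 / s\<^sup>2))"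
          using radial_ge_one_sub[of z s] by (intro flat_2_lower) linarith+
        then show ?thesis using True by (simp only: indicator_simps mult_1_right)
      qed (simp add: flat_nonneg)
    qed
    finally show ?thesis .
  qed
  then show ?thesis using c by blast
qed

lemma kmass_pos: "0 < s \<Longrightarrow> 0 < kmass TYPE('a::euclidean_space) s"
proof -
  assume s: "0 < s"
  obtain c where c: "c > 0" "\<And>s. s > 0 \<Longrightarrow> c * s ^ DIM('a) \<le> kmass TYPE('a) s" using kmass_lower[where 'a = 'a] by blast
  have "0 < c * s ^ DIM('a)" using c(1) s by simp
  then show ?thesis using c(2)[OF s] by linarith
qed

lemma smooth_kern: "smooth_on UNIV (kern s :: 'a::euclidean_space \<Rightarrow> real)"
  unfolding kern_def[abs_def] by (rule smooth_radial)

lemma kern_zero: "0 < s \<Longrightarrow> s \<le> norm z \<Longrightarrow> kern s z = 0"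
  unfolding kern_def using radial_zero[of s z] flat_zero by simp

lemma mollifier_kern: "0 < s \<Longrightarrow> mollifier (kern s :: 'a::euclidean_space \<Rightarrow> real) s"
  unfolding mollifier_def
proof (intro conjI allI impI)
  assume s: "0 < s"
  show "continuous_on UNIV (kern s :: 'a \<Rightarrow> real)" by (intro C1_continuous smooth_C1 smooth_kern)
  show "0 \<le> kern s (z::'a)" for z unfolding kern_def using kmass_pos[OF s, where 'a='a] flat_nonneg by simp
  show "kern s z = 0" if "s < norm z" for z :: 'a using that by (intro kern_zero s) simp
  show "(\<integral>z. kern s (z::'a) \<partial>lborel) = 1"
    using kmass_pos[OF s, where 'a='a] unfolding kern_def by (simp add: kmass_def)
qed

text \<open>Since derivatives of a convolution fall on the kernel, this gives equality of the mixed
  second derivatives of every mollified function.\<close>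

lemma D2_kern_sym:
  "frechet_derivative (\<lambda>z. frechet_derivative (kern s) (at z) v) (at z) w
    = frechet_derivative (\<lambda>z. frechet_derivative (kern s) (at z) w) (at z) (v::'a::euclidean_space)"
  unfolding kern_def[abs_def] D2_radial by (simp add: inner_commute algebra_simps)

text \<open>A smooth convex substitute for the norm. Its gradient has length at most 1, so it can be
  paired with a merely integrable right-hand side.\<close>

definition Phi :: "'b::real_inner \<Rightarrow> real" where "Phi y = sqrt (1 + y \<bullet> y)"

lemma Phi: "1 \<le> Phi y" "norm y \<le> Phi y" "(Phi y)\<^sup>2 = 1 + y \<bullet> y"
proof -
  show 1: "1 \<le> Phi y" unfolding Phi_def by simp
  show 3: "(Phi y)\<^sup>2 = 1 + y \<bullet> y" unfolding Phi_def by (simp add: add_nonneg_nonneg)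
  have "(norm y)\<^sup>2 \<le> (Phi y)\<^sup>2" unfolding 3 by (simp add: power2_norm_eq_inner)
  then show "norm y \<le> Phi y" using 1 by (simp add: power2_le_iff_abs_le abs_le_iff)
qed

text \<open>\<open>Phi y\<close> is the norm of the pair \<open>(1, y)\<close>, so this is the
  reverse triangle inequality.\<close>

lemma Phi_lipschitz: "\<bar>Phi a - Phi b\<bar> \<le> norm (a - b)"
proof -
  have "Phi y = norm (1::real, y)" for y :: 'a by (simp add: Phi_def norm_Pair power2_norm_eq_inner)
  then have "\<bar>Phi a - Phi b\<bar> \<le> norm ((1::real, a) - (1, b))" using norm_triangle_ineq3[of "(1::real, a)" "(1, b)"] by (simp only:)
  then show ?thesis by (simp add: norm_Pair)
qed

lemma Phi_pos: "0 < Phi y" using Phi(1)[of y] by linarith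

lemma Phi_continuous: "continuous_on S Phi"
  unfolding Phi_def by (intro continuous_intros)

lemma Phi_derivative: "(Phi has_derivative (\<lambda>h. ((1 / Phi y) *\<^sub>R y) \<bullet> h)) (at y)"
proof -
  have 1: "((\<lambda>y. 1 + y \<bullet> y) has_derivative (\<lambda>h. 2 * (y \<bullet> h))) (at y)"
    by (auto intro!: derivative_eq_intros simp: inner_commute)
  have 2: "(sqrt has_derivative (*) (inverse (sqrt (1 + y \<bullet> y)) / 2)) (at (1 + y \<bullet> y))"
    using DERIV_real_sqrt[of "1 + y \<bullet> y"] by (simp add: has_field_derivative_def add_pos_nonneg)
  show ?thesis
    unfolding Phi_def[abs_def]
  proof (rule has_derivative_eq_rhs[OF has_derivative_compose[OF 1 2]])
    show "(\<lambda>h. inverse (sqrt (1 + y \<bullet> y)) / 2 * (2 * (y \<bullet> h))) = (\<lambda>h. ((1 / sqrt (1 + y \<bullet> y)) *\<^sub>R y) \<bullet> h)"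
      by (simp add: inverse_eq_divide)
  qed
qed

lemma invPhi_derivative: "((\<lambda>y. 1 / Phi y) has_derivative (\<lambda>h. ((- 1 / Phi y ^ 3) *\<^sub>R y) \<bullet> h)) (at y)"
proof -
  have "((\<lambda>t. 1 / t) has_derivative (*) (- 1 / (Phi y)\<^sup>2)) (at (Phi y))"
    using Phi_pos[of y] unfolding has_field_derivative_def[symmetric]
    by (auto intro!: derivative_eq_intros simp: field_simps power2_eq_square)
  from has_derivative_compose[OF Phi_derivative this] show ?thesis
    by (rule has_derivative_eq_rhs) (simp add: power2_eq_square power3_eq_cube)
qed

lemma conv_C1:
  fixes f :: "'a::euclidean_space \<Rightarrow> 'b::euclidean_space"
  assumes f: "integrable lborel f" and \<rho>: "smooth_on UNIV \<rho>" "compact_support_in UNIV \<rho>"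
  shows "C1 (conv \<rho> f)" "frechet_derivative (conv \<rho> f) (at x) v = conv (\<lambda>z. frechet_derivative \<rho> (at z) v) f x"
proof -
  have c: "C1c UNIV \<rho>" using \<rho> smooth_C1 unfolding C1c_def by blast
  have 2: "continuous_on UNIV (\<lambda>x. conv (\<lambda>z. frechet_derivative \<rho> (at z) v) f x)" for v
    by (rule conv_continuous[OF f C1c_deriv[OF c]])
  show "C1 (conv \<rho> f)" by (rule C1I(1)[OF conv_has_derivative[OF f c] 2])
  show "frechet_derivative (conv \<rho> f) (at x) v = conv (\<lambda>z. frechet_derivative \<rho> (at z) v) f x"
    by (subst C1I(2)[OF conv_has_derivative[OF f c] 2]) simp
qed

lemma support_deriv:
  assumes "\<And>z. s \<le> norm z \<Longrightarrow> \<rho> z = 0" "s < norm z"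
  shows "frechet_derivative (\<rho> :: 'a::euclidean_space \<Rightarrow> real) (at z) v = 0"
proof (rule deriv_zero_outside[of "cball 0 s"])
  fix x :: 'a assume "x \<notin> cball 0 s" then have "s \<le> norm x" by simp
  then show "\<rho> x = 0" by (rule assms(1))
qed (use assms in auto)

text \<open>Mollification at points of \<open>K\<close> with radius at most \<open>r\<close> sees
  only values on the larger compact set \<open>K'\<close>, where local integrability
  applies.\<close>

lemma compact_neighbourhood:
  fixes K :: "'a::euclidean_space set"
  assumes "compact K" "K \<subseteq> \<Omega>" "open \<Omega>"
  obtains r K' where "0 < r" "compact K'" "K' \<subseteq> \<Omega>" "\<And>x s. x \<in> K \<Longrightarrow> s \<le> r \<Longrightarrow> cball x s \<subseteq> K'" "K \<subseteq> K'"
proof -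
  obtain r where r: "0 < r" "(\<Union>x\<in>K. cball x r) \<subseteq> \<Omega>"
    using compact_subset_open_imp_cball_epsilon_subset[OF assms(1,3,2)] by blast
  define K' where "K' = {x + y | x y. x \<in> K \<and> y \<in> cball 0 r}"
  have eq: "K' = (\<Union>x\<in>K. cball x r)"
  proof
    show "K' \<subseteq> (\<Union>x\<in>K. cball x r)" by (auto simp: K'_def dist_norm)
    show "(\<Union>x\<in>K. cball x r) \<subseteq> K'"
    proof
      fix z assume "z \<in> (\<Union>x\<in>K. cball x r)"
      then obtain x where "x \<in> K" "norm (z - x) \<le> r" by (auto simp: dist_norm norm_minus_commute)
      then show "z \<in> K'" unfolding K'_def by (intro CollectI exI[of _ x] exI[of _ "z - x"]) auto
    qed
  qed
  show ?thesis
  proof (rule that[OF r(1)])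
    show "compact K'" unfolding K'_def by (intro compact_sums assms(1) compact_cball)
    show "K' \<subseteq> \<Omega>" using r(2) eq by simp
    show "cball x s \<subseteq> K'" if "x \<in> K" "s \<le> r" for x s
      unfolding eq using that subset_cball[OF that(2), of x] by blast
    show "K \<subseteq> K'" unfolding eq using r(1) by (force simp: less_imp_le)
  qed
qed

subsection \<open>Kato's inequality, local boundedness and the stress identity\<close>

text \<open>The setting for mollification: Borel functions on the whole plane, with all integrals
  over the plane, and the equation tested only inside \<open>\<Omega>\<close>. \<open>W\<close>
  stands for the potential divided by the squared parameter. About \<open>gW (u x)\<close> only
  local integrability is known at this stage, so any bound on \<open>u\<close> has to be
  derived.\<close>

locale weak_sol =
  fixes \<Omega> :: "(real^2) set" and u :: "real^2 \<Rightarrow> 'b::euclidean_space" and Gr :: "real^2 \<Rightarrow> real^2 \<Rightarrow> 'b"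
    and W :: "'b \<Rightarrow> real" and gW :: "'b \<Rightarrow> 'b" and R0 :: real
  assumes open_dom: "open \<Omega>"
    and u_int: "integrable lborel u" and u_L2: "integrable lborel (\<lambda>x. (norm (u x))\<^sup>2)"
    and Gr_int: "\<And>b. b \<in> Basis \<Longrightarrow> integrable lborel (Gr b)"
    and Gr_L2: "\<And>b. b \<in> Basis \<Longrightarrow> integrable lborel (\<lambda>x. (norm (Gr b x))\<^sup>2)"
    and W_deriv: "\<And>y. (W has_derivative (\<lambda>h. gW y \<bullet> h)) (at y)"
    and gW_cont: "continuous_on UNIV gW"
    and gW_int: "\<And>K. compact K \<Longrightarrow> K \<subseteq> \<Omega> \<Longrightarrow> integrable lborel (\<lambda>x. indicator K x *\<^sub>R gW (u x))"
    and weak1: "\<And>\<phi> b. test_function \<Omega> \<phi> \<Longrightarrow> b \<in> Basis \<Longrightarrow>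
       (\<integral>x. frechet_derivative \<phi> (at x) b *\<^sub>R u x \<partial>lborel) = - (\<integral>x. \<phi> x *\<^sub>R Gr b x \<partial>lborel)"
    and weak2: "\<And>\<phi>. test_function \<Omega> \<phi> \<Longrightarrow>
       (\<integral>x. (\<Sum>b\<in>Basis. frechet_derivative \<phi> (at x) b *\<^sub>R Gr b x) \<partial>lborel) = - (\<integral>x. \<phi> x *\<^sub>R gW (u x) \<partial>lborel)"
    and coercive: "\<And>y. R0 < norm y \<Longrightarrow> 0 \<le> y \<bullet> gW y"
begin

lemma u_meas[measurable]: "u \<in> borel_measurable borel" using u_int by auto
lemma gW_meas[measurable]: "gW \<in> borel_measurable borel" by (rule borel_measurable_continuous_onI[OF gW_cont])

lemma conv_weak1:
  assumes \<rho>: "smooth_on UNIV \<rho>" "\<And>z. s < norm z \<Longrightarrow> \<rho> z = 0" and x: "cball x s \<subseteq> \<Omega>" and b: "b \<in> Basis"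
  shows "conv (\<lambda>z. frechet_derivative \<rho> (at z) b) u x = conv \<rho> (Gr b) x"
proof -
  have dif: "\<rho> differentiable (at z)" for z using smooth_C1[OF \<rho>(1)] by (simp add: C1_def)
  have t: "test_function \<Omega> (\<lambda>y. \<rho> (x - y))" by (rule test_function_reflect[OF \<rho> x])
  have "(\<integral>y. - (frechet_derivative \<rho> (at (x - y)) b *\<^sub>R u y) \<partial>lborel) = - (\<integral>y. \<rho> (x - y) *\<^sub>R Gr b y \<partial>lborel)"
    using weak1[OF t b] by (simp add: frechet_derivative_reflect(2)[OF dif] deriv_minus[OF dif])
  then show ?thesis unfolding conv_def by simp
qed

text \<open>\<open>gW (u y)\<close> is integrable only over compact sets. The cut-off by
  \<open>K\<close> makes the convolution meaningful and changes nothing at \<open>x\<close>, as the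
  kernel there sees only points of \<open>K\<close>.\<close>

lemma conv_weak2:
  assumes \<rho>: "smooth_on UNIV \<rho>" "\<And>z. s < norm z \<Longrightarrow> \<rho> z = 0" and x: "cball x s \<subseteq> K" and K: "K \<subseteq> \<Omega>"
  shows "(\<Sum>b\<in>Basis. conv (\<lambda>z. frechet_derivative \<rho> (at z) b) (Gr b) x) = conv \<rho> (\<lambda>y. indicator K y *\<^sub>R gW (u y)) x"
proof -
  have dif: "\<rho> differentiable (at z)" for z using smooth_C1[OF \<rho>(1)] by (simp add: C1_def)
  have cs: "compact_support_in UNIV \<rho>" using \<rho>(2) by (intro compact_support_inI[of "cball 0 s"]) auto
  have c: "C1c UNIV \<rho>" unfolding C1c_def using smooth_C1[OF \<rho>(1)] cs by simp
  have t: "test_function \<Omega> (\<lambda>y. \<rho> (x - y))" by (rule test_function_reflect[OF \<rho>]) (use x K in auto)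
  have "(\<integral>y. - (\<Sum>b\<in>Basis. frechet_derivative \<rho> (at (x - y)) b *\<^sub>R Gr b y) \<partial>lborel) = - (\<integral>y. \<rho> (x - y) *\<^sub>R gW (u y) \<partial>lborel)"
    using weak2[OF t] by (simp add: frechet_derivative_reflect(2)[OF dif] deriv_minus[OF dif] sum_negf)
  then have "(\<integral>y. (\<Sum>b\<in>Basis. frechet_derivative \<rho> (at (x - y)) b *\<^sub>R Gr b y) \<partial>lborel) = (\<integral>y. \<rho> (x - y) *\<^sub>R gW (u y) \<partial>lborel)" by simp
  also have "(\<integral>y. (\<Sum>b\<in>Basis. frechet_derivative \<rho> (at (x - y)) b *\<^sub>R Gr b y) \<partial>lborel) =
     (\<Sum>b\<in>Basis. (\<integral>y. frechet_derivative \<rho> (at (x - y)) b *\<^sub>R Gr b y \<partial>lborel))"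
    by (intro Bochner_Integration.integral_sum integrable_conv[OF Gr_int C1c_deriv[OF c]])
  also have "(\<integral>y. \<rho> (x - y) *\<^sub>R gW (u y) \<partial>lborel) = (\<integral>y. \<rho> (x - y) *\<^sub>R indicator K y *\<^sub>R gW (u y) \<partial>lborel)"
  proof (intro Bochner_Integration.integral_cong refl)
    fix y
    show "\<rho> (x - y) *\<^sub>R gW (u y) = \<rho> (x - y) *\<^sub>R indicator K y *\<^sub>R gW (u y)"
      using \<rho>(2)[of "x - y"] x by (cases "norm (x - y) \<le> s") (auto simp: dist_norm indicator_def)
  qed
  finally show ?thesis unfolding conv_def .
qed

text \<open>Coercivity settles large \<open>y\<close>. On the ball of radius \<open>R0\<close>
  compactness bounds \<open>gW\<close>, and the vector paired with it has length at most 1.\<close>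

lemma n_gW_lower: obtains c where "0 \<le> c" "\<And>y. - c \<le> ((1 / Phi y) *\<^sub>R y) \<bullet> gW y"
proof -
  have "compact ((\<lambda>y. norm (gW y)) ` cball 0 R0)"
    by (intro compact_continuous_image compact_cball continuous_on_norm continuous_on_subset[OF gW_cont]) auto
  then have "bounded ((\<lambda>y. norm (gW y)) ` cball 0 R0)" by (rule compact_imp_bounded)
  then obtain c where "\<forall>v\<in>(\<lambda>y. norm (gW y)) ` cball 0 R0. norm v \<le> c" unfolding bounded_iff by blast
  then have c: "norm (gW y) \<le> c" if "norm y \<le> R0" for y using that by simp
  show ?thesis
  proof (rule that[of "\<bar>c\<bar>"])
    fix y
    show "- \<bar>c\<bar> \<le> ((1 / Phi y) *\<^sub>R y) \<bullet> gW y"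
    proof (cases "norm y \<le> R0")
      case True
      have "norm ((1 / Phi y) *\<^sub>R y) \<le> 1" using Phi(2)[of y] Phi_pos[of y] by (simp add: divide_le_eq)
      then have "norm ((1 / Phi y) *\<^sub>R y) * norm (gW y) \<le> 1 * \<bar>c\<bar>" using c[OF True] by (intro mult_mono) auto
      then show ?thesis using Cauchy_Schwarz_ineq2[of "(1 / Phi y) *\<^sub>R y" "gW y"] by linarith
    next
      case False
      then have "0 \<le> (1 / Phi y) * (y \<bullet> gW y)" using coercive[of y] Phi_pos[of y] by (intro mult_nonneg_nonneg) auto
      then show ?thesis by simp
    qed
  qed simp
qed

end

section \<open>Integration by parts and almost everywhere limits of mollifications\<close>

lemma integral_by_parts:
  fixes f \<phi> :: "'a::euclidean_space \<Rightarrow> real"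
  assumes \<phi>: "C1c \<Omega> \<phi>" and f: "C1 f"
  shows "(\<integral>x. frechet_derivative \<phi> (at x) v * f x \<partial>lborel) = - (\<integral>x. \<phi> x * frechet_derivative f (at x) v \<partial>lborel)"
    "integrable lborel (\<lambda>x. frechet_derivative \<phi> (at x) v * f x)" "integrable lborel (\<lambda>x. \<phi> x * frechet_derivative f (at x) v)"
proof -
  have C1\<phi>: "C1 \<phi>" and cs: "compact_support_in \<Omega> \<phi>" using \<phi> by (auto simp: C1c_def)
  obtain K where K: "compact K" "K \<subseteq> \<Omega>" "\<And>x. x \<notin> K \<Longrightarrow> \<phi> x = 0" using cs unfolding compact_support_in_def by blast
  have DK: "frechet_derivative \<phi> (at x) v = 0" if "x \<notin> K" for x
    using deriv_zero_outside[OF compact_imp_closed[OF K(1)] K(3) that] .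
  have c: "C1c \<Omega> (\<lambda>x. \<phi> x * f x)" unfolding C1c_def
    using K by (intro conjI C1_mult C1\<phi> f compact_support_inI[of K]) auto
  show i1: "integrable lborel (\<lambda>x. frechet_derivative \<phi> (at x) v * f x)"
    by (rule integrable_C1c[of _ \<Omega>], intro continuous_on_mult C1_continuous_deriv[OF C1\<phi>] C1_continuous[OF f],
        intro compact_support_inI[OF K(1,2)]) (simp add: DK)
  show i2: "integrable lborel (\<lambda>x. \<phi> x * frechet_derivative f (at x) v)"
    by (rule integrable_C1c[of _ \<Omega>], intro continuous_on_mult C1_continuous_deriv[OF f] C1_continuous[OF C1\<phi>],
        intro compact_support_inI[OF K(1,2)]) (simp add: K(3))
  have "0 = (\<integral>x. \<phi> x * frechet_derivative f (at x) v + frechet_derivative \<phi> (at x) v * f x \<partial>lborel)"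
    using integral_deriv_zero[OF c, of v] by (simp add: D_mult[OF C1\<phi> f])
  also have "\<dots> = (\<integral>x. \<phi> x * frechet_derivative f (at x) v \<partial>lborel) + (\<integral>x. frechet_derivative \<phi> (at x) v * f x \<partial>lborel)"
    by (rule Bochner_Integration.integral_add[OF i2 i1])
  finally show "(\<integral>x. frechet_derivative \<phi> (at x) v * f x \<partial>lborel) = - (\<integral>x. \<phi> x * frechet_derivative f (at x) v \<partial>lborel)" by simp
qed

lemma mollifier_AE_subseq:
  fixes f :: "'a::euclidean_space \<Rightarrow> 'b::euclidean_space"
  assumes m: "\<And>n. mollifier (\<rho> n) (\<delta> n)" and \<delta>: "\<delta> \<longlonglongrightarrow> 0" and f: "integrable lborel f"
  obtains r :: "nat \<Rightarrow> nat" where "strict_mono r" "AE x in lborel. (\<lambda>n. conv (\<rho> (r n)) f x) \<longlonglongrightarrow> f x"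
proof -
  have cs: "continuous_on UNIV (\<rho> n)" "compact_support_in UNIV (\<rho> n)" for n
    using m[of n] mollifier_compact[OF m[of n]] by (auto simp: mollifier_def)
  have fp: "integrable lborel (\<lambda>x. norm (f x) ^ 1)" using f by simp
  have cm: "conv (\<rho> n) f \<in> borel_measurable borel" for n
    by (intro borel_measurable_continuous_onI conv_continuous[OF f cs])
  have mc: "integrable lborel (\<lambda>x. norm (conv (\<rho> n) f x - f x))" "(\<lambda>n. \<integral>x. norm (conv (\<rho> n) f x - f x) \<partial>lborel) \<longlonglongrightarrow> 0" for n
    using mollifier_conv(1)[OF m \<delta> f fp, of n] mollifier_conv(2)[OF m \<delta> f fp] by simp_all
  have i: "integrable lborel (\<lambda>x. conv (\<rho> n) f x - f x)" for n
    using mc(1)[of n] cm f by (subst (asm) integrable_norm_iff) auto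
  obtain r where r: "strict_mono r" "AE x in lborel. (\<lambda>n. conv (\<rho> (r n)) f x - f x) \<longlonglongrightarrow> 0"
    using tendsto_L1_AE_subseq[OF i mc(2)] by blast
  show ?thesis
  proof (rule that[OF r(1)])
    show "AE x in lborel. (\<lambda>n. conv (\<rho> (r n)) f x) \<longlonglongrightarrow> f x"
      using r(2) by eventually_elim (rule LIM_zero_cancel)
  qed
qed

lemma conv_bound_AE:
  fixes f :: "'a::euclidean_space \<Rightarrow> 'b::euclidean_space"
  assumes m: "mollifier \<rho> \<delta>" and f: "integrable lborel f"
    and b: "AE y in lborel. norm (x - y) \<le> \<delta> \<longrightarrow> norm (f y) \<le> B"
  shows "norm (conv \<rho> f x) \<le> B"
proof -
  have cs: "continuous_on UNIV \<rho>" "compact_support_in UNIV \<rho>" using m mollifier_compact by (auto simp: mollifier_def)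
  have nn: "0 \<le> \<rho> z" for z using m by (auto simp: mollifier_def)
  have "norm (conv \<rho> f x) \<le> (\<integral>y. norm (\<rho> (x - y) *\<^sub>R f y) \<partial>lborel)" unfolding conv_def by (rule integral_norm_bound)
  also have "\<dots> \<le> (\<integral>y. \<rho> (x - y) * B \<partial>lborel)"
  proof (rule integral_mono_AE)
    show "integrable lborel (\<lambda>y. norm (\<rho> (x - y) *\<^sub>R f y))" by (rule integrable_norm[OF integrable_conv[OF f cs]])
    show "integrable lborel (\<lambda>y. \<rho> (x - y) * B)" using integral_mollifier_shift(1)[OF m] by simp
    show "AE y in lborel. norm (\<rho> (x - y) *\<^sub>R f y) \<le> \<rho> (x - y) * B"
      using b
    proof eventually_elim
      case (elim y)
      show ?case
      proof (cases "norm (x - y) \<le> \<delta>")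
        case True then show ?thesis using elim nn by (simp add: mult_left_mono)
      next
        case False then show ?thesis using m by (simp add: mollifier_def)
      qed
    qed
  qed
  also have "\<dots> = B" using integral_mollifier_shift(2)[OF m] by simp
  finally show ?thesis .
qed

lemma Phi_ne: "Phi y \<noteq> 0" using Phi_pos[of y] by simp

context weak_sol
begin

text \<open>Kato's inequality: \<open>\<Delta> \<Phi>(u) \<ge> -c\<close> in the sense of distributions for the convex function
  \<open>\<Phi>(y) = (1 + |y|\<^sup>2)\<^sup>1\<^sup>/\<^sup>2\<close>, which needs no bound on \<open>\<nabla>W(u)\<close> beyond local integrability.\<close>

lemma kato:
  assumes c: "0 \<le> c" "\<And>y. - c \<le> ((1 / Phi y) *\<^sub>R y) \<bullet> gW y"
    and \<tau>: "smooth_on UNIV \<tau>" "compact_support_in \<Omega> \<tau>" "\<And>x. 0 \<le> \<tau> x"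
  shows "- c * (\<integral>x. \<tau> x \<partial>lborel) \<le> (\<integral>x. (\<Sum>b\<in>Basis. frechet_derivative (\<lambda>z. frechet_derivative \<tau> (at z) b) (at x) b) * Phi (u x) \<partial>lborel)"
proof -
  obtain K where K: "compact K" "K \<subseteq> \<Omega>" "\<And>x. x \<notin> K \<Longrightarrow> \<tau> x = 0" using \<tau>(2) unfolding compact_support_in_def by blast
  obtain r K' where r: "0 < r" "compact K'" "K' \<subseteq> \<Omega>" "\<And>x s. x \<in> K \<Longrightarrow> s \<le> r \<Longrightarrow> cball x s \<subseteq> K'" "K \<subseteq> K'"
    using compact_neighbourhood[OF K(1,2) open_dom] by metis
  \<comment> \<open>Cut off on the larger compact set, so that mollification at points of
    \<open>K\<close> is unaffected.\<close>
  define gK where "gK y = indicator K' y *\<^sub>R gW (u y)" for y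
  have gK: "integrable lborel gK" unfolding gK_def[abs_def] by (rule gW_int[OF r(2,3)])
  define D1 where "D1 b z = frechet_derivative \<tau> (at z) b" for b z
  define D2 where "D2 b z = frechet_derivative (D1 b) (at z) b" for b z
  have C\<tau>: "C1c \<Omega> \<tau>" using \<tau>(1,2) smooth_C1 unfolding C1c_def by blast
  have C1\<tau>: "C1 \<tau>" by (rule smooth_C1[OF \<tau>(1)])
  have sD1: "smooth_on UNIV (D1 b)" for b unfolding D1_def[abs_def] by (rule smooth_deriv[OF \<tau>(1)])
  have D1K: "D1 b x = 0" if "x \<notin> K" for b x unfolding D1_def
    by (rule deriv_zero_outside[OF compact_imp_closed[OF K(1)] K(3) that])
  have D2K: "D2 b x = 0" if "x \<notin> K" for b x unfolding D2_def
    by (rule deriv_zero_outside[OF compact_imp_closed[OF K(1)] D1K that])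
  have CD1: "C1c \<Omega> (D1 b)" for b unfolding C1c_def
    by (intro conjI smooth_C1 sD1 compact_support_inI[OF K(1,2)] D1K)
  define \<Delta> where "\<Delta> x = (\<Sum>b\<in>Basis. D2 b x)" for x
  have \<Delta>c: "continuous_on UNIV \<Delta>" unfolding \<Delta>_def[abs_def] D2_def
    by (intro continuous_on_sum C1_continuous_deriv smooth_C1 sD1)
  have \<Delta>K: "\<Delta> x = 0" if "x \<notin> K" for x unfolding \<Delta>_def using D2K[OF that] by simp
  have \<Delta>s: "compact_support_in \<Omega> \<Delta>" by (intro compact_support_inI[OF K(1,2)] \<Delta>K)
  obtain B where B: "0 \<le> B" "\<And>x. norm (\<Delta> x) \<le> B" using bounded_compact_support[OF \<Delta>c \<Delta>s] by blast
  obtain B' where B': "0 \<le> B'" "\<And>x. norm (\<tau> x) \<le> B'" using bounded_compact_support[OF C1_continuous[OF C1\<tau>] \<tau>(2)] by blast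
  have [measurable]: "\<Delta> \<in> borel_measurable borel" "\<tau> \<in> borel_measurable borel"
    using \<Delta>c C1_continuous[OF C1\<tau>] by (auto intro: borel_measurable_continuous_onI)
  define s where "s n = r / real (Suc n)" for n
  have s: "0 < s n" "s n \<le> r" for n using r(1) by (auto simp: s_def divide_le_eq)
  have s0: "s \<longlonglongrightarrow> 0" unfolding s_def using tendsto_mult_right_zero[OF LIMSEQ_Suc[OF lim_1_over_n], of r] by simp
  define U where "U n = conv (kern (s n)) u" for n
  define gn where "gn n = conv (kern (s n)) gK" for n
  have kz: "kern (s n) z = 0" if "s n \<le> norm z" for n and z :: "real^2" by (rule kern_zero[OF s(1) that])
  have kz': "kern (s n) z = 0" if "s n < norm z" for n and z :: "real^2" using kz[of n z] that by simp
  have kc: "compact_support_in UNIV (kern (s n) :: real^2 \<Rightarrow> real)" for n by (rule mollifier_compact[OF mollifier_kern[OF s(1)]])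
  define dk where "dk n b z = frechet_derivative (kern (s n)) (at z) b" for n and b z :: "real^2"
  have sdk: "smooth_on UNIV (dk n b)" for n b unfolding dk_def[abs_def] by (rule smooth_deriv[OF smooth_kern])
  have dkz: "dk n b z = 0" if "s n < norm z" for n b z unfolding dk_def by (rule support_deriv[OF kz that])
  have dkc: "compact_support_in UNIV (dk n b)" for n b using dkz by (intro compact_support_inI[of "cball 0 (s n)"]) auto
  have C1U: "C1 (U n)" and DU: "frechet_derivative (U n) (at x) b = conv (dk n b) u x" for n x b
    unfolding U_def dk_def[abs_def] using conv_C1[OF u_int smooth_kern kc] by auto
  define V where "V n b = conv (dk n b) u" for n b
  have C1V: "C1 (V n b)" and DV: "frechet_derivative (V n b) (at x) b' = conv (\<lambda>z. frechet_derivative (dk n b) (at z) b') u x" for n b b' x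
    unfolding V_def using conv_C1[OF u_int sdk dkc] by auto
  have lapU: "(\<Sum>b\<in>Basis. frechet_derivative (V n b) (at x) b) = gn n x" if x: "x \<in> K" for n x
  proof -
    have cb: "cball x (s n) \<subseteq> K'" by (rule r(4)[OF x s(2)])
    have cb\<Omega>: "cball x (s n) \<subseteq> \<Omega>" using cb r(3) by blast
    have "(\<Sum>b\<in>Basis. frechet_derivative (V n b) (at x) b) = (\<Sum>b\<in>Basis. conv (dk n b) (Gr b) x)"
      unfolding DV by (intro sum.cong refl conv_weak1[OF sdk dkz cb\<Omega>])
    also have "\<dots> = gn n x" unfolding gn_def gK_def[abs_def] dk_def[abs_def]
      by (rule conv_weak2[OF smooth_kern kz' cb r(3)])
    finally show ?thesis .
  qed
  \<comment> \<open>\<open>P n b\<close> is the derivative of \<open>Phi (U n x)\<close> along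
    \<open>b\<close>, in a form that can be differentiated once more.\<close>
  define P where "P n b x = (U n x \<bullet> V n b x) * (1 / Phi (U n x))" for n b x
  have ngrad_c: "continuous_on UNIV (\<lambda>y::'b. (1 / Phi y) *\<^sub>R y)" "continuous_on UNIV (\<lambda>y::'b. (- 1 / Phi y ^ 3) *\<^sub>R y)"
    by (auto intro!: continuous_intros Phi_continuous simp: Phi_ne)
  note Pgrad = C1_compose_grad[OF C1U Phi_derivative ngrad_c(1)] D_compose_grad[OF C1U Phi_derivative ngrad_c(1)]
  note Igrad = C1_compose_grad[OF C1U invPhi_derivative ngrad_c(2)] D_compose_grad[OF C1U invPhi_derivative ngrad_c(2)]
  have DUV: "frechet_derivative (U n) (at x) b = V n b x" for n x b by (simp add: DU V_def)
  have DPhi: "frechet_derivative (\<lambda>x. Phi (U n x)) (at x) b = P n b x" for n x b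
    unfolding Pgrad(2) DU P_def V_def by simp
  have C1P: "C1 (P n b)" for n b unfolding P_def[abs_def] by (intro C1_mult C1_inner C1U C1V Igrad(1))
  \<comment> \<open>Convexity of \<open>Phi\<close>: the discarded term is nonnegative by
    Cauchy-Schwarz, since \<open>(Phi y)\<^sup>2\<close> exceeds
    \<open>y \<bullet> y\<close>.\<close>
  have DP: "(U n x \<bullet> frechet_derivative (V n b) (at x) b) * (1 / Phi (U n x)) \<le> frechet_derivative (P n b) (at x) b" for n b x
  proof -
    let ?p = "Phi (U n x)" and ?V = "V n b x"
    have p: "0 < ?p" by (rule Phi_pos)
    have "frechet_derivative (P n b) (at x) b = (U n x \<bullet> ?V) * (((- 1 / ?p ^ 3) *\<^sub>R U n x) \<bullet> ?V)
        + (U n x \<bullet> frechet_derivative (V n b) (at x) b + ?V \<bullet> ?V) * (1 / ?p)"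
      unfolding P_def[abs_def] by (subst D_mult[OF C1_inner[OF C1U C1V] Igrad(1)])
        (simp add: D_inner[OF C1U C1V] Igrad(2) DUV)
    also have "\<dots> = (U n x \<bullet> frechet_derivative (V n b) (at x) b) * (1 / ?p) + (?p\<^sup>2 * (?V \<bullet> ?V) - (U n x \<bullet> ?V)\<^sup>2) / ?p ^ 3"
      using p by (simp add: field_simps power2_eq_square power3_eq_cube)
    finally have eq: "frechet_derivative (P n b) (at x) b = \<dots>" .
    have "(U n x \<bullet> ?V)\<^sup>2 \<le> (U n x \<bullet> U n x) * (?V \<bullet> ?V)" by (rule Cauchy_Schwarz_ineq)
    also have "\<dots> \<le> ?p\<^sup>2 * (?V \<bullet> ?V)" unfolding Phi(3) by (intro mult_right_mono) auto
    finally have "0 \<le> (?p\<^sup>2 * (?V \<bullet> ?V) - (U n x \<bullet> ?V)\<^sup>2) / ?p ^ 3" using p by (intro divide_nonneg_pos) auto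
    then show ?thesis unfolding eq by linarith
  qed
  define nn where "nn y = (1 / Phi y) *\<^sub>R y" for y :: 'b
  have nnc: "continuous_on UNIV nn" using ngrad_c(1) by (simp add: nn_def[abs_def])
  have nn1: "norm (nn y) \<le> 1" for y using Phi(2)[of y] Phi_pos[of y] by (simp add: nn_def divide_le_eq)
  have Um[measurable]: "U n \<in> borel_measurable borel" for n by (intro borel_measurable_continuous_onI C1_continuous C1U)
  have nm[measurable]: "nn \<in> borel_measurable borel" "(Phi :: 'b \<Rightarrow> real) \<in> borel_measurable borel"
    using nnc Phi_continuous by (auto intro: borel_measurable_continuous_onI)
  have gi: "integrable lborel (\<lambda>x. norm (gn n x - gK x))" "(\<lambda>n. \<integral>x. norm (gn n x - gK x) \<partial>lborel) \<longlonglongrightarrow> 0" for n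
    using mollifier_conv(1)[OF mollifier_kern[OF s(1)] s0 gK, of 1 n] mollifier_conv(2)[OF mollifier_kern[OF s(1)] s0 gK, of 1] gK by (simp_all add: gn_def)
  have Ui: "integrable lborel (\<lambda>x. norm (U n x - u x))" "(\<lambda>n. \<integral>x. norm (U n x - u x) \<partial>lborel) \<longlonglongrightarrow> 0" for n
    using mollifier_conv(1)[OF mollifier_kern[OF s(1)] s0 u_int, of 1 n] mollifier_conv(2)[OF mollifier_kern[OF s(1)] s0 u_int, of 1] u_int by (simp_all add: U_def)
  have [measurable]: "gK \<in> borel_measurable borel" using gK by auto
  have gnm[measurable]: "gn n \<in> borel_measurable borel" for n
    unfolding gn_def by (intro borel_measurable_continuous_onI conv_continuous[OF gK] kc C1_continuous smooth_C1 smooth_kern)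
  have iU: "integrable lborel (\<lambda>x. \<Delta> x * Phi (U n x))" for n
    by (rule integrable_C1c[of _ \<Omega>], intro continuous_on_mult \<Delta>c C1_continuous[OF Pgrad(1)],
        intro compact_support_inI[OF K(1,2)]) (simp add: \<Delta>K)
  have ign: "integrable lborel (\<lambda>x. \<tau> x * (nn (U n x) \<bullet> gK x))" for n
  proof (rule Bochner_Integration.integrable_bound)
    show "integrable lborel (\<lambda>x. B' * norm (gK x))" using gK by simp
    show "AE x in lborel. norm (\<tau> x * (nn (U n x) \<bullet> gK x)) \<le> norm (B' * norm (gK x))"
    proof (rule AE_I2)
      fix x
      have "\<bar>nn (U n x) \<bullet> gK x\<bar> \<le> 1 * norm (gK x)"
        using Cauchy_Schwarz_ineq2[of "nn (U n x)" "gK x"] mult_right_mono[OF nn1[of "U n x"] norm_ge_zero[of "gK x"]] by linarith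
      then have "\<bar>\<tau> x\<bar> * \<bar>nn (U n x) \<bullet> gK x\<bar> \<le> B' * norm (gK x)" using B'(2)[of x] B'(1) by (intro mult_mono) auto
      then show "norm (\<tau> x * (nn (U n x) \<bullet> gK x)) \<le> norm (B' * norm (gK x))" using B'(1) by (simp add: abs_mult)
    qed
  qed measurable
  \<comment> \<open>Two integrations by parts move the Laplacian from \<open>\<tau>\<close> to
    \<open>Phi (U n x)\<close>. Replacing the mollified right-hand side by \<open>gK\<close> costs
    at most \<open>B'\<close> times an L1 distance, because \<open>nn\<close> has length at most
    1.\<close>
  have ineq: "(\<integral>x. \<tau> x * (nn (U n x) \<bullet> gK x) \<partial>lborel) - B' * (\<integral>x. norm (gn n x - gK x) \<partial>lborel) \<le> (\<integral>x. \<Delta> x * Phi (U n x) \<partial>lborel)" for n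
  proof -
    have ibp1: "(\<integral>x. D2 b x * Phi (U n x) \<partial>lborel) = (\<integral>x. \<tau> x * frechet_derivative (P n b) (at x) b \<partial>lborel)" for b
    proof -
      have "(\<integral>x. D2 b x * Phi (U n x) \<partial>lborel) = - (\<integral>x. D1 b x * P n b x \<partial>lborel)"
        using integral_by_parts(1)[OF CD1 Pgrad(1), of b b n] unfolding DPhi D2_def .
      also have "(\<integral>x. D1 b x * P n b x \<partial>lborel) = - (\<integral>x. \<tau> x * frechet_derivative (P n b) (at x) b \<partial>lborel)"
        using integral_by_parts(1)[OF C\<tau> C1P, of b n b] unfolding D1_def .
      finally show ?thesis by simp
    qed
    have iD2: "integrable lborel (\<lambda>x. D2 b x * Phi (U n x))" for b
      using integral_by_parts(2)[OF CD1 Pgrad(1), of b b n] unfolding D2_def .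
    have iP: "integrable lborel (\<lambda>x. \<tau> x * frechet_derivative (P n b) (at x) b)" for b
      by (rule integral_by_parts(3)[OF C\<tau> C1P])
    have "(\<integral>x. \<Delta> x * Phi (U n x) \<partial>lborel) = (\<integral>x. (\<Sum>b\<in>Basis. D2 b x * Phi (U n x)) \<partial>lborel)"
      by (simp add: \<Delta>_def sum_distrib_right)
    also have "\<dots> = (\<Sum>b\<in>Basis. \<integral>x. D2 b x * Phi (U n x) \<partial>lborel)"
      by (intro Bochner_Integration.integral_sum iD2)
    also have "\<dots> = (\<Sum>b\<in>Basis. \<integral>x. \<tau> x * frechet_derivative (P n b) (at x) b \<partial>lborel)" by (simp only: ibp1)
    also have "\<dots> = (\<integral>x. (\<Sum>b\<in>Basis. \<tau> x * frechet_derivative (P n b) (at x) b) \<partial>lborel)"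
      by (intro Bochner_Integration.integral_sum[symmetric] iP)
    also have "\<dots> \<ge> (\<integral>x. \<tau> x * (nn (U n x) \<bullet> gK x) - B' * norm (gn n x - gK x) \<partial>lborel)"
    proof (rule integral_mono)
      show "integrable lborel (\<lambda>x. \<tau> x * (nn (U n x) \<bullet> gK x) - B' * norm (gn n x - gK x))" using ign gi(1) by auto
      show "integrable lborel (\<lambda>x. \<Sum>b\<in>Basis. \<tau> x * frechet_derivative (P n b) (at x) b)" using iP by auto
      fix x
      show "\<tau> x * (nn (U n x) \<bullet> gK x) - B' * norm (gn n x - gK x) \<le> (\<Sum>b\<in>Basis. \<tau> x * frechet_derivative (P n b) (at x) b)"
      proof (cases "x \<in> K")
        case False then show ?thesis using K(3) B'(1) by simp
      next
        case True
        have "\<tau> x * (nn (U n x) \<bullet> gn n x) = (\<Sum>b\<in>Basis. \<tau> x * ((U n x \<bullet> frechet_derivative (V n b) (at x) b) * (1 / Phi (U n x))))"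
          unfolding lapU[OF True, symmetric] nn_def
        proof -
          have "(1 / p) *\<^sub>R a \<bullet> (\<Sum>b\<in>Basis. h b) = (\<Sum>b\<in>Basis. (a \<bullet> h b) * (1 / p))" for p :: real and a :: 'b and h :: "real^2 \<Rightarrow> 'b"
            by (simp add: inner_sum_right)
          then show "\<tau> x * ((1 / Phi (U n x)) *\<^sub>R U n x \<bullet> (\<Sum>b\<in>Basis. frechet_derivative (V n b) (at x) b)) =
             (\<Sum>b\<in>Basis. \<tau> x * ((U n x \<bullet> frechet_derivative (V n b) (at x) b) * (1 / Phi (U n x))))"
            by (simp only: sum_distrib_left)
        qed
        also have "\<dots> \<le> (\<Sum>b\<in>Basis. \<tau> x * frechet_derivative (P n b) (at x) b)"
          by (intro sum_mono mult_left_mono DP \<tau>(3))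
        finally have 1: "\<tau> x * (nn (U n x) \<bullet> gn n x) \<le> (\<Sum>b\<in>Basis. \<tau> x * frechet_derivative (P n b) (at x) b)" .
        have "\<bar>nn (U n x) \<bullet> (gn n x - gK x)\<bar> \<le> 1 * norm (gn n x - gK x)"
          using Cauchy_Schwarz_ineq2[of "nn (U n x)" "gn n x - gK x"] mult_right_mono[OF nn1[of "U n x"] norm_ge_zero[of "gn n x - gK x"]] by linarith
        then have "\<bar>\<tau> x\<bar> * \<bar>nn (U n x) \<bullet> (gn n x - gK x)\<bar> \<le> B' * norm (gn n x - gK x)" using B'(2)[of x] B'(1) by (intro mult_mono) auto
        then have "\<bar>\<tau> x * (nn (U n x) \<bullet> gn n x) - \<tau> x * (nn (U n x) \<bullet> gK x)\<bar> \<le> B' * norm (gn n x - gK x)"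
          by (simp only: inner_diff_right right_diff_distrib abs_mult[symmetric])
        then show ?thesis using 1 by linarith
      qed
    qed
    also have "(\<integral>x. \<tau> x * (nn (U n x) \<bullet> gK x) - B' * norm (gn n x - gK x) \<partial>lborel) =
       (\<integral>x. \<tau> x * (nn (U n x) \<bullet> gK x) \<partial>lborel) - B' * (\<integral>x. norm (gn n x - gK x) \<partial>lborel)" using ign gi(1) by simp
    finally show ?thesis .
  qed
  \<comment> \<open>The nonlinear factor \<open>nn (U n x)\<close> needs pointwise convergence,
    hence a subsequence.\<close>
  obtain q :: "nat \<Rightarrow> nat" where q: "strict_mono q" "AE x in lborel. (\<lambda>n. U (q n) x) \<longlonglongrightarrow> u x"
  proof (rule mollifier_AE_subseq[OF mollifier_kern[OF s(1)] s0 u_int])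
    fix q :: "nat \<Rightarrow> nat" assume "strict_mono q" "AE x in lborel. (\<lambda>n. conv (kern (s (q n))) u x) \<longlonglongrightarrow> u x"
    then show thesis using that unfolding U_def by blast
  qed
  have lim1: "(\<lambda>n. \<integral>x. \<tau> x * (nn (U (q n) x) \<bullet> gK x) \<partial>lborel) \<longlonglongrightarrow> (\<integral>x. \<tau> x * (nn (u x) \<bullet> gK x) \<partial>lborel)"
  proof (rule integral_dominated_convergence[where w = "\<lambda>x. B' * norm (gK x)"])
    show "integrable lborel (\<lambda>x. B' * norm (gK x))" using gK by simp
    show "AE x in lborel. (\<lambda>n. \<tau> x * (nn (U (q n) x) \<bullet> gK x)) \<longlonglongrightarrow> \<tau> x * (nn (u x) \<bullet> gK x)"
      using q(2)
    proof eventually_elim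
      case (elim x)
      have "isCont nn (u x)" using nnc by (simp add: continuous_on_eq_continuous_at)
      then show ?case by (intro tendsto_intros isCont_tendsto_compose[of _ nn] elim)
    qed
    show "AE x in lborel. norm (\<tau> x * (nn (U (q n) x) \<bullet> gK x)) \<le> B' * norm (gK x)" for n
    proof (rule AE_I2)
      fix x
      have "\<bar>nn (U (q n) x) \<bullet> gK x\<bar> \<le> 1 * norm (gK x)"
        using Cauchy_Schwarz_ineq2[of "nn (U (q n) x)" "gK x"] mult_right_mono[OF nn1[of "U (q n) x"] norm_ge_zero[of "gK x"]] by linarith
      then have "\<bar>\<tau> x\<bar> * \<bar>nn (U (q n) x) \<bullet> gK x\<bar> \<le> B' * norm (gK x)" using B'(2)[of x] B'(1) by (intro mult_mono) auto
      then show "norm (\<tau> x * (nn (U (q n) x) \<bullet> gK x)) \<le> B' * norm (gK x)" by (simp add: abs_mult)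
    qed
  qed measurable
  \<comment> \<open>Here L1 convergence suffices, since \<open>Phi\<close> is 1-Lipschitz.\<close>
  have iu: "integrable lborel (\<lambda>x. \<Delta> x * Phi (u x))" and
    du: "\<bar>(\<integral>x. \<Delta> x * Phi (U n x) \<partial>lborel) - (\<integral>x. \<Delta> x * Phi (u x) \<partial>lborel)\<bar> \<le> B * (\<integral>x. norm (U n x - u x) \<partial>lborel)" for n
  proof -
    have bd: "\<bar>\<Delta> x * Phi (U n x) - \<Delta> x * Phi (u x)\<bar> \<le> B * norm (U n x - u x)" for x n
    proof -
      have "\<bar>\<Delta> x\<bar> * \<bar>Phi (U n x) - Phi (u x)\<bar> \<le> B * norm (U n x - u x)"
        using B(2)[of x] B(1) by (intro mult_mono Phi_lipschitz) auto
      then show ?thesis by (simp only: right_diff_distrib abs_mult[symmetric])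
    qed
    have id: "integrable lborel (\<lambda>x. \<Delta> x * Phi (U n x) - \<Delta> x * Phi (u x))" for n
    proof (rule Bochner_Integration.integrable_bound)
      show "integrable lborel (\<lambda>x. B * norm (U n x - u x))" using Ui(1) by simp
      show "AE x in lborel. norm (\<Delta> x * Phi (U n x) - \<Delta> x * Phi (u x)) \<le> norm (B * norm (U n x - u x))"
        using bd B(1) by (intro AE_I2) simp
    qed measurable
    show iu: "integrable lborel (\<lambda>x. \<Delta> x * Phi (u x))"
      using Bochner_Integration.integrable_diff[OF iU[of 0] id[of 0]] by simp
    have "(\<integral>x. \<Delta> x * Phi (U n x) \<partial>lborel) - (\<integral>x. \<Delta> x * Phi (u x) \<partial>lborel) = (\<integral>x. \<Delta> x * Phi (U n x) - \<Delta> x * Phi (u x) \<partial>lborel)"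
      by (rule Bochner_Integration.integral_diff[OF iU iu, symmetric])
    also have "\<bar>\<dots>\<bar> \<le> (\<integral>x. \<bar>\<Delta> x * Phi (U n x) - \<Delta> x * Phi (u x)\<bar> \<partial>lborel)" by (rule integral_abs_bound)
    also have "\<dots> \<le> (\<integral>x. B * norm (U n x - u x) \<partial>lborel)"
      using Ui(1) by (intro integral_mono Bochner_Integration.integrable_abs id bd) auto
    finally show "\<bar>(\<integral>x. \<Delta> x * Phi (U n x) \<partial>lborel) - (\<integral>x. \<Delta> x * Phi (u x) \<partial>lborel)\<bar> \<le> B * (\<integral>x. norm (U n x - u x) \<partial>lborel)" by simp
  qed
  have "(\<lambda>n. \<integral>x. \<Delta> x * Phi (U n x) \<partial>lborel) \<longlonglongrightarrow> (\<integral>x. \<Delta> x * Phi (u x) \<partial>lborel)"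
  proof (rule LIM_zero_cancel, rule Lim_null_comparison)
    show "\<forall>\<^sub>F n in sequentially. norm ((\<integral>x. \<Delta> x * Phi (U n x) \<partial>lborel) - (\<integral>x. \<Delta> x * Phi (u x) \<partial>lborel)) \<le> B * (\<integral>x. norm (U n x - u x) \<partial>lborel)"
      using du by (intro always_eventually) auto
    show "(\<lambda>n. B * (\<integral>x. norm (U n x - u x) \<partial>lborel)) \<longlonglongrightarrow> 0" using tendsto_mult_right_zero[OF Ui(2)] by simp
  qed
  then have lim2: "(\<lambda>n. \<integral>x. \<Delta> x * Phi (U (q n) x) \<partial>lborel) \<longlonglongrightarrow> (\<integral>x. \<Delta> x * Phi (u x) \<partial>lborel)"
    using q(1) LIMSEQ_subseq_LIMSEQ unfolding comp_def by blast
  have lim3: "(\<lambda>n. \<integral>x. norm (gn (q n) x - gK x) \<partial>lborel) \<longlonglongrightarrow> 0"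
    using gi(2) q(1) LIMSEQ_subseq_LIMSEQ unfolding comp_def by blast
  have "(\<integral>x. \<tau> x * (nn (u x) \<bullet> gK x) \<partial>lborel) - B' * 0 \<le> (\<integral>x. \<Delta> x * Phi (u x) \<partial>lborel)"
    by (rule LIMSEQ_le[OF tendsto_diff[OF lim1 tendsto_mult_left[OF lim3]] lim2]) (use ineq in auto)
  \<comment> \<open>The lower bound \<open>- c\<close> applies only after the limit, when
    \<open>nn\<close> and \<open>gW\<close> are evaluated at the same point
    \<open>u x\<close>.\<close>
  moreover have "(\<integral>x. - c * \<tau> x \<partial>lborel) \<le> (\<integral>x. \<tau> x * (nn (u x) \<bullet> gK x) \<partial>lborel)"
  proof (rule integral_mono)
    show "integrable lborel (\<lambda>x. - c * \<tau> x)" using integrable_C1c[OF C1_continuous[OF C1\<tau>] \<tau>(2)] by simp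
    show "integrable lborel (\<lambda>x. \<tau> x * (nn (u x) \<bullet> gK x))"
    proof (rule Bochner_Integration.integrable_bound)
      show "integrable lborel (\<lambda>x. B' * norm (gK x))" using gK by simp
      show "AE x in lborel. norm (\<tau> x * (nn (u x) \<bullet> gK x)) \<le> norm (B' * norm (gK x))"
      proof (rule AE_I2)
        fix x
        have "\<bar>nn (u x) \<bullet> gK x\<bar> \<le> 1 * norm (gK x)"
          using Cauchy_Schwarz_ineq2[of "nn (u x)" "gK x"] mult_right_mono[OF nn1[of "u x"] norm_ge_zero[of "gK x"]] by linarith
        then have "\<bar>\<tau> x\<bar> * \<bar>nn (u x) \<bullet> gK x\<bar> \<le> B' * norm (gK x)" using B'(2)[of x] B'(1) by (intro mult_mono) auto
        then show "norm (\<tau> x * (nn (u x) \<bullet> gK x)) \<le> norm (B' * norm (gK x))" using B'(1) by (simp add: abs_mult)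
      qed
    qed measurable
    fix x
    show "- c * \<tau> x \<le> \<tau> x * (nn (u x) \<bullet> gK x)"
    proof (cases "x \<in> K")
      case True
      then have "gK x = gW (u x)" using r(5) by (auto simp: gK_def)
      then show ?thesis using mult_left_mono[OF c(2)[of "u x"] \<tau>(3)[of x]] by (simp add: nn_def mult.commute)
    qed (use K(3) in simp)
  qed
  ultimately show ?thesis unfolding \<Delta>_def D2_def D1_def by simp
qed

end

text \<open>The right-hand side is shaped to agree with the derivative in \<open>s\<close> of the
  averaging kernel. The constant 4 is twice the dimension of the plane.\<close>

lemma radial_laplacian:
  fixes x y :: "real^2"
  assumes s: "0 < s"
  defines "q \<equiv> 1 - ((x - y) \<bullet> (x - y)) * (1 / s\<^sup>2)"
  shows "(\<Sum>b\<in>Basis. frechet_derivative (\<lambda>z. frechet_derivative (\<lambda>y. flat 0 (1 - ((x - y) \<bullet> (x - y)) * (1 / s\<^sup>2)) * (1 / s)) (at z) b) (at y) b)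
     = dflat 2 q * (2 * ((x - y) \<bullet> (x - y)) / s ^ 3) * (2 / s\<^sup>2) + flat 2 q * (- 4 / s ^ 3)"
proof -
  define E where "E = (\<lambda>z::real^2. flat 0 (1 - (z \<bullet> z) * (1 / s\<^sup>2)) * (1 / s))"
  have sE: "smooth_on UNIV E" unfolding E_def by (rule smooth_radial)
  have d1: "E differentiable (at z)" for z using smooth_C1[OF sE] by (simp add: C1_def)
  have d2: "(\<lambda>z. frechet_derivative E (at z) v) differentiable (at z)" for v z
    using smooth_C1[OF smooth_deriv[OF sE]] by (simp add: C1_def)
  have e: "(\<lambda>y. flat 0 (1 - ((x - y) \<bullet> (x - y)) * (1 / s\<^sup>2)) * (1 / s)) = (\<lambda>y. E (x - y))" by (simp add: E_def)
  have "frechet_derivative (\<lambda>z. frechet_derivative (\<lambda>y. E (x - y)) (at z) b) (at y) b =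
      (dflat 0 q * (- 2 * (1 / s\<^sup>2) * (b \<bullet> b)) + ddflat 0 q * (4 * (1 / s\<^sup>2)\<^sup>2 * ((x - y) \<bullet> b)\<^sup>2)) * (1 / s)" for b
    unfolding frechet_derivative_reflect(2)[OF d1] frechet_derivative_reflect(2)[OF d2] unfolding E_def D2_radial q_def
    by (simp add: power2_eq_square)
  moreover have "(a * (- 2 * k * 1) + d * (4 * k' * X)) * h = a * (- 2 * k) * h + (d * 4 * k' * h) * X" for a k d k' X h :: real
    by (simp add: algebra_simps)
  ultimately have "frechet_derivative (\<lambda>z. frechet_derivative (\<lambda>y. E (x - y)) (at z) b) (at y) b =
      dflat 0 q * (- 2 * (1 / s\<^sup>2)) * (1 / s) + (ddflat 0 q * 4 * (1 / s\<^sup>2)\<^sup>2 * (1 / s)) * ((x - y) \<bullet> b)\<^sup>2" if "b \<in> Basis" for b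
    using inner_same_Basis[OF that] by (simp only:)
  then have "(\<Sum>b\<in>Basis. frechet_derivative (\<lambda>z. frechet_derivative (\<lambda>y. E (x - y)) (at z) b) (at y) b) =
     (\<Sum>b\<in>(Basis::(real^2) set). dflat 0 q * (- 2 * (1 / s\<^sup>2)) * (1 / s)) + (\<Sum>b\<in>Basis. (ddflat 0 q * 4 * (1 / s\<^sup>2)\<^sup>2 * (1 / s)) * ((x - y) \<bullet> b)\<^sup>2)"
    by (simp only: sum.distrib cong: sum.cong)
  also have "(\<Sum>b\<in>Basis. (ddflat 0 q * 4 * (1 / s\<^sup>2)\<^sup>2 * (1 / s)) * ((x - y) \<bullet> b)\<^sup>2) = (ddflat 0 q * 4 * (1 / s\<^sup>2)\<^sup>2 * (1 / s)) * ((x - y) \<bullet> (x - y))"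
    unfolding euclidean_inner[of "x - y" "x - y"] by (simp only: sum_distrib_left power2_eq_square)
  also have "dflat 0 q = flat 2 q" unfolding dflat_def by (simp only: of_nat_0 add_0 mult_zero_left diff_0_right)
  also have "ddflat 0 q = dflat 2 q" unfolding ddflat_def by (simp only: of_nat_0 add_0 mult_zero_left diff_0_right)
  finally show ?thesis unfolding e using s by (simp add: field_simps power2_eq_square power3_eq_cube)
qed

text \<open>With \<open>Z\<close> in the role of |x - y|^2 this is the expression found for the
  Laplacian of the bump with profile \<open>flat 0\<close>, so the change of the averages in
  \<open>s\<close> is governed by Kato's inequality.\<close>

lemma DERIV_scaled_kernel:
  fixes Z :: real
  assumes s: "0 < s"
  shows "((\<lambda>s. flat 2 (1 - Z * (1 / s\<^sup>2)) * (2 / s\<^sup>2)) has_real_derivative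
     dflat 2 (1 - Z * (1 / s\<^sup>2)) * (2 * Z / s ^ 3) * (2 / s\<^sup>2) + flat 2 (1 - Z * (1 / s\<^sup>2)) * (- 4 / s ^ 3)) (at s)"
proof -
  have 1: "((\<lambda>s. 1 - Z * (1 / s\<^sup>2)) has_real_derivative 2 * Z / s ^ 3) (at s)"
    using s by (auto intro!: derivative_eq_intros simp: field_simps power2_eq_square power3_eq_cube)
  have 2: "((\<lambda>s. 2 / s\<^sup>2) has_real_derivative (- 4 / s ^ 3)) (at s)"
    using s by (auto intro!: derivative_eq_intros simp: field_simps power2_eq_square power3_eq_cube)
  have 3: "((\<lambda>s. flat 2 (1 - Z * (1 / s\<^sup>2))) has_real_derivative dflat 2 (1 - Z * (1 / s\<^sup>2)) * (2 * Z / s ^ 3)) (at s)"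
    by (rule DERIV_chain2[OF DERIV_flat 1])
  show ?thesis using DERIV_mult[OF 3 2] by (simp add: mult.commute add.commute)
qed

context weak_sol
begin

lemma Phi_integrable:
  assumes "compact K'" shows "integrable lborel (\<lambda>x. indicator K' x * Phi (u x))"
proof (rule Bochner_Integration.integrable_bound)
  have [measurable]: "K' \<in> sets borel" using assms by (simp add: borel_compact)
  show "integrable lborel (\<lambda>x. indicator K' x + norm (u x))"
    using u_int emeasure_compact_finite[OF assms] by (auto simp: less_top)
  have [measurable]: "(Phi :: 'b \<Rightarrow> real) \<in> borel_measurable borel"
    by (rule borel_measurable_continuous_onI[OF Phi_continuous])
  show "(\<lambda>x. indicator K' x * Phi (u x)) \<in> borel_measurable lborel" by measurable
  show "AE x in lborel. norm (indicator K' x * Phi (u x)) \<le> norm (indicat_real K' x + norm (u x))"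
  proof (rule AE_I2)
    fix x
    have "Phi (u x) \<le> 1 + norm (u x)"
      using Phi_lipschitz[of "u x" 0] by (simp add: Phi_def)
    then show "norm (indicator K' x * Phi (u x)) \<le> norm (indicat_real K' x + norm (u x))"
      using Phi_pos[of "u x"] by (cases "x \<in> K'") auto
  qed
qed

text \<open>The averages \<open>A(s)\<close> of \<open>\<Phi>(u)\<close> against the kernels \<open>2 s\<^sup>-\<^sup>2 f\<^sub>2(1 - |z|\<^sup>2/s\<^sup>2)\<close>, with \<open>f\<^sub>a = flat a\<close>, are almost
  monotone in \<open>s\<close>: their \<open>s\<close>-derivative pairs \<open>\<Phi>(u)\<close> with the Laplacian of the test function
  \<open>s\<^sup>-\<^sup>1 f\<^sub>0(1 - |z|\<^sup>2/s\<^sup>2)\<close>.\<close>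

lemma locally_bounded:
  assumes K: "compact K" "K \<subseteq> \<Omega>"
  obtains M where "0 \<le> M" "AE x in lborel. x \<in> K \<longrightarrow> norm (u x) \<le> M"
proof -
  obtain c where c: "0 \<le> c" "\<And>y. - c \<le> ((1 / Phi y) *\<^sub>R y) \<bullet> gW y" using n_gW_lower by blast
  obtain r K' where r: "0 < r" "compact K'" "K' \<subseteq> \<Omega>" "\<And>x s. x \<in> K \<Longrightarrow> s \<le> r \<Longrightarrow> cball x s \<subseteq> K'" "K \<subseteq> K'"
    using compact_neighbourhood[OF K open_dom] by metis
  define w where "w y = indicator K' y * Phi (u y)" for y
  have wi: "integrable lborel w" unfolding w_def[abs_def] by (rule Phi_integrable[OF r(2)])
  have w0: "0 \<le> w y" for y using Phi_pos[of "u y"] by (simp add: w_def)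
  obtain B where B: "0 \<le> B" "\<And>t. t \<le> 1 \<Longrightarrow> \<bar>dflat 2 t\<bar> \<le> B" "\<And>t. t \<le> 1 \<Longrightarrow> \<bar>flat 2 t\<bar> \<le> B" using dflat_bounded[of 2] by blast
  obtain c2 where c2: "0 < c2" "\<And>s. 0 < s \<Longrightarrow> c2 * s ^ 2 \<le> kmass TYPE(real^2) s" using kmass_lower[where 'a = "real^2"] by auto
  define \<omega> where "\<omega> = measure lborel (ball (0::real^2) 1)"
  have \<omega>: "0 \<le> \<omega>" by (simp add: \<omega>_def)
  define r0 where "r0 = r / 2"
  have r0: "0 < r0" "r0 < r" using r(1) by (auto simp: r0_def)
  \<comment> \<open>The possible loss of monotonicity: the test function \<open>\<tau>\<close> used
    below has integral at most \<open>\<omega> * s\<close>, hence at most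
    \<open>\<omega> * r\<close>.\<close>
  define C where "C = c * \<omega> * r"
  have C: "0 \<le> C" unfolding C_def using c(1) \<omega> r(1) by simp
  define I where "I = (\<integral>y. w y \<partial>lborel)"
  \<comment> \<open>Independent of the point of \<open>K\<close> and of the radius of the average.
    The numerator bounds the averages with kernel \<open>\<kappa>\<close>, and \<open>2 * c2\<close>
    accounts for the normalisation.\<close>
  define M where "M = ((2 / r0\<^sup>2) * B * I + C * r0) / (2 * c2)"
  have contG: "continuous_on UNIV (\<lambda>y::real^2. flat a (1 - ((x - y) \<bullet> (x - y)) * (1 / s\<^sup>2)))" for a x s
    by (intro continuous_on_compose2[OF flat_continuous] continuous_intros) auto
  have contdG: "continuous_on UNIV (\<lambda>y::real^2. dflat a (1 - ((x - y) \<bullet> (x - y)) * (1 / s\<^sup>2)))" for a x s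
    unfolding dflat_def by (intro continuous_intros contG)
  have Gm[measurable]: "(\<lambda>y. flat a (1 - ((x - y) \<bullet> (x - y)) * (1 / s\<^sup>2))) \<in> borel_measurable borel" for a s and x :: "real^2"
    by (rule borel_measurable_continuous_onI[OF contG])
  have dGm[measurable]: "(\<lambda>y. dflat a (1 - ((x - y) \<bullet> (x - y)) * (1 / s\<^sup>2))) \<in> borel_measurable borel" for a s and x :: "real^2"
    by (rule borel_measurable_continuous_onI[OF contdG])
  have q1: "1 - ((x - y) \<bullet> (x - y)) * (1 / s\<^sup>2) \<le> 1" for x y :: "real^2" and s using radial_ge_one_sub[of "x - y" s] by linarith
  have q0: "1 - ((x - y) \<bullet> (x - y)) * (1 / s\<^sup>2) \<le> 0" if "0 < s" "y \<notin> ball x s" for x y :: "real^2" and s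
    using that by (intro radial_zero) (auto simp: dist_norm)
  define \<kappa> where "\<kappa> x s y = flat 2 (1 - ((x - y) \<bullet> (x - y)) * (1 / s\<^sup>2)) * (2 / s\<^sup>2)" for x y :: "real^2" and s
  define \<kappa>' where "\<kappa>' x s y = dflat 2 (1 - ((x - y) \<bullet> (x - y)) * (1 / s\<^sup>2)) * (2 * ((x - y) \<bullet> (x - y)) / s ^ 3) * (2 / s\<^sup>2)
     + flat 2 (1 - ((x - y) \<bullet> (x - y)) * (1 / s\<^sup>2)) * (- 4 / s ^ 3)" for x y :: "real^2" and s
  have \<kappa>b: "0 \<le> \<kappa> x s y" "\<kappa> x s y \<le> B * (2 / s\<^sup>2)" for x y s
  proof -
    show "0 \<le> \<kappa> x s y" unfolding \<kappa>_def by (intro mult_nonneg_nonneg flat_nonneg) simp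
    have "flat 2 (1 - ((x - y) \<bullet> (x - y)) * (1 / s\<^sup>2)) \<le> B" using B(3)[OF q1[of x y s]] by linarith
    then show "\<kappa> x s y \<le> B * (2 / s\<^sup>2)" unfolding \<kappa>_def by (rule mult_right_mono) simp
  qed
  have \<kappa>m[measurable]: "\<kappa> x s \<in> borel_measurable borel" "\<kappa>' x s \<in> borel_measurable borel" for x s
    unfolding \<kappa>_def[abs_def] \<kappa>'_def[abs_def] by measurable
  have \<kappa>i: "integrable lborel (\<lambda>y. \<kappa> x s y * w y)" for x s
    using integrable_scaleR_bounded[OF wi, of "\<kappa> x s" "B * (2 / s\<^sup>2)"] \<kappa>b[of x s] by simp
  have \<kappa>'b: "\<bar>\<kappa>' x s y\<bar> \<le> 8 * B / s ^ 3" if s: "0 < s" for x y s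
  proof (cases "y \<in> ball x s")
    case False
    then show ?thesis using q0[OF s False] B(1) s by (simp add: \<kappa>'_def dflat_zero flat_zero)
  next
    case True
    then have "norm (x - y) < s" by (simp add: dist_norm)
    then have z: "(x - y) \<bullet> (x - y) \<le> s\<^sup>2" by (simp add: norm_lt_square)
    have "2 * ((x - y) \<bullet> (x - y)) / s ^ 3 \<le> 2 * s\<^sup>2 / s ^ 3" using z s by (intro divide_right_mono) auto
    also have "\<dots> = 2 / s" using s by (simp add: power2_eq_square power3_eq_cube)
    finally have z2: "2 * ((x - y) \<bullet> (x - y)) / s ^ 3 \<le> 2 / s" .
    have "\<bar>dflat 2 (1 - ((x - y) \<bullet> (x - y)) * (1 / s\<^sup>2)) * (2 * ((x - y) \<bullet> (x - y)) / s ^ 3) * (2 / s\<^sup>2)\<bar> \<le> B * (2 / s) * (2 / s\<^sup>2)"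
      unfolding abs_mult using B(1) B(2)[OF q1] z2 s by (intro mult_mono) auto
    moreover have "\<bar>flat 2 (1 - ((x - y) \<bullet> (x - y)) * (1 / s\<^sup>2)) * (- 4 / s ^ 3)\<bar> \<le> B * (4 / s ^ 3)"
      unfolding abs_mult using B(1) B(3)[OF q1] s by (intro mult_mono) auto
    ultimately have "\<bar>\<kappa>' x s y\<bar> \<le> B * (2 / s) * (2 / s\<^sup>2) + B * (4 / s ^ 3)" unfolding \<kappa>'_def by linarith
    also have "\<dots> = 8 * B / s ^ 3" using s by (simp add: field_simps power2_eq_square power3_eq_cube)
    finally show ?thesis .
  qed
  have main: "(\<integral>y. \<kappa> x t y * w y \<partial>lborel) \<le> (2 / r0\<^sup>2) * B * I + C * r0" if x: "x \<in> K" and t: "0 < t" "t \<le> r0" for x t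
  proof -
    define A where "A s = (\<integral>y. \<kappa> x s y * w y \<partial>lborel)" for s
    \<comment> \<open>The interval from \<open>s / 2\<close> to \<open>2 * s\<close> stays away from
      0, where the derivative of the kernel blows up.\<close>
    have dA: "(A has_real_derivative (\<integral>y. \<kappa>' x s y * w y \<partial>lborel)) (at s)" if s: "0 < s" for s
      unfolding A_def
    proof (rule has_real_derivative_integral[where \<alpha> = "s/2" and \<beta> = "2 * s" and B = "8 * B / (s/2) ^ 3"])
      show "((\<lambda>s. \<kappa> x s y) has_real_derivative \<kappa>' x \<sigma> y) (at \<sigma>)" if "s/2 < \<sigma>" "\<sigma> < 2 * s" for \<sigma> y
        unfolding \<kappa>_def \<kappa>'_def using that s by (intro DERIV_scaled_kernel) simp
      show "\<bar>\<kappa>' x \<sigma> y\<bar> \<le> 8 * B / (s/2) ^ 3" if "s/2 < \<sigma>" "\<sigma> < 2 * s" for \<sigma> y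
      proof -
        have "\<bar>\<kappa>' x \<sigma> y\<bar> \<le> 8 * B / \<sigma> ^ 3" using that s by (intro \<kappa>'b) simp
        also have "\<dots> \<le> 8 * B / (s/2) ^ 3" using that s B(1) by (intro divide_left_mono power_mono mult_pos_pos zero_less_power) auto
        finally show ?thesis .
      qed
      show "(\<lambda>y. \<kappa>' x s y * w y) \<in> borel_measurable lborel" using wi by measurable
    qed (use s wi \<kappa>i in auto)
    \<comment> \<open>Kato's inequality for the bump with profile \<open>flat 0\<close>, whose
      Laplacian is exactly \<open>\<kappa>'\<close>.\<close>
    have lowA: "- C \<le> (\<integral>y. \<kappa>' x s y * w y \<partial>lborel)" if s: "0 < s" "s \<le> r" for s
    proof -
      define \<tau> where "\<tau> y = flat 0 (1 - ((x - y) \<bullet> (x - y)) * (1 / s\<^sup>2)) * (1 / s)" for y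
      have sm: "smooth_on UNIV \<tau>" unfolding \<tau>_def[abs_def] by (rule smooth_bump)
      have \<tau>0: "\<tau> y = 0" if "y \<notin> ball x s" for y unfolding \<tau>_def using q0[OF s(1) that] by (simp add: flat_zero)
      have cb: "cball x s \<subseteq> K'" by (rule r(4)[OF x s(2)])
      have cs: "compact_support_in \<Omega> \<tau>"
        using cb r(3) \<tau>0 by (intro compact_support_inI[of "cball x s"]) auto
      have \<tau>n: "0 \<le> \<tau> y" for y unfolding \<tau>_def using s by (simp add: flat_nonneg)
      have "(\<integral>y. \<tau> y \<partial>lborel) \<le> (\<integral>y. (1 / s) * indicator (cball x s) y \<partial>lborel)"
      proof (rule integral_mono)
        show "integrable lborel \<tau>" by (rule integrable_C1c[OF C1_continuous[OF smooth_C1[OF sm]] cs])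
        show "integrable lborel (\<lambda>y. (1 / s) * indicator (cball x s) y :: real)" by (rule integrable_indicator_cball)
        fix y
        show "\<tau> y \<le> (1 / s) * indicator (cball x s) y"
        proof (cases "y \<in> ball x s")
          case True
          then have "y \<in> cball x s" by simp
          then show ?thesis using mult_right_mono[OF flat_0_le_1, of "1 / s"] s by (simp add: \<tau>_def)
        qed (use \<tau>0 s in auto)
      qed
      also have "\<dots> = (1 / s) * (s ^ 2 * \<omega>)"
        using content_ball_conv_unit_ball[of s x] s content_cball_conv_ball[of x s] by (simp add: \<omega>_def)
      also have "\<dots> = \<omega> * s" using s by (simp add: power2_eq_square)
      also have "\<dots> \<le> \<omega> * r" using s \<omega> by (intro mult_left_mono)
      finally have "c * (\<integral>y. \<tau> y \<partial>lborel) \<le> C" using c(1) mult_left_mono[of _ "\<omega> * r" c] by (simp add: C_def mult.assoc)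
      moreover have "- c * (\<integral>y. \<tau> y \<partial>lborel) \<le> (\<integral>y. (\<Sum>b\<in>Basis. frechet_derivative (\<lambda>z. frechet_derivative \<tau> (at z) b) (at y) b) * Phi (u y) \<partial>lborel)"
        by (rule kato[OF c sm cs \<tau>n])
      moreover have "(\<Sum>b\<in>Basis. frechet_derivative (\<lambda>z. frechet_derivative \<tau> (at z) b) (at y) b) * Phi (u y) = \<kappa>' x s y * w y" for y
      proof -
        have "(\<Sum>b\<in>Basis. frechet_derivative (\<lambda>z. frechet_derivative \<tau> (at z) b) (at y) b) = \<kappa>' x s y"
          unfolding \<tau>_def[abs_def] \<kappa>'_def by (rule radial_laplacian[OF s(1)])
        moreover have "\<kappa>' x s y = 0" if "y \<notin> K'"
        proof -
          have "y \<notin> ball x s" using that cb ball_subset_cball[of x s] by blast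
          then show ?thesis using q0[OF s(1)] by (simp add: \<kappa>'_def dflat_zero flat_zero)
        qed
        ultimately show ?thesis by (cases "y \<in> K'") (simp_all add: w_def)
      qed
      ultimately show ?thesis by simp
    qed
    \<comment> \<open>Adding \<open>C * s\<close> compensates the loss, so the corrected average
      increases up to the radius \<open>r0\<close>, where the integral of \<open>w\<close> bounds
      it.\<close>
    have "A t + C * t \<le> A r0 + C * r0"
    proof (rule DERIV_nonneg_imp_nondecreasing[OF t(2)])
      fix s assume s: "t \<le> s" "s \<le> r0"
      have "((\<lambda>s. A s + C * s) has_real_derivative (\<integral>y. \<kappa>' x s y * w y \<partial>lborel) + C) (at s)"
        using dA[of s] s t by (auto intro!: derivative_eq_intros)
      moreover have "0 \<le> (\<integral>y. \<kappa>' x s y * w y \<partial>lborel) + C" using lowA[of s] s t r0 by auto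
      ultimately show "\<exists>y. ((\<lambda>s. A s + C * s) has_real_derivative y) (at s) \<and> 0 \<le> y" by blast
    qed
    moreover have "A r0 \<le> (\<integral>y. (B * (2 / r0\<^sup>2)) * w y \<partial>lborel)"
      unfolding A_def using \<kappa>b w0 wi by (intro integral_mono \<kappa>i mult_right_mono) auto
    moreover have "0 \<le> C * t" using C t by simp
    ultimately show ?thesis unfolding A_def[symmetric] by (simp add: I_def mult.commute mult.left_commute)
  qed
  define s where "s n = r0 / real (Suc n)" for n
  have s: "0 < s n" "s n \<le> r0" for n using r0(1) by (auto simp: s_def divide_le_eq)
  have s0: "s \<longlonglongrightarrow> 0" unfolding s_def using tendsto_mult_right_zero[OF LIMSEQ_Suc[OF lim_1_over_n], of r0] by simp
  \<comment> \<open>The mollification is the average with kernel \<open>\<kappa>\<close> up to a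
    factor, which the lower bound for \<open>kmass\<close> keeps below
    \<open>1 / (2 * c2)\<close>.\<close>
  have cb: "conv (kern (s n)) w x \<le> M" if x: "x \<in> K" for n x
  proof -
    let ?m = "kmass TYPE(real^2) (s n)"
    have m: "0 < ?m" by (rule kmass_pos[OF s(1)])
    let ?A = "\<integral>y. \<kappa> x (s n) y * w y \<partial>lborel"
    have A0: "0 \<le> ?A" using \<kappa>b w0 by (intro Bochner_Integration.integral_nonneg) auto
    have "conv (kern (s n)) w x = (\<integral>y. ((s n)\<^sup>2 / (2 * ?m)) * (\<kappa> x (s n) y * w y) \<partial>lborel)"
      unfolding conv_def kern_def \<kappa>_def using s(1)[of n] m
      by (intro Bochner_Integration.integral_cong refl) (simp add: field_simps)
    also have "\<dots> = ((s n)\<^sup>2 / (2 * ?m)) * ?A" by simp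
    also have "\<dots> \<le> (1 / (2 * c2)) * ?A"
    proof (rule mult_right_mono[OF _ A0])
      show "(s n)\<^sup>2 / (2 * ?m) \<le> 1 / (2 * c2)" using c2(1) c2(2)[OF s(1)[of n]] m by (simp add: field_simps)
    qed
    also have "\<dots> \<le> (1 / (2 * c2)) * ((2 / r0\<^sup>2) * B * I + C * r0)"
      using c2(1) main[OF x s] by (intro mult_left_mono) auto
    finally show ?thesis by (simp add: M_def)
  qed
  show ?thesis
  proof (rule that[of "\<bar>M\<bar>"])
    show "AE x in lborel. x \<in> K \<longrightarrow> norm (u x) \<le> \<bar>M\<bar>"
    proof (rule mollifier_AE_subseq[OF mollifier_kern[OF s(1)] s0 wi])
      fix q :: "nat \<Rightarrow> nat" assume "AE x in lborel. (\<lambda>n. conv (kern (s (q n))) w x) \<longlonglongrightarrow> w x"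
      then show ?thesis
      proof eventually_elim
        case (elim x)
        show ?case
        proof
          assume x: "x \<in> K"
          \<comment> \<open>Almost every point is a limit of mollified values along the subsequence,
            and all of these are bounded by \<open>M\<close>.\<close>
          have "w x \<le> M" by (rule LIMSEQ_le_const2[OF elim]) (use cb[OF x] in auto)
          moreover have "w x = Phi (u x)" using x r(5) by (auto simp: w_def)
          ultimately show "norm (u x) \<le> \<bar>M\<bar>" using Phi(2)[of "u x"] by linarith
        qed
      qed
    qed
  qed simp
qed

lemma W_cont: "continuous_on S W"
  by (intro continuous_at_imp_continuous_on ballI has_derivative_continuous[OF W_deriv])

text \<open>The mollified function solves an equation with right-hand side \<open>gn\<close>, the
  mollification of \<open>gW (u x)\<close>, and not \<open>gW (U n x)\<close>. The identity
  therefore holds up to a difference of two pairings with \<open>H n v\<close>. Since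
  \<open>u\<close> is bounded near the support, both right-hand sides converge in L2 and have the
  same limit there, so the defect disappears.\<close>

lemma stress_identity:
  assumes \<phi>: "C1c \<Omega> \<phi>" and v: "v \<in> Basis"
  shows "1/2 * (\<Sum>b\<in>Basis. \<integral>x. frechet_derivative \<phi> (at x) v * (Gr b x \<bullet> Gr b x) \<partial>lborel)
     + (\<integral>x. frechet_derivative \<phi> (at x) v * W (u x) \<partial>lborel)
     - (\<Sum>b\<in>Basis. \<integral>x. frechet_derivative \<phi> (at x) b * (Gr b x \<bullet> Gr v x) \<partial>lborel) = 0"
proof -
  let ?D = "\<lambda>b x. frechet_derivative \<phi> (at x) b"
  have C1\<phi>: "C1 \<phi>" and cs: "compact_support_in \<Omega> \<phi>" using \<phi> by (auto simp: C1c_def)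
  obtain K where K: "compact K" "K \<subseteq> \<Omega>" "\<And>x. x \<notin> K \<Longrightarrow> \<phi> x = 0" using cs unfolding compact_support_in_def by blast
  have DK: "?D b x = 0" if "x \<notin> K" for b x
    using deriv_zero_outside[OF compact_imp_closed[OF K(1)] K(3) that] .
  obtain B0 where B0: "0 \<le> B0" "\<And>x. \<bar>\<phi> x\<bar> \<le> B0"
    using bounded_compact_support[OF C1_continuous[OF C1\<phi>] cs] by auto
  have "\<exists>B. 0 \<le> B \<and> (\<forall>x. \<bar>?D b x\<bar> \<le> B)" for b
    using bounded_compact_support[OF C1c_deriv[OF \<phi>], of b] by (metis real_norm_def)
  then obtain BD where BD: "\<And>b. 0 \<le> BD b" "\<And>b x. \<bar>?D b x\<bar> \<le> BD b" by metis
  have \<phi>m[measurable]: "\<phi> \<in> borel_measurable borel" by (rule borel_measurable_continuous_onI[OF C1_continuous[OF C1\<phi>]])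
  have Dm[measurable]: "?D b \<in> borel_measurable borel" for b by (rule borel_measurable_continuous_onI[OF C1_continuous_deriv[OF C1\<phi>]])
  obtain r K' where r: "0 < r" "compact K'" "K' \<subseteq> \<Omega>" "\<And>x s. x \<in> K \<Longrightarrow> s \<le> r \<Longrightarrow> cball x s \<subseteq> K'" "K \<subseteq> K'"
    using compact_neighbourhood[OF K(1,2) open_dom] by metis
  have [measurable]: "K \<in> sets borel" "K' \<in> sets borel" using K(1) r(2) by (auto simp: borel_compact)
  obtain M where M: "0 \<le> M" "AE x in lborel. x \<in> K' \<longrightarrow> norm (u x) \<le> M" using locally_bounded[OF r(2,3)] by blast
  have cW: "compact (W ` cball 0 M)" by (intro compact_continuous_image W_cont compact_cball)
  have cg: "compact (gW ` cball 0 M)" by (intro compact_continuous_image continuous_on_subset[OF gW_cont] compact_cball) auto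
  obtain BW where BW': "\<forall>y\<in>W ` cball 0 M. norm y \<le> BW" using compact_imp_bounded[OF cW] unfolding bounded_iff by blast
  have BW: "\<bar>W y\<bar> \<le> BW" if "norm y \<le> M" for y using BW' that by simp
  obtain Bg where Bg': "\<forall>y\<in>gW ` cball 0 M. norm y \<le> Bg" using compact_imp_bounded[OF cg] unfolding bounded_iff by blast
  have Bg: "norm (gW y) \<le> Bg" if "norm y \<le> M" for y using Bg' that by simp
  have Bg0: "0 \<le> Bg" using Bg[of 0] M(1) norm_ge_zero[of "gW 0"] by (simp add: order_trans[OF norm_ge_zero])
  have BW0: "0 \<le> BW" using BW[of 0] M(1) abs_ge_zero[of "W 0"] by simp
  define gK where "gK y = indicator K' y *\<^sub>R gW (u y)" for y
  have gK: "integrable lborel gK" unfolding gK_def[abs_def] by (rule gW_int[OF r(2,3)])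
  have gKm[measurable]: "gK \<in> borel_measurable borel" using gK by auto
  have gKb: "AE x in lborel. norm (gK x) \<le> Bg * indicator K' x"
    using M(2) by eventually_elim (auto simp: gK_def indicator_def intro: Bg)
  have indK: "integrable lborel (\<lambda>x. k * indicator K' x :: real)" "integrable lborel (\<lambda>x. k * indicator K x :: real)" for k
    using emeasure_compact_finite[OF r(2)] emeasure_compact_finite[OF K(1)] by (auto simp: less_top)
  \<comment> \<open>Local boundedness upgrades local integrability of \<open>gW (u x)\<close> to
    square integrability, as needed for pairing with the gradient.\<close>
  have gK2: "integrable lborel (\<lambda>x. (norm (gK x))\<^sup>2)"
  proof (rule Bochner_Integration.integrable_bound[OF indK(1)[of "Bg\<^sup>2"]])
    show "AE x in lborel. norm ((norm (gK x))\<^sup>2) \<le> norm (Bg\<^sup>2 * indicat_real K' x)"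
      using gKb
    proof eventually_elim
      case (elim x)
      have "(norm (gK x))\<^sup>2 \<le> (Bg * indicator K' x)\<^sup>2" using elim by (rule power_mono) simp
      then show ?case by (cases "x \<in> K'") simp_all
    qed
  qed measurable
  define t where "t n = r / real (Suc n)" for n
  have t: "0 < t n" "t n \<le> r" for n using r(1) by (auto simp: t_def divide_le_eq)
  have t0: "t \<longlonglongrightarrow> 0" unfolding t_def using tendsto_mult_right_zero[OF LIMSEQ_Suc[OF lim_1_over_n], of r] by simp
  \<comment> \<open>The subsequence is taken before \<open>U\<close> is defined, so that the whole
    sequence used below converges almost everywhere.\<close>
  obtain q :: "nat \<Rightarrow> nat" where q: "strict_mono q" "AE x in lborel. (\<lambda>n. conv (kern (t (q n))) u x) \<longlonglongrightarrow> u x"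
    using mollifier_AE_subseq[OF mollifier_kern[OF t(1)] t0 u_int] by blast
  define s where "s n = t (q n)" for n
  have s: "0 < s n" "s n \<le> r" for n by (simp_all add: s_def t)
  have s0: "s \<longlonglongrightarrow> 0" unfolding s_def using LIMSEQ_subseq_LIMSEQ[OF t0 q(1)] by (simp add: comp_def)
  define U where "U n = conv (kern (s n)) u" for n
  define H where "H n b = conv (kern (s n)) (Gr b)" for n b
  define gn where "gn n = conv (kern (s n)) gK" for n
  have Uq: "AE x in lborel. (\<lambda>n. U n x) \<longlonglongrightarrow> u x" using q(2) by (simp add: U_def s_def)
  have kz: "kern (s n) z = 0" if "s n \<le> norm z" for n and z :: "real^2" by (rule kern_zero[OF s(1) that])
  have kz': "kern (s n) z = 0" if "s n < norm z" for n and z :: "real^2" using kz[of n z] that by simp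
  have kc: "compact_support_in UNIV (kern (s n) :: real^2 \<Rightarrow> real)" for n by (rule mollifier_compact[OF mollifier_kern[OF s(1)]])
  define dk where "dk n b z = frechet_derivative (kern (s n)) (at z) b" for n and b z :: "real^2"
  have sdk: "smooth_on UNIV (dk n b)" for n b unfolding dk_def[abs_def] by (rule smooth_deriv[OF smooth_kern])
  have dkz: "dk n b z = 0" if "s n < norm z" for n b z unfolding dk_def by (rule support_deriv[OF kz that])
  have dkc: "compact_support_in UNIV (dk n b)" for n b using dkz by (intro compact_support_inI[of "cball 0 (s n)"]) auto
  define V where "V n b = conv (dk n b) u" for n b
  have C1U: "C1 (U n)" and DU: "frechet_derivative (U n) (at x) b = V n b x" for n x b
    unfolding U_def V_def dk_def[abs_def] using conv_C1[OF u_int smooth_kern kc] by auto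
  have C1V: "C1 (V n b)" and DV: "frechet_derivative (V n b) (at x) b' = conv (\<lambda>z. frechet_derivative (dk n b) (at z) b') u x" for n b b' x
    unfolding V_def using conv_C1[OF u_int sdk dkc] by auto
  \<comment> \<open>Equality of mixed derivatives is what makes the terms \<open>?X b\<close> below
    cancel.\<close>
  have sym: "frechet_derivative (V n b) (at x) b' = frechet_derivative (V n b') (at x) b" for n b b' x
    unfolding DV dk_def[abs_def] by (subst D2_kern_sym) (rule refl)
  have lapU: "(\<Sum>b\<in>Basis. frechet_derivative (V n b) (at x) b) = gn n x" if x: "x \<in> K" for n x
  proof -
    have cb: "cball x (s n) \<subseteq> K'" by (rule r(4)[OF x s(2)])
    have cb\<Omega>: "cball x (s n) \<subseteq> \<Omega>" using cb r(3) by blast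
    have "(\<Sum>b\<in>Basis. frechet_derivative (V n b) (at x) b) = (\<Sum>b\<in>Basis. conv (dk n b) (Gr b) x)"
      unfolding DV by (intro sum.cong refl conv_weak1[OF sdk dkz cb\<Omega>])
    also have "\<dots> = gn n x" unfolding gn_def gK_def[abs_def] dk_def[abs_def]
      by (rule conv_weak2[OF smooth_kern kz' cb r(3)])
    finally show ?thesis .
  qed
  \<comment> \<open>Near the support the derivative of the mollification is the mollification of the
    weak derivative, which converges in L2.\<close>
  have VH: "V n b x = H n b x" if x: "x \<in> K" and b: "b \<in> Basis" for n b x
  proof -
    have cb\<Omega>: "cball x (s n) \<subseteq> \<Omega>" using r(4)[OF x s(2)] r(3) by blast
    show ?thesis unfolding V_def H_def dk_def[abs_def] by (rule conv_weak1[OF smooth_kern kz' cb\<Omega> b])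
  qed
  have ic: "integrable lborel (\<lambda>x. \<phi> x * f x)" if "continuous_on UNIV f" for f :: "real^2 \<Rightarrow> real"
    by (rule integrable_C1c[of _ \<Omega>], intro continuous_on_mult C1_continuous[OF C1\<phi>] that,
        intro compact_support_inI[OF K(1,2)]) (simp add: K(3))
  have cV: "continuous_on UNIV (V n b)" "continuous_on UNIV (\<lambda>x. frechet_derivative (V n b) (at x) b')" for n b b'
    using C1V by (auto intro: C1_continuous C1_continuous_deriv)
  have gnc: "continuous_on UNIV (gn n)" for n
    unfolding gn_def by (intro conv_continuous[OF gK] kc C1_continuous smooth_C1 smooth_kern)
  have gWUc: "continuous_on UNIV (\<lambda>x. gW (U n x))" for n
    by (rule continuous_on_compose2[OF gW_cont C1_continuous[OF C1U]]) auto
  define hn where "hn n x = indicator K x *\<^sub>R gW (U n x)" for n x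
  \<comment> \<open>Each term on the left is integrated by parts. The terms \<open>?X b\<close>
    cancel between the squared gradient and the products, the terms \<open>?Y b\<close> add up to
    the Laplacian, and the potential produces \<open>hn\<close>.\<close>
  have identity: "1/2 * (\<Sum>b\<in>Basis. \<integral>x. ?D v x * (H n b x \<bullet> H n b x) \<partial>lborel) + (\<integral>x. ?D v x * W (U n x) \<partial>lborel)
     - (\<Sum>b\<in>Basis. \<integral>x. ?D b x * (H n b x \<bullet> H n v x) \<partial>lborel)
     = (\<integral>x. \<phi> x * (gn n x \<bullet> H n v x) \<partial>lborel) - (\<integral>x. \<phi> x * (hn n x \<bullet> H n v x) \<partial>lborel)" for n
  proof -
    let ?X = "\<lambda>b. \<integral>x. \<phi> x * (V n b x \<bullet> frechet_derivative (V n b) (at x) v) \<partial>lborel"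
    let ?Y = "\<lambda>b. \<integral>x. \<phi> x * (frechet_derivative (V n b) (at x) b \<bullet> V n v x) \<partial>lborel"
    have iX: "integrable lborel (\<lambda>x. \<phi> x * (V n b x \<bullet> frechet_derivative (V n b) (at x) v))" for b
      by (intro ic continuous_on_inner cV)
    have iY: "integrable lborel (\<lambda>x. \<phi> x * (frechet_derivative (V n b) (at x) b \<bullet> V n v x))" for b
      by (intro ic continuous_on_inner cV)
    have e1: "(\<integral>x. ?D v x * (H n b x \<bullet> H n b x) \<partial>lborel) = - 2 * ?X b" if b: "b \<in> Basis" for b
    proof -
      have "(\<integral>x. ?D v x * (H n b x \<bullet> H n b x) \<partial>lborel) = (\<integral>x. ?D v x * (V n b x \<bullet> V n b x) \<partial>lborel)"
      proof (intro Bochner_Integration.integral_cong refl)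
        fix x show "?D v x * (H n b x \<bullet> H n b x) = ?D v x * (V n b x \<bullet> V n b x)"
          using VH[OF _ b, of x n] DK[of x v] by (cases "x \<in> K") simp_all
      qed
      also have "\<dots> = - (\<integral>x. \<phi> x * frechet_derivative (\<lambda>x. V n b x \<bullet> V n b x) (at x) v \<partial>lborel)"
        by (rule integral_by_parts(1)[OF \<phi> C1_inner[OF C1V C1V]])
      also have "(\<integral>x. \<phi> x * frechet_derivative (\<lambda>x. V n b x \<bullet> V n b x) (at x) v \<partial>lborel) = (\<integral>x. 2 * (\<phi> x * (V n b x \<bullet> frechet_derivative (V n b) (at x) v)) \<partial>lborel)"
        unfolding D_inner[OF C1V C1V] by (intro Bochner_Integration.integral_cong refl) (simp add: inner_commute)
      finally show ?thesis by simp
    qed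
    have e2: "(\<integral>x. ?D b x * (H n b x \<bullet> H n v x) \<partial>lborel) = - (?X b + ?Y b)" if b: "b \<in> Basis" for b
    proof -
      have "(\<integral>x. ?D b x * (H n b x \<bullet> H n v x) \<partial>lborel) = (\<integral>x. ?D b x * (V n b x \<bullet> V n v x) \<partial>lborel)"
      proof (intro Bochner_Integration.integral_cong refl)
        fix x show "?D b x * (H n b x \<bullet> H n v x) = ?D b x * (V n b x \<bullet> V n v x)"
          using VH[OF _ b, of x n] VH[OF _ v, of x n] DK[of x b] by (cases "x \<in> K") simp_all
      qed
      also have "\<dots> = - (\<integral>x. \<phi> x * frechet_derivative (\<lambda>x. V n b x \<bullet> V n v x) (at x) b \<partial>lborel)"
        by (rule integral_by_parts(1)[OF \<phi> C1_inner[OF C1V C1V]])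
      also have "(\<integral>x. \<phi> x * frechet_derivative (\<lambda>x. V n b x \<bullet> V n v x) (at x) b \<partial>lborel)
          = (\<integral>x. \<phi> x * (V n b x \<bullet> frechet_derivative (V n b) (at x) v) + \<phi> x * (frechet_derivative (V n b) (at x) b \<bullet> V n v x) \<partial>lborel)"
        unfolding D_inner[OF C1V C1V] sym[of n v _ b] by (simp only: distrib_left)
      also have "\<dots> = ?X b + ?Y b" by (rule Bochner_Integration.integral_add[OF iX iY])
      finally show ?thesis .
    qed
    have e3: "(\<integral>x. ?D v x * W (U n x) \<partial>lborel) = - (\<integral>x. \<phi> x * (hn n x \<bullet> H n v x) \<partial>lborel)"
    proof -
      have "(\<integral>x. ?D v x * W (U n x) \<partial>lborel) = - (\<integral>x. \<phi> x * frechet_derivative (\<lambda>x. W (U n x)) (at x) v \<partial>lborel)"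
        by (rule integral_by_parts(1)[OF \<phi> C1_compose_grad[OF C1U W_deriv gW_cont]])
      also have "(\<integral>x. \<phi> x * frechet_derivative (\<lambda>x. W (U n x)) (at x) v \<partial>lborel) = (\<integral>x. \<phi> x * (hn n x \<bullet> H n v x) \<partial>lborel)"
      proof (intro Bochner_Integration.integral_cong refl)
        fix x show "\<phi> x * frechet_derivative (\<lambda>x. W (U n x)) (at x) v = \<phi> x * (hn n x \<bullet> H n v x)"
          unfolding D_compose_grad[OF C1U W_deriv gW_cont] DU hn_def
          using VH[OF _ v, of x n] K(3)[of x] by (cases "x \<in> K") simp_all
      qed
      finally show ?thesis .
    qed
    have e4: "(\<Sum>b\<in>Basis. ?Y b) = (\<integral>x. \<phi> x * (gn n x \<bullet> H n v x) \<partial>lborel)"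
    proof -
      have "(\<Sum>b\<in>Basis. ?Y b) = (\<integral>x. (\<Sum>b\<in>Basis. \<phi> x * (frechet_derivative (V n b) (at x) b \<bullet> V n v x)) \<partial>lborel)"
        by (intro Bochner_Integration.integral_sum[symmetric] iY)
      also have "\<dots> = (\<integral>x. \<phi> x * (gn n x \<bullet> H n v x) \<partial>lborel)"
      proof (intro Bochner_Integration.integral_cong refl)
        fix x
        show "(\<Sum>b\<in>Basis. \<phi> x * (frechet_derivative (V n b) (at x) b \<bullet> V n v x)) = \<phi> x * (gn n x \<bullet> H n v x)"
        proof (cases "x \<in> K")
          case True
          then show ?thesis unfolding lapU[OF True, symmetric] VH[OF True v, symmetric]
            by (simp only: inner_sum_left sum_distrib_left)
        qed (simp add: K(3))
      qed
      finally show ?thesis .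
    qed
    have "1/2 * (\<Sum>b\<in>Basis. \<integral>x. ?D v x * (H n b x \<bullet> H n b x) \<partial>lborel) = - (\<Sum>b\<in>Basis. ?X b)"
      by (simp add: e1 sum_negf flip: sum_distrib_left)
    moreover have "(\<Sum>b\<in>Basis. \<integral>x. ?D b x * (H n b x \<bullet> H n v x) \<partial>lborel) = - ((\<Sum>b\<in>Basis. ?X b) + (\<Sum>b\<in>Basis. ?Y b))"
      by (simp only: e2 sum_negf sum.distrib cong: sum.cong)
    ultimately show ?thesis using e3 e4 by linarith
  qed
  have Grm: "Gr b \<in> borel_measurable lborel" if "b \<in> Basis" for b using Gr_int[OF that] by auto
  have Hm: "H n b \<in> borel_measurable lborel" if "b \<in> Basis" for n b
  proof -
    have "continuous_on UNIV (H n b)" unfolding H_def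
      by (intro conv_continuous Gr_int that kc C1_continuous smooth_C1 smooth_kern)
    then show ?thesis by (simp add: borel_measurable_continuous_onI)
  qed
  have p2: "(2::nat) = 1 \<or> (2::nat) = 2" by simp
  have Hi: "integrable lborel (\<lambda>x. (norm (H n b x - Gr b x))\<^sup>2)" "(\<lambda>n. \<integral>x. (norm (H n b x - Gr b x))\<^sup>2 \<partial>lborel) \<longlonglongrightarrow> 0" if "b \<in> Basis" for n b
    unfolding H_def
    by (rule mollifier_conv(1)[OF mollifier_kern[OF s(1)] s0 Gr_int[OF that] Gr_L2[OF that] p2])
       (rule mollifier_conv(2)[OF mollifier_kern[OF s(1)] s0 Gr_int[OF that] Gr_L2[OF that] p2])
  have gni: "integrable lborel (\<lambda>x. (norm (gn n x - gK x))\<^sup>2)" "(\<lambda>n. \<integral>x. (norm (gn n x - gK x))\<^sup>2 \<partial>lborel) \<longlonglongrightarrow> 0" for n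
    unfolding gn_def
    by (rule mollifier_conv(1)[OF mollifier_kern[OF s(1)] s0 gK gK2 p2])
       (rule mollifier_conv(2)[OF mollifier_kern[OF s(1)] s0 gK gK2 p2])
  have L1: "(\<lambda>n. \<integral>x. ?D b' x * (H n b x \<bullet> H n c x) \<partial>lborel) \<longlonglongrightarrow> (\<integral>x. ?D b' x * (Gr b x \<bullet> Gr c x) \<partial>lborel)"
    if "b \<in> Basis" "c \<in> Basis" for b c b'
  proof (rule L2_product_limit(3)[where B = "BD b'"])
    show "?D b' \<in> borel_measurable lborel" using Dm by simp
  qed (intro Grm Hm Gr_L2 Hi that BD)+
  have gnm: "gn n \<in> borel_measurable lborel" for n using gnc by (simp add: borel_measurable_continuous_onI)
  have L2: "(\<lambda>n. \<integral>x. \<phi> x * (gn n x \<bullet> H n v x) \<partial>lborel) \<longlonglongrightarrow> (\<integral>x. \<phi> x * (gK x \<bullet> Gr v x) \<partial>lborel)"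
  proof (rule L2_product_limit(3)[where B = B0])
    show "\<phi> \<in> borel_measurable lborel" "gK \<in> borel_measurable lborel" using \<phi>m gKm by simp_all
  qed (intro Grm Hm gnm Gr_L2 gK2 Hi gni v B0)+
  have UM: "norm (U n x) \<le> M" if x: "x \<in> K" for n x
    unfolding U_def
  proof (rule conv_bound_AE[OF mollifier_kern[OF s(1)] u_int])
    show "AE y in lborel. norm (x - y) \<le> s n \<longrightarrow> norm (u y) \<le> M"
      using M(2)
    proof eventually_elim
      case (elim y)
      show ?case
      proof
        assume "norm (x - y) \<le> s n"
        then have "y \<in> K'" using r(4)[OF x s(2)[of n]] by (auto simp: dist_norm)
        then show "norm (u y) \<le> M" using elim by blast
      qed
    qed
  qed
  \<comment> \<open>The limit of \<open>hn\<close>; it differs from \<open>gK\<close> only off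
    \<open>K\<close>, where \<open>\<phi>\<close> vanishes.\<close>
  define h where "h x = indicator K x *\<^sub>R gK x" for x
  have hm: "h \<in> borel_measurable lborel" unfolding h_def[abs_def] by measurable
  have hnm: "hn n \<in> borel_measurable lborel" for n
  proof -
    have [measurable]: "(\<lambda>x. gW (U n x)) \<in> borel_measurable borel" by (rule borel_measurable_continuous_onI[OF gWUc])
    show ?thesis unfolding hn_def[abs_def] by measurable
  qed
  have hK: "h x = indicator K x *\<^sub>R gW (u x)" for x using r(5) by (auto simp: h_def gK_def indicator_def)
  have h2: "integrable lborel (\<lambda>x. (norm (h x))\<^sup>2)"
  proof (rule Bochner_Integration.integrable_bound[OF gK2])
    show "(\<lambda>x. (norm (h x))\<^sup>2) \<in> borel_measurable lborel" using hm by measurable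
    show "AE x in lborel. norm ((norm (h x))\<^sup>2) \<le> norm ((norm (gK x))\<^sup>2)"
    proof (rule AE_I2)
      fix x show "norm ((norm (h x))\<^sup>2) \<le> norm ((norm (gK x))\<^sup>2)" by (cases "x \<in> K") (simp_all add: h_def)
    qed
  qed
  have hb: "AE x in lborel. norm ((norm (hn n x - h x))\<^sup>2) \<le> (2 * Bg)\<^sup>2 * indicator K x" for n
    using M(2)
  proof eventually_elim
    case (elim x)
    show ?case
    proof (cases "x \<in> K")
      case True
      have "norm (hn n x - h x) \<le> norm (hn n x) + norm (h x)" by (rule norm_triangle_ineq4)
      also have "\<dots> \<le> Bg + Bg" using True r(5) elim
        by (intro add_mono) (auto simp: hn_def hK intro!: Bg UM[OF True])
      finally have "(norm (hn n x - h x))\<^sup>2 \<le> (2 * Bg)\<^sup>2" by (intro power_mono) auto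
      then show ?thesis using True by simp
    qed (simp add: hn_def h_def)
  qed
  have hi: "integrable lborel (\<lambda>x. (norm (hn n x - h x))\<^sup>2)" for n
  proof (rule Bochner_Integration.integrable_bound[OF indK(2)[of "(2 * Bg)\<^sup>2"]])
    show "(\<lambda>x. (norm (hn n x - h x))\<^sup>2) \<in> borel_measurable lborel" using hm hnm by measurable
    show "AE x in lborel. norm ((norm (hn n x - h x))\<^sup>2) \<le> norm ((2 * Bg)\<^sup>2 * indicat_real K x)"
      using hb[of n] by eventually_elim (simp add: abs_mult)
  qed
  have hl: "(\<lambda>n. \<integral>x. (norm (hn n x - h x))\<^sup>2 \<partial>lborel) \<longlonglongrightarrow> 0"
  proof -
    have "(\<lambda>n. \<integral>x. (norm (hn n x - h x))\<^sup>2 \<partial>lborel) \<longlonglongrightarrow> (\<integral>x. 0 \<partial>(lborel :: (real^2) measure))"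
    proof (rule integral_dominated_convergence[where w = "\<lambda>x. (2 * Bg)\<^sup>2 * indicator K x"])
      show "(\<lambda>x. (norm (hn n x - h x))\<^sup>2) \<in> borel_measurable lborel" for n using hi[of n] by auto
      show "AE x in lborel. (\<lambda>n. (norm (hn n x - h x))\<^sup>2) \<longlonglongrightarrow> 0"
        using Uq
      proof eventually_elim
        case (elim x)
        have "isCont gW (u x)" using gW_cont by (simp add: continuous_on_eq_continuous_at)
        then have "(\<lambda>n. hn n x) \<longlonglongrightarrow> h x"
          unfolding hn_def hK by (intro tendsto_intros isCont_tendsto_compose[of _ gW] elim)
        then have "(\<lambda>n. (norm (hn n x - h x))\<^sup>2) \<longlonglongrightarrow> (norm (h x - h x))\<^sup>2" by (intro tendsto_intros)
        then show ?case by simp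
      qed
    qed (use indK hb in auto)
    then show ?thesis by simp
  qed
  have L3: "(\<lambda>n. \<integral>x. \<phi> x * (hn n x \<bullet> H n v x) \<partial>lborel) \<longlonglongrightarrow> (\<integral>x. \<phi> x * (h x \<bullet> Gr v x) \<partial>lborel)"
  proof (rule L2_product_limit(3)[where B = B0])
    show "\<phi> \<in> borel_measurable lborel" using \<phi>m by simp
  qed (intro Grm Hm hm hnm Gr_L2 h2 Hi hi hl v B0)+
  have same: "(\<integral>x. \<phi> x * (h x \<bullet> Gr v x) \<partial>lborel) = (\<integral>x. \<phi> x * (gK x \<bullet> Gr v x) \<partial>lborel)"
  proof (intro Bochner_Integration.integral_cong refl)
    fix x show "\<phi> x * (h x \<bullet> Gr v x) = \<phi> x * (gK x \<bullet> Gr v x)" using K(3)[of x] by (cases "x \<in> K") (simp_all add: h_def)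
  qed
  have Wm[measurable]: "W \<in> borel_measurable borel" by (rule borel_measurable_continuous_onI[OF W_cont])
  have L4: "(\<lambda>n. \<integral>x. ?D v x * W (U n x) \<partial>lborel) \<longlonglongrightarrow> (\<integral>x. ?D v x * W (u x) \<partial>lborel)"
  proof (rule integral_dominated_convergence[where w = "\<lambda>x. (BD v * BW) * indicator K x"])
    have [measurable]: "U n \<in> borel_measurable borel" for n by (rule borel_measurable_continuous_onI[OF C1_continuous[OF C1U]])
    show "(\<lambda>x. ?D v x * W (u x)) \<in> borel_measurable lborel" "(\<lambda>x. ?D v x * W (U n x)) \<in> borel_measurable lborel" for n by measurable
    show "integrable lborel (\<lambda>x. (BD v * BW) * indicator K x :: real)" by (rule indK)
    show "AE x in lborel. (\<lambda>n. ?D v x * W (U n x)) \<longlonglongrightarrow> ?D v x * W (u x)"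
      using Uq
    proof eventually_elim
      case (elim x)
      have "isCont W (u x)" by (rule has_derivative_continuous[OF W_deriv])
      then show ?case by (intro tendsto_intros isCont_tendsto_compose[of _ W] elim)
    qed
    show "AE x in lborel. norm (?D v x * W (U n x)) \<le> (BD v * BW) * indicator K x" for n
    proof (rule AE_I2)
      fix x
      show "norm (?D v x * W (U n x)) \<le> (BD v * BW) * indicator K x"
      proof (cases "x \<in> K")
        case True
        have "\<bar>?D v x\<bar> * \<bar>W (U n x)\<bar> \<le> BD v * BW" using BD BW[OF UM[OF True]] by (intro mult_mono) auto
        then show ?thesis using True by (simp add: abs_mult)
      qed (simp add: DK)
    qed
  qed
  have "(\<lambda>n. 1/2 * (\<Sum>b\<in>Basis. \<integral>x. ?D v x * (H n b x \<bullet> H n b x) \<partial>lborel) + (\<integral>x. ?D v x * W (U n x) \<partial>lborel)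
     - (\<Sum>b\<in>Basis. \<integral>x. ?D b x * (H n b x \<bullet> H n v x) \<partial>lborel))
    \<longlonglongrightarrow> 1/2 * (\<Sum>b\<in>Basis. \<integral>x. ?D v x * (Gr b x \<bullet> Gr b x) \<partial>lborel) + (\<integral>x. ?D v x * W (u x) \<partial>lborel)
     - (\<Sum>b\<in>Basis. \<integral>x. ?D b x * (Gr b x \<bullet> Gr v x) \<partial>lborel)"
    by (intro tendsto_intros L1 L4 v)
  moreover have "(\<lambda>n. (\<integral>x. \<phi> x * (gn n x \<bullet> H n v x) \<partial>lborel) - (\<integral>x. \<phi> x * (hn n x \<bullet> H n v x) \<partial>lborel)) \<longlonglongrightarrow> 0"
    using tendsto_diff[OF L2 L3] same by simp
  ultimately show ?thesis unfolding identity using LIMSEQ_unique by blast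
qed

end

subsection \<open>From weak solutions to the limiting stress tensor\<close>

text \<open>Solutions are only Lebesgue measurable functions on \<open>\<Omega>\<close>. A Borel
  version that vanishes outside moves them to \<open>lborel\<close> on the whole space; it is built
  coordinate by coordinate.\<close>

lemma borel_representative:
  fixes f :: "'a::euclidean_space \<Rightarrow> 'b::euclidean_space"
  assumes f: "f \<in> borel_measurable (lebesgue_on \<Omega>)" and \<Omega>: "open \<Omega>"
  obtains g where "g \<in> borel_measurable borel" "\<And>x. x \<notin> \<Omega> \<Longrightarrow> g x = 0" "AE x in lebesgue. x \<in> \<Omega> \<longrightarrow> f x = g x"
proof -
  have \<Omega>b: "\<Omega> \<in> sets borel" "\<Omega> \<inter> space lebesgue \<in> sets lebesgue" using \<Omega> by auto
  have m: "(\<lambda>x. indicator \<Omega> x *\<^sub>R f x) \<in> borel_measurable lebesgue"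
    by (rule borel_measurable_restrict_space_iff[OF \<Omega>b(2), THEN iffD1, OF f])
  have "\<exists>h\<in>borel_measurable lborel. AE x in lborel. (indicator \<Omega> x *\<^sub>R f x) \<bullet> b = h x" for b
    by (intro completion_ex_borel_measurable_real borel_measurable_inner[OF m] borel_measurable_const)
  then obtain h where h: "\<And>b. h b \<in> borel_measurable lborel" "\<And>b. AE x in lborel. (indicator \<Omega> x *\<^sub>R f x) \<bullet> b = h b x"
    by metis
  define g where "g x = indicator \<Omega> x *\<^sub>R (\<Sum>b\<in>Basis. h b x *\<^sub>R b)" for x
  have hb: "h b \<in> borel_measurable borel" for b using h(1) by simp
  show ?thesis
  proof (rule that[of g])
    show "g \<in> borel_measurable borel" unfolding g_def[abs_def]
      using hb \<Omega>b(1) by (intro borel_measurable_scaleR borel_measurable_indicator borel_measurable_sum borel_measurable_const) auto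
    have "AE x in lborel. \<forall>b\<in>Basis. (indicator \<Omega> x *\<^sub>R f x) \<bullet> b = h b x" using h(2) by (intro AE_finite_allI) auto
    then have "AE x in lborel. x \<in> \<Omega> \<longrightarrow> f x = g x"
    proof eventually_elim
      case (elim x)
      show ?case
      proof
        assume x: "x \<in> \<Omega>"
        then have "g x = (\<Sum>b\<in>Basis. (f x \<bullet> b) *\<^sub>R b)" using elim by (simp add: g_def)
        then show "f x = g x" by (simp add: euclidean_representation)
      qed
    qed
    then show "AE x in lebesgue. x \<in> \<Omega> \<longrightarrow> f x = g x" by (rule AE_completion)
  qed (simp add: g_def)
qed

lemma set_integral_representative:
  fixes F :: "'a::euclidean_space \<Rightarrow> 'b::euclidean_space"
  assumes F: "F \<in> borel_measurable (lebesgue_on \<Omega>)" and \<Omega>: "open \<Omega>" and H: "H \<in> borel_measurable borel"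
    and ae: "AE x in lebesgue. x \<in> \<Omega> \<longrightarrow> F x = H x" and z: "\<And>x. x \<notin> \<Omega> \<Longrightarrow> H x = 0"
  shows "(LINT x:\<Omega>|lebesgue. F x) = (\<integral>x. H x \<partial>lborel)"
proof -
  have \<Omega>b: "\<Omega> \<inter> space lebesgue \<in> sets lebesgue" using \<Omega> by auto
  have m: "(\<lambda>x. indicator \<Omega> x *\<^sub>R F x) \<in> borel_measurable lebesgue"
    by (rule borel_measurable_restrict_space_iff[OF \<Omega>b, THEN iffD1, OF F])
  have H': "H \<in> borel_measurable lborel" using H by simp
  have "(LINT x:\<Omega>|lebesgue. F x) = (\<integral>x. H x \<partial>lebesgue)"
    unfolding set_lebesgue_integral_def
  proof (rule integral_cong_AE[OF m])
    show "H \<in> borel_measurable lebesgue" using H' by (rule measurable_completion)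
    show "AE x in lebesgue. indicator \<Omega> x *\<^sub>R F x = H x"
      using ae by eventually_elim (auto simp: indicator_def z)
  qed
  also have "\<dots> = (\<integral>x. H x \<partial>lborel)" by (rule integral_completion[OF H'])
  finally show ?thesis .
qed

lemma integrable_representative:
  fixes F :: "'a::euclidean_space \<Rightarrow> real"
  assumes F: "integrable (lebesgue_on \<Omega>) F" and \<Omega>: "open \<Omega>" and H: "H \<in> borel_measurable borel"
    and ae: "AE x in lebesgue. x \<in> \<Omega> \<longrightarrow> F x = H x" and z: "\<And>x. x \<notin> \<Omega> \<Longrightarrow> H x = 0"
  shows "integrable lborel H"
proof -
  have \<Omega>b: "\<Omega> \<inter> space lebesgue \<in> sets lebesgue" using \<Omega> by auto
  have m: "integrable lebesgue (\<lambda>x. indicator \<Omega> x *\<^sub>R F x)"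
    using F integrable_restrict_space[OF \<Omega>b, of F] by simp
  have H': "H \<in> borel_measurable lborel" using H by simp
  have "integrable lebesgue H"
  proof (rule integrable_cong_AE_imp[OF m])
    show "H \<in> borel_measurable lebesgue" using H' by (rule measurable_completion)
    show "AE x in lebesgue. indicator \<Omega> x *\<^sub>R F x = H x"
      using ae by eventually_elim (auto simp: indicator_def z)
  qed
  then show ?thesis by (simp add: integrable_completion[OF H'])
qed

text \<open>\<open>norm (f x)\<close> is at most 1 plus its square, and a bounded set has finite
  volume.\<close>

lemma integrable_from_L2:
  fixes f :: "'a::euclidean_space \<Rightarrow> 'b::euclidean_space"
  assumes "f \<in> borel_measurable borel" "integrable lborel (\<lambda>x. (norm (f x))\<^sup>2)" "bounded \<Omega>" "open \<Omega>" "\<And>x. x \<notin> \<Omega> \<Longrightarrow> f x = 0"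
  shows "integrable lborel f"
proof (rule Bochner_Integration.integrable_bound)
  have "emeasure lborel \<Omega> < \<infinity>" using assms(3) by (rule emeasure_bounded_finite)
  then show "integrable lborel (\<lambda>x. indicator \<Omega> x + (norm (f x))\<^sup>2)" using assms(2,4) by (auto simp: less_top)
  show "AE x in lborel. norm (f x) \<le> norm (indicat_real \<Omega> x + (norm (f x))\<^sup>2)"
  proof (rule AE_I2)
    fix x
    have "norm (f x) \<le> 1 + (norm (f x))\<^sup>2" using self_le_power[of "norm (f x)" 2] by (cases "1 \<le> norm (f x)") (auto intro: add_increasing add_increasing2)
    then show "norm (f x) \<le> norm (indicat_real \<Omega> x + (norm (f x))\<^sup>2)" using assms(5)[of x] by (cases "x \<in> \<Omega>") simp_all
  qed
qed (use assms in simp)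

text \<open>At a point of \<open>\<Omega>\<close> the mollification with a small kernel is a pairing
  with a test function, hence 0; almost everywhere a subsequence of mollifications converges to
  \<open>f\<close>.\<close>

lemma fundamental_lemma:
  fixes f :: "'a::euclidean_space \<Rightarrow> 'b::euclidean_space"
  assumes \<Omega>: "open \<Omega>" and f: "integrable lborel f"
    and z: "\<And>\<phi>. test_function \<Omega> \<phi> \<Longrightarrow> (\<integral>x. \<phi> x *\<^sub>R f x \<partial>lborel) = 0"
  shows "AE x in lborel. x \<in> \<Omega> \<longrightarrow> f x = 0"
proof -
  define s where "s n = 1 / real (Suc n)" for n
  have s: "0 < s n" for n by (simp add: s_def)
  have s0: "s \<longlonglongrightarrow> 0" unfolding s_def by (rule LIMSEQ_Suc[OF lim_1_over_n])
  show ?thesis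
  proof (rule mollifier_AE_subseq[OF mollifier_kern[OF s] s0 f])
    fix q :: "nat \<Rightarrow> nat" assume q: "strict_mono q" "AE x in lborel. (\<lambda>n. conv (kern (s (q n))) f x) \<longlonglongrightarrow> f x"
    from q(2) show ?thesis
    proof eventually_elim
      case (elim x)
      show ?case
      proof
        assume "x \<in> \<Omega>"
        then obtain r where r: "0 < r" "cball x r \<subseteq> \<Omega>" using \<Omega> open_contains_cball by blast
        have "(\<lambda>n. s (q n)) \<longlonglongrightarrow> 0" using LIMSEQ_subseq_LIMSEQ[OF s0 q(1)] by (simp add: comp_def)
        then have "\<forall>\<^sub>F n in sequentially. s (q n) < r" using r(1) by (rule order_tendstoD(2))
        then have "\<forall>\<^sub>F n in sequentially. conv (kern (s (q n))) f x = 0"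
        proof eventually_elim
          case (elim n)
          have "test_function \<Omega> (\<lambda>y. kern (s (q n)) (x - y))"
          proof (rule test_function_reflect[OF smooth_kern])
            show "kern (s (q n)) z = 0" if "s (q n) < norm z" for z :: 'a using that by (intro kern_zero s) simp
            show "cball x (s (q n)) \<subseteq> \<Omega>" using elim r(2) subset_cball[of "s (q n)" r x] by auto
          qed
          then show ?case using z unfolding conv_def by blast
        qed
        then have "(\<lambda>n. conv (kern (s (q n))) f x) \<longlonglongrightarrow> 0" by (rule tendsto_eventually)
        then show "f x = 0" using elim LIMSEQ_unique by blast
      qed
    qed
  qed
qed

section \<open>Gradients and change of orthonormal frame\<close>

lemma grad_has_derivative:
  assumes "V differentiable (at y)"
  shows "(V has_derivative (\<lambda>h. grad V y \<bullet> h)) (at y)"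
proof -
  have d: "(V has_derivative frechet_derivative V (at y)) (at y)" using assms by (simp add: frechet_derivative_works)
  interpret bounded_linear "frechet_derivative V (at y)" by (rule has_derivative_bounded_linear[OF d])
  have "frechet_derivative V (at y) h = grad V y \<bullet> h" for h
  proof -
    have "frechet_derivative V (at y) h = frechet_derivative V (at y) (\<Sum>b\<in>Basis. (h \<bullet> b) *\<^sub>R b)" by (simp add: euclidean_representation)
    also have "\<dots> = (\<Sum>b\<in>Basis. (h \<bullet> b) * frechet_derivative V (at y) b)" by (simp add: sum scaleR)
    also have "\<dots> = grad V y \<bullet> h" unfolding grad_def inner_sum_left inner_scaleR_left
      by (intro sum.cong refl) (simp add: inner_commute mult.commute)
    finally show ?thesis .
  qed
  then have "frechet_derivative V (at y) = (\<lambda>h. grad V y \<bullet> h)" by (rule ext)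
  then show ?thesis using d by simp
qed

lemma grad_continuous: "C1 V \<Longrightarrow> continuous_on UNIV (grad V)"
  unfolding grad_def[abs_def] by (intro continuous_on_sum continuous_on_scaleR C1_continuous_deriv continuous_on_const)

text \<open>Orthonormality of the rows gives a square matrix the transpose as right inverse; this is
  then a left inverse too, so contraction over the frame preserves the inner product.\<close>

lemma frame_parseval:
  fixes e :: "2 \<Rightarrow> real^2"
  assumes "\<And>i j. e i \<bullet> e j = (if i = j then 1 else 0)"
  shows "(\<Sum>i\<in>UNIV. (e i \<bullet> x) * (e i \<bullet> y)) = x \<bullet> y"
proof -
  define A :: "real^2^2" where "A = (\<chi> i. e i)"
  have Av: "(A *v x) $ i = e i \<bullet> x" for x i
    by (simp add: A_def matrix_vector_mult_def inner_vec_def mult.commute)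
  have "A ** transpose A = mat 1"
    using assms by (simp add: A_def matrix_matrix_mult_def transpose_def mat_def vec_eq_iff inner_vec_def)
  then have tA: "transpose A ** A = mat 1" by (simp add: matrix_left_right_inverse)
  have "(A *v x) \<bullet> (A *v y) = ((A *v x) v* A) \<bullet> y" by (simp only: dot_lmul_matrix)
  also have "(A *v x) v* A = transpose A *v (A *v x)" by simp
  also have "\<dots> = x" unfolding matrix_vector_mul_assoc tA by simp
  finally show ?thesis unfolding inner_vec_def[of "A *v x" "A *v y"] Av by simp
qed

lemma sum_Basis_inner:
  "b \<in> Basis \<Longrightarrow> (\<Sum>c\<in>Basis. (b \<bullet> c) * F c) = (F b :: real)" for b :: "'a::euclidean_space"
  by (subst sum.remove[OF finite_Basis, of b]) (auto intro!: sum.neutral simp: inner_Basis split: if_splits)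

text \<open>Contraction over an orthonormal frame does not depend on the frame; this carries the
  stress identity from the standard basis to the adapted frame.\<close>

lemma frame_contract:
  fixes e :: "2 \<Rightarrow> real^2" and p :: "real^2 \<Rightarrow> real" and h :: "real^2 \<Rightarrow> 'b::real_inner"
  assumes e: "\<And>i j. e i \<bullet> e j = (if i = j then 1 else 0)"
  shows "(\<Sum>i\<in>UNIV. (\<Sum>b\<in>Basis. (e i \<bullet> b) * p b) * ((\<Sum>c\<in>Basis. (e i \<bullet> c) *\<^sub>R h c) \<bullet> k)) = (\<Sum>b\<in>Basis. p b * (h b \<bullet> k))"
    "(\<Sum>i\<in>UNIV. (\<Sum>b\<in>Basis. (e i \<bullet> b) *\<^sub>R h b) \<bullet> (\<Sum>c\<in>Basis. (e i \<bullet> c) *\<^sub>R h c)) = (\<Sum>b\<in>Basis. h b \<bullet> h b)"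
proof -
  have "(\<Sum>i\<in>UNIV. (\<Sum>b\<in>Basis. (e i \<bullet> b) * p b) * ((\<Sum>c\<in>Basis. (e i \<bullet> c) *\<^sub>R h c) \<bullet> k)) =
    (\<Sum>i\<in>UNIV. \<Sum>b\<in>Basis. \<Sum>c\<in>Basis. ((e i \<bullet> b) * (e i \<bullet> c)) * (p b * (h c \<bullet> k)))"
    by (simp add: inner_sum_left sum_product mult_ac)
  also have "\<dots> = (\<Sum>b\<in>Basis. \<Sum>c\<in>Basis. (\<Sum>i\<in>UNIV. (e i \<bullet> b) * (e i \<bullet> c)) * (p b * (h c \<bullet> k)))"
    unfolding sum_distrib_right by (subst sum.swap, intro sum.cong refl, subst sum.swap) (rule refl)
  also have "\<dots> = (\<Sum>b\<in>Basis. \<Sum>c\<in>Basis. (b \<bullet> c) * (p b * (h c \<bullet> k)))" unfolding frame_parseval[OF e] ..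
  also have "\<dots> = (\<Sum>b\<in>Basis. p b * (h b \<bullet> k))"
  proof (intro sum.cong refl)
    fix b :: "real^2" assume "b \<in> Basis"
    then show "(\<Sum>c\<in>Basis. (b \<bullet> c) * (p b * (h c \<bullet> k))) = p b * (h b \<bullet> k)" by (rule sum_Basis_inner)
  qed
  finally show "(\<Sum>i\<in>UNIV. (\<Sum>b\<in>Basis. (e i \<bullet> b) * p b) * ((\<Sum>c\<in>Basis. (e i \<bullet> c) *\<^sub>R h c) \<bullet> k)) = (\<Sum>b\<in>Basis. p b * (h b \<bullet> k))" .
  have "(\<Sum>i\<in>UNIV. (\<Sum>b\<in>Basis. (e i \<bullet> b) *\<^sub>R h b) \<bullet> (\<Sum>c\<in>Basis. (e i \<bullet> c) *\<^sub>R h c)) =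
    (\<Sum>i\<in>UNIV. \<Sum>b\<in>Basis. \<Sum>c\<in>Basis. ((e i \<bullet> b) * (e i \<bullet> c)) * (h b \<bullet> h c))"
    by (simp add: inner_sum_left inner_sum_right sum_distrib_left mult_ac inner_commute)
  also have "\<dots> = (\<Sum>b\<in>Basis. \<Sum>c\<in>Basis. (\<Sum>i\<in>UNIV. (e i \<bullet> b) * (e i \<bullet> c)) * (h b \<bullet> h c))"
    unfolding sum_distrib_right by (subst sum.swap, intro sum.cong refl, subst sum.swap) (rule refl)
  also have "\<dots> = (\<Sum>b\<in>Basis. \<Sum>c\<in>Basis. (b \<bullet> c) * (h b \<bullet> h c))" unfolding frame_parseval[OF e] ..
  also have "\<dots> = (\<Sum>b\<in>Basis. h b \<bullet> h b)"
  proof (intro sum.cong refl)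
    fix b :: "real^2" assume "b \<in> Basis"
    then show "(\<Sum>c\<in>Basis. (b \<bullet> c) * (h b \<bullet> h c)) = h b \<bullet> h b" by (rule sum_Basis_inner)
  qed
  finally show "(\<Sum>i\<in>UNIV. (\<Sum>b\<in>Basis. (e i \<bullet> b) *\<^sub>R h b) \<bullet> (\<Sum>c\<in>Basis. (e i \<bullet> c) *\<^sub>R h c)) = (\<Sum>b\<in>Basis. h b \<bullet> h b)" .
qed


lemma test_function_C1c: "test_function \<Omega> \<phi> \<Longrightarrow> C1c \<Omega> \<phi>"
  unfolding test_function_def C1c_def by (simp add: smooth_C1)

lemma C1_deriv_expand:
  assumes "C1 (\<phi> :: 'a::euclidean_space \<Rightarrow> real)"
  shows "frechet_derivative \<phi> (at x) v = (\<Sum>b\<in>Basis. (v \<bullet> b) * frechet_derivative \<phi> (at x) b)"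
proof -
  interpret bounded_linear "frechet_derivative \<phi> (at x)"
    by (rule has_derivative_bounded_linear[OF C1_has_derivative[OF assms]])
  have "frechet_derivative \<phi> (at x) v = frechet_derivative \<phi> (at x) (\<Sum>b\<in>Basis. (v \<bullet> b) *\<^sub>R b)" by (simp add: euclidean_representation)
  also have "\<dots> = (\<Sum>b\<in>Basis. (v \<bullet> b) * frechet_derivative \<phi> (at x) b)" by (simp add: sum scaleR)
  finally show ?thesis .
qed

lemma integral_sum_scaleR:
  fixes f :: "'i \<Rightarrow> 'c \<Rightarrow> 'b::{banach, second_countable_topology}"
  assumes "\<And>i. i \<in> I \<Longrightarrow> integrable M (f i)"
  shows "(\<integral>x. (\<Sum>i\<in>I. a i *\<^sub>R f i x) \<partial>M) = (\<Sum>i\<in>I. a i *\<^sub>R (\<integral>x. f i x \<partial>M))"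
proof -
  have "(\<integral>x. (\<Sum>i\<in>I. a i *\<^sub>R f i x) \<partial>M) = (\<Sum>i\<in>I. \<integral>x. a i *\<^sub>R f i x \<partial>M)"
    by (rule Bochner_Integration.integral_sum) (intro integrable_scaleR_right assms)
  then show ?thesis by simp
qed

lemma integral_sum_mult:
  fixes f :: "'i \<Rightarrow> 'c \<Rightarrow> real"
  assumes "\<And>i. i \<in> I \<Longrightarrow> integrable M (f i)"
  shows "(\<integral>x. (\<Sum>i\<in>I. a i * f i x) \<partial>M) = (\<Sum>i\<in>I. a i * (\<integral>x. f i x \<partial>M))"
  using integral_sum_scaleR[of I M f a, OF assms] by simp

text \<open>The abstract identity in the terms in which the limits are given: integrals over
  \<open>\<Omega>\<close>, weak derivatives along the frame, and the scaling of the energy. The two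
  bounds by the energy density are kept because they survive in the limit and force the other limits
  to vanish where \<nu> does.\<close>

lemma weak_solution_facts:
  fixes \<Omega> :: "(real^2) set" and u :: "real^2 \<Rightarrow> 'b::euclidean_space" and e :: "2 \<Rightarrow> real^2"
  assumes \<Omega>: "open \<Omega>" "bounded \<Omega>" and V: "multi_well_potential V" and \<epsilon>: "0 < \<epsilon>"
    and sol: "weak_solution \<Omega> V \<epsilon> u" and en: "energy \<Omega> V \<epsilon> u < \<infinity>"
    and frame: "\<And>i j. e i \<bullet> e j = (if i = j then 1 else 0)"
  defines "wd \<equiv> \<lambda>i. weak_deriv \<Omega> (e i) u"
  shows "\<And>\<phi> j. C1c \<Omega> \<phi> \<Longrightarrow>
      (LINT x:\<Omega>|lebesgue. frechet_derivative \<phi> (at x) (e j) * (V (u x) / \<epsilon>))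
      + 1/2 * (\<Sum>i\<in>UNIV. LINT x:\<Omega>|lebesgue. frechet_derivative \<phi> (at x) (e j) * (\<epsilon> * (wd i x \<bullet> wd i x)))
      - (\<Sum>i\<in>UNIV. LINT x:\<Omega>|lebesgue. frechet_derivative \<phi> (at x) (e i) * (\<epsilon> * (wd i x \<bullet> wd j x))) = 0" (is "\<And>\<phi> j. _ \<Longrightarrow> ?ID \<phi> j")
    and "\<And>\<psi>. continuous_on UNIV \<psi> \<Longrightarrow> compact_support_in \<Omega> \<psi> \<Longrightarrow>
      \<bar>LINT x:\<Omega>|lebesgue. \<psi> x * (V (u x) / \<epsilon>)\<bar> \<le> (LINT x:\<Omega>|lebesgue. \<bar>\<psi> x\<bar> * energy_density \<Omega> V \<epsilon> u x)" (is "\<And>\<psi>. _ \<Longrightarrow> _ \<Longrightarrow> ?B1 \<psi>")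
    and "\<And>\<psi> i j. continuous_on UNIV \<psi> \<Longrightarrow> compact_support_in \<Omega> \<psi> \<Longrightarrow>
      \<bar>LINT x:\<Omega>|lebesgue. \<psi> x * (\<epsilon> * (wd i x \<bullet> wd j x))\<bar> \<le> 2 * (LINT x:\<Omega>|lebesgue. \<bar>\<psi> x\<bar> * energy_density \<Omega> V \<epsilon> u x)" (is "\<And>\<psi> i j. _ \<Longrightarrow> _ \<Longrightarrow> ?B2 \<psi> i j")
proof -
  have smV: "smooth_on UNIV V" using V by (simp add: multi_well_potential_def)
  have C1V: "C1 V" by (rule smooth_C1[OF smV])
  have V0: "0 \<le> V y" for y
  proof -
    have "(INF y. V y) \<le> V y" using V by (intro cINF_lower) (auto simp: multi_well_potential_def)
    then show ?thesis using V by (simp add: multi_well_potential_def)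
  qed
  obtain R where R: "\<And>y. R < norm y \<Longrightarrow> 0 \<le> y \<bullet> grad V y"
  proof -
    obtain \<alpha> R where "0 < \<alpha>" "\<forall>y. R < norm y \<longrightarrow> y \<bullet> grad V y \<ge> \<alpha> * (norm y)\<^sup>2"
      using V unfolding multi_well_potential_def by blast
    then have "0 \<le> y \<bullet> grad V y" if "R < norm y" for y
      using that order_trans[OF mult_nonneg_nonneg[of \<alpha> "(norm y)\<^sup>2"], of "y \<bullet> grad V y"] by simp
    then show ?thesis by (rule that)
  qed
  have gVc: "continuous_on UNIV (grad V)" by (rule grad_continuous[OF C1V])
  have Vm[measurable]: "V \<in> borel_measurable borel" by (rule borel_measurable_continuous_onI[OF C1_continuous[OF C1V]])
  have gVm[measurable]: "grad V \<in> borel_measurable borel" by (rule borel_measurable_continuous_onI[OF gVc])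
  have H1u: "H1 \<Omega> u" using sol by (simp add: weak_solution_def)
  have L2u: "L2_on \<Omega> u" using H1u by (simp add: H1_def)
  have wdL2: "L2_on \<Omega> (weak_deriv \<Omega> v u)" "is_weak_deriv \<Omega> v u (weak_deriv \<Omega> v u)" for v
  proof -
    have "\<exists>g. L2_on \<Omega> g \<and> is_weak_deriv \<Omega> v u g" using H1u by (simp add: H1_def)
    from someI_ex[OF this] show "L2_on \<Omega> (weak_deriv \<Omega> v u)" "is_weak_deriv \<Omega> v u (weak_deriv \<Omega> v u)"
      unfolding weak_deriv_def by auto
  qed
  have rep: "\<exists>g. g \<in> borel_measurable borel \<and> (\<forall>x. x \<notin> \<Omega> \<longrightarrow> g x = 0) \<and> (AE x in lebesgue. x \<in> \<Omega> \<longrightarrow> f x = g x)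
      \<and> integrable lborel (\<lambda>x. (norm (g x))\<^sup>2) \<and> integrable lborel g" if f: "L2_on \<Omega> f" for f :: "real^2 \<Rightarrow> 'b"
  proof -
    have fm: "f \<in> borel_measurable (lebesgue_on \<Omega>)" and fi: "integrable (lebesgue_on \<Omega>) (\<lambda>x. (norm (f x))\<^sup>2)"
      using f by (auto simp: L2_on_def)
    obtain g where g: "g \<in> borel_measurable borel" "\<And>x. x \<notin> \<Omega> \<Longrightarrow> g x = 0" "AE x in lebesgue. x \<in> \<Omega> \<longrightarrow> f x = g x"
      using borel_representative[OF fm \<Omega>(1)] by blast
    have g2: "integrable lborel (\<lambda>x. (norm (g x))\<^sup>2)"
    proof (rule integrable_representative[OF fi \<Omega>(1)])
      show "(\<lambda>x. (norm (g x))\<^sup>2) \<in> borel_measurable borel" using g(1) by measurable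
      show "AE x in lebesgue. x \<in> \<Omega> \<longrightarrow> (norm (f x))\<^sup>2 = (norm (g x))\<^sup>2" using g(3) by eventually_elim simp
    qed (simp add: g(2))
    have "integrable lborel g" by (rule integrable_from_L2[OF g(1) g2 \<Omega>(2,1) g(2)])
    then show ?thesis using g g2 by blast
  qed
  obtain u' where u': "u' \<in> borel_measurable borel" "\<And>x. x \<notin> \<Omega> \<Longrightarrow> u' x = 0" "AE x in lebesgue. x \<in> \<Omega> \<longrightarrow> u x = u' x"
     "integrable lborel (\<lambda>x. (norm (u' x))\<^sup>2)" "integrable lborel u'" using rep[OF L2u] by blast
  obtain gr where gr: "\<And>v. gr v \<in> borel_measurable borel" "\<And>v x. x \<notin> \<Omega> \<Longrightarrow> gr v x = 0" "\<And>v. AE x in lebesgue. x \<in> \<Omega> \<longrightarrow> weak_deriv \<Omega> v u x = gr v x"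
     "\<And>v. integrable lborel (\<lambda>x. (norm (gr v x))\<^sup>2)" "\<And>v. integrable lborel (gr v)" 
  proof -
    define gr where "gr v = (SOME g. g \<in> borel_measurable borel \<and> (\<forall>x. x \<notin> \<Omega> \<longrightarrow> g x = 0)
        \<and> (AE x in lebesgue. x \<in> \<Omega> \<longrightarrow> weak_deriv \<Omega> v u x = g x)
        \<and> integrable lborel (\<lambda>x. (norm (g x))\<^sup>2) \<and> integrable lborel g)" for v
    note sp = someI_ex[OF rep[OF wdL2(1)], folded gr_def]
    show ?thesis using sp by (intro that[of gr]) blast+
  qed
  note [measurable] = u'(1) gr(1)
  have um: "u \<in> borel_measurable (lebesgue_on \<Omega>)" using L2u by (simp add: L2_on_def)
  have wm: "weak_deriv \<Omega> v u \<in> borel_measurable (lebesgue_on \<Omega>)" for v using wdL2(1)[of v] by (simp add: L2_on_def)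
  have cm: "f \<in> borel_measurable (lebesgue_on \<Omega>)" if "continuous_on UNIV f" for f :: "real^2 \<Rightarrow> real"
  proof -
    have "f \<in> borel_measurable lborel" using borel_measurable_continuous_onI[OF that] by simp
    then have "f \<in> borel_measurable lebesgue" by (rule measurable_completion)
    then show ?thesis by (rule measurable_restrict_space1)
  qed
  have Vum: "(\<lambda>x. V (u x)) \<in> borel_measurable (lebesgue_on \<Omega>)" "(\<lambda>x. grad V (u x)) \<in> borel_measurable (lebesgue_on \<Omega>)"
    using measurable_compose[OF um Vm] measurable_compose[OF um gVm] by auto
  have tC: "continuous_on UNIV \<phi>" "continuous_on UNIV (\<lambda>x. frechet_derivative \<phi> (at x) v)" if "C1c \<Omega> \<phi>" for \<phi> v
    using that C1_continuous C1_continuous_deriv unfolding C1c_def by blast+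
  have t0: "\<phi> x = 0" "frechet_derivative \<phi> (at x) v = 0" if \<phi>: "C1c \<Omega> \<phi>" and x: "x \<notin> \<Omega>" for \<phi> v x
  proof -
    show "\<phi> x = 0" using \<phi> x unfolding C1c_def compact_support_in_def by blast
    show "frechet_derivative \<phi> (at x) v = 0" using C1c_deriv(2)[OF \<phi>, of v] x unfolding compact_support_in_def by blast
  qed
  have weakdir: "(\<integral>x. frechet_derivative \<phi> (at x) v *\<^sub>R u' x \<partial>lborel) = - (\<integral>x. \<phi> x *\<^sub>R gr v x \<partial>lborel)" if t: "test_function \<Omega> \<phi>" for \<phi> v
  proof -
    note c = test_function_C1c[OF t]
    have [measurable]: "\<phi> \<in> borel_measurable borel" "(\<lambda>x. frechet_derivative \<phi> (at x) v) \<in> borel_measurable borel"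
      using tC[OF c] by (auto intro: borel_measurable_continuous_onI)
    have "(LINT x:\<Omega>|lebesgue. frechet_derivative \<phi> (at x) v *\<^sub>R u x) = (\<integral>x. frechet_derivative \<phi> (at x) v *\<^sub>R u' x \<partial>lborel)"
    proof (rule set_integral_representative[OF _ \<Omega>(1)])
      show "(\<lambda>x. frechet_derivative \<phi> (at x) v *\<^sub>R u x) \<in> borel_measurable (lebesgue_on \<Omega>)" by (intro borel_measurable_scaleR cm tC c um)
      show "AE x in lebesgue. x \<in> \<Omega> \<longrightarrow> frechet_derivative \<phi> (at x) v *\<^sub>R u x = frechet_derivative \<phi> (at x) v *\<^sub>R u' x"
        using u'(3) by eventually_elim simp
    qed (use t0[OF c] in \<open>auto\<close>)
    moreover have "(LINT x:\<Omega>|lebesgue. \<phi> x *\<^sub>R weak_deriv \<Omega> v u x) = (\<integral>x. \<phi> x *\<^sub>R gr v x \<partial>lborel)"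
    proof (rule set_integral_representative[OF _ \<Omega>(1)])
      show "(\<lambda>x. \<phi> x *\<^sub>R weak_deriv \<Omega> v u x) \<in> borel_measurable (lebesgue_on \<Omega>)" by (intro borel_measurable_scaleR cm tC c wm)
      show "AE x in lebesgue. x \<in> \<Omega> \<longrightarrow> \<phi> x *\<^sub>R weak_deriv \<Omega> v u x = \<phi> x *\<^sub>R gr v x"
        using gr(3)[of v] by eventually_elim simp
    qed (use t0[OF c] in \<open>auto\<close>)
    ultimately show ?thesis using wdL2(2)[of v] t unfolding is_weak_deriv_def by simp
  qed
  have bt: "\<exists>B. \<forall>x. \<bar>\<phi> x\<bar> \<le> B" "\<exists>B. \<forall>x. \<bar>frechet_derivative \<phi> (at x) v\<bar> \<le> B" if c: "C1c \<Omega> \<phi>" for \<phi> v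
  proof -
    have "compact_support_in \<Omega> \<phi>" using c by (simp add: C1c_def)
    then show "\<exists>B. \<forall>x. \<bar>\<phi> x\<bar> \<le> B" using bounded_compact_support[OF tC(1)[OF c]] by (metis real_norm_def)
    show "\<exists>B. \<forall>x. \<bar>frechet_derivative \<phi> (at x) v\<bar> \<le> B" using bounded_compact_support[OF C1c_deriv[OF c]] by (metis real_norm_def)
  qed
  have ti: "integrable lborel (\<lambda>x. \<phi> x *\<^sub>R f x)" "integrable lborel (\<lambda>x. frechet_derivative \<phi> (at x) v *\<^sub>R f x)"
    if c: "C1c \<Omega> \<phi>" and f: "integrable lborel f" for \<phi> v and f :: "real^2 \<Rightarrow> 'b"
  proof -
    obtain B where "\<And>x. \<bar>\<phi> x\<bar> \<le> B" using bt(1)[OF c] by blast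
    moreover obtain B' where "\<And>x. \<bar>frechet_derivative \<phi> (at x) v\<bar> \<le> B'" using bt(2)[OF c] by blast
    ultimately show "integrable lborel (\<lambda>x. \<phi> x *\<^sub>R f x)" "integrable lborel (\<lambda>x. frechet_derivative \<phi> (at x) v *\<^sub>R f x)"
      using tC[OF c] by (auto intro!: integrable_scaleR_bounded[OF f] borel_measurable_continuous_onI)
  qed
  \<comment> \<open>\<open>weak_deriv\<close> is chosen separately for each direction, so linearity
    in the direction is not built in. The combination of basis derivatives agrees with the chosen
    derivative along \<open>e i\<close> almost everywhere, by the fundamental lemma.\<close>
  define E where "E i x = (\<Sum>b\<in>Basis. (e i \<bullet> b) *\<^sub>R gr b x)" for i x
  have Em[measurable]: "E i \<in> borel_measurable borel" for i unfolding E_def[abs_def] by measurable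
  have E0: "E i x = 0" if "x \<notin> \<Omega>" for i x using gr(2)[OF that] by (simp add: E_def)
  have Ei: "integrable lborel (E i)" for i unfolding E_def[abs_def] using gr(5) by simp
  have Eeq: "AE x in lebesgue. x \<in> \<Omega> \<longrightarrow> wd i x = E i x" for i
  proof -
    have "AE x in lborel. x \<in> \<Omega> \<longrightarrow> gr (e i) x - E i x = 0"
    proof (rule fundamental_lemma[OF \<Omega>(1)])
      show "integrable lborel (\<lambda>x. gr (e i) x - E i x)" using gr(5) Ei by simp
      fix \<phi> assume t: "test_function \<Omega> \<phi>"
      note c = test_function_C1c[OF t]
      have C1\<phi>: "C1 \<phi>" using c by (simp add: C1c_def)
      have "(\<integral>x. \<phi> x *\<^sub>R E i x \<partial>lborel) = (\<integral>x. (\<Sum>b\<in>Basis. (e i \<bullet> b) *\<^sub>R (\<phi> x *\<^sub>R gr b x)) \<partial>lborel)"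
        by (simp add: E_def scaleR_sum_right mult.commute)
      also have "\<dots> = (\<Sum>b\<in>Basis. (e i \<bullet> b) *\<^sub>R (\<integral>x. \<phi> x *\<^sub>R gr b x \<partial>lborel))"
        by (rule integral_sum_scaleR[OF ti(1)[OF c gr(5)]])
      also have "\<dots> = - (\<Sum>b\<in>Basis. (e i \<bullet> b) *\<^sub>R (\<integral>x. frechet_derivative \<phi> (at x) b *\<^sub>R u' x \<partial>lborel))"
        by (simp add: weakdir[OF t] sum_negf)
      also have "(\<Sum>b\<in>Basis. (e i \<bullet> b) *\<^sub>R (\<integral>x. frechet_derivative \<phi> (at x) b *\<^sub>R u' x \<partial>lborel)) =
         (\<integral>x. (\<Sum>b\<in>Basis. (e i \<bullet> b) *\<^sub>R (frechet_derivative \<phi> (at x) b *\<^sub>R u' x)) \<partial>lborel)"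
        by (rule integral_sum_scaleR[OF ti(2)[OF c u'(5)], symmetric])
      also have "\<dots> = (\<integral>x. frechet_derivative \<phi> (at x) (e i) *\<^sub>R u' x \<partial>lborel)"
        by (simp add: C1_deriv_expand[OF C1\<phi>, of _ "e i"] scaleR_sum_left)
      also have "- \<dots> = (\<integral>x. \<phi> x *\<^sub>R gr (e i) x \<partial>lborel)" using weakdir[OF t, of "e i"] by simp
      finally show "(\<integral>x. \<phi> x *\<^sub>R (gr (e i) x - E i x) \<partial>lborel) = 0"
        using ti(1)[OF c gr(5)[of "e i"]] ti(1)[OF c Ei[of i]] by (simp add: scaleR_diff_right)
    qed
    then have "AE x in lebesgue. x \<in> \<Omega> \<longrightarrow> gr (e i) x - E i x = 0" by (rule AE_completion)
    then show ?thesis using gr(3)[of "e i"] by eventually_elim (simp add: wd_def)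
  qed
  \<comment> \<open>The squared parameter is absorbed into the potential; multiplying the resulting
    identity by \<open>\<epsilon>\<close> restores the scaling
    \<open>V (u x) / \<epsilon>\<close>.\<close>
  interpret ws: weak_sol \<Omega> u' gr "\<lambda>y. V y / \<epsilon>\<^sup>2" "\<lambda>y. (1 / \<epsilon>\<^sup>2) *\<^sub>R grad V y" R
  proof
    show "((\<lambda>y. V y / \<epsilon>\<^sup>2) has_derivative (\<lambda>h. (1 / \<epsilon>\<^sup>2) *\<^sub>R grad V y \<bullet> h)) (at y)" for y
    proof -
      have "V differentiable (at y)" using C1V by (simp add: C1_def)
      from has_derivative_mult_left[OF grad_has_derivative[OF this], of "1 / \<epsilon>\<^sup>2"] show ?thesis by (simp add: mult.commute)
    qed
    show "continuous_on UNIV (\<lambda>y. (1 / \<epsilon>\<^sup>2) *\<^sub>R grad V y)" by (intro continuous_intros gVc)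
    show "integrable lborel (\<lambda>x. indicator K x *\<^sub>R (1 / \<epsilon>\<^sup>2) *\<^sub>R grad V (u' x))" if K: "compact K" "K \<subseteq> \<Omega>" for K
    proof -
      have si: "integrable lebesgue (\<lambda>x. indicator K x *\<^sub>R grad V (u x))"
        using sol K unfolding weak_solution_def set_integrable_def by blast
      have Kb[measurable]: "K \<in> sets borel" using K(1) by (simp add: borel_compact)
      have m: "(\<lambda>x. indicator K x *\<^sub>R grad V (u' x)) \<in> borel_measurable lborel" by measurable
      have "integrable lebesgue (\<lambda>x. indicator K x *\<^sub>R grad V (u' x))"
      proof (rule integrable_cong_AE_imp[OF si measurable_completion[OF m]])
        show "AE x in lebesgue. indicator K x *\<^sub>R grad V (u x) = indicator K x *\<^sub>R grad V (u' x)"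
          using u'(3) by eventually_elim (use K(2) in \<open>auto simp: indicator_def\<close>)
      qed
      then have "integrable lborel (\<lambda>x. indicator K x *\<^sub>R grad V (u' x))" by (simp only: integrable_completion[OF m])
      then have "integrable lborel (\<lambda>x. (1 / \<epsilon>\<^sup>2) *\<^sub>R (indicator K x *\<^sub>R grad V (u' x)))" by (rule integrable_scaleR_right)
      then show ?thesis by (simp only: scaleR_scaleR mult.commute)
    qed
    show "(\<integral>x. (\<Sum>b\<in>Basis. frechet_derivative \<phi> (at x) b *\<^sub>R gr b x) \<partial>lborel) = - (\<integral>x. \<phi> x *\<^sub>R (1 / \<epsilon>\<^sup>2) *\<^sub>R grad V (u' x) \<partial>lborel)"
      if t: "test_function \<Omega> \<phi>" for \<phi>
    proof -
      note c = test_function_C1c[OF t]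
      have [measurable]: "\<phi> \<in> borel_measurable borel" "\<And>v. (\<lambda>x. frechet_derivative \<phi> (at x) v) \<in> borel_measurable borel"
        using tC[OF c] by (auto intro: borel_measurable_continuous_onI)
      have "(LINT x:\<Omega>|lebesgue. (\<Sum>b\<in>Basis. frechet_derivative \<phi> (at x) b *\<^sub>R weak_deriv \<Omega> b u x)) =
         (\<integral>x. (\<Sum>b\<in>Basis. frechet_derivative \<phi> (at x) b *\<^sub>R gr b x) \<partial>lborel)"
      proof (rule set_integral_representative[OF _ \<Omega>(1)])
        show "(\<lambda>x. \<Sum>b\<in>Basis. frechet_derivative \<phi> (at x) b *\<^sub>R weak_deriv \<Omega> b u x) \<in> borel_measurable (lebesgue_on \<Omega>)"
          by (intro borel_measurable_sum borel_measurable_scaleR cm tC c wm)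
        have "AE x in lebesgue. \<forall>b\<in>Basis. x \<in> \<Omega> \<longrightarrow> weak_deriv \<Omega> b u x = gr b x" using gr(3) by (intro AE_finite_allI) auto
        then show "AE x in lebesgue. x \<in> \<Omega> \<longrightarrow> (\<Sum>b\<in>Basis. frechet_derivative \<phi> (at x) b *\<^sub>R weak_deriv \<Omega> b u x) = (\<Sum>b\<in>Basis. frechet_derivative \<phi> (at x) b *\<^sub>R gr b x)"
          by eventually_elim (auto intro!: sum.cong)
      qed (use t0[OF c] in \<open>auto\<close>)
      moreover have "(LINT x:\<Omega>|lebesgue. \<phi> x *\<^sub>R grad V (u x)) = (\<integral>x. \<phi> x *\<^sub>R grad V (u' x) \<partial>lborel)"
      proof (rule set_integral_representative[OF _ \<Omega>(1)])
        show "(\<lambda>x. \<phi> x *\<^sub>R grad V (u x)) \<in> borel_measurable (lebesgue_on \<Omega>)" by (intro borel_measurable_scaleR cm tC c Vum)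
        show "AE x in lebesgue. x \<in> \<Omega> \<longrightarrow> \<phi> x *\<^sub>R grad V (u x) = \<phi> x *\<^sub>R grad V (u' x)"
          using u'(3) by eventually_elim simp
      qed (use t0[OF c] in \<open>auto\<close>)
      moreover have "(\<integral>x. \<phi> x *\<^sub>R (1 / \<epsilon>\<^sup>2) *\<^sub>R grad V (u' x) \<partial>lborel) = (1 / \<epsilon>\<^sup>2) *\<^sub>R (\<integral>x. \<phi> x *\<^sub>R grad V (u' x) \<partial>lborel)"
        by (subst integral_scaleR_right[symmetric]) (simp only: scaleR_scaleR mult.commute)
      ultimately show ?thesis using sol t unfolding weak_solution_def by simp
    qed
    show "0 \<le> y \<bullet> (1 / \<epsilon>\<^sup>2) *\<^sub>R grad V y" if "R < norm y" for y using R[OF that] by simp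
  qed (use \<Omega> u' gr weakdir in auto)
  \<comment> \<open>The gradient part of the energy density is defined through the standard basis,
    but it is the same in every orthonormal frame.\<close>
  have dens: "AE x in lebesgue. x \<in> \<Omega> \<longrightarrow> energy_density \<Omega> V \<epsilon> u x = \<epsilon> * (\<Sum>i\<in>UNIV. (norm (E i x))\<^sup>2) / 2 + V (u' x) / \<epsilon>"
  proof -
    have "AE x in lebesgue. \<forall>b\<in>Basis. x \<in> \<Omega> \<longrightarrow> weak_deriv \<Omega> b u x = gr b x" using gr(3) by (intro AE_finite_allI) auto
    with u'(3) show ?thesis
    proof eventually_elim
      case (elim x)
      show ?case
      proof
        assume x: "x \<in> \<Omega>"
        have "(\<Sum>b\<in>Basis. (norm (weak_deriv \<Omega> b u x))\<^sup>2) = (\<Sum>b\<in>Basis. gr b x \<bullet> gr b x)"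
          using elim x by (intro sum.cong) (auto simp: power2_norm_eq_inner)
        also have "\<dots> = (\<Sum>i\<in>UNIV. (norm (E i x))\<^sup>2)"
          unfolding frame_contract(2)[OF frame, symmetric] by (simp add: E_def power2_norm_eq_inner)
        finally show "energy_density \<Omega> V \<epsilon> u x = \<epsilon> * (\<Sum>i\<in>UNIV. (norm (E i x))\<^sup>2) / 2 + V (u' x) / \<epsilon>"
          using elim x by (simp add: energy_density_def)
      qed
    qed
  qed
  \<comment> \<open>A Borel function on the whole plane, integrable since the energy is finite; up
    to a factor 2 it dominates the potential term and all products of derivatives.\<close>
  define ed where "ed x = indicator \<Omega> x * (\<epsilon> * (\<Sum>i\<in>UNIV. (norm (E i x))\<^sup>2) / 2 + V (u' x) / \<epsilon>)" for x
  have \<Omega>b[measurable]: "\<Omega> \<in> sets borel" using \<Omega>(1) by simp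
  have edm[measurable]: "ed \<in> borel_measurable borel" unfolding ed_def[abs_def] by measurable
  have edn: "0 \<le> ed x" for x unfolding ed_def using \<epsilon> V0[of "u' x"] by (intro mult_nonneg_nonneg add_nonneg_nonneg sum_nonneg divide_nonneg_pos) auto
  have edi: "integrable lborel ed"
  proof (rule integrableI_nonneg)
    show "ed \<in> borel_measurable lborel" by simp
    have "(\<integral>\<^sup>+x. ennreal (ed x) \<partial>lborel) = (\<integral>\<^sup>+x. ennreal (ed x) \<partial>lebesgue)"
      by (rule nn_integral_completion[symmetric])
    also have "\<dots> = energy \<Omega> V \<epsilon> u"
      unfolding energy_def
    proof (rule nn_integral_cong_AE)
      show "AE x in lebesgue. ennreal (ed x) = ennreal (energy_density \<Omega> V \<epsilon> u x) * indicator \<Omega> x"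
        using dens by eventually_elim (auto simp: ed_def indicator_def)
    qed
    finally show "(\<integral>\<^sup>+x. ennreal (ed x) \<partial>lborel) < \<infinity>" using en by simp
  qed (use edn in auto)
  have E2: "(norm (E i x))\<^sup>2 \<le> (2 / \<epsilon>) * ed x" if "x \<in> \<Omega>" for i x
  proof -
    have "\<epsilon> * (norm (E i x))\<^sup>2 \<le> \<epsilon> * (\<Sum>i\<in>UNIV. (norm (E i x))\<^sup>2)"
      using \<epsilon> by (intro mult_left_mono member_le_sum) auto
    moreover have "\<epsilon> * (\<Sum>i\<in>UNIV. (norm (E i x))\<^sup>2) / 2 \<le> ed x" using that V0[of "u' x"] \<epsilon> by (simp add: ed_def)
    ultimately have "\<epsilon> * (norm (E i x))\<^sup>2 \<le> 2 * ed x" by linarith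
    then show ?thesis using \<epsilon> by (simp add: field_simps)
  qed
  have Vb: "V (u' x) / \<epsilon> \<le> ed x" if "x \<in> \<Omega>" for x
    using that \<epsilon> by (simp add: ed_def sum_nonneg)
  have EEb: "\<bar>\<epsilon> * (E i x \<bullet> E j x)\<bar> \<le> 2 * ed x" if x: "x \<in> \<Omega>" for i j x
  proof -
    have "\<bar>E i x \<bullet> E j x\<bar> \<le> norm (E i x) * norm (E j x)" by (rule Cauchy_Schwarz_ineq2)
    also have "\<dots> \<le> ((norm (E i x))\<^sup>2 + (norm (E j x))\<^sup>2) / 2"
      using sum_squares_bound[of "norm (E i x)" "norm (E j x)"] by simp
    also have "\<dots> \<le> ((2 / \<epsilon>) * ed x + (2 / \<epsilon>) * ed x) / 2" by (intro divide_right_mono add_mono E2[OF x]) simp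
    finally have "\<epsilon> * \<bar>E i x \<bullet> E j x\<bar> \<le> \<epsilon> * ((2 / \<epsilon>) * ed x)" using \<epsilon> by (intro mult_left_mono) auto
    then show ?thesis using \<epsilon> by (simp add: abs_mult)
  qed
  have conv1: "(LINT x:\<Omega>|lebesgue. \<psi> x * (V (u x) / \<epsilon>)) = (\<integral>x. \<psi> x * (V (u' x) / \<epsilon>) \<partial>lborel)"
    and conv2: "(LINT x:\<Omega>|lebesgue. \<psi> x * (\<epsilon> * (wd i x \<bullet> wd j x))) = (\<integral>x. \<psi> x * (\<epsilon> * (E i x \<bullet> E j x)) \<partial>lborel)"
    and conv3: "(LINT x:\<Omega>|lebesgue. \<bar>\<psi> x\<bar> * energy_density \<Omega> V \<epsilon> u x) = (\<integral>x. \<bar>\<psi> x\<bar> * ed x \<partial>lborel)"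
    and int1: "integrable lborel (\<lambda>x. \<psi> x * (V (u' x) / \<epsilon>))" and int2: "integrable lborel (\<lambda>x. \<psi> x * (\<epsilon> * (E i x \<bullet> E j x)))"
    and int3: "integrable lborel (\<lambda>x. \<bar>\<psi> x\<bar> * ed x)"
    if c: "continuous_on UNIV \<psi>" and cs: "compact_support_in \<Omega> \<psi>" for \<psi> i j
  proof -
    have z: "\<psi> x = 0" if "x \<notin> \<Omega>" for x using cs that unfolding compact_support_in_def by blast
    have [measurable]: "\<psi> \<in> borel_measurable borel" by (rule borel_measurable_continuous_onI[OF c])
    obtain B where B: "0 \<le> B" "\<And>x. norm (\<psi> x) \<le> B" using bounded_compact_support[OF c cs] by blast
    show "(LINT x:\<Omega>|lebesgue. \<psi> x * (V (u x) / \<epsilon>)) = (\<integral>x. \<psi> x * (V (u' x) / \<epsilon>) \<partial>lborel)"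
    proof (rule set_integral_representative[OF _ \<Omega>(1)])
      show "(\<lambda>x. \<psi> x * (V (u x) / \<epsilon>)) \<in> borel_measurable (lebesgue_on \<Omega>)"
        by (intro borel_measurable_times[OF cm[OF c]] borel_measurable_divide Vum borel_measurable_const)
      show "AE x in lebesgue. x \<in> \<Omega> \<longrightarrow> \<psi> x * (V (u x) / \<epsilon>) = \<psi> x * (V (u' x) / \<epsilon>)" using u'(3) by eventually_elim simp
    qed (auto simp: z)
    show "(LINT x:\<Omega>|lebesgue. \<psi> x * (\<epsilon> * (wd i x \<bullet> wd j x))) = (\<integral>x. \<psi> x * (\<epsilon> * (E i x \<bullet> E j x)) \<partial>lborel)"
    proof (rule set_integral_representative[OF _ \<Omega>(1)])
      show "(\<lambda>x. \<psi> x * (\<epsilon> * (wd i x \<bullet> wd j x))) \<in> borel_measurable (lebesgue_on \<Omega>)" unfolding wd_def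
        by (intro borel_measurable_times[OF cm[OF c]] borel_measurable_times borel_measurable_inner wm borel_measurable_const)
      show "AE x in lebesgue. x \<in> \<Omega> \<longrightarrow> \<psi> x * (\<epsilon> * (wd i x \<bullet> wd j x)) = \<psi> x * (\<epsilon> * (E i x \<bullet> E j x))"
        using Eeq[of i] Eeq[of j] by eventually_elim simp
    qed (auto simp: z)
    show "(LINT x:\<Omega>|lebesgue. \<bar>\<psi> x\<bar> * energy_density \<Omega> V \<epsilon> u x) = (\<integral>x. \<bar>\<psi> x\<bar> * ed x \<partial>lborel)"
    proof (rule set_integral_representative[OF _ \<Omega>(1)])
      show "(\<lambda>x. \<bar>\<psi> x\<bar> * energy_density \<Omega> V \<epsilon> u x) \<in> borel_measurable (lebesgue_on \<Omega>)" unfolding energy_density_def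
        by (intro borel_measurable_times[OF cm[OF continuous_on_rabs[OF c]]] borel_measurable_add borel_measurable_divide borel_measurable_times
             borel_measurable_sum borel_measurable_power measurable_compose[OF wm borel_measurable_norm] Vum(1) borel_measurable_const)
      show "AE x in lebesgue. x \<in> \<Omega> \<longrightarrow> \<bar>\<psi> x\<bar> * energy_density \<Omega> V \<epsilon> u x = \<bar>\<psi> x\<bar> * ed x"
        using dens by eventually_elim (simp add: ed_def)
    qed (auto simp: z)
    have bnd: "integrable lborel (\<lambda>x. \<psi> x * f x)" if "f \<in> borel_measurable borel" "\<And>x. x \<in> \<Omega> \<Longrightarrow> \<bar>f x\<bar> \<le> 2 * ed x" for f
    proof (rule Bochner_Integration.integrable_bound)
      show "integrable lborel (\<lambda>x. B * (2 * ed x))" using edi by simp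
      show "(\<lambda>x. \<psi> x * f x) \<in> borel_measurable lborel" using that(1) by measurable
      show "AE x in lborel. norm (\<psi> x * f x) \<le> norm (B * (2 * ed x))"
      proof (rule AE_I2)
        fix x
        show "norm (\<psi> x * f x) \<le> norm (B * (2 * ed x))"
        proof (cases "x \<in> \<Omega>")
          case True
          have "\<bar>\<psi> x\<bar> * \<bar>f x\<bar> \<le> B * (2 * ed x)" using B that(2)[OF True] by (intro mult_mono) auto
          then show ?thesis using B(1) edn[of x] by (simp add: abs_mult)
        qed (simp add: z)
      qed
    qed
    show "integrable lborel (\<lambda>x. \<psi> x * (V (u' x) / \<epsilon>))"
    proof (rule bnd)
      show "\<bar>V (u' x) / \<epsilon>\<bar> \<le> 2 * ed x" if "x \<in> \<Omega>" for x using Vb[OF that] V0[of "u' x"] edn[of x] \<epsilon> by (simp add: abs_of_nonneg)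
    qed measurable
    show "integrable lborel (\<lambda>x. \<psi> x * (\<epsilon> * (E i x \<bullet> E j x)))" by (rule bnd) (use EEb in auto)
    have "integrable lborel (\<lambda>x. \<psi> x * ed x)" by (rule bnd) (use edn in auto)
    then have "integrable lborel (\<lambda>x. \<bar>\<psi> x * ed x\<bar>)" by simp
    then show "integrable lborel (\<lambda>x. \<bar>\<psi> x\<bar> * ed x)" using edn by (simp add: abs_mult)
  qed
  show "?ID \<phi> j" if \<phi>: "C1c \<Omega> \<phi>" for \<phi> j
  proof -
    have C1\<phi>: "C1 \<phi>" using \<phi> by (simp add: C1c_def)
    note cd = C1c_deriv[OF \<phi>]
    let ?D = "\<lambda>v x. frechet_derivative \<phi> (at x) v"
    have "\<exists>BD. \<forall>v x. \<bar>?D v x\<bar> \<le> BD v" using bt(2)[OF \<phi>] by (intro choice allI)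
    then obtain BD where BD: "\<And>v x. \<bar>?D v x\<bar> \<le> BD v" by blast
    have Dm: "?D v \<in> borel_measurable lborel" for v using borel_measurable_continuous_onI[OF cd(1)] by simp
    have iprod: "integrable lborel (\<lambda>x. ?D v x * (gr b x \<bullet> gr c x))" for v b c
      using L2_product_limit(1)[of "gr b" lborel "gr c" "\<lambda>_. gr b" "\<lambda>_. gr c" "?D v" "BD v"] gr(1,4) Dm BD by simp
    have id: "\<epsilon> * (1/2 * (\<Sum>b\<in>Basis. \<integral>x. ?D v x * (gr b x \<bullet> gr b x) \<partial>lborel)
       + (\<integral>x. ?D v x * (V (u' x) / \<epsilon>\<^sup>2) \<partial>lborel)
       - (\<Sum>b\<in>Basis. \<integral>x. ?D b x * (gr b x \<bullet> gr v x) \<partial>lborel)) = 0" if "v \<in> Basis" for v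
      using ws.stress_identity[OF \<phi> that] by simp
    have De: "?D (e i) x = (\<Sum>b\<in>Basis. (e i \<bullet> b) * ?D b x)" for i x by (rule C1_deriv_expand[OF C1\<phi>])
    \<comment> \<open>The identity along \<open>e j\<close> is the combination of the basis
      identities with the coordinates of \<open>e j\<close> as weights.\<close>
    have A: "(\<integral>x. ?D (e j) x * (V (u' x) / \<epsilon>) \<partial>lborel) = (\<Sum>v\<in>Basis. (e j \<bullet> v) * (\<epsilon> * (\<integral>x. ?D v x * (V (u' x) / \<epsilon>\<^sup>2) \<partial>lborel)))"
    proof -
      have "(\<integral>x. ?D (e j) x * (V (u' x) / \<epsilon>) \<partial>lborel) = (\<integral>x. (\<Sum>v\<in>Basis. (e j \<bullet> v) * (?D v x * (V (u' x) / \<epsilon>))) \<partial>lborel)"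
        unfolding De by (simp only: sum_distrib_right mult.assoc)
      also have "\<dots> = (\<Sum>v\<in>Basis. (e j \<bullet> v) * (\<integral>x. ?D v x * (V (u' x) / \<epsilon>) \<partial>lborel))"
        by (rule integral_sum_mult[OF int1[OF cd]])
      also have "\<dots> = (\<Sum>v\<in>Basis. (e j \<bullet> v) * (\<epsilon> * (\<integral>x. ?D v x * (V (u' x) / \<epsilon>\<^sup>2) \<partial>lborel)))"
        using \<epsilon> by (simp add: power2_eq_square field_simps)
      finally show ?thesis .
    qed
    have Bq: "(\<Sum>i\<in>UNIV. \<integral>x. ?D (e j) x * (\<epsilon> * (E i x \<bullet> E i x)) \<partial>lborel) =
       (\<Sum>v\<in>Basis. (e j \<bullet> v) * (\<epsilon> * (\<Sum>b\<in>Basis. \<integral>x. ?D v x * (gr b x \<bullet> gr b x) \<partial>lborel)))"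
    proof -
      have "(\<Sum>i\<in>UNIV. \<integral>x. ?D (e j) x * (\<epsilon> * (E i x \<bullet> E i x)) \<partial>lborel) = (\<integral>x. (\<Sum>i\<in>UNIV. ?D (e j) x * (\<epsilon> * (E i x \<bullet> E i x))) \<partial>lborel)"
        by (intro Bochner_Integration.integral_sum[symmetric] int2[OF cd])
      also have "\<dots> = (\<integral>x. (\<Sum>v\<in>Basis. (e j \<bullet> v) * (\<epsilon> * (\<Sum>b\<in>Basis. ?D v x * (gr b x \<bullet> gr b x)))) \<partial>lborel)"
      proof (intro Bochner_Integration.integral_cong refl)
        fix x
        have "(\<Sum>i\<in>UNIV. E i x \<bullet> E i x) = (\<Sum>b\<in>Basis. gr b x \<bullet> gr b x)" unfolding E_def by (rule frame_contract(2)[OF frame])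
        then have "(\<Sum>i\<in>UNIV. ?D (e j) x * (\<epsilon> * (E i x \<bullet> E i x))) = ?D (e j) x * (\<epsilon> * (\<Sum>b\<in>Basis. gr b x \<bullet> gr b x))"
          by (simp only: sum_distrib_left[symmetric])
        also have "\<dots> = (\<Sum>v\<in>Basis. (e j \<bullet> v) * (\<epsilon> * (?D v x * (\<Sum>b\<in>Basis. gr b x \<bullet> gr b x))))"
          unfolding De sum_distrib_right by (intro sum.cong refl) (simp only: mult_ac)
        finally show "(\<Sum>i\<in>UNIV. ?D (e j) x * (\<epsilon> * (E i x \<bullet> E i x))) = (\<Sum>v\<in>Basis. (e j \<bullet> v) * (\<epsilon> * (\<Sum>b\<in>Basis. ?D v x * (gr b x \<bullet> gr b x))))"
          by (simp only: sum_distrib_left[of "?D _ x"])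
      qed
      also have "\<dots> = (\<Sum>v\<in>Basis. (e j \<bullet> v) * (\<epsilon> * (\<Sum>b\<in>Basis. \<integral>x. ?D v x * (gr b x \<bullet> gr b x) \<partial>lborel)))"
      proof -
        have "(\<integral>x. (\<Sum>b\<in>Basis. ?D v x * (gr b x \<bullet> gr b x)) \<partial>lborel) = (\<Sum>b\<in>Basis. \<integral>x. ?D v x * (gr b x \<bullet> gr b x) \<partial>lborel)" for v
          by (rule Bochner_Integration.integral_sum) (rule iprod)
        moreover have "integrable lborel (\<lambda>x. \<epsilon> * (\<Sum>b\<in>Basis. ?D v x * (gr b x \<bullet> gr b x)))" for v
          by (intro integrable_mult_right Bochner_Integration.integrable_sum iprod)
        ultimately show ?thesis by (subst integral_sum_mult) (simp_all only: integral_mult_right_zero)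
      qed
      finally show ?thesis .
    qed
    \<comment> \<open>The index summed over the frame is contracted to the standard basis, while
      \<open>e j\<close> in the other slot is expanded.\<close>
    have Cq: "(\<Sum>i\<in>UNIV. \<integral>x. ?D (e i) x * (\<epsilon> * (E i x \<bullet> E j x)) \<partial>lborel) =
       (\<Sum>v\<in>Basis. (e j \<bullet> v) * (\<epsilon> * (\<Sum>b\<in>Basis. \<integral>x. ?D b x * (gr b x \<bullet> gr v x) \<partial>lborel)))"
    proof -
      have "(\<Sum>i\<in>UNIV. \<integral>x. ?D (e i) x * (\<epsilon> * (E i x \<bullet> E j x)) \<partial>lborel) = (\<integral>x. (\<Sum>i\<in>UNIV. ?D (e i) x * (\<epsilon> * (E i x \<bullet> E j x))) \<partial>lborel)"
        by (intro Bochner_Integration.integral_sum[symmetric] int2[OF cd])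
      also have "\<dots> = (\<integral>x. (\<Sum>v\<in>Basis. (e j \<bullet> v) * (\<epsilon> * (\<Sum>b\<in>Basis. ?D b x * (gr b x \<bullet> gr v x)))) \<partial>lborel)"
      proof (intro Bochner_Integration.integral_cong refl)
        fix x
        have "(\<Sum>i\<in>UNIV. ?D (e i) x * (E i x \<bullet> E j x)) = (\<Sum>b\<in>Basis. ?D b x * (gr b x \<bullet> E j x))"
          unfolding De E_def[of _ x] by (rule frame_contract(1)[OF frame])
        then have "(\<Sum>i\<in>UNIV. ?D (e i) x * (\<epsilon> * (E i x \<bullet> E j x))) = \<epsilon> * (\<Sum>b\<in>Basis. ?D b x * (gr b x \<bullet> E j x))"
          by (simp only: sum_distrib_left[symmetric] mult.left_commute[of _ \<epsilon>])
        also have "(\<Sum>b\<in>Basis. ?D b x * (gr b x \<bullet> E j x)) = (\<Sum>b\<in>Basis. \<Sum>v\<in>Basis. (e j \<bullet> v) * (?D b x * (gr b x \<bullet> gr v x)))"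
          unfolding E_def inner_sum_right inner_scaleR_right sum_distrib_left by (intro sum.cong refl) (simp only: mult_ac)
        also have "\<dots> = (\<Sum>v\<in>Basis. (e j \<bullet> v) * (\<Sum>b\<in>Basis. ?D b x * (gr b x \<bullet> gr v x)))"
          unfolding sum_distrib_left by (rule sum.swap)
        finally show "(\<Sum>i\<in>UNIV. ?D (e i) x * (\<epsilon> * (E i x \<bullet> E j x))) = (\<Sum>v\<in>Basis. (e j \<bullet> v) * (\<epsilon> * (\<Sum>b\<in>Basis. ?D b x * (gr b x \<bullet> gr v x))))"
          by (simp only: sum_distrib_left[of \<epsilon>] mult.left_commute[of \<epsilon>])
      qed
      also have "\<dots> = (\<Sum>v\<in>Basis. (e j \<bullet> v) * (\<epsilon> * (\<Sum>b\<in>Basis. \<integral>x. ?D b x * (gr b x \<bullet> gr v x) \<partial>lborel)))"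
      proof -
        have "(\<integral>x. (\<Sum>b\<in>Basis. ?D b x * (gr b x \<bullet> gr v x)) \<partial>lborel) = (\<Sum>b\<in>Basis. \<integral>x. ?D b x * (gr b x \<bullet> gr v x) \<partial>lborel)" for v
          by (rule Bochner_Integration.integral_sum) (rule iprod)
        moreover have "integrable lborel (\<lambda>x. \<epsilon> * (\<Sum>b\<in>Basis. ?D b x * (gr b x \<bullet> gr v x)))" for v
          by (intro integrable_mult_right Bochner_Integration.integrable_sum iprod)
        ultimately show ?thesis by (subst integral_sum_mult) (simp_all only: integral_mult_right_zero)
      qed
      finally show ?thesis .
    qed
    have "(\<Sum>v\<in>Basis. (e j \<bullet> v) * (\<epsilon> * (1/2 * (\<Sum>b\<in>Basis. \<integral>x. ?D v x * (gr b x \<bullet> gr b x) \<partial>lborel)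
       + (\<integral>x. ?D v x * (V (u' x) / \<epsilon>\<^sup>2) \<partial>lborel)
       - (\<Sum>b\<in>Basis. \<integral>x. ?D b x * (gr b x \<bullet> gr v x) \<partial>lborel)))) = 0"
      by (intro sum.neutral ballI) (simp only: id mult_zero_right)
    moreover have "(\<Sum>v\<in>Basis. (e j \<bullet> v) * (\<epsilon> * \<beta> v)) + 1/2 * (\<Sum>v\<in>Basis. (e j \<bullet> v) * (\<epsilon> * \<alpha> v)) - (\<Sum>v\<in>Basis. (e j \<bullet> v) * (\<epsilon> * \<gamma> v))
       = (\<Sum>v\<in>Basis. (e j \<bullet> v) * (\<epsilon> * (1/2 * \<alpha> v + \<beta> v - \<gamma> v)))" for \<alpha> \<beta> \<gamma>
      unfolding sum_distrib_left sum.distrib[symmetric] sum_subtractf[symmetric] by (intro sum.cong refl) (simp add: algebra_simps)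
    ultimately show ?thesis unfolding conv1[OF cd] conv2[OF cd] A Bq Cq by (simp only:)
  qed
  show "?B1 \<psi>" if c: "continuous_on UNIV \<psi>" "compact_support_in \<Omega> \<psi>" for \<psi>
  proof -
    have "\<bar>\<integral>x. \<psi> x * (V (u' x) / \<epsilon>) \<partial>lborel\<bar> \<le> (\<integral>x. \<bar>\<psi> x * (V (u' x) / \<epsilon>)\<bar> \<partial>lborel)" by (rule integral_abs_bound)
    also have "\<dots> \<le> (\<integral>x. \<bar>\<psi> x\<bar> * ed x \<partial>lborel)"
    proof (intro integral_mono integrable_abs int1[OF c] int3[OF c])
      fix x show "\<bar>\<psi> x * (V (u' x) / \<epsilon>)\<bar> \<le> \<bar>\<psi> x\<bar> * ed x"
      proof (cases "x \<in> \<Omega>")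
        case True then show ?thesis unfolding abs_mult using Vb[OF True] V0[of "u' x"] \<epsilon> by (intro mult_left_mono) auto
      next
        case False then have "\<psi> x = 0" using c(2) unfolding compact_support_in_def by blast
        then show ?thesis by simp
      qed
    qed
    finally show ?thesis unfolding conv1[OF c] conv3[OF c] .
  qed
  show "?B2 \<psi> i j" if c: "continuous_on UNIV \<psi>" "compact_support_in \<Omega> \<psi>" for \<psi> i j
  proof -
    have "\<bar>\<integral>x. \<psi> x * (\<epsilon> * (E i x \<bullet> E j x)) \<partial>lborel\<bar> \<le> (\<integral>x. \<bar>\<psi> x * (\<epsilon> * (E i x \<bullet> E j x))\<bar> \<partial>lborel)" by (rule integral_abs_bound)
    also have "\<dots> \<le> (\<integral>x. 2 * (\<bar>\<psi> x\<bar> * ed x) \<partial>lborel)"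
    proof (intro integral_mono integrable_abs int2[OF c])
      show "integrable lborel (\<lambda>x. 2 * (\<bar>\<psi> x\<bar> * ed x))" using int3[OF c] by simp
      fix x show "\<bar>\<psi> x * (\<epsilon> * (E i x \<bullet> E j x))\<bar> \<le> 2 * (\<bar>\<psi> x\<bar> * ed x)"
      proof (cases "x \<in> \<Omega>")
        case True
        have "\<bar>\<psi> x\<bar> * \<bar>\<epsilon> * (E i x \<bullet> E j x)\<bar> \<le> \<bar>\<psi> x\<bar> * (2 * ed x)" using EEb[OF True] by (intro mult_left_mono) auto
        then show ?thesis by (simp add: abs_mult)
      next
        case False then have "\<psi> x = 0" using c(2) unfolding compact_support_in_def by blast
        then show ?thesis by simp
      qed
    qed
    finally show ?thesis unfolding conv2[OF c] conv3[OF c] by simp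
  qed
qed

text \<open>Push-forward by the inclusion: sets are measured through their trace on the domain, so
  that all measures live on the same Borel sigma-algebra, as the lemmas on families require.\<close>

definition borel_extension :: "'a::topological_space measure \<Rightarrow> 'a measure" where
  "borel_extension M = distr M borel (\<lambda>x. x)"

lemma sets_borel_extension[simp, measurable_cong]: "sets (borel_extension M) = sets borel"
  by (simp add: borel_extension_def)

lemma
  fixes M :: "'a::topological_space measure"
  assumes M: "sets M = sets (restrict_space borel \<Omega>)"
  shows measurable_ident_restrict: "(\<lambda>x. x) \<in> measurable M borel"
    and space_restrict: "space M = \<Omega>"
    and emeasure_borel_extension: "A \<in> sets borel \<Longrightarrow> emeasure (borel_extension M) A = emeasure M (A \<inter> \<Omega>)"
    and measure_borel_extension: "A \<in> sets borel \<Longrightarrow> measure (borel_extension M) A = measure M (A \<inter> \<Omega>)"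
    and integral_borel_extension: "f \<in> borel_measurable borel \<Longrightarrow> (\<integral>x. f x \<partial>borel_extension M) = (\<integral>x. (f x :: real) \<partial>M)"
    and nn_integral_borel_extension: "g \<in> borel_measurable borel \<Longrightarrow> (\<integral>\<^sup>+x. g x \<partial>borel_extension M) = (\<integral>\<^sup>+x. g x \<partial>M)"
    and integrable_borel_extension: "f \<in> borel_measurable borel \<Longrightarrow> integrable (borel_extension M) f \<longleftrightarrow> integrable M f"
proof -
  show m: "(\<lambda>x. x) \<in> measurable M borel"
    unfolding measurable_cong_sets[OF M refl] by (rule measurable_restrict_space1) simp
  show s: "space M = \<Omega>" using sets_eq_imp_space_eq[OF M] by (simp add: space_restrict_space)
  show e: "emeasure (borel_extension M) A = emeasure M (A \<inter> \<Omega>)" if "A \<in> sets borel" for A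
    unfolding borel_extension_def using that by (subst emeasure_distr[OF m]) (auto simp: s)
  show "measure (borel_extension M) A = measure M (A \<inter> \<Omega>)" if "A \<in> sets borel" for A
    unfolding measure_def e[OF that] ..
  show "(\<integral>x. f x \<partial>borel_extension M) = (\<integral>x. f x \<partial>M)" if "f \<in> borel_measurable borel"
    unfolding borel_extension_def using that by (subst integral_distr[OF m]) auto
  show "integrable (borel_extension M) f \<longleftrightarrow> integrable M f" if "f \<in> borel_measurable borel"
    unfolding borel_extension_def using that by (subst integrable_distr_eq[OF m]) auto
  show "(\<integral>\<^sup>+x. g x \<partial>borel_extension M) = (\<integral>\<^sup>+x. g x \<partial>M)" if "g \<in> borel_measurable borel"
    unfolding borel_extension_def using that by (subst nn_integral_distr[OF m]) auto
qed

lemma borel_measurable_indicator_extension: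
  fixes f :: "'a::topological_space \<Rightarrow> real"
  assumes "sets M = sets (restrict_space borel \<Omega>)" "open \<Omega>" "f \<in> borel_measurable M"
  shows "(\<lambda>x. indicator \<Omega> x * f x) \<in> borel_measurable borel"
  using assms(2,3) borel_measurable_restrict_space_iff[of \<Omega> borel f] measurable_cong_sets[OF assms(1) refl, of borel] by auto

text \<open>A point off the set has small radii with ratio below \<open>\<eta>\<close>, so
  clearing-out gives a null ball around it; conversely a null ball contains no point of the set.
  Countably many null balls cover the complement.\<close>

lemma concentration_set_complement:
  fixes \<nu> :: "'a::euclidean_space measure"
  assumes \<Omega>: "open \<Omega>" and \<eta>: "0 < \<eta>" and \<nu>: "sets \<nu> = sets (restrict_space borel \<Omega>)"
    and clear: "\<And>x r. 0 < r \<Longrightarrow> ball x r \<subseteq> \<Omega> \<Longrightarrow> emeasure \<nu> (cball x r \<inter> \<Omega>) < ennreal (\<eta> * r) \<Longrightarrow> emeasure \<nu> (cball x (r / 2) \<inter> \<Omega>) = 0"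
  shows "open (\<Omega> - concentration_set \<Omega> \<eta> \<nu>)" "emeasure \<nu> (\<Omega> - concentration_set \<Omega> \<eta> \<nu>) = 0"
proof -
  define S where "S = concentration_set \<Omega> \<eta> \<nu>"
  have sm: "A \<inter> \<Omega> \<in> sets \<nu>" if "A \<in> sets borel" for A
    using that \<Omega> unfolding \<nu> by (auto simp: sets_restrict_space Int_commute)
  have null: "\<exists>s>0. ball x s \<subseteq> \<Omega> \<and> emeasure \<nu> (ball x s) = 0" if x: "x \<in> \<Omega> - S" for x
  proof -
    obtain d where d: "0 < d" "ball x d \<subseteq> \<Omega>" using x \<Omega> by (meson Diff_iff openE)
    have "\<not> ennreal \<eta> \<le> Liminf (at_right 0) (\<lambda>r. emeasure \<nu> (cball x r \<inter> \<Omega>) / ennreal r)"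
      using x by (simp add: S_def concentration_set_def)
    \<comment> \<open>Failure of the lower limit bound provides a level strictly below
      \<open>\<eta>\<close> that the ratio does not exceed for arbitrarily small radii.\<close>
    then obtain y where y: "y < ennreal \<eta>" and ny: "\<not> eventually (\<lambda>r. y < emeasure \<nu> (cball x r \<inter> \<Omega>) / ennreal r) (at_right 0)"
      unfolding le_Liminf_iff by blast
    obtain r where r: "0 < r" "r < d" "emeasure \<nu> (cball x r \<inter> \<Omega>) / ennreal r \<le> y"
    proof -
      have "\<not> (\<forall>r>0. r < d \<longrightarrow> y < emeasure \<nu> (cball x r \<inter> \<Omega>) / ennreal r)"
        using ny d(1) unfolding eventually_at_right_field by blast
      then obtain r where "0 < r" "r < d" "\<not> y < emeasure \<nu> (cball x r \<inter> \<Omega>) / ennreal r" by blast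
      then show ?thesis using that[of r] by (simp only: not_less)
    qed
    have ft: "y \<noteq> top" using y by (auto simp: top_unique)
    have "emeasure \<nu> (cball x r \<inter> \<Omega>) = emeasure \<nu> (cball x r \<inter> \<Omega>) / ennreal r * ennreal r"
      using r(1) by (simp add: ennreal_divide_times ennreal_mult_divide_eq)
    also have "\<dots> \<le> y * ennreal r" using r(3) by (rule mult_right_mono) simp
    also have "\<dots> < ennreal \<eta> * ennreal r" using y r(1) ft by (intro ennreal_mult_strict_right_mono) (auto simp: less_top)
    also have "\<dots> = ennreal (\<eta> * r)" using r(1) \<eta> by (simp add: ennreal_mult)
    finally have z: "emeasure \<nu> (cball x (r / 2) \<inter> \<Omega>) = 0"
      using r d(2) by (intro clear) auto
    have "ball x (r / 2) \<subseteq> \<Omega>" using r d(2) by (auto simp: subset_iff)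
    moreover have "emeasure \<nu> (ball x (r / 2)) \<le> emeasure \<nu> (cball x (r / 2) \<inter> \<Omega>)"
      using calculation by (intro emeasure_mono sm) auto
    ultimately show ?thesis using z r(1) by (intro exI[of _ "r / 2"]) auto
  qed
  have notin: "y \<notin> S" if "ball x s \<subseteq> \<Omega>" "emeasure \<nu> (ball x s) = 0" "y \<in> ball x s" for x y s
  proof
    assume "y \<in> S"
    then have "ennreal \<eta> \<le> Liminf (at_right 0) (\<lambda>r. emeasure \<nu> (cball y r \<inter> \<Omega>) / ennreal r)"
      by (simp add: S_def concentration_set_def)
    then have "eventually (\<lambda>r. 0 < emeasure \<nu> (cball y r \<inter> \<Omega>) / ennreal r) (at_right 0)"
      unfolding le_Liminf_iff using \<eta> by simp
    moreover have "0 < s - dist x y" using that(3) by simp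
    then have "eventually (\<lambda>r. r < s - dist x y) (at_right 0)" by (rule order_tendstoD(2)[OF tendsto_ident_at])
    ultimately have "eventually (\<lambda>r::real. False) (at_right 0)"
    proof eventually_elim
      case (elim r)
      have "cball y r \<inter> \<Omega> \<subseteq> ball x s"
      proof
        fix z assume "z \<in> cball y r \<inter> \<Omega>"
        then show "z \<in> ball x s" using elim(2) dist_triangle[of x z y] by simp
      qed
      then have "emeasure \<nu> (cball y r \<inter> \<Omega>) \<le> emeasure \<nu> (ball x s)"
        using sm[of "ball x s"] that(1) by (intro emeasure_mono) (auto simp: Int_absorb2)
      then show ?case using elim(1) that(2) by simp
    qed
    then show False by simp
  qed
  show op: "open (\<Omega> - concentration_set \<Omega> \<eta> \<nu>)"
    unfolding S_def[symmetric] open_contains_ball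
  proof
    fix x assume "x \<in> \<Omega> - S"
    then obtain s where s: "0 < s" "ball x s \<subseteq> \<Omega>" "emeasure \<nu> (ball x s) = 0" using null by blast
    then show "\<exists>s>0. ball x s \<subseteq> \<Omega> - S" using notin[OF s(2,3)] by blast
  qed
  define \<F> where "\<F> = {ball x s |x s. ball x s \<subseteq> \<Omega> \<and> emeasure \<nu> (ball x s) = 0}"
  obtain \<G> where \<G>: "\<G> \<subseteq> \<F>" "countable \<G>" "\<Union>\<G> = \<Union>\<F>" by (rule Lindelof[of \<F>]) (auto simp: \<F>_def)
  have "\<Union>\<G> \<in> null_sets \<nu>"
  proof -
    have "(\<Union>B\<in>\<G>. B) \<in> null_sets \<nu>"
    proof (rule null_sets_UN'[OF \<G>(2)])
      fix B assume "B \<in> \<G>"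
      then obtain x s where "B = ball x s" "ball x s \<subseteq> \<Omega>" "emeasure \<nu> (ball x s) = 0" using \<G>(1) unfolding \<F>_def by blast
      then show "B \<in> null_sets \<nu>" using sm[of "ball x s"] by (auto simp: null_sets_def Int_absorb2)
    qed
    then show ?thesis by simp
  qed
  then have "emeasure \<nu> (\<Union>\<G>) = 0" "\<Union>\<G> \<in> sets \<nu>" by auto
  moreover have "\<Omega> - S \<subseteq> \<Union>\<G>"
  proof
    fix x assume "x \<in> \<Omega> - S"
    then obtain s where s: "0 < s" "ball x s \<subseteq> \<Omega>" "emeasure \<nu> (ball x s) = 0" using null by blast
    then have "ball x s \<in> \<F>" unfolding \<F>_def by blast
    then show "x \<in> \<Union>\<G>" unfolding \<G>(3) using s(1) by (intro UnionI[of "ball x s"]) simp_all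
  qed
  ultimately have "emeasure \<nu> (\<Omega> - S) \<le> 0" using emeasure_mono[of "\<Omega> - S" "\<Union>\<G>" \<nu>] by simp
  then show "emeasure \<nu> (\<Omega> - concentration_set \<Omega> \<eta> \<nu>) = 0" by (simp add: S_def)
qed

text \<open>The two extra members of the family are the positive and negative parts of \<open>a l\<close>.\<close>

lemma family_density:
  fixes P :: "nat \<Rightarrow> 'a::euclidean_space measure" and l :: "'a measure"
  assumes \<Omega>: "open \<Omega>" and S: "S \<in> sets borel" and K: "compact K" "K \<subseteq> \<Omega>"
    and P: "\<And>i. i < k \<Longrightarrow> sets (P i) = sets borel" "\<And>i. i < k \<Longrightarrow> emeasure (P i) K < \<infinity>"
    and l: "sets l = sets borel" and a: "integrable l a"
    and null: "\<And>D. hausdorff1 D = 0 \<Longrightarrow> D \<in> sets borel \<Longrightarrow> D \<subseteq> \<Omega> \<Longrightarrow> (\<And>i. i < k \<Longrightarrow> emeasure (P i) D < \<infinity>) \<Longrightarrow> (\<Sum>i<k. c i * measure (P i) D) = 0"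
    and off: "\<And>D. D \<in> sets borel \<Longrightarrow> D \<subseteq> \<Omega> - S \<Longrightarrow> (\<And>i. i < k \<Longrightarrow> emeasure (P i) D < \<infinity>) \<Longrightarrow> (\<Sum>i<k. c i * measure (P i) D) = 0"
    and N: "N \<in> sets borel" "hausdorff1 (N \<inter> S) = 0" "N \<subseteq> \<Omega>"
    and dens: "\<And>D. D \<in> sets borel \<Longrightarrow> D \<subseteq> \<Omega> - N \<Longrightarrow> (\<And>i. i < k \<Longrightarrow> emeasure (P i) D < \<infinity>) \<Longrightarrow> (\<Sum>i<k. c i * measure (P i) D) = (LINT x:D|l. a x)"
    and lS: "\<And>A. A \<in> sets borel \<Longrightarrow> A \<subseteq> \<Omega> \<Longrightarrow> emeasure l A = hausdorff1 (A \<inter> S)"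
    and f: "f \<in> borel_measurable borel" "\<And>x. \<bar>f x\<bar> \<le> B" "\<And>x. x \<notin> K \<Longrightarrow> f x = 0"
  shows "(\<Sum>i<k. c i * (LINT x|P i. f x)) = (LINT x|l. f x * a x)"
proof -
  have Kb: "K \<in> sets borel" using K(1) by (simp add: borel_compact)
  have am[measurable]: "a \<in> borel_measurable borel" using a borel_measurable_integrable[OF a] measurable_cong_sets[OF l refl] by blast
  define Lp where "Lp = density l (\<lambda>x. ennreal (a x))"
  define Ln where "Ln = density l (\<lambda>x. ennreal (- a x))"
  have fin: "(\<integral>\<^sup>+x. ennreal (a x) \<partial>l) < \<infinity>" "(\<integral>\<^sup>+x. ennreal (- a x) \<partial>l) < \<infinity>"
    using integrableD[OF a] by (auto simp: less_top)
  have pm: "(\<lambda>x. max 0 (a x)) \<in> borel_measurable l" "(\<lambda>x. max 0 (- a x)) \<in> borel_measurable l"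
    unfolding measurable_cong_sets[OF l refl] by measurable
  have mx: "ennreal (a x) = ennreal (max 0 (a x))" "ennreal (- a x) = ennreal (max 0 (- a x))" for x by (simp_all add: max_def ennreal_neg)
  have pi: "integrable l (\<lambda>x. max 0 (a x))" "integrable l (\<lambda>x. max 0 (- a x))" using a by (auto intro: integrable_max)
  have Leq: "(LINT x|Lp. g x) - (LINT x|Ln. g x) = (LINT x|l. g x * a x)"
    if g: "g \<in> borel_measurable borel" "\<And>x. \<bar>g x\<bar> \<le> C" for g :: "'a \<Rightarrow> real" and C
  proof -
    have gm: "g \<in> borel_measurable l" unfolding measurable_cong_sets[OF l refl] by (rule g(1))
    have bi: "integrable l (\<lambda>x. h x * g x)" if "integrable l h" for h
    proof (rule Bochner_Integration.integrable_bound)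
      show "integrable l (\<lambda>x. C * h x)" using that by simp
      show "(\<lambda>x. h x * g x) \<in> borel_measurable l" using that gm by measurable
      have "\<bar>h x\<bar> * \<bar>g x\<bar> \<le> \<bar>h x\<bar> * \<bar>C\<bar>" for x
        by (rule mult_left_mono[OF order_trans[OF g(2) abs_ge_self]]) simp
      then show "AE x in l. norm (h x * g x) \<le> norm (C * h x)"
        by (intro AE_I2) (simp add: abs_mult mult.commute[of "\<bar>C\<bar>"])
    qed
    have "(LINT x|Lp. g x) = (LINT x|l. max 0 (a x) * g x)" "(LINT x|Ln. g x) = (LINT x|l. max 0 (- a x) * g x)"
      unfolding Lp_def Ln_def mx using integral_density[OF gm pm(1)] integral_density[OF gm pm(2)] by auto
    then have "(LINT x|Lp. g x) - (LINT x|Ln. g x) = (LINT x|l. max 0 (a x) * g x - max 0 (- a x) * g x)"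
      using bi[OF pi(1)] bi[OF pi(2)] by simp
    also have "\<dots> = (LINT x|l. g x * a x)" by (intro Bochner_Integration.integral_cong refl) (simp add: max_def)
    finally show ?thesis .
  qed
  have Lf: "emeasure Lp A < \<infinity>" "emeasure Ln A < \<infinity>" "sets Lp = sets borel" "sets Ln = sets borel" for A
  proof -
    have "emeasure Lp A \<le> emeasure Lp (space Lp)" "emeasure Ln A \<le> emeasure Ln (space Ln)" by (rule emeasure_space)+
    moreover have "emeasure Lp (space Lp) < \<infinity>" "emeasure Ln (space Ln) < \<infinity>"
      using fin pm by (auto simp: Lp_def Ln_def emeasure_density mx cong: nn_integral_cong)
    ultimately show "emeasure Lp A < \<infinity>" "emeasure Ln A < \<infinity>" by (auto intro: le_less_trans)
    show "sets Lp = sets borel" "sets Ln = sets borel" by (simp_all add: Lp_def Ln_def l)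
  qed
  define P' where "P' i = (if i < k then P i else if i = k then Lp else Ln)" for i
  define c' where "c' i = (if i < k then c i else if i = k then - 1 else 1)" for i :: nat
  have sum': "(\<Sum>i<Suc (Suc k). c' i * g (P' i)) = (\<Sum>i<k. c i * g (P i)) - g Lp + g Ln" for g :: "'a measure \<Rightarrow> real"
    by (simp add: c'_def P'_def)
  have "(\<Sum>i<Suc (Suc k). c' i * (LINT x|P' i. f x)) = 0"
  proof (rule signed_family_bounded_borel[OF _ _ _ Kb _ f])
    show "sets (P' i) = sets borel" if "i \<in> {..<Suc (Suc k)}" for i using that P Lf by (auto simp: P'_def)
    show "emeasure (P' i) K < \<infinity>" if "i \<in> {..<Suc (Suc k)}" for i using that P Lf by (auto simp: P'_def)
    fix D assume D: "D \<in> sets borel" "D \<subseteq> K"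
    have LD: "measure Lp E - measure Ln E = (LINT x:E|l. a x)" if "E \<in> sets borel" for E
    proof -
      have "space Lp = UNIV" "space Ln = UNIV" using sets_eq_imp_space_eq[OF Lf(3)] sets_eq_imp_space_eq[OF Lf(4)] by simp_all
      then have "(LINT x|Lp. indicator E x :: real) = measure Lp E" "(LINT x|Ln. indicator E x :: real) = measure Ln E" by simp_all
      moreover have "(LINT x|Lp. indicator E x) - (LINT x|Ln. indicator E x) = (LINT x|l. indicator E x * a x)"
        using that by (intro Leq[of _ 1]) (auto simp: indicator_def)
      ultimately show ?thesis by (simp add: set_lebesgue_integral_def)
    qed
    have fD: "emeasure (P i) E < \<infinity>" if "i < k" "E \<subseteq> D" for i E
      using that D(2) P Kb by (intro le_less_trans[OF emeasure_mono P(2)]) auto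
    \<comment> \<open>\<open>N\<close> is known to be null only along \<open>S\<close>. So
      \<open>D1\<close> is null for the Hausdorff measure, \<open>D2\<close> lies off
      \<open>S\<close>, and the density formula is used on \<open>D3\<close> alone.\<close>
    define D1 D2 D3 where "D1 = D \<inter> N \<inter> S" and "D2 = D - S" and "D3 = D \<inter> S - N"
    have Db: "D1 \<in> sets borel" "D2 \<in> sets borel" "D3 \<in> sets borel" using D(1) S N(1) by (auto simp: D1_def D2_def D3_def)
    have Deq: "D = D1 \<union> D2 \<union> D3" and dj: "D1 \<inter> D2 = {}" "(D1 \<union> D2) \<inter> D3 = {}" and sub: "D1 \<subseteq> D" "D2 \<subseteq> D" "D3 \<subseteq> D"
      by (auto simp: D1_def D2_def D3_def)
    have D\<Omega>: "D \<subseteq> \<Omega>" using D(2) K(2) by auto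
    have h1: "hausdorff1 D1 = 0" using hausdorff1_mono[of D1 "N \<inter> S"] N(2) by (auto simp: D1_def)
    have split: "measure M D = measure M D1 + measure M D2 + measure M D3" if "sets M = sets borel" "emeasure M D < \<infinity>" for M
    proof -
      have fm: "emeasure M E \<noteq> \<infinity>" if "E \<subseteq> D" for E using \<open>emeasure M D < \<infinity>\<close> emeasure_mono[OF that, of M] D(1) \<open>sets M = _\<close> by (auto simp: top_unique)
      have "measure M (D1 \<union> D2 \<union> D3) = measure M (D1 \<union> D2) + measure M D3"
        using Db dj fm Deq that by (intro measure_Union) auto
      also have "measure M (D1 \<union> D2) = measure M D1 + measure M D2"
        using Db dj fm Deq that by (intro measure_Union) auto
      finally show ?thesis using Deq by simp
    qed
    have nullint: "(LINT x:E|l. a x) = 0" if "E \<in> sets borel" "emeasure l E = 0" for E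
    proof -
      have "AE x in l. x \<notin> E" using that l by (intro AE_not_in) (auto simp: null_sets_def)
      then have "AE x in l. indicator E x *\<^sub>R a x = 0" by eventually_elim simp
      then show ?thesis unfolding set_lebesgue_integral_def by (rule integral_eq_zero_AE)
    qed
    have "(\<Sum>i<k. c i * measure (P i) D) = (\<Sum>i<k. c i * measure (P i) D1) + (\<Sum>i<k. c i * measure (P i) D2) + (\<Sum>i<k. c i * measure (P i) D3)"
      using split[OF P(1) fD[OF _ subset_refl]] by (simp add: distrib_left sum.distrib)
    also have "(\<Sum>i<k. c i * measure (P i) D1) = 0" using h1 Db sub D\<Omega> fD by (intro null) auto
    also have "(\<Sum>i<k. c i * measure (P i) D2) = 0" using Db sub D\<Omega> fD by (intro off) (auto simp: D2_def)
    also have "(\<Sum>i<k. c i * measure (P i) D3) = (LINT x:D3|l. a x)" using Db sub D\<Omega> fD by (intro dens) (auto simp: D3_def)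
    also have "(LINT x:D3|l. a x) = measure Lp D3 - measure Ln D3" using LD[OF Db(3)] by simp
    \<comment> \<open>\<open>l\<close> charges neither \<open>D1\<close> nor \<open>D2\<close>, so
      passing from \<open>D3\<close> to \<open>D\<close> changes nothing.\<close>
    also have "\<dots> = measure Lp D - measure Ln D"
    proof -
      have "emeasure l D1 = 0" using lS[OF Db(1) subset_trans[OF sub(1) D\<Omega>]] h1 by (simp add: D1_def Int_assoc)
      moreover have "D2 \<inter> S = {}" by (auto simp: D2_def)
      then have "emeasure l D2 = 0" using lS[OF Db(2) subset_trans[OF sub(2) D\<Omega>]] hausdorff1_mono[of "{}" D1] h1 by simp
      ultimately have "measure Lp D1 - measure Ln D1 = 0" "measure Lp D2 - measure Ln D2 = 0"
        using LD Db nullint by simp_all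
      then show ?thesis using split[OF Lf(3,1)] split[OF Lf(4,2)] by simp
    qed
    finally show "(\<Sum>i<Suc (Suc k). c' i * measure (P' i) D) = 0" unfolding sum'[of "\<lambda>M. measure M D"] by simp
  qed simp
  then show ?thesis using Leq[OF f(1,2)] unfolding sum'[of "\<lambda>M. LINT x|M. f x"] by simp
qed

text \<open>In the plane a unit vector orthogonal to \<open>p\<close> is \<open>perp p\<close> up to
  a sign, the determinant \<open>s\<close> of the pair.\<close>

lemma frame_perp:
  fixes p q z :: "real^2"
  assumes "p \<bullet> p = 1" "q \<bullet> q = 1" "p \<bullet> q = 0"
  shows "\<bar>perp p \<bullet> z\<bar> = \<bar>q \<bullet> z\<bar>"
proof -
  define a b c d where "a = p $ 1" and "b = p $ 2" and "c = q $ 1" and "d = q $ 2"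
  have h: "a * a + b * b = 1" "c * c + d * d = 1" "a * c + b * d = 0"
    using assms by (simp_all add: inner_vec_def sum_2 a_def b_def c_def d_def)
  define s where "s = a * d - b * c"
  have "s * s = 1" using h unfolding s_def by algebra
  then have "\<bar>s\<bar> = 1" by (metis abs_mult_self_eq abs_one abs_mult abs_square_eq_1 power2_eq_square)
  moreover have "c = s * (- b)" "d = s * a" using h unfolding s_def by algebra+
  then have "q \<bullet> z = s * (perp p \<bullet> z)"
    by (simp add: inner_vec_def sum_2 perp_def c_def[symmetric] d_def[symmetric] a_def[symmetric] b_def[symmetric] algebra_simps)
  ultimately show ?thesis by (simp add: abs_mult)
qed

text \<open>Each fact is stable under convergence of integrals against continuous compactly
  supported functions, and derivatives of C1 test functions are of this kind. Symmetry is inherited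
  from the products before the limit.\<close>

lemma limit_stress:
  fixes \<Omega> :: "(real^2) set" and V :: "'b::euclidean_space \<Rightarrow> real" and e :: "2 \<Rightarrow> real^2"
  assumes \<Omega>: "open \<Omega>" "bounded \<Omega>" and potential: "multi_well_potential V"
    and eps: "\<And>n. 0 < \<epsilon> n" and sol: "\<And>n. weak_solution \<Omega> V (\<epsilon> n) (u n)" and en: "\<And>n. energy \<Omega> V (\<epsilon> n) (u n) < \<infinity>"
    and frame: "\<And>i j. e i \<bullet> e j = (if i = j then 1 else 0)"
    and conv_nu: "weak_limit_measure \<Omega> (\<lambda>n. energy_density \<Omega> V (\<epsilon> n) (u n)) \<nu>"
    and conv_zeta: "weak_limit_measure \<Omega> (\<lambda>n x. V (u n x) / \<epsilon> n) \<zeta>"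
    and conv_mu: "\<And>i j. weak_limit_signed \<Omega>
          (\<lambda>n x. \<epsilon> n * (weak_deriv \<Omega> (e i) (u n) x \<bullet> weak_deriv \<Omega> (e j) (u n) x)) (\<mu> i j)"
  shows "\<And>\<phi> j. C1c \<Omega> \<phi> \<Longrightarrow> (LINT x|\<zeta>. frechet_derivative \<phi> (at x) (e j))
      + 1/2 * (\<Sum>i\<in>UNIV. sintegral (\<mu> i i) (\<lambda>x. frechet_derivative \<phi> (at x) (e j)))
      - (\<Sum>i\<in>UNIV. sintegral (\<mu> i j) (\<lambda>x. frechet_derivative \<phi> (at x) (e i))) = 0"
    and "\<And>\<psi> :: real^2 \<Rightarrow> real. continuous_on UNIV \<psi> \<Longrightarrow> compact_support_in \<Omega> \<psi> \<Longrightarrow> \<bar>LINT x|\<zeta>. \<psi> x\<bar> \<le> (LINT x|\<nu>. \<bar>\<psi> x\<bar>)"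
    and "\<And>\<psi> i j. continuous_on UNIV \<psi> \<Longrightarrow> compact_support_in \<Omega> \<psi> \<Longrightarrow> \<bar>sintegral (\<mu> i j) \<psi>\<bar> \<le> 2 * (LINT x|\<nu>. \<bar>\<psi> x\<bar>)"
    and "\<And>\<psi> i j. continuous_on UNIV \<psi> \<Longrightarrow> compact_support_in \<Omega> \<psi> \<Longrightarrow> sintegral (\<mu> i j) \<psi> = sintegral (\<mu> j i) \<psi>"
proof -
  note facts = weak_solution_facts[OF \<Omega> potential eps sol en frame]
  have Tz: "(\<lambda>n. LINT x:\<Omega>|lebesgue. \<psi> x * (V (u n x) / \<epsilon> n)) \<longlonglongrightarrow> (LINT x|\<zeta>. \<psi> x)"
    and Tn: "(\<lambda>n. LINT x:\<Omega>|lebesgue. \<psi> x * energy_density \<Omega> V (\<epsilon> n) (u n) x) \<longlonglongrightarrow> (LINT x|\<nu>. \<psi> x)"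
    and Tm: "(\<lambda>n. LINT x:\<Omega>|lebesgue. \<psi> x * (\<epsilon> n * (weak_deriv \<Omega> (e i) (u n) x \<bullet> weak_deriv \<Omega> (e j) (u n) x))) \<longlonglongrightarrow> sintegral (\<mu> i j) \<psi>"
    if "continuous_on UNIV \<psi>" "compact_support_in \<Omega> \<psi>" for \<psi> :: "real^2 \<Rightarrow> real" and i j
    using conv_zeta conv_nu conv_mu[of i j] that unfolding weak_limit_measure_def weak_limit_signed_def by auto
  have abs: "continuous_on UNIV (\<lambda>x. \<bar>\<psi> x\<bar>)" "compact_support_in \<Omega> (\<lambda>x. \<bar>\<psi> x\<bar>)"
    if "continuous_on UNIV \<psi>" "compact_support_in \<Omega> \<psi>" for \<psi> :: "real^2 \<Rightarrow> real"
    using that by (auto intro: continuous_on_rabs simp: compact_support_in_def)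
  show "(LINT x|\<zeta>. frechet_derivative \<phi> (at x) (e j))
      + 1/2 * (\<Sum>i\<in>UNIV. sintegral (\<mu> i i) (\<lambda>x. frechet_derivative \<phi> (at x) (e j)))
      - (\<Sum>i\<in>UNIV. sintegral (\<mu> i j) (\<lambda>x. frechet_derivative \<phi> (at x) (e i))) = 0" (is "?L = 0") if \<phi>: "C1c \<Omega> \<phi>" for \<phi> j
  proof -
    note cd = C1c_deriv[OF \<phi>]
    have "(\<lambda>n. (LINT x:\<Omega>|lebesgue. frechet_derivative \<phi> (at x) (e j) * (V (u n x) / \<epsilon> n))
      + 1/2 * (\<Sum>i\<in>UNIV. LINT x:\<Omega>|lebesgue. frechet_derivative \<phi> (at x) (e j) * (\<epsilon> n * (weak_deriv \<Omega> (e i) (u n) x \<bullet> weak_deriv \<Omega> (e i) (u n) x)))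
      - (\<Sum>i\<in>UNIV. LINT x:\<Omega>|lebesgue. frechet_derivative \<phi> (at x) (e i) * (\<epsilon> n * (weak_deriv \<Omega> (e i) (u n) x \<bullet> weak_deriv \<Omega> (e j) (u n) x))))
      \<longlonglongrightarrow> ?L"
      by (intro tendsto_diff tendsto_add tendsto_mult tendsto_const tendsto_sum Tz Tm cd)
    then show ?thesis unfolding facts(1)[OF \<phi>] by (simp add: LIMSEQ_const_iff)
  qed
  show "\<bar>LINT x|\<zeta>. \<psi> x\<bar> \<le> (LINT x|\<nu>. \<bar>\<psi> x\<bar>)" if c: "continuous_on UNIV \<psi>" "compact_support_in \<Omega> \<psi>" for \<psi> :: "real^2 \<Rightarrow> real"
    by (rule LIMSEQ_le[OF tendsto_rabs[OF Tz[OF c]] Tn[OF abs[OF c]]]) (use facts(2)[OF c] in blast)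
  show "\<bar>sintegral (\<mu> i j) \<psi>\<bar> \<le> 2 * (LINT x|\<nu>. \<bar>\<psi> x\<bar>)" if c: "continuous_on UNIV \<psi>" "compact_support_in \<Omega> \<psi>" for \<psi> i j
    by (rule LIMSEQ_le[OF tendsto_rabs[OF Tm[OF c]] tendsto_mult[OF tendsto_const Tn[OF abs[OF c]]]]) (use facts(3)[OF c] in blast)
  show "sintegral (\<mu> i j) \<psi> = sintegral (\<mu> j i) \<psi>" if c: "continuous_on UNIV \<psi>" "compact_support_in \<Omega> \<psi>" for \<psi> i j
    using LIMSEQ_unique[OF Tm[OF c, of i j]] Tm[OF c, of j i] by (simp only: inner_commute[of "weak_deriv \<Omega> (e i) _ _"])
qed

lemma restricted_density:
  fixes lam :: "'a::euclidean_space measure" and f :: "'a \<Rightarrow> real"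
  assumes lam: "sets lam = sets (restrict_space borel \<Omega>)" and \<Omega>: "open \<Omega>" and f: "integrable lam f"
  defines "g \<equiv> \<lambda>x. indicator \<Omega> x * f x"
  shows "integrable (borel_extension lam) g"
    and "D \<in> sets borel \<Longrightarrow> D \<subseteq> \<Omega> \<Longrightarrow> (LINT x:D|borel_extension lam. g x) = (LINT x:D|lam. f x)"
proof -
  have gm: "g \<in> borel_measurable borel" unfolding g_def
    by (rule borel_measurable_indicator_extension[OF lam \<Omega> borel_measurable_integrable[OF f]])
  have eq: "g x = f x" if "x \<in> space lam" for x using that space_restrict[OF lam] by (simp add: g_def)
  show "integrable (borel_extension lam) g"
    unfolding integrable_borel_extension[OF lam gm] using f by (subst Bochner_Integration.integrable_cong[OF refl eq]) auto
  show "(LINT x:D|borel_extension lam. g x) = (LINT x:D|lam. f x)" if "D \<in> sets borel" "D \<subseteq> \<Omega>"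
    unfolding set_lebesgue_integral_def using gm that
    by (subst integral_borel_extension[OF lam]) (auto intro!: Bochner_Integration.integral_cong simp: eq)
qed

text \<open>The singular part sits on a null set, and off it the measure is given by its density.
  Only this is extracted; on the null set the divergence law takes over.\<close>

lemma lebesgue_decomp_extension:
  fixes lam \<zeta> :: "'a::euclidean_space measure"
  assumes lam: "sets lam = sets (restrict_space borel \<Omega>)" and \<zeta>: "sets \<zeta> = sets (restrict_space borel \<Omega>)" and \<Omega>: "open \<Omega>"
    and dec: "lebesgue_decomp lam \<zeta> f \<zeta>s"
  shows "\<exists>N. N \<in> sets borel \<and> N \<subseteq> \<Omega> \<and> emeasure (borel_extension lam) N = 0 \<and>
    (\<forall>D. D \<in> sets borel \<and> D \<subseteq> \<Omega> - N \<longrightarrow> measure (borel_extension \<zeta>) D = (LINT x:D|borel_extension lam. indicator \<Omega> x * f x))"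
proof -
  have f: "integrable lam f" "AE x in lam. 0 \<le> f x" using dec by (auto simp: lebesgue_decomp_def)
  obtain N where N: "N \<in> sets lam" "emeasure lam N = 0" "measure_vanishes_on \<zeta>s (space lam - N)"
    using dec by (auto simp: lebesgue_decomp_def)
  have s: "D \<in> sets lam" if "D \<in> sets borel" "D \<subseteq> \<Omega>" for D
    using that \<Omega> unfolding lam by (auto simp: sets_restrict_space_iff)
  have Nb: "N \<in> sets borel" "N \<subseteq> \<Omega>" using N(1) \<Omega> unfolding lam by (auto simp: sets_restrict_space_iff)
  show ?thesis
  proof (intro exI[of _ N] conjI allI impI)
    show "emeasure (borel_extension lam) N = 0"
      using N(2) Nb by (simp add: emeasure_borel_extension[OF lam] Int_absorb2)
    fix D assume "D \<in> sets borel \<and> D \<subseteq> \<Omega> - N"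
    then have D: "D \<in> sets borel" "D \<subseteq> \<Omega> - N" by auto
    have Ds: "D \<in> sets lam" "D \<subseteq> \<Omega>" using s D by auto
    have "emeasure \<zeta>s D = 0" using N(3) D Ds(1) dec space_restrict[OF lam] unfolding measure_vanishes_on_def lebesgue_decomp_def by blast
    then have e: "emeasure \<zeta> D = (\<integral>\<^sup>+x\<in>D. ennreal (f x) \<partial>lam)" using dec Ds(1) by (simp add: lebesgue_decomp_def)
    have "(LINT x:D|lam. f x) = enn2real (\<integral>\<^sup>+x. ennreal (indicator D x *\<^sub>R f x) \<partial>lam)"
      unfolding set_lebesgue_integral_def
    proof (rule integral_eq_nn_integral)
      show "(\<lambda>x. indicator D x *\<^sub>R f x) \<in> borel_measurable lam" using f(1) Ds(1) by (intro borel_measurable_scaleR borel_measurable_indicator) auto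
      show "AE x in lam. 0 \<le> indicator D x *\<^sub>R f x" using f(2) by eventually_elim (simp add: indicator_def)
    qed
    also have "(\<integral>\<^sup>+x. ennreal (indicator D x *\<^sub>R f x) \<partial>lam) = emeasure \<zeta> D"
      unfolding e by (intro nn_integral_cong) (simp add: indicator_def)
    finally show "measure (borel_extension \<zeta>) D = (LINT x:D|borel_extension lam. indicator \<Omega> x * f x)"
      by (simp only: restricted_density(2)[OF lam \<Omega> f(1) D(1) Ds(2)] measure_borel_extension[OF \<zeta> D(1)] Int_absorb2[OF Ds(2)])
        (simp only: measure_def)
  qed (use Nb in auto)
qed

lemma signed_lebesgue_decomp_extension:
  fixes lam :: "'a::euclidean_space measure" and \<mu> :: "'a signed_measure"
  assumes lam: "sets lam = sets (restrict_space borel \<Omega>)" and \<mu>: "signed_measure_on \<Omega> \<mu>" and \<Omega>: "open \<Omega>"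
    and dec: "signed_lebesgue_decomp \<Omega> lam \<mu> f \<mu>s"
  shows "\<exists>N. N \<in> sets borel \<and> N \<subseteq> \<Omega> \<and> emeasure (borel_extension lam) N = 0 \<and>
    (\<forall>D. D \<in> sets borel \<and> D \<subseteq> \<Omega> - N \<longrightarrow>
      measure (borel_extension (fst \<mu>)) D - measure (borel_extension (snd \<mu>)) D = (LINT x:D|borel_extension lam. indicator \<Omega> x * f x))"
proof -
  have f: "integrable lam f" and \<mu>s: "signed_measure_on \<Omega> \<mu>s" using dec by (auto simp: signed_lebesgue_decomp_def)
  obtain N where N: "N \<in> sets lam" "emeasure lam N = 0" "signed_vanishes_on \<mu>s (space lam - N)"
    using dec by (auto simp: signed_lebesgue_decomp_def)
  have s: "D \<in> sets lam" if "D \<in> sets borel" "D \<subseteq> \<Omega>" for D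
    using that \<Omega> unfolding lam by (auto simp: sets_restrict_space_iff)
  have Nb: "N \<in> sets borel" "N \<subseteq> \<Omega>" using N(1) \<Omega> unfolding lam by (auto simp: sets_restrict_space_iff)
  have ms: "sets (fst \<mu>) = sets (restrict_space borel \<Omega>)" "sets (snd \<mu>) = sets (restrict_space borel \<Omega>)" "sets (fst \<mu>s) = sets lam"
    using \<mu> \<mu>s lam by (auto simp: signed_measure_on_def)
  show ?thesis
  proof (intro exI[of _ N] conjI allI impI)
    show "emeasure (borel_extension lam) N = 0"
      using N(2) Nb by (simp add: emeasure_borel_extension[OF lam] Int_absorb2)
    fix D assume "D \<in> sets borel \<and> D \<subseteq> \<Omega> - N"
    then have D: "D \<in> sets borel" "D \<subseteq> \<Omega> - N" by auto
    have Ds: "D \<in> sets lam" "D \<subseteq> \<Omega>" using s D by auto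
    have "smeasure \<mu>s D = 0" using N(3) D Ds(1) ms(3) space_restrict[OF lam] unfolding signed_vanishes_on_def by blast
    then have "smeasure \<mu> D = (LINT x:D|lam. f x)" using dec Ds(1) by (simp add: signed_lebesgue_decomp_def)
    then show "measure (borel_extension (fst \<mu>)) D - measure (borel_extension (snd \<mu>)) D = (LINT x:D|borel_extension lam. indicator \<Omega> x * f x)"
      using D(1) Ds(2)
      by (simp add: restricted_density(2)[OF lam \<Omega> f D(1) Ds(2)] measure_borel_extension[OF ms(1)] measure_borel_extension[OF ms(2)] smeasure_def Int_absorb2)
  qed (use Nb in auto)
qed

section \<open>Asymptotics in small disks\<close>

lemma ratio_tendsto_zero:
  assumes "((\<lambda>r. F r / ennreal r) \<longlongrightarrow> 0) (at_right 0)" and t: "0 < t"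
  shows "eventually (\<lambda>r. F r \<le> ennreal (t * r)) (at_right 0)"
proof -
  have "eventually (\<lambda>r. F r / ennreal r < ennreal t) (at_right 0)" using assms(1) by (rule order_tendstoD) (simp add: t)
  moreover have "eventually (\<lambda>r::real. 0 < r) (at_right 0)" by (rule eventually_at_right_less)
  ultimately show ?thesis
  proof eventually_elim
    case (elim r)
    have "F r = F r / ennreal r * ennreal r" using elim(2) by (simp add: ennreal_divide_times ennreal_mult_divide_eq)
    also have "\<dots> \<le> ennreal t * ennreal r" using elim(1) by (intro mult_right_mono) auto
    finally show ?case using t elim(2) by (simp add: ennreal_mult)
  qed
qed

text \<open>The restricted measure charges nothing off \<open>S\<close>, so the integral over the
  part of the disk in \<open>S\<close> is the integral of the extended density over the full
  disk.\<close>

lemma lebesgue_point_extension: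
  fixes lam :: "(real^2) measure"
  assumes lam: "sets lam = sets (restrict_space borel \<Omega>)" and \<Omega>: "open \<Omega>" and f: "integrable lam f"
    and S: "S \<in> sets borel" "S \<subseteq> \<Omega>" "emeasure lam (\<Omega> - S) = 0" and x: "x \<in> S" and pt: "lebesgue_point lam S f x" and t: "0 < t"
  shows "eventually (\<lambda>r. (\<integral>\<^sup>+y\<in>ball x r. ennreal \<bar>indicator \<Omega> y * f y - indicator \<Omega> x * f x\<bar> \<partial>borel_extension lam) \<le> ennreal (t * r)) (at_right 0)"
proof -
  have gm[measurable]: "(\<lambda>x. indicator \<Omega> x * f x) \<in> borel_measurable borel"
    by (rule borel_measurable_indicator_extension[OF lam \<Omega> borel_measurable_integrable[OF f]])
  have "\<Omega> - S \<in> null_sets lam" using S \<Omega> by (auto simp: null_sets_def lam sets_restrict_space_iff)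
  then have AE: "AE y in lam. y \<notin> \<Omega> - S" by (rule AE_not_in)
  have "(\<integral>\<^sup>+y\<in>ball x r. ennreal \<bar>indicator \<Omega> y * f y - indicator \<Omega> x * f x\<bar> \<partial>borel_extension lam)
     = (\<integral>\<^sup>+y\<in>S \<inter> ball x r. ennreal \<bar>f y - f x\<bar> \<partial>lam)" for r
  proof -
    have "(\<integral>\<^sup>+y\<in>ball x r. ennreal \<bar>indicator \<Omega> y * f y - indicator \<Omega> x * f x\<bar> \<partial>borel_extension lam)
      = (\<integral>\<^sup>+y\<in>ball x r. ennreal \<bar>indicator \<Omega> y * f y - indicator \<Omega> x * f x\<bar> \<partial>lam)"
      by (intro nn_integral_borel_extension[OF lam] borel_measurable_times_ennreal measurable_compose[OF _ measurable_ennreal]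
           borel_measurable_abs borel_measurable_diff gm borel_measurable_const borel_measurable_indicator) simp
    also have "\<dots> = (\<integral>\<^sup>+y\<in>S \<inter> ball x r. ennreal \<bar>f y - f x\<bar> \<partial>lam)"
    proof (rule nn_integral_cong_AE)
      show "AE y in lam. ennreal \<bar>indicator \<Omega> y * f y - indicator \<Omega> x * f x\<bar> * indicator (ball x r) y = ennreal \<bar>f y - f x\<bar> * indicator (S \<inter> ball x r) y"
        using AE AE_space
      proof eventually_elim
        case (elim y)
        then have "y \<in> S" "y \<in> \<Omega>" using space_restrict[OF lam] by auto
        then show ?case using x S(2) by (auto simp: indicator_def)
      qed
    qed
    finally show ?thesis .
  qed
  then show ?thesis using ratio_tendsto_zero[OF pt[unfolded lebesgue_point_def] t] by simp
qed

text \<open>Thresholds 3/2 and 1/2 on the two sides of the limit 1, multiplied by the diameters 2r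
  and r of the disks of radii r and r/2.\<close>

lemma unit_density_bounds:
  assumes "unit_density_at S x"
  shows "eventually (\<lambda>r. hausdorff1 (S \<inter> ball x r) \<le> ennreal (3 * r) \<and> ennreal (r / 2) \<le> hausdorff1 (S \<inter> ball x (r / 2))) (at_right 0)"
proof -
  have lim: "((\<lambda>r. hausdorff1 (S \<inter> ball x r) / ennreal (2 * r)) \<longlongrightarrow> 1) (at_right 0)" using assms by (simp add: unit_density_at_def)
  have "(1::ennreal) < ennreal (3/2)" "ennreal (1/2) < 1" using ennreal_less_iff[of 1 "3/2"] ennreal_less_iff[of "1/2" 1] by simp_all
  note b = order_tendstoD(2)[OF lim this(1)] order_tendstoD(1)[OF lim this(2)]
  have "filterlim (\<lambda>r::real. r / 2) (at_right 0) (at_right 0)"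
    unfolding filterlim_at by (auto intro!: tendsto_eq_intros eventually_at_right_less simp: eventually_at_filter)
  then have "eventually (\<lambda>r. ennreal (1/2) < hausdorff1 (S \<inter> ball x (r/2)) / ennreal (2 * (r/2))) (at_right 0)"
    by (rule eventually_compose_filterlim[OF b(2)])
  with b(1) eventually_at_right_less[of "0::real"] show ?thesis
  proof eventually_elim
    case (elim r)
    have eq: "h = h / ennreal s * ennreal s" if "0 < s" for h s
      using that by (simp add: ennreal_divide_times ennreal_mult_divide_eq)
    have "hausdorff1 (S \<inter> ball x r) \<le> ennreal (3/2) * ennreal (2 * r)"
      using elim by (subst eq[of "2 * r"]) (auto intro!: mult_right_mono)
    moreover have "ennreal (1/2) * ennreal (2 * (r/2)) \<le> hausdorff1 (S \<inter> ball x (r/2))"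
      using elim by (subst (2) eq[of "2 * (r/2)"]) (auto intro!: mult_right_mono)
    moreover have "ennreal (3/2) * ennreal (2 * r) = ennreal (3 * r)" "ennreal (1/2) * ennreal (2 * (r/2)) = ennreal (r / 2)"
      using elim(2) by (auto simp: ennreal_mult[symmetric] simp del: ennreal_half)
    ultimately show ?case by (simp only:)
  qed
qed

subsection \<open>Blow-up at a point of the concentration set\<close>

text \<open>Stated for an arbitrary row of the divergence law, because the two stress entries with a
  normal index are treated alike. The quantitative estimate holds for every slope \<open>t\<close>
  at some small radius, and \<open>t\<close> tends to 0.\<close>

lemma normal_density_zero:
  fixes P Q :: "nat \<Rightarrow> (real^2) measure" and l :: "(real^2) measure"
  assumes \<Omega>: "open \<Omega>" "x0 \<in> \<Omega>" and vw: "v \<bullet> v = 1" "w \<bullet> w = 1" "w \<bullet> v = 0"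
    and l: "sets l = sets borel" and ab: "integrable l a" "integrable l b"
    and lS: "\<And>A. A \<in> sets borel \<Longrightarrow> A \<subseteq> \<Omega> \<Longrightarrow> emeasure l A = hausdorff1 (A \<inter> S)"
    and div: "\<And>\<phi>. C1c \<Omega> \<phi> \<Longrightarrow>
      (\<Sum>i<k. c i * (LINT x|P i. frechet_derivative \<phi> (at x) v)) + (\<Sum>j<k'. d j * (LINT x|Q j. frechet_derivative \<phi> (at x) w)) = 0"
    and densP: "\<And>K f B. compact K \<Longrightarrow> K \<subseteq> \<Omega> \<Longrightarrow> f \<in> borel_measurable borel \<Longrightarrow> (\<And>x. \<bar>f x\<bar> \<le> B) \<Longrightarrow> (\<And>x. x \<notin> K \<Longrightarrow> f x = 0) \<Longrightarrow>
      (\<Sum>i<k. c i * (LINT x|P i. f x)) = (LINT x|l. f x * a x)"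
    and densQ: "\<And>K f B. compact K \<Longrightarrow> K \<subseteq> \<Omega> \<Longrightarrow> f \<in> borel_measurable borel \<Longrightarrow> (\<And>x. \<bar>f x\<bar> \<le> B) \<Longrightarrow> (\<And>x. x \<notin> K \<Longrightarrow> f x = 0) \<Longrightarrow>
      (\<Sum>j<k'. d j * (LINT x|Q j. f x)) = (LINT x|l. f x * b x)"
    and ud: "unit_density_at S x0" and tan: "approx_tangent S x0 w"
    and La: "\<And>t. 0 < t \<Longrightarrow> eventually (\<lambda>r. (\<integral>\<^sup>+y\<in>ball x0 r. ennreal \<bar>a y - a x0\<bar> \<partial>l) \<le> ennreal (t * r)) (at_right 0)"
    and Lb: "\<And>t. 0 < t \<Longrightarrow> eventually (\<lambda>r. (\<integral>\<^sup>+y\<in>ball x0 r. ennreal \<bar>b y - b x0\<bar> \<partial>l) \<le> ennreal (t * r)) (at_right 0)"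
  shows "a x0 = 0"
proof -
  have bound: "\<bar>a x0\<bar> / 4 \<le> t * (9 + 16 * (\<bar>a x0\<bar> + \<bar>b x0\<bar>))" if t: "0 < t" for t
  proof -
    \<comment> \<open>The opening angle is chosen so that the cone has slope exactly
      \<open>t\<close>.\<close>
    have "arctan t \<in> {0<..<pi/2}" using t arctan_ubound[of t] by simp
    then have cone: "eventually (\<lambda>r. hausdorff1 (S \<inter> ball x0 r - cone x0 w (arctan t)) \<le> ennreal (t * r)) (at_right 0)"
      using tan t unfolding approx_tangent_def by (intro ratio_tendsto_zero) auto
    obtain R where R: "0 < R" "cball x0 R \<subseteq> \<Omega>" using \<Omega> open_contains_cball by blast
    have "eventually (\<lambda>r. r < R) (at_right 0)" using R(1) by (rule order_tendstoD(2)[OF tendsto_ident_at])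
    with eventually_at_right_less[of "0::real"] unit_density_bounds[OF ud] cone La[OF t] Lb[OF t]
    have "eventually (\<lambda>r::real. \<bar>a x0\<bar> / 4 \<le> t * (9 + 16 * (\<bar>a x0\<bar> + \<bar>b x0\<bar>)) \<and> 0 < r) (at_right 0)"
    proof eventually_elim
      case (elim r)
      have r: "0 < r" "cball x0 r \<subseteq> \<Omega>" using elim(1,6) R by (auto simp: subset_iff)
      have sub: "ball x0 s \<subseteq> \<Omega>" if "s \<le> r" for s using r(2) that by (auto simp: subset_iff)
      have "\<bar>a x0\<bar> / 4 \<le> t * (9 + 16 * (\<bar>a x0\<bar> + \<bar>b x0\<bar>))"
      proof (rule blowup_quantitative[OF vw r l ab _ _ _ t])
        show "(\<Sum>i<k. c i * (LINT x|P i. frechet_derivative \<phi> (at x) v)) + (\<Sum>j<k'. d j * (LINT x|Q j. frechet_derivative \<phi> (at x) w)) = 0"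
          if "C1c \<Omega> \<phi>" for \<phi> by (rule div[OF that])
        show "(\<Sum>i<k. c i * (LINT x|P i. f x)) = (LINT x|l. f x * a x)"
          if "f \<in> borel_measurable borel" "\<And>x. \<bar>f x\<bar> \<le> B" "\<And>x. x \<notin> cball x0 r \<Longrightarrow> f x = 0" for f B
          by (rule densP[OF compact_cball r(2) that])
        show "(\<Sum>j<k'. d j * (LINT x|Q j. f x)) = (LINT x|l. f x * b x)"
          if "f \<in> borel_measurable borel" "\<And>x. \<bar>f x\<bar> \<le> B" "\<And>x. x \<notin> cball x0 r \<Longrightarrow> f x = 0" for f B
          by (rule densQ[OF compact_cball r(2) that])
        show "emeasure l (ball x0 r) \<le> ennreal (3 * r)" using elim(2) lS[OF borel_open[OF open_ball] sub[OF order_refl]] by (simp only: Int_commute)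
        show "ennreal (r / 2) \<le> emeasure l (ball x0 (r / 2))" using elim(2) lS[OF borel_open[OF open_ball] sub[of "r / 2"]] r(1) by (simp only: Int_commute)
        let ?A = "{y \<in> ball x0 r. t * \<bar>w \<bullet> (y - x0)\<bar> < \<bar>v \<bullet> (y - x0)\<bar>}"
        have "open ({y. t * \<bar>w \<bullet> (y - x0)\<bar> < \<bar>v \<bullet> (y - x0)\<bar>} \<inter> ball x0 r)"
          by (intro open_Int open_Collect_less open_ball continuous_intros)
        moreover have "{y. t * \<bar>w \<bullet> (y - x0)\<bar> < \<bar>v \<bullet> (y - x0)\<bar>} \<inter> ball x0 r = ?A" by auto
        ultimately have "?A \<in> sets borel" by (simp only: borel_open)
        then have "emeasure l ?A = hausdorff1 (?A \<inter> S)" by (intro lS subset_trans[OF _ sub[OF order_refl]]) auto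
        also have "\<dots> \<le> hausdorff1 (S \<inter> ball x0 r - cone x0 w (arctan t))"
          by (intro hausdorff1_mono) (auto simp: cone_def tan_arctan frame_perp[OF vw(2,1,3)])
        finally show "emeasure l ?A \<le> ennreal (t * r)" using elim(3) by (rule order_trans)
      qed (rule elim(4,5))+
      then show ?case using r(1) by simp
    qed
    \<comment> \<open>The first conjunct is independent of \<open>r\<close>, and the filter of small
      positive radii is nontrivial.\<close>
    then show ?thesis by (simp add: eventually_conj_iff)
  qed
  define M where "M = 9 + 16 * (\<bar>a x0\<bar> + \<bar>b x0\<bar>)"
  have M: "0 < M" by (simp add: M_def)
  show "a x0 = 0"
  proof (rule ccontr)
    assume "a x0 \<noteq> 0"
    \<comment> \<open>For this value of \<open>t\<close> the right-hand side is only half of the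
      left-hand side.\<close>
    then have "\<bar>a x0\<bar> / 4 \<le> (\<bar>a x0\<bar> / (8 * M)) * M" using M unfolding M_def[symmetric] by (intro bound[folded M_def]) simp
    then show False using M \<open>a x0 \<noteq> 0\<close> by simp
  qed
qed

theorem proposition5:
  fixes \<Omega> :: "(real^2) set"
    and V :: "real^'k \<Rightarrow> real"
    and M\<^sub>0 \<eta>\<^sub>1 :: real
    and \<epsilon> :: "nat \<Rightarrow> real"
    and u :: "nat \<Rightarrow> real^2 \<Rightarrow> real^'k"
    and e :: "2 \<Rightarrow> real^2"
    and \<nu> \<zeta> \<nu>s \<zeta>s lam :: "(real^2) measure"
    and \<mu> \<mu>s :: "2 \<Rightarrow> 2 \<Rightarrow> (real^2) signed_measure"
    and S A B C :: "(real^2) set"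
    and dens \<Theta> :: "real^2 \<Rightarrow> real"
    and m :: "2 \<Rightarrow> 2 \<Rightarrow> real^2 \<Rightarrow> real"
    and tang :: "real^2 \<Rightarrow> real^2"
    and x\<^sub>0 :: "real^2"
  assumes domain: "smooth_bounded_domain \<Omega>"
    and potential: "multi_well_potential V"
    and M0: "M\<^sub>0 > 0"
    and eps: "\<And>n. 0 < \<epsilon> n" "\<And>n. \<epsilon> n \<le> 1" "\<epsilon> \<longlonglongrightarrow> 0"
    and sol: "\<And>n. weak_solution \<Omega> V (\<epsilon> n) (u n)"
    and bound: "\<And>n. energy \<Omega> V (\<epsilon> n) (u n) \<le> ennreal M\<^sub>0"
    and frame: "\<And>i j. e i \<bullet> e j = (if i = j then 1 else 0)"
    and conv_nu: "weak_limit_measure \<Omega> (\<lambda>n. energy_density \<Omega> V (\<epsilon> n) (u n)) \<nu>"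
    and conv_zeta: "weak_limit_measure \<Omega> (\<lambda>n x. V (u n x) / \<epsilon> n) \<zeta>"
    and conv_mu: "\<And>i j. weak_limit_signed \<Omega>
          (\<lambda>n x. \<epsilon> n * (weak_deriv \<Omega> (e i) (u n) x \<bullet> weak_deriv \<Omega> (e j) (u n) x)) (\<mu> i j)"
    and eta: "\<eta>\<^sub>1 > 0" "clearing_out \<Omega> V \<eta>\<^sub>1"
    and S_def: "S = concentration_set \<Omega> \<eta>\<^sub>1 \<nu>"
    and lam_def: "lam = hausdorff1_restr \<Omega> S"
    and dec_nu: "lebesgue_decomp lam \<nu> dens \<nu>s"
    and dec_zeta: "lebesgue_decomp lam \<zeta> \<Theta> \<zeta>s"
    and dec_mu: "\<And>i j. signed_lebesgue_decomp \<Omega> lam (\<mu> i j) (m i j) (\<mu>s i j)"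
    and A: "A \<subseteq> S" "hausdorff1 A = 0"
      "\<And>x. x \<in> S - A \<Longrightarrow> unit_density_at S x"
      "\<And>x. x \<in> S - A \<Longrightarrow> approx_tangent S x (tang x)"
    and B: "B \<subseteq> S" "hausdorff1 B = 0"
      "measure_vanishes_on \<nu>s (S - B)"
      "measure_vanishes_on \<zeta>s (S - B)"
      "\<And>i j. signed_vanishes_on (\<mu>s i j) (S - B)"
    and C_def: "C = S - {x \<in> S. lebesgue_point lam S \<Theta> x \<and> lebesgue_point lam S dens x \<and>
                               (\<forall>i j. lebesgue_point lam S (m i j) x)}"
    and x0: "x\<^sub>0 \<in> S - (A \<union> B \<union> C)"
    and adapted: "e 1 = tang x\<^sub>0"
  shows "2 * \<Theta> x\<^sub>0 = m 2 2 x\<^sub>0 - m 1 1 x\<^sub>0 \<and> m 1 2 x\<^sub>0 = 0"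
proof -
  let ?be = "borel_extension :: (real^2) measure \<Rightarrow> (real^2) measure"
  have \<Omega>: "open \<Omega>" "bounded \<Omega>" using domain by (auto simp: smooth_bounded_domain_def)
  have en: "energy \<Omega> V (\<epsilon> n) (u n) < \<infinity>" for n using bound[of n] by (rule le_less_trans) simp
  note limits = limit_stress[OF \<Omega> potential eps(1) sol en frame conv_nu conv_zeta conv_mu]
  have sn: "sets \<nu> = sets (restrict_space borel \<Omega>)" and sz: "sets \<zeta> = sets (restrict_space borel \<Omega>)"
    and fz: "\<And>K. compact K \<Longrightarrow> K \<subseteq> \<Omega> \<Longrightarrow> emeasure \<zeta> K < \<infinity>"
    using conv_nu conv_zeta by (auto simp: weak_limit_measure_def radon_measure_on_def)
  have sm: "signed_measure_on \<Omega> (\<mu> i j)" for i j using conv_mu[of i j] by (simp add: weak_limit_signed_def)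
  have sf: "sets (fst (\<mu> i j)) = sets (restrict_space borel \<Omega>)" "sets (snd (\<mu> i j)) = sets (restrict_space borel \<Omega>)"
    "finite_measure (fst (\<mu> i j))" "finite_measure (snd (\<mu> i j))" for i j
    using sm[of i j] by (auto simp: signed_measure_on_def)
  \<comment> \<open>Clearing-out is applied to the given sequence itself, whose energies have the
    common bound \<open>M\<^sub>0\<close>.\<close>
  have clear: "emeasure \<nu> (cball x (r / 2) \<inter> \<Omega>) = 0"
    if "0 < r" "ball x r \<subseteq> \<Omega>" "emeasure \<nu> (cball x r \<inter> \<Omega>) < ennreal (\<eta>\<^sub>1 * r)" for x r
  proof -
    have "(SUP n. energy \<Omega> V (\<epsilon> n) (u n)) \<le> ennreal M\<^sub>0" by (intro SUP_least bound)
    then have "(SUP n. energy \<Omega> V (\<epsilon> n) (u n)) < \<infinity>" by (rule le_less_trans) simp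
    then show ?thesis using eta(2)[unfolded clearing_out_def, rule_format, of \<epsilon> u \<nu> r x] eps sol conv_nu that by blast
  qed
  \<comment> \<open>Both the relative closedness of \<open>S\<close> and the vanishing of \<nu> off
    \<open>S\<close> come from clearing-out.\<close>
  have oW: "open (\<Omega> - S)" and nW: "emeasure \<nu> (\<Omega> - S) = 0"
    unfolding S_def using concentration_set_complement[OF \<Omega>(1) eta(1) sn clear] by blast+
  have S\<Omega>: "S \<subseteq> \<Omega>" unfolding S_def concentration_set_def by blast
  have Sb: "S \<in> sets borel"
  proof -
    have "S = \<Omega> - (\<Omega> - S)" using S\<Omega> by blast
    moreover have "\<Omega> - (\<Omega> - S) \<in> sets borel" using \<Omega>(1) oW by (intro sets.Diff borel_open)
    ultimately show ?thesis by simp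
  qed
  have slam: "sets lam = sets (restrict_space borel \<Omega>)" unfolding lam_def by (rule sets_hausdorff1_restr)
  define l where "l = ?be lam"
  have sl: "sets l = sets borel" by (simp add: l_def)
  have lS: "emeasure l D = hausdorff1 (D \<inter> S)" if "D \<in> sets borel" "D \<subseteq> \<Omega>" for D
  proof -
    have "D \<in> sets (restrict_space borel \<Omega>)" using that \<Omega>(1) by (simp add: sets_restrict_space_iff)
    then have "emeasure lam D = hausdorff1 (D \<inter> S)" unfolding lam_def by (rule emeasure_hausdorff1_restr[OF \<Omega>(1)])
    then show ?thesis unfolding l_def emeasure_borel_extension[OF slam that(1)] Int_absorb2[OF that(2)] .
  qed
  have lamW: "emeasure lam (\<Omega> - S) = 0"
  proof -
    have "hausdorff1 ((\<Omega> - S) \<inter> S) \<le> hausdorff1 A" by (rule hausdorff1_mono) auto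
    then have "emeasure l (\<Omega> - S) = 0" using lS[of "\<Omega> - S"] oW A(2) by simp
    then show ?thesis unfolding l_def using oW by (simp add: emeasure_borel_extension[OF slam] Int_absorb2)
  qed
  have iT: "integrable lam \<Theta>" using dec_zeta by (simp add: lebesgue_decomp_def)
  have im: "integrable lam (m i j)" for i j using dec_mu[of i j] by (simp add: signed_lebesgue_decomp_def)
  define \<Theta>' where "\<Theta>' x = indicator \<Omega> x * \<Theta> x" for x
  define m' where "m' i j x = indicator \<Omega> x * m i j x" for i j x
  have il: "integrable l \<Theta>'" "integrable l (m' i j)" for i j
    unfolding l_def \<Theta>'_def[abs_def] m'_def[abs_def] using restricted_density(1)[OF slam \<Omega>(1)] iT im by blast+
  have bm: "\<Theta>' \<in> borel_measurable borel" "m' i j \<in> borel_measurable borel" for i j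
    using borel_measurable_integrable[OF il(1)] borel_measurable_integrable[OF il(2)] measurable_cong_sets[OF sl refl, of borel] by auto
  obtain N0 where N0: "N0 \<in> sets borel" "N0 \<subseteq> \<Omega>" "emeasure l N0 = 0"
      and N0_dens: "\<forall>D. D \<in> sets borel \<and> D \<subseteq> \<Omega> - N0 \<longrightarrow> measure (?be \<zeta>) D = (LINT x:D|l. \<Theta>' x)"
    using lebesgue_decomp_extension[OF slam sz \<Omega>(1) dec_zeta, folded l_def \<Theta>'_def] by (elim exE conjE)
  \<comment> \<open>A choice function, because the exceptional null set depends on the
    entry.\<close>
  define N' where "N' i j = (SOME N. N \<in> sets borel \<and> N \<subseteq> \<Omega> \<and> emeasure l N = 0 \<and>
      (\<forall>D. D \<in> sets borel \<and> D \<subseteq> \<Omega> - N \<longrightarrow> measure (?be (fst (\<mu> i j))) D - measure (?be (snd (\<mu> i j))) D = (LINT x:D|l. m' i j x)))" for i j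
  note N'_prop = someI_ex[OF signed_lebesgue_decomp_extension[OF slam sm \<Omega>(1) dec_mu, folded l_def m'_def], folded N'_def]
  have N': "N' i j \<in> sets borel" "N' i j \<subseteq> \<Omega>" "emeasure l (N' i j) = 0"
      and N'_dens: "D \<in> sets borel \<Longrightarrow> D \<subseteq> \<Omega> - N' i j \<Longrightarrow> measure (?be (fst (\<mu> i j))) D - measure (?be (snd (\<mu> i j))) D = (LINT x:D|l. m' i j x)" for i j D
    using N'_prop[of i j] by simp_all
  \<comment> \<open>With weights \<open>c s\<close> this family is the potential limit plus
    \<open>s / 2\<close> times the difference of the first and second diagonal entries of
    \<open>\<mu>\<close>: the 22 entry of the stress for \<open>s = 1\<close>, the 11 entry for
    \<open>s = - 1\<close>. \<open>Q\<close> with weights \<open>d\<close> is the 12 entry, minus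
    \<open>\<mu> 1 2\<close>.\<close>
  define P where "P i = [?be \<zeta>, ?be (fst (\<mu> 1 1)), ?be (snd (\<mu> 1 1)), ?be (fst (\<mu> 2 2)), ?be (snd (\<mu> 2 2))] ! i" for i
  define Q where "Q i = [?be (fst (\<mu> 1 2)), ?be (snd (\<mu> 1 2))] ! i" for i
  define c where "c s i = [1, s / 2, - (s / 2), - (s / 2), s / 2] ! i" for s :: real and i
  define d where "d i = [- 1, 1 :: real] ! i" for i
  have sumP: "(\<Sum>i<5. c s i * g (P i)) = g (?be \<zeta>) + s / 2 * (g (?be (fst (\<mu> 1 1))) - g (?be (snd (\<mu> 1 1)))) - s / 2 * (g (?be (fst (\<mu> 2 2))) - g (?be (snd (\<mu> 2 2))))" for s and g :: "(real^2) measure \<Rightarrow> real"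
    by (simp add: c_def P_def eval_nat_numeral algebra_simps)
  have sumQ: "(\<Sum>i<2. d i * g (Q i)) = - (g (?be (fst (\<mu> 1 2))) - g (?be (snd (\<mu> 1 2))))" for g :: "(real^2) measure \<Rightarrow> real"
    by (simp add: d_def Q_def eval_nat_numeral)
  have P: "sets (P i) = sets borel" "compact K \<Longrightarrow> K \<subseteq> \<Omega> \<Longrightarrow> emeasure (P i) K < \<infinity>" if "i < 5" for i K
  proof -
    have i: "i = 0 \<or> i = 1 \<or> i = 2 \<or> i = 3 \<or> i = 4" using that by auto
    show "sets (P i) = sets borel" using i by (auto simp: P_def eval_nat_numeral)
    assume K: "compact K" "K \<subseteq> \<Omega>"
    show "emeasure (P i) K < \<infinity>"
      using i fz[OF K] finite_measure.emeasure_finite[OF sf(3)] finite_measure.emeasure_finite[OF sf(4)]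
      by (auto simp: P_def eval_nat_numeral emeasure_borel_extension[OF sz] emeasure_borel_extension[OF sf(1)] emeasure_borel_extension[OF sf(2)]
         borel_compact[OF K(1)] Int_absorb2[OF K(2)] less_top)
  qed
  have Q: "sets (Q i) = sets borel" "compact K \<Longrightarrow> K \<subseteq> \<Omega> \<Longrightarrow> emeasure (Q i) K < \<infinity>" if "i < 2" for i K
  proof -
    have i: "i = 0 \<or> i = 1" using that by auto
    show "sets (Q i) = sets borel" using i by (auto simp: Q_def)
    assume K: "compact K" "K \<subseteq> \<Omega>"
    show "emeasure (Q i) K < \<infinity>"
      using i finite_measure.emeasure_finite[OF sf(3)] finite_measure.emeasure_finite[OF sf(4)]
      by (auto simp: Q_def emeasure_borel_extension[OF sf(1)] emeasure_borel_extension[OF sf(2)] borel_compact[OF K(1)] less_top)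
  qed
  have sint: "(LINT x|?be (fst (\<mu> i j)). \<psi> x) - (LINT x|?be (snd (\<mu> i j)). \<psi> x) = sintegral (\<mu> i j) \<psi>"
    and zint: "(LINT x|?be \<zeta>. \<psi> x) = (LINT x|\<zeta>. \<psi> x)" if "continuous_on UNIV \<psi>" for \<psi> i j
    using borel_measurable_continuous_onI[OF that]
    by (simp_all add: sintegral_def integral_borel_extension[OF sf(1)] integral_borel_extension[OF sf(2)] integral_borel_extension[OF sz])
  \<comment> \<open>The second and the first row of the divergence law. The first row uses that
    \<open>\<mu> 1 2\<close> and \<open>\<mu> 2 1\<close> agree on test functions.\<close>
  have div2: "(\<Sum>i<5. c 1 i * (LINT x|P i. frechet_derivative \<phi> (at x) (e 2))) + (\<Sum>i<2. d i * (LINT x|Q i. frechet_derivative \<phi> (at x) (e 1))) = 0"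
    and div1: "(\<Sum>i<5. c (-1) i * (LINT x|P i. frechet_derivative \<phi> (at x) (e 1))) + (\<Sum>i<2. d i * (LINT x|Q i. frechet_derivative \<phi> (at x) (e 2))) = 0"
    if \<phi>: "C1c \<Omega> \<phi>" for \<phi>
  proof -
    note cd = C1c_deriv[OF \<phi>]
    let ?D = "\<lambda>v x. frechet_derivative \<phi> (at x) v"
    have alg2: "X = 0" if "X = z + 1 / 2 * p - 1 / 2 * q - w" "z + 1 / 2 * (p + q) - (w + q) = 0" for X z p q w :: real
      using that by argo
    have alg1: "X = 0" if "X = z + (-1) / 2 * p - (-1) / 2 * q - w" "z + 1 / 2 * (p + q) - (p + w') = 0" "w = w'" for X z p q w w' :: real
      using that by argo
    have "(\<Sum>i<5. c 1 i * (LINT x|P i. ?D (e 2) x)) + (\<Sum>i<2. d i * (LINT x|Q i. ?D (e 1) x))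
        = (LINT x|\<zeta>. ?D (e 2) x) + 1 / 2 * sintegral (\<mu> 1 1) (?D (e 2)) - 1 / 2 * sintegral (\<mu> 2 2) (?D (e 2)) - sintegral (\<mu> 1 2) (?D (e 1))"
      unfolding sumP[of _ "\<lambda>M. LINT x|M. ?D (e 2) x"] sumQ[of "\<lambda>M. LINT x|M. ?D (e 1) x"] sint[OF cd(1)] zint[OF cd(1)] by simp
    then show "(\<Sum>i<5. c 1 i * (LINT x|P i. ?D (e 2) x)) + (\<Sum>i<2. d i * (LINT x|Q i. ?D (e 1) x)) = 0"
      using limits(1)[OF \<phi>, of 2, unfolded sum_2] by (rule alg2)
    have "(\<Sum>i<5. c (-1) i * (LINT x|P i. ?D (e 1) x)) + (\<Sum>i<2. d i * (LINT x|Q i. ?D (e 2) x))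
        = (LINT x|\<zeta>. ?D (e 1) x) + (-1) / 2 * sintegral (\<mu> 1 1) (?D (e 1)) - (-1) / 2 * sintegral (\<mu> 2 2) (?D (e 1)) - sintegral (\<mu> 1 2) (?D (e 2))"
      unfolding sumP[of _ "\<lambda>M. LINT x|M. ?D (e 1) x"] sumQ[of "\<lambda>M. LINT x|M. ?D (e 2) x"] sint[OF cd(1)] zint[OF cd(1)] by simp
    then show "(\<Sum>i<5. c (-1) i * (LINT x|P i. ?D (e 1) x)) + (\<Sum>i<2. d i * (LINT x|Q i. ?D (e 2) x)) = 0"
      using limits(1)[OF \<phi>, of 1, unfolded sum_2] limits(4)[OF cd] by (rule alg1)
  qed
  \<comment> \<open>Off \<open>S\<close> all limits are dominated by \<nu>, which vanishes
    there.\<close>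
  have W0: "(LINT x|\<zeta>. \<xi> x) = 0" "sintegral (\<mu> i j) \<xi> = 0" "continuous_on UNIV \<xi>" if \<xi>: "C1c (\<Omega> - S) \<xi>" for \<xi> i j
  proof -
    show c: "continuous_on UNIV \<xi>" using \<xi> C1_continuous by (auto simp: C1c_def)
    obtain K where K: "compact K" "K \<subseteq> \<Omega> - S" "\<And>x. x \<notin> K \<Longrightarrow> \<xi> x = 0" using \<xi> unfolding C1c_def compact_support_in_def by blast
    have cs: "compact_support_in \<Omega> \<xi>" by (rule compact_support_inI[of K]) (use K in auto)
    have "\<Omega> - S \<in> null_sets \<nu>" using nW oW \<Omega>(1) by (auto simp: null_sets_def sn sets_restrict_space_iff)
    then have "AE x in \<nu>. x \<notin> \<Omega> - S" by (rule AE_not_in)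
    then have "AE x in \<nu>. \<bar>\<xi> x\<bar> = 0" by eventually_elim (use K in auto)
    then have z: "(LINT x|\<nu>. \<bar>\<xi> x\<bar>) = 0" by (rule integral_eq_zero_AE)
    show "(LINT x|\<zeta>. \<xi> x) = 0" using limits(2)[OF c cs] z by simp
    show "sintegral (\<mu> i j) \<xi> = 0" using limits(3)[OF c cs, of i j] z by simp
  qed
  have offP: "(\<Sum>i<5. c s i * measure (P i) D) = 0" if D: "D \<in> sets borel" "D \<subseteq> \<Omega> - S" "\<And>i. i < 5 \<Longrightarrow> emeasure (P i) D < \<infinity>" for s D
  proof (rule signed_family_zero[where Z = UNIV and U = "\<Omega> - S"])
    show "(\<Sum>i<5. c s i * (LINT y|P i. indicator UNIV y * \<xi> y)) = 0" if "C1c (\<Omega> - S) \<xi>" for \<xi>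
      unfolding sumP[of _ "\<lambda>M. LINT y|M. indicator UNIV y * \<xi> y"] using sint[OF W0(3)[OF that]] zint[OF W0(3)[OF that]] W0[OF that] by simp
    show "sets (P i) = sets borel" if "i \<in> {..<5}" for i using P(1) that by simp
    show "emeasure (P i) K < \<infinity>" if "i \<in> {..<5}" "compact K" "K \<subseteq> \<Omega> - S" for i K using P(2)[of i K] that by auto
    show "emeasure (P i) D < \<infinity>" if "i \<in> {..<5}" for i using D(3) that by simp
  qed (use D oW in auto)
  have offQ: "(\<Sum>i<2. d i * measure (Q i) D) = 0" if D: "D \<in> sets borel" "D \<subseteq> \<Omega> - S" "\<And>i. i < 2 \<Longrightarrow> emeasure (Q i) D < \<infinity>" for D
  proof (rule signed_family_zero[where Z = UNIV and U = "\<Omega> - S"])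
    show "(\<Sum>i<2. d i * (LINT y|Q i. indicator UNIV y * \<xi> y)) = 0" if "C1c (\<Omega> - S) \<xi>" for \<xi>
      unfolding sumQ[of "\<lambda>M. LINT y|M. indicator UNIV y * \<xi> y"] using sint[OF W0(3)[OF that]] W0[OF that] by simp
    show "sets (Q i) = sets borel" if "i \<in> {..<2}" for i using Q(1) that by simp
    show "emeasure (Q i) K < \<infinity>" if "i \<in> {..<2}" "compact K" "K \<subseteq> \<Omega> - S" for i K using Q(2)[of i K] that by auto
    show "emeasure (Q i) D < \<infinity>" if "i \<in> {..<2}" for i using D(3) that by simp
  qed (use D oW in auto)
  have e: "e 1 \<bullet> e 1 = 1" "e 2 \<bullet> e 2 = 1" "e 1 \<bullet> e 2 = 0" "e 2 \<bullet> e 1 = 0" using frame by simp_all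
  \<comment> \<open>Null sets are projected to the \<open>e 2\<close> axis for the 22 entry and to
    the \<open>e 1\<close> axis for the 11 entry; the row used is the one in which that entry is
    differentiated along its own axis.\<close>
  have nullP: "(\<Sum>i<5. c s i * measure (P i) D) = 0" if s: "s = 1 \<or> s = - 1"
      and D: "hausdorff1 D = 0" "D \<in> sets borel" "D \<subseteq> \<Omega>" "\<And>i. i < 5 \<Longrightarrow> emeasure (P i) D < \<infinity>" for s D
    using s
  proof
    assume s1: "s = 1"
    show ?thesis unfolding s1
      by (rule div_free_null[where \<Omega> = \<Omega> and v = "e 2" and w = "e 1" and J = "{..<2}" and d = d and Q = Q]) (use \<Omega>(1) P Q e D div2 in auto)
  next
    assume s1: "s = - 1"
    show ?thesis unfolding s1
      by (rule div_free_null[where \<Omega> = \<Omega> and v = "e 1" and w = "e 2" and J = "{..<2}" and d = d and Q = Q]) (use \<Omega>(1) P Q e D div1 in auto)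
  qed
  \<comment> \<open>The 12 entry is differentiated along \<open>e 2\<close> in the first row, with
    the 11 entry as companion.\<close>
  have nullQ: "(\<Sum>i<2. d i * measure (Q i) D) = 0"
      if D: "hausdorff1 D = 0" "D \<in> sets borel" "D \<subseteq> \<Omega>" "\<And>i. i < 2 \<Longrightarrow> emeasure (Q i) D < \<infinity>" for D
  proof (rule div_free_null[where \<Omega> = \<Omega> and v = "e 2" and w = "e 1" and J = "{..<5}" and d = "c (- 1)" and Q = P])
    show "(\<Sum>i<2. d i * (LINT x|Q i. frechet_derivative \<phi> (at x) (e 2))) + (\<Sum>i<5. c (-1) i * (LINT x|P i. frechet_derivative \<phi> (at x) (e 1))) = 0"
      if "C1c \<Omega> \<phi>" for \<phi> using div1[OF that] by (simp only: add.commute)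
  qed (use \<Omega>(1) P Q e D in auto)
  \<comment> \<open>Densities of the diagonal stress entries, 22 for \<open>s = 1\<close> and 11 for
    \<open>s = - 1\<close>; \<open>b\<close> is the density of the 12 entry.\<close>
  define a where "a s x = \<Theta>' x + s / 2 * m' 1 1 x - s / 2 * m' 2 2 x" for s x
  define b where "b x = - m' 1 2 x" for x
  have ai: "integrable l (a s)" "integrable l b" for s unfolding a_def[abs_def] b_def[abs_def] using il by auto
  define N where "N = N0 \<union> N' 1 1 \<union> N' 2 2"
  have N: "N \<in> sets borel" "N \<subseteq> \<Omega>" using N0 N' by (auto simp: N_def)
  have N_null: "hausdorff1 (N \<inter> S) = 0"
  proof -
    have "N0 \<in> null_sets l" "N' 1 1 \<in> null_sets l" "N' 2 2 \<in> null_sets l" using N0 N' by (auto simp: null_sets_def sl)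
    then have "N \<in> null_sets l" unfolding N_def by (intro null_sets.Un)
    then show ?thesis using lS[OF N] by (simp add: null_sets_def)
  qed
  have densP: "(\<Sum>i<5. c s i * (LINT x|P i. f x)) = (LINT x|l. f x * a s x)"
    if s: "s = 1 \<or> s = - 1" and K: "compact K" "K \<subseteq> \<Omega>" and f: "f \<in> borel_measurable borel" "\<And>x. \<bar>f x\<bar> \<le> B" "\<And>x. x \<notin> K \<Longrightarrow> f x = 0" for s K f B
  proof (rule family_density[OF \<Omega>(1) Sb K P(1) P(2)[OF _ K] sl ai(1) nullP[OF s] offP N(1) N_null N(2) _ lS f])
    fix D assume D: "D \<in> sets borel" "D \<subseteq> \<Omega> - N"
    have i: "integrable l (\<lambda>x. indicator D x * g x)" if "integrable l g" for g :: "real^2 \<Rightarrow> real"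
      using integrable_mult_indicator[of D l g] D(1) that by (simp add: sl)
    have "(LINT x:D|l. a s x) = (LINT x|l. indicator D x * \<Theta>' x + s / 2 * (indicator D x * m' 1 1 x) - s / 2 * (indicator D x * m' 2 2 x))"
      unfolding set_lebesgue_integral_def a_def by (intro Bochner_Integration.integral_cong refl) (simp add: algebra_simps)
    also have "\<dots> = (LINT x:D|l. \<Theta>' x) + s / 2 * (LINT x:D|l. m' 1 1 x) - s / 2 * (LINT x:D|l. m' 2 2 x)"
      using i[OF il(1)] i[OF il(2)] by (simp add: set_lebesgue_integral_def)
    also have "\<dots> = (\<Sum>i<5. c s i * measure (P i) D)"
      unfolding sumP[of _ "\<lambda>M. measure M D"] using N0_dens[rule_format, of D] D(1) N'_dens[OF D(1)] D(2) by (simp add: N_def Diff_Un)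
    finally show "(\<Sum>i<5. c s i * measure (P i) D) = (LINT x:D|l. a s x)" ..
  qed
  have densQ: "(\<Sum>i<2. d i * (LINT x|Q i. f x)) = (LINT x|l. f x * b x)"
    if K: "compact K" "K \<subseteq> \<Omega>" and f: "f \<in> borel_measurable borel" "\<And>x. \<bar>f x\<bar> \<le> B" "\<And>x. x \<notin> K \<Longrightarrow> f x = 0" for K f B
  proof (rule family_density[OF \<Omega>(1) Sb K Q(1) Q(2)[OF _ K] sl ai(2) nullQ offQ N'(1) _ N'(2) _ lS f])
    show "hausdorff1 (N' 1 2 \<inter> S) = 0" using lS[OF N'(1,2)] N'(3) by simp
    show "(\<Sum>i<2. d i * measure (Q i) D) = (LINT x:D|l. b x)" if "D \<in> sets borel" "D \<subseteq> \<Omega> - N' 1 2" for D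
      unfolding sumQ[of "\<lambda>M. measure M D"] using N'_dens[OF that] by (simp add: b_def set_lebesgue_integral_def)
  qed
  have x0S: "x\<^sub>0 \<in> S" "x\<^sub>0 \<in> S - A" and x0\<Omega>: "x\<^sub>0 \<in> \<Omega>" using x0 S\<Omega> by auto
  have pts: "lebesgue_point lam S \<Theta> x\<^sub>0" "lebesgue_point lam S (m i j) x\<^sub>0" for i j using x0 unfolding C_def by auto
  have LT: "eventually (\<lambda>r. (\<integral>\<^sup>+y\<in>ball x\<^sub>0 r. ennreal \<bar>\<Theta>' y - \<Theta>' x\<^sub>0\<bar> \<partial>l) \<le> ennreal (t * r)) (at_right 0)" if "0 < t" for t
    unfolding l_def \<Theta>'_def by (rule lebesgue_point_extension[OF slam \<Omega>(1) iT Sb S\<Omega> lamW x0S(1) pts(1) that])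
  have Lm: "eventually (\<lambda>r. (\<integral>\<^sup>+y\<in>ball x\<^sub>0 r. ennreal \<bar>m' i j y - m' i j x\<^sub>0\<bar> \<partial>l) \<le> ennreal (t * r)) (at_right 0)" if "0 < t" for t i j
    unfolding l_def m'_def by (rule lebesgue_point_extension[OF slam \<Omega>(1) im Sb S\<Omega> lamW x0S(1) pts(2) that])
  have Lb: "eventually (\<lambda>r. (\<integral>\<^sup>+y\<in>ball x\<^sub>0 r. ennreal \<bar>b y - b x\<^sub>0\<bar> \<partial>l) \<le> ennreal (t * r)) (at_right 0)" if "0 < t" for t
  proof -
    have "\<bar>b y - b x\<^sub>0\<bar> = \<bar>m' 1 2 y - m' 1 2 x\<^sub>0\<bar>" for y by (simp add: b_def abs_minus_commute)
    then show ?thesis using Lm[OF that] by simp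
  qed
  have La: "eventually (\<lambda>r. (\<integral>\<^sup>+y\<in>ball x\<^sub>0 r. ennreal \<bar>a s y - a s x\<^sub>0\<bar> \<partial>l) \<le> ennreal (t * r)) (at_right 0)" if s: "s = 1 \<or> s = - 1" and t: "0 < t" for s t
  proof -
    \<comment> \<open>The oscillation of \<open>a s\<close> is at most the sum of three
      oscillations, each allowed a third of \<open>t\<close>.\<close>
    have t3: "0 < t / 3" using t by simp
    from LT[OF t3] Lm[OF t3, of 1 1] Lm[OF t3, of 2 2] eventually_at_right_less[of "0::real"] show ?thesis
    proof eventually_elim
      case (elim r)
      let ?g = "\<lambda>h y. ennreal \<bar>h y - h x\<^sub>0\<bar> * indicator (ball x\<^sub>0 r) (y :: real^2)"
      have meas: "?g h \<in> borel_measurable l" if "h \<in> borel_measurable borel" for h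
        unfolding measurable_cong_sets[OF sl refl]
        by (intro borel_measurable_times_ennreal measurable_compose[OF _ measurable_ennreal] borel_measurable_abs borel_measurable_diff
             that borel_measurable_const borel_measurable_indicator) simp
      have "(\<integral>\<^sup>+y. ?g (a s) y \<partial>l) \<le> (\<integral>\<^sup>+y. ?g \<Theta>' y + (?g (m' 1 1) y + ?g (m' 2 2) y) \<partial>l)"
      proof (rule nn_integral_mono)
        fix y
        have "\<bar>a s y - a s x\<^sub>0\<bar> \<le> \<bar>\<Theta>' y - \<Theta>' x\<^sub>0\<bar> + (\<bar>m' 1 1 y - m' 1 1 x\<^sub>0\<bar> + \<bar>m' 2 2 y - m' 2 2 x\<^sub>0\<bar>)"
          using s by (auto simp: a_def)
        then have "ennreal \<bar>a s y - a s x\<^sub>0\<bar> \<le> ennreal \<bar>\<Theta>' y - \<Theta>' x\<^sub>0\<bar> + (ennreal \<bar>m' 1 1 y - m' 1 1 x\<^sub>0\<bar> + ennreal \<bar>m' 2 2 y - m' 2 2 x\<^sub>0\<bar>)"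
          by (simp add: ennreal_plus[symmetric] del: ennreal_plus)
        then show "?g (a s) y \<le> ?g \<Theta>' y + (?g (m' 1 1) y + ?g (m' 2 2) y)"
          unfolding distrib_right[symmetric] by (rule mult_right_mono) simp
      qed
      also have "\<dots> = (\<integral>\<^sup>+y. ?g \<Theta>' y \<partial>l) + ((\<integral>\<^sup>+y. ?g (m' 1 1) y \<partial>l) + (\<integral>\<^sup>+y. ?g (m' 2 2) y \<partial>l))"
        using meas[OF bm(1)] meas[OF bm(2)] by (simp add: nn_integral_add)
      also have "\<dots> \<le> ennreal (t / 3 * r) + (ennreal (t / 3 * r) + ennreal (t / 3 * r))"
        using elim(1-3) by (intro add_mono)
      also have "\<dots> = ennreal (t * r)" using t elim(4) by (simp add: ennreal_plus[symmetric] del: ennreal_plus)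
      finally show ?case .
    qed
  qed
  have tang: "approx_tangent S x\<^sub>0 (e 1)" using A(4)[OF x0S(2)] unfolding adapted .
  \<comment> \<open>Second row: the normal derivative acts on the 22 entry, and the vanishing of its
    density is the first assertion up to a factor 2.\<close>
  have a0: "a 1 x\<^sub>0 = 0"
    by (rule normal_density_zero[where v = "e 2" and w = "e 1" and l = l and b = b and P = P and Q = Q and k = 5 and k' = 2 and c = "c 1" and d = d,
        OF \<Omega>(1) x0\<Omega> e(2,1,3) sl ai lS div2 densP[of 1] densQ A(3)[OF x0S(2)] tang La[of 1] Lb]) auto
  \<comment> \<open>First row: the normal derivative acts on the 12 entry and the tangential one on
    the 11 entry.\<close>
  have b0: "b x\<^sub>0 = 0"
  proof (rule normal_density_zero[where v = "e 2" and w = "e 1" and l = l and a = b and b = "a (- 1)" and P = Q and Q = P and k = 2 and k' = 5 and c = d and d = "c (- 1)",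
        OF \<Omega>(1) x0\<Omega> e(2,1,3) sl ai(2,1) lS _ densQ densP[of "- 1"] A(3)[OF x0S(2)] tang Lb La[of "- 1"]])
    show "(\<Sum>i<2. d i * (LINT x|Q i. frechet_derivative \<phi> (at x) (e 2))) + (\<Sum>i<5. c (-1) i * (LINT x|P i. frechet_derivative \<phi> (at x) (e 1))) = 0"
      if "C1c \<Omega> \<phi>" for \<phi> using div1[OF that] by (simp only: add.commute)
  qed auto
  show ?thesis using a0 b0 x0\<Omega> by (simp add: a_def b_def \<Theta>'_def m'_def)
qed

end
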